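(* There exists $\beta_0>0$ such that for all $h>0$ and all $0<\beta\le\beta_0$, $$\lim_{k\to\infty}\limsup_{N\to\infty}\mathbb{E}\left|\frac1N\log\mathbb{E}_k(Z_N)-\operatorname{RS}(\beta,h)\right|=0,$$ where $\mathbb{E}_k$ denotes conditional expectation with respect to $\mathcal{G}_k$.
   Context: Let $\beta>0$, $h>0$. For each $N$ let $\mathbf{g}=(g_{ij})_{1\le i,j\le N}$ have i.i.d. centered Gaussian entries of variance $1/N$ (all $N^2$ entries independent), and let $$Z_N=2^{-N}\sum_{\sigma\in\{-1,1\}^N}\exp\Big[\frac{\beta}{\sqrt2}\sum_{i,j=1}^N g_{ij}\sigma_i\sigma_j+h\sum_{i=1}^N\sigma_i\Big].$$ Put $$\operatorname{RS}(\beta,h)=\inf_{q'\ge0}\Big[E\log\cosh(h+\beta\sqrt{q'}Z)+\frac{\beta^2(1-q')^2}{4}\Big].$$ Here and below $Z,Z',Z''$ are independent standard Gaussian variables with expectation $E$. Let $q>0$ be the unique solution of $q=E\tanh^2(h+\beta\sqrt q Z)$, and $\operatorname{Th}(x)=\tanh(h+\beta x)$. On $\mathbb{R}^N$ use $\langle\mathbf{x},\mathbf{y}\rangle=\frac1N\sum_i x_iy_i$, $\|\mathbf{x}\|=\sqrt{\langle\mathbf{x},\mathbf{x}\rangle}$, and $(\mathbf{a}\otimes\mathbf{b})_{ij}=a_ib_j/N$. Functions act on vectors componentwise; $\mathbf{1}$ is the all-ones vector. Real sequences: $\gamma_1=E\tanh(h+\beta\sqrt q Z)$, $\rho_1=\sqrt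 q\,\gamma_1$, $$\psi(t)=E\operatorname{Th}(\sqrt tZ+\sqrt{q-t}Z')\operatorname{Th}(\sqrt tZ+\sqrt{q-t}Z'')\quad(0\le t\le q),$$ and for $k\ge2$, with $\Gamma_{k-1}^2=\sum_{j=1}^{k-1}\gamma_j^2$ ($\Gamma_0=0$), $$\rho_k=\psi(\rho_{k-1}),\qquad \gamma_k=\frac{\rho_k-\Gamma_{k-1}^2}{\sqrt{q-\Gamma_{k-1}^2}}.$$ It is known that $\Gamma_{k-1}^2<\rho_k<q$ for all $k$. Recursion of random objects: $\mathbf{g}^{(1)}=\mathbf{g}$, $\phi^{(1)}=\mathbf{1}$, $\mathbf{m}^{(1)}=\sqrt q\,\mathbf{1}$. Given $\mathbf{g}^{(s)},\phi^{(s)},\mathbf{m}^{(s)}$ for $s\le k$, put $$\xi^{(s)}=\mathbf{g}^{(s)}\phi^{(s)},\quad \eta^{(s)}=(\mathbf{g}^{(s)})^T\phi^{(s)},\quad \zeta^{(s)}=\frac{\xi^{(s)}+\eta^{(s)}}{\sqrt2},$$ $$\mathbf{h}^{(k+1)}=h\mathbf{1}+\beta\sum_{s=1}^{k-1}\gamma_s\zeta^{(s)}+\beta\sqrt{q-\Gamma_{k-1}^2}\,\zeta^{(k)},\quad \mathbf{m}^{(k+1)}=\tanh(\mathbf{h}^{(k+1)}),$$ $$\phi^{(k+1)}=\frac{\mathbf{m}^{(k+1)}-\sum_{s=1}^k\langle\mathbf{m}^{(k+1)},\phi^{(s)}\rangle\phi^{(s)}}{\|\mathbf{m}^{(k+1)}-\sum_{s=1}^k\langle\mathbf{m}^{(k+1)},\phi^{(s)}\rangle\phi^{(s)}\|},$$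 $$\mathbf{g}^{(k+1)}=\mathbf{g}^{(k)}-\Big(\xi^{(k)}\otimes\phi^{(k)}+\phi^{(k)}\otimes\eta^{(k)}-\langle\phi^{(k)},\xi^{(k)}\rangle\,\phi^{(k)}\otimes\phi^{(k)}\Big).$$ For $N>k$ the denominator is almost surely nonzero. All objects depend on $N$. Finally $\mathcal{G}_k=\sigma(\xi^{(m)},\eta^{(m)}:m\le k)$. *)

theory Defs
  imports "HOL-Probability.Probability"
begin

definition gauss_E :: "(real \<Rightarrow> real) \<Rightarrow> real" where
  "gauss_E f = (\<integral>z. f z \<partial>std_normal_distribution)"

definition RS :: "real \<Rightarrow> real \<Rightarrow> real" where
  "RS \<beta> h = (INF q\<in>{0..}. gauss_E (\<lambda>z. ln (cosh (h + \<beta> * sqrt q * z))) + \<beta>\<^sup>2 * (1 - q)\<^sup>2 / 4)"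

(* The fixed point is unique for h > 0. *)
definition q_fix :: "real \<Rightarrow> real \<Rightarrow> real" where
  "q_fix \<beta> h = (THE q. q > 0 \<and> q = gauss_E (\<lambda>z. (tanh (h + \<beta> * sqrt q * z))\<^sup>2))"

definition Th :: "real \<Rightarrow> real \<Rightarrow> real \<Rightarrow> real" where
  "Th \<beta> h x = tanh (h + \<beta> * x)"

definition psi :: "real \<Rightarrow> real \<Rightarrow> real \<Rightarrow> real" where
  "psi \<beta> h t = (let q = q_fix \<beta> h in
     \<integral>(z, z', z''). Th \<beta> h (sqrt t * z + sqrt (q - t) * z') * Th \<beta> h (sqrt t * z + sqrt (q - t) * z'')
       \<partial>(std_normal_distribution \<Otimes>\<^sub>M (std_normal_distribution \<Otimes>\<^sub>M std_normal_distribution)))"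

definition gamma_1 :: "real \<Rightarrow> real \<Rightarrow> real" where
  "gamma_1 \<beta> h = gauss_E (\<lambda>z. tanh (h + \<beta> * sqrt (q_fix \<beta> h) * z))"

(* All sequences indexed by k below start at k = 1; their values at 0 are never used. *)

fun rho :: "real \<Rightarrow> real \<Rightarrow> nat \<Rightarrow> real" where
  "rho \<beta> h 0 = 0"
| "rho \<beta> h (Suc 0) = sqrt (q_fix \<beta> h) * gamma_1 \<beta> h"
| "rho \<beta> h (Suc (Suc k)) = psi \<beta> h (rho \<beta> h (Suc k))"

fun gam :: "real \<Rightarrow> real \<Rightarrow> nat \<Rightarrow> real" where
  "gam \<beta> h k = (if k \<le> 1 then gamma_1 \<beta> h
     else (rho \<beta> h k - (\<Sum>j = 1..<k. (gam \<beta> h j)\<^sup>2)) /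
            sqrt (q_fix \<beta> h - (\<Sum>j = 1..<k. (gam \<beta> h j)\<^sup>2)))"

declare gam.simps [simp del]

definition Gam_sq :: "real \<Rightarrow> real \<Rightarrow> nat \<Rightarrow> real" where
  "Gam_sq \<beta> h k = (\<Sum>j = 1..k. (gam \<beta> h j)\<^sup>2)"

(* Vectors in R^N and N x N matrices are functions on indices, of which only those below N matter;
   sites are numbered from 0. *)

type_synonym vect = "nat \<Rightarrow> real"
type_synonym matr = "nat \<Rightarrow> nat \<Rightarrow> real"

definition ip :: "nat \<Rightarrow> vect \<Rightarrow> vect \<Rightarrow> real" where
  "ip N x y = (\<Sum>i<N. x i * y i) / real N"

definition nrm :: "nat \<Rightarrow> vect \<Rightarrow> real" where
  "nrm N x = sqrt (ip N x x)"

definition tens :: "nat \<Rightarrow> vect \<Rightarrow> vect \<Rightarrow> matr" where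
  "tens N a b = (\<lambda>i j. a i * b j / real N)"

definition mult_mv :: "nat \<Rightarrow> matr \<Rightarrow> vect \<Rightarrow> vect" where
  "mult_mv N A x = (\<lambda>i. \<Sum>j<N. A i j * x j)"

definition transp_m :: "matr \<Rightarrow> matr" where
  "transp_m A = (\<lambda>i j. A j i)"

(* With A the disorder matrix: the matrices g^(k), the vectors m^(k), phi^(k), xi^(k), eta^(k), zeta^(k),
   k >= 1.  If the Gram-Schmidt residual vanishes (in particular for N <= k), phi^(k+1) is 0 because
   x / 0 = 0; for N > k this happens only on a null set. *)
function (sequential)
      it_g :: "real \<Rightarrow> real \<Rightarrow> nat \<Rightarrow> matr \<Rightarrow> nat \<Rightarrow> matr"
  and it_m :: "real \<Rightarrow> real \<Rightarrow> nat \<Rightarrow> matr \<Rightarrow> nat \<Rightarrow> vect"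
  and it_phi :: "real \<Rightarrow> real \<Rightarrow> nat \<Rightarrow> matr \<Rightarrow> nat \<Rightarrow> vect"
  and it_xi :: "real \<Rightarrow> real \<Rightarrow> nat \<Rightarrow> matr \<Rightarrow> nat \<Rightarrow> vect"
  and it_eta :: "real \<Rightarrow> real \<Rightarrow> nat \<Rightarrow> matr \<Rightarrow> nat \<Rightarrow> vect"
  and it_zeta :: "real \<Rightarrow> real \<Rightarrow> nat \<Rightarrow> matr \<Rightarrow> nat \<Rightarrow> vect"
where
  "it_g \<beta> h N A 0 = A"
| "it_g \<beta> h N A (Suc 0) = A"
| "it_g \<beta> h N A (Suc (Suc l)) =
     (let k = Suc l; x = it_xi \<beta> h N A k; y = it_eta \<beta> h N A k; p = it_phi \<beta> h N A k in
        (\<lambda>i j. it_g \<beta> h N A k i j - (tens N x p i j + tens N p y i j - ip N p x * tens N p p i j)))"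
| "it_m \<beta> h N A 0 = (\<lambda>i. 0)"
| "it_m \<beta> h N A (Suc 0) = (\<lambda>i. sqrt (q_fix \<beta> h))"
| "it_m \<beta> h N A (Suc (Suc l)) =
     (let k = Suc l in
        (\<lambda>i. tanh (h + \<beta> * (\<Sum>s = 1..<k. gam \<beta> h s * it_zeta \<beta> h N A s i)
                  + \<beta> * sqrt (q_fix \<beta> h - Gam_sq \<beta> h (k - 1)) * it_zeta \<beta> h N A k i)))"
| "it_phi \<beta> h N A 0 = (\<lambda>i. 0)"
| "it_phi \<beta> h N A (Suc 0) = (\<lambda>i. 1)"
| "it_phi \<beta> h N A (Suc (Suc l)) =
     (let k = Suc l; m = it_m \<beta> h N A (Suc k);
          r = (\<lambda>i. m i - (\<Sum>s = 1..k. ip N m (it_phi \<beta> h N A s) * it_phi \<beta> h N A s i)) in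
        (\<lambda>i. r i / nrm N r))"
| "it_xi \<beta> h N A k = mult_mv N (it_g \<beta> h N A k) (it_phi \<beta> h N A k)"
| "it_eta \<beta> h N A k = mult_mv N (transp_m (it_g \<beta> h N A k)) (it_phi \<beta> h N A k)"
| "it_zeta \<beta> h N A k = (\<lambda>i. (it_xi \<beta> h N A k i + it_eta \<beta> h N A k i) / sqrt 2)"
  by pat_completeness auto
termination
  by (relation "Wellfounded.measure (case_sum
         (case_sum (\<lambda>(\<beta>, h, N, A, k). 4 * k)
            (case_sum (\<lambda>(\<beta>, h, N, A, k). 4 * k) (\<lambda>(\<beta>, h, N, A, k). 4 * k + 1)))
         (case_sum (\<lambda>(\<beta>, h, N, A, k). 4 * k + 2)
            (case_sum (\<lambda>(\<beta>, h, N, A, k). 4 * k + 2) (\<lambda>(\<beta>, h, N, A, k). 4 * k + 3))))") auto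

definition partition_fn :: "real \<Rightarrow> real \<Rightarrow> nat \<Rightarrow> matr \<Rightarrow> real" where
  "partition_fn \<beta> h N A =
     (\<Sum>\<sigma> \<in> {..<N} \<rightarrow>\<^sub>E {-1, 1}.
        exp (\<beta> / sqrt 2 * (\<Sum>i<N. \<Sum>j<N. A i j * \<sigma> i * \<sigma> j) + h * (\<Sum>i<N. \<sigma> i))) / 2 ^ N"

(* The last parameter of normal_density is the standard deviation, so the variance is 1 / N. *)
definition gaussian_disorder :: "'a measure \<Rightarrow> nat \<Rightarrow> ('a \<Rightarrow> matr) \<Rightarrow> bool" where
  "gaussian_disorder M N g \<longleftrightarrow>
     prob_space M \<and>
     prob_space.indep_vars M (\<lambda>_. borel) (\<lambda>(i, j) \<omega>. g \<omega> i j) ({..<N} \<times> {..<N}) \<and>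
     (\<forall>i<N. \<forall>j<N. distributed M lborel (\<lambda>\<omega>. g \<omega> i j) (normal_density 0 (1 / sqrt (real N))))"

definition sigma_G :: "real \<Rightarrow> real \<Rightarrow> 'a measure \<Rightarrow> nat \<Rightarrow> ('a \<Rightarrow> matr) \<Rightarrow> nat \<Rightarrow> 'a measure" where
  "sigma_G \<beta> h M N g k = sigma (space M)
     (\<Union>m\<in>{1..k}. \<Union>i\<in>{..<N}.
        {(\<lambda>\<omega>. it_xi \<beta> h N (g \<omega>) m i) -` B \<inter> space M | B. B \<in> sets borel} \<union>
        {(\<lambda>\<omega>. it_eta \<beta> h N (g \<omega>) m i) -` B \<inter> space M | B. B \<in> sets borel})"

end

(*
  Given the first k steps, the matrix that is left is Gaussian on the orthogonal complement of
  phi^(1), ..., phi^(k); replacing it by an independent copy ("resampling") preserves the law of the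
  disorder and everything revealed so far.  This yields both an explicit formula (Wpart) for the
  conditional expectation of Z_N and, by refreshing a single direction at a time, a law of large numbers
  for averages of functions of zeta^(1), ..., zeta^(k).

  The formula is a partition function with 2k collective coordinates <sigma, phi^(s)>, <sigma, zeta^(s)>.
  Tilting by h^(k+1) turns the spins into independent ones with means m^(k+1), and the remaining exponent
  is, up to its value at these means, at most quadratic in the centered coordinates with coefficient 2 beta.
  For beta <= 1/32 the quadratic exponential moment is bounded uniformly in N (Gaussian linearization), and
  Cauchy-Schwarz turns this upper bound into a matching lower bound.  The value at the means converges
  to RS up to errors controlled by q - Gamma_(k-1)^2, which tends to 0.
*)
theory Submission
  imports Defs "HOL-Probability.Probability" "HOL-Real_Asymp.Real_Asymp"
begin

section \<open>Standard Gaussian vectors\<close>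

text \<open>Conditional laws are never handled as kernels. Invariance is an identity of integrals
  over all nonnegative measurable functions: \<open>A\<close> and \<open>resample\<close> of
  \<open>A\<close> with an independent matrix have the same law, while xi, eta up to step k and phi
  up to step k + 1 agree pointwise. Conditioning thus becomes Fubini with \<open>A\<close> held
  fixed, and the random direction phi^(k+1) becomes deterministic.

  Gram-Schmidt can break down. Every direction is therefore only asked to be a unit vector or zero
  on the sites, and the identities are arranged to hold in both cases; that q - Gamma_k^2 stays
  positive shows later that the zero case has vanishing probability.

  Since k is fixed while N grows, a factor exponential in k costs only O(k / N) in the free energy,
  so crude bounds on the 2k coordinates suffice. The coefficient 2 beta, a Gram matrix bounded by 4
  and the integrability of exp(g^2 / 4) for a standard Gaussian g require 8 beta <= 1/4; this is the
  origin of 1/32. Convergence in probability is raised to convergence in mean by second moments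
  bounded in N.\<close>

abbreviation sn :: "real measure" where "sn \<equiv> std_normal_distribution"

abbreviation gs :: "'i set => ('i => real) measure" where
  "gs I \<equiv> PiM I (\<lambda>_. sn)"

global_interpretation SN: prob_space sn
  by (rule prob_space_normal_density) simp

global_interpretation GS: product_sigma_finite "\<lambda>_. sn"
  by (simp add: product_sigma_finite_def prob_space_imp_sigma_finite SN.prob_space_axioms)

lemma emeasure_sn_UNIV [simp]: "emeasure sn UNIV = 1"
  using SN.emeasure_space_1 by simp

lemma prob_space_gs: "prob_space (gs I)"
  by (intro prob_space_PiM SN.prob_space_axioms)

lemma emeasure_gs_space [simp]: "emeasure (gs I) (space (gs I)) = 1"
  by (rule prob_space.emeasure_space_1[OF prob_space_gs])

lemma sets_gs [measurable_cong]: "sets (gs I) = sets (PiM I (\<lambda>_. borel))"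
  by (intro sets_PiM_cong) auto

lemma sigma_finite_gs: "sigma_finite_measure (gs I)"
  by (intro prob_space_imp_sigma_finite prob_space_gs)

section \<open>Rotation invariance and resampling along orthonormal directions\<close>

lemma nn_integral_swap:
  assumes "sigma_finite_measure A" "sigma_finite_measure B"
    and "case_prod f \<in> borel_measurable (A \<Otimes>\<^sub>M B)"
  shows "(\<integral>\<^sup>+x. \<integral>\<^sup>+y. f x y \<partial>B \<partial>A) = (\<integral>\<^sup>+y. \<integral>\<^sup>+x. f x y \<partial>A \<partial>B)"
proof -
  interpret pair_sigma_finite A B using assms by (simp add: pair_sigma_finite_def)
  show ?thesis using Fubini'[OF assms(3)] by simp
qed

text \<open>For \<open>c ~= 0\<close> the rotation factors into two one-dimensional affine
  substitutions: first a is replaced by p = c a + s b, then, for fixed p, b by (b - s p) / c. Their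
  Jacobian factors cancel.\<close>

lemma lborel_rotation_aux:
  fixes c s :: real and G :: "real => real => ennreal"
  assumes cs: "c\<^sup>2 + s\<^sup>2 = 1" and c: "c ~= 0"
    and [measurable]: "case_prod G \<in> borel_measurable (borel \<Otimes>\<^sub>M borel)"
  shows "(\<integral>\<^sup>+a. \<integral>\<^sup>+b. G (c*a + s*b) (c*b - s*a) \<partial>lborel \<partial>lborel) = (\<integral>\<^sup>+a. \<integral>\<^sup>+b. G a b \<partial>lborel \<partial>lborel)"
proof -
  have "(\<integral>\<^sup>+a. \<integral>\<^sup>+b. G (c*a + s*b) (c*b - s*a) \<partial>lborel \<partial>lborel)
      = (\<integral>\<^sup>+b. \<integral>\<^sup>+a. G (c*a + s*b) (c*b - s*a) \<partial>lborel \<partial>lborel)"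
    by (rule nn_integral_swap) (auto intro: lborel.sigma_finite_measure_axioms)
  also have "\<dots> = (\<integral>\<^sup>+b. ennreal \<bar>1/c\<bar> * (\<integral>\<^sup>+p. G p (- s*p/c + 1/c*b) \<partial>lborel) \<partial>lborel)"
  proof (rule nn_integral_cong)
    fix b
    have e: "c * (- s*b/c + 1/c*p) + s*b = p \<and> c*b - s*(- s*b/c + 1/c*p) = - s*p/c + 1/c*b" for p
    proof -
      have "c * c * b + s * s * b = b" using cs by (metis distrib_right mult_1 power2_eq_square)
      then show ?thesis using c by (simp add: field_simps)
    qed
    show "(\<integral>\<^sup>+a. G (c*a + s*b) (c*b - s*a) \<partial>lborel) = ennreal \<bar>1/c\<bar> * (\<integral>\<^sup>+p. G p (- s*p/c + 1/c*b) \<partial>lborel)"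
      by (subst nn_integral_real_affine[where c="1/c" and t="-s*b/c"]) (use c e in auto)
  qed
  also have "\<dots> = ennreal \<bar>1/c\<bar> * (\<integral>\<^sup>+b. (\<integral>\<^sup>+p. G p (- s*p/c + 1/c*b) \<partial>lborel) \<partial>lborel)"
    by (rule nn_integral_cmult) auto
  also have "(\<integral>\<^sup>+b. (\<integral>\<^sup>+p. G p (- s*p/c + 1/c*b) \<partial>lborel) \<partial>lborel) = (\<integral>\<^sup>+p. (\<integral>\<^sup>+b. G p (- s*p/c + 1/c*b) \<partial>lborel) \<partial>lborel)"
    by (rule nn_integral_swap) (auto intro: lborel.sigma_finite_measure_axioms)
  also have "ennreal \<bar>1/c\<bar> * \<dots> = (\<integral>\<^sup>+p. ennreal \<bar>1/c\<bar> * (\<integral>\<^sup>+b. G p (- s*p/c + 1/c*b) \<partial>lborel) \<partial>lborel)"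
    by (rule nn_integral_cmult[symmetric]) auto
  also have "\<dots> = (\<integral>\<^sup>+p. \<integral>\<^sup>+b. G p b \<partial>lborel \<partial>lborel)"
    by (intro nn_integral_cong nn_integral_real_affine[symmetric]) (use c in auto)
  finally show ?thesis .
qed

lemma lborel_rotation:
  fixes c s :: real and G :: "real => real => ennreal"
  assumes cs: "c\<^sup>2 + s\<^sup>2 = 1"
    and [measurable]: "case_prod G \<in> borel_measurable (borel \<Otimes>\<^sub>M borel)"
  shows "(\<integral>\<^sup>+a. \<integral>\<^sup>+b. G (c*a + s*b) (c*b - s*a) \<partial>lborel \<partial>lborel) = (\<integral>\<^sup>+a. \<integral>\<^sup>+b. G a b \<partial>lborel \<partial>lborel)"
proof (cases "c = 0")
  \<comment> \<open>The quarter turn. The factorization divides by c, so here the map is treated as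
    a swap of the two variables with sign changes.\<close>
  case True
  then have s: "s * s = 1" "s ~= 0" using cs by (auto simp: power2_eq_square)
  then have s1: "\<bar>s\<bar> = 1" by (metis abs_mult_self_eq abs_1 abs_ge_zero abs_square_eq_1 power2_eq_square)
  have aff: "(\<integral>\<^sup>+b. H (t*b) \<partial>lborel) = (\<integral>\<^sup>+b. H b \<partial>lborel)"
    if [measurable]: "H \<in> borel_measurable borel" and "\<bar>t\<bar> = 1" for t and H :: "real => ennreal"
    using nn_integral_real_affine[of H t 0] that(2) by (cases "t = 0") auto
  have "(\<integral>\<^sup>+a. \<integral>\<^sup>+b. G (s*b) (- s*a) \<partial>lborel \<partial>lborel) = (\<integral>\<^sup>+a. \<integral>\<^sup>+b. G b (- s*a) \<partial>lborel \<partial>lborel)"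
    by (intro nn_integral_cong aff) (use s1 in auto)
  also have "\<dots> = (\<integral>\<^sup>+b. \<integral>\<^sup>+a. G b (- s*a) \<partial>lborel \<partial>lborel)"
    by (rule nn_integral_swap) (auto intro: lborel.sigma_finite_measure_axioms)
  also have "\<dots> = (\<integral>\<^sup>+b. \<integral>\<^sup>+a. G b a \<partial>lborel \<partial>lborel)"
    by (intro nn_integral_cong aff) (use s1 in auto)
  finally show ?thesis using True by simp
qed (use lborel_rotation_aux[OF cs] in auto)

lemma nn_integral_sn:
  assumes [measurable]: "f \<in> borel_measurable borel"
  shows "(\<integral>\<^sup>+x. f x \<partial>sn) = (\<integral>\<^sup>+x. ennreal (std_normal_density x) * f x \<partial>lborel)"
  by (subst nn_integral_density) auto

text \<open>The product density depends on \<open>a\<^sup>2 + b\<^sup>2\<close> alone, which the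
  rotation preserves; \<open>lborel_rotation\<close> is applied to density times integrand.\<close>

lemma sn_rotation:
  fixes c s :: real and G :: "real => real => ennreal"
  assumes cs: "c\<^sup>2 + s\<^sup>2 = 1"
    and [measurable]: "case_prod G \<in> borel_measurable (borel \<Otimes>\<^sub>M borel)"
  shows "(\<integral>\<^sup>+a. \<integral>\<^sup>+b. G (c*a + s*b) (c*b - s*a) \<partial>sn \<partial>sn)
       = (\<integral>\<^sup>+a. \<integral>\<^sup>+b. G a b \<partial>sn \<partial>sn)"
proof -
  define d where "d a b = ennreal (std_normal_density a) * ennreal (std_normal_density b)" for a b
  have [measurable]: "case_prod d \<in> borel_measurable (borel \<Otimes>\<^sub>M borel)"
    unfolding d_def by measurable
  have conv: "(\<integral>\<^sup>+a. \<integral>\<^sup>+b. H a b \<partial>sn \<partial>sn)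
      = (\<integral>\<^sup>+a. \<integral>\<^sup>+b. d a b * H a b \<partial>lborel \<partial>lborel)"
    if [measurable]: "case_prod H \<in> borel_measurable (borel \<Otimes>\<^sub>M borel)" for H :: "real => real => ennreal"
    by (simp add: nn_integral_sn nn_integral_cmult[symmetric] d_def mult.assoc)
  have e: "(c*a + s*b)\<^sup>2 + (c*b - s*a)\<^sup>2 = a\<^sup>2 + b\<^sup>2" for a b
  proof -
    have "(c*a + s*b)\<^sup>2 + (c*b - s*a)\<^sup>2 = (c\<^sup>2+s\<^sup>2) * (a\<^sup>2 + b\<^sup>2)" by algebra
    then show ?thesis using cs by simp
  qed
  have dd: "d x y = ennreal (1/(2*pi) * exp (- (x\<^sup>2 + y\<^sup>2)/2))" for x y
  proof -
    have "1 / sqrt (2*pi) * exp (- x\<^sup>2 / 2) * (1 / sqrt (2*pi) * exp (- y\<^sup>2 / 2))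
        = 1 / (sqrt (2*pi) * sqrt (2*pi)) * (exp (- x\<^sup>2 / 2) * exp (- y\<^sup>2 / 2))"
      by simp
    also have "exp (- x\<^sup>2 / 2) * exp (- y\<^sup>2 / 2) = exp (- (x\<^sup>2 + y\<^sup>2)/2)"
      by (subst exp_add[symmetric]) (simp add: field_simps)
    also have "sqrt (2*pi) * sqrt (2*pi) = 2 * pi" by simp
    finally show ?thesis unfolding d_def std_normal_density_def
      by (subst ennreal_mult[symmetric]) simp_all
  qed
  have "d (c*a + s*b) (c*b - s*a) = d a b" for a b
    unfolding dd e ..
  then show ?thesis
    using lborel_rotation[OF cs, of "\<lambda>a b. d a b * G a b"] by (simp add: conv)
qed

lemma gs_reflect_coordinate:
  fixes F :: "real => ennreal"
  assumes [measurable]: "F \<in> borel_measurable borel" and "s\<^sup>2 = 1"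
  shows "(\<integral>\<^sup>+z. F (s * z) \<partial>sn) = (\<integral>\<^sup>+z. F z \<partial>sn)"
  using sn_rotation[of s 0 "\<lambda>a b. F a"] assms
  by simp

lemma sum_fun_upd_insert:
  fixes u x :: "_ => real"
  assumes "finite I" "j \<notin> I"
  shows "(\<Sum>i\<in>insert j I. u i * (x(j:=y)) i) = u j * y + (\<Sum>i\<in>I. u i * x i)"
proof -
  have "(\<Sum>i\<in>I. u i * (x(j:=y)) i) = (\<Sum>i\<in>I. u i * x i)"
    by (rule sum.cong) (use assms in auto)
  then show ?thesis using assms by simp
qed

lemma restrict_insert_upd:
  assumes "j \<notin> I" shows "(\<lambda>i\<in>insert j I. f i) = (\<lambda>i\<in>I. f i)(j := f j)"
  using assms by (auto simp: restrict_def)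

lemma measurable_pair_PiM_insert:
  assumes [measurable]: "F \<in> borel_measurable (PiM (insert j I) (\<lambda>_. borel::real measure))"
    and "f \<in> measurable M (PiM I (\<lambda>_. borel))" and "g \<in> borel_measurable M"
  shows "(\<lambda>x. F ((f x)(j := g x))) \<in> borel_measurable M"
  by (rule measurable_compose[OF measurable_fun_upd assms(1)]) (use assms in auto)

text \<open>The component of x along the unit vector u is exchanged for an independent z. Instead of
  completing u to an orthonormal basis, induction on I splits u into its entry s at j and the rest c
  v with v a unit vector. By the induction hypothesis the coordinate along v behaves like an
  independent Gaussian p, so only a rotation of the (p, y)-plane remains.\<close>

lemma gs_resample:
  fixes F :: "('i => real) => ennreal"
  assumes "finite I" "(\<Sum>i\<in>I. (u i)\<^sup>2) = 1"
    and "F \<in> borel_measurable (PiM I (\<lambda>_. borel))"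
  shows "(\<integral>\<^sup>+x. \<integral>\<^sup>+z. F (\<lambda>i\<in>I. x i + (z - (\<Sum>l\<in>I. u l * x l)) * u i) \<partial>sn \<partial>gs I) = (\<integral>\<^sup>+x. F x \<partial>gs I)"
  using assms
proof (induction I arbitrary: u F rule: finite_induct)
  case empty
  then show ?case by simp
next
  case (insert j I)
  note [measurable] = insert.prems(2)
  note fin = insert.hyps
  define s where "s = u j"
  define c where "c = sqrt (\<Sum>i\<in>I. (u i)\<^sup>2)"
  have c2: "c\<^sup>2 = (\<Sum>i\<in>I. (u i)\<^sup>2)" unfolding c_def by (simp add: sum_nonneg)
  have cs: "c\<^sup>2 + s\<^sup>2 = 1" using insert by (simp add: s_def c2)
  let ?N = "sn"
  let ?u = "\<lambda>x y. (\<Sum>l\<in>insert j I. u l * (x(j:=y)) l)"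
  have L: "(\<integral>\<^sup>+x. \<integral>\<^sup>+z. F (\<lambda>i\<in>insert j I. x i + (z - (\<Sum>l\<in>insert j I. u l * x l)) * u i) \<partial>?N \<partial>gs (insert j I))
     = (\<integral>\<^sup>+x. \<integral>\<^sup>+y. \<integral>\<^sup>+z. F (\<lambda>i\<in>insert j I. (x(j:=y)) i + (z - ?u x y) * u i) \<partial>?N \<partial>?N \<partial>gs I)"
    by (subst GS.product_nn_integral_insert) (use fin in auto)
  show ?case
  proof (cases "c = 0")
    \<comment> \<open>Here u is concentrated at j with entry s equal to 1 or -1, so the new entry at
      j is s z, and symmetry of the Gaussian suffices.\<close>
    case True
    then have u0: "u i = 0" if "i \<in> I" for i
      using c2 that fin by (simp add: sum_nonneg_eq_0_iff)
    have s2: "s\<^sup>2 = 1" using cs True by simp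
    then have s1: "s * s = 1" by (simp add: power2_eq_square)
    have e: "(\<lambda>i\<in>insert j I. (x(j:=y)) i + (z - ?u x y) * u i) = (\<lambda>i\<in>I. x i)(j := s * z)" for x y z
    proof -
      have "?u x y = s * y"
        by (subst sum_fun_upd_insert) (use fin u0 in \<open>auto simp: s_def\<close>)
      moreover have "y + (z - s * y) * s = s * z" using s1 by algebra
      ultimately show ?thesis
        by (subst restrict_insert_upd[OF fin(2)]) (use u0 fin in \<open>auto simp: s_def fun_eq_iff restrict_def\<close>)
    qed
    have "(\<integral>\<^sup>+y. \<integral>\<^sup>+z. F ((\<lambda>i\<in>I. x i)(j := s * z)) \<partial>?N \<partial>?N) = (\<integral>\<^sup>+z. F (x(j := z)) \<partial>?N)" if "x \<in> space (gs I)" for x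
    proof -
      have [measurable]: "(\<lambda>z. F (x(j:=z))) \<in> borel_measurable borel"
        by (rule measurable_pair_PiM_insert[where I=I]) (use that in \<open>auto simp: space_PiM\<close>)
      have "restrict x I = x" using that by (auto simp: space_PiM)
      then show ?thesis
        using gs_reflect_coordinate[of "\<lambda>z. F (x(j:=z))" s] s2 by simp
    qed
    then have "(\<integral>\<^sup>+x. \<integral>\<^sup>+y. \<integral>\<^sup>+z. F ((\<lambda>i\<in>I. x i)(j := s * z)) \<partial>?N \<partial>?N \<partial>gs I) = (\<integral>\<^sup>+x. \<integral>\<^sup>+z. F (x(j := z)) \<partial>?N \<partial>gs I)"
      by (rule nn_integral_cong)
    also have "\<dots> = (\<integral>\<^sup>+x. F x \<partial>gs (insert j I))"
      by (subst GS.product_nn_integral_insert) (use fin in auto)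
    finally show ?thesis unfolding L e .
  next
    case False
    define v where "v i = u i / c" for i
    have v1: "(\<Sum>i\<in>I. (v i)\<^sup>2) = 1"
      unfolding v_def power_divide using False by (simp add: sum_divide_distrib[symmetric] c2[symmetric])
    have uv: "u i = c * v i" for i using False by (simp add: v_def)
    let ?v = "\<lambda>x. \<Sum>l\<in>I. v l * x l"
    \<comment> \<open>\<open>H x p t\<close> is F at the vector whose coordinate along v is p and
      whose entry at j is t; the other coordinates are those of x.\<close>
    define H where "H x p t = F ((\<lambda>i\<in>I. x i + (p - ?v x) * v i)(j := t))" for x p t
    have [measurable]: "(\<lambda>q. H (f q) (g q) (h q)) \<in> borel_measurable M"
      if [measurable]: "f \<in> measurable M (PiM I (\<lambda>_. borel))" "g \<in> borel_measurable M" "h \<in> borel_measurable M" for M f g h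
      unfolding H_def by (rule measurable_pair_PiM_insert) measurable
    have vx: "?v (\<lambda>i\<in>I. x i + (p - ?v x) * v i) = p" for x p
    proof -
      have "?v (\<lambda>i\<in>I. x i + (p - ?v x) * v i) = (\<Sum>l\<in>I. v l * x l + (p - ?v x) * (v l)\<^sup>2)"
        by (rule sum.cong) (auto simp: algebra_simps power2_eq_square)
      also have "\<dots> = ?v x + (p - ?v x) * (\<Sum>l\<in>I. (v l)\<^sup>2)"
        by (simp add: sum.distrib sum_distrib_left)
      finally show ?thesis using v1 by simp
    qed
    have e: "F (\<lambda>i\<in>insert j I. (x(j:=y)) i + (z - ?u x y) * u i)
        = H x (?v x + (z - (s * y + c * ?v x)) * c) (y + (z - (s * y + c * ?v x)) * s)" for x y z
    proof -
      have "?u x y = s * y + c * ?v x"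
        by (subst sum_fun_upd_insert) (use fin in \<open>auto simp: s_def uv sum_distrib_left mult.assoc\<close>)
      then show ?thesis unfolding H_def
        by (subst restrict_insert_upd[OF fin(2)]) (use fin in \<open>auto simp: s_def uv algebra_simps intro!: arg_cong[of _ _ F] ext\<close>)
    qed
    have H': "H (\<lambda>i\<in>I. x i + (p - ?v x) * v i) q t = H x q t" for x p q t
      unfolding H_def vx
      by (intro arg_cong[of _ _ F] ext) (auto simp: algebra_simps)
    have rot: "(\<integral>\<^sup>+p. \<integral>\<^sup>+y. \<integral>\<^sup>+z. H x (p + (z - (s * y + c * p)) * c) (y + (z - (s * y + c * p)) * s) \<partial>?N \<partial>?N \<partial>?N)
          = (\<integral>\<^sup>+p. \<integral>\<^sup>+y. H x p y \<partial>?N \<partial>?N)" if x: "x \<in> space (gs I)" for x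
    proof -
      have x': "(\<lambda>q. x) \<in> measurable M (PiM I (\<lambda>_. borel))" for M
        using x by (auto simp: space_PiM)
      note [measurable] = x'
      \<comment> \<open>In the (p, y)-plane the coordinate along (c, s) becomes z and the orthogonal
        coordinate t = c y - s p is kept. One rotation shows that t is standard Gaussian; a second
        one, with -s, returns from (z, t) to (p, y).\<close>
      define K where "K t = (\<integral>\<^sup>+z. H x (c * z + (-s) * t) (c * t - (-s) * z) \<partial>?N)" for t
      have [measurable]: "K \<in> borel_measurable borel" unfolding K_def by measurable
      have "p + (z - (s * y + c * p)) * c = c * z + (-s) * (c * y - s * p)"
           "y + (z - (s * y + c * p)) * s = c * (c * y - s * p) - (-s) * z" for p y z
        using cs by algebra+
      then have "(\<integral>\<^sup>+p. \<integral>\<^sup>+y. \<integral>\<^sup>+z. H x (p + (z - (s * y + c * p)) * c) (y + (z - (s * y + c * p)) * s) \<partial>?N \<partial>?N \<partial>?N)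
          = (\<integral>\<^sup>+p. \<integral>\<^sup>+y. K (c * y - s * p) \<partial>?N \<partial>?N)"
        unfolding K_def by simp
      also have "\<dots> = (\<integral>\<^sup>+t. K t \<partial>?N)"
        using sn_rotation[OF cs, of "\<lambda>a b. K b"] by simp
      also have "\<dots> = (\<integral>\<^sup>+z. \<integral>\<^sup>+t. H x (c * z + (-s) * t) (c * t - (-s) * z) \<partial>?N \<partial>?N)"
        unfolding K_def by (rule nn_integral_swap) (auto intro: SN.sigma_finite_measure_axioms)
      also have "\<dots> = (\<integral>\<^sup>+p. \<integral>\<^sup>+y. H x p y \<partial>?N \<partial>?N)"
        by (rule sn_rotation) (use cs in auto)
      finally show ?thesis .
    qed
    have m: "(\<lambda>x. \<integral>\<^sup>+y. F (x(j := y)) \<partial>?N) \<in> borel_measurable (PiM I (\<lambda>_. borel))"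
    proof (rule SN.borel_measurable_nn_integral)
      have "(\<lambda>q. F ((fst q)(j := snd q))) \<in> borel_measurable (PiM I (\<lambda>_. borel) \<Otimes>\<^sub>M ?N)"
        by (rule measurable_pair_PiM_insert[where I=I]) measurable
      then show "(\<lambda>(x, y). F (x(j := y))) \<in> borel_measurable (PiM I (\<lambda>_. borel) \<Otimes>\<^sub>M ?N)"
        by (simp add: case_prod_beta')
    qed
    have "(\<integral>\<^sup>+x. \<integral>\<^sup>+y. \<integral>\<^sup>+z. F (\<lambda>i\<in>insert j I. (x(j:=y)) i + (z - ?u x y) * u i) \<partial>?N \<partial>?N \<partial>gs I)
        = (\<integral>\<^sup>+x. \<integral>\<^sup>+p. \<integral>\<^sup>+y. \<integral>\<^sup>+z. H x (p + (z - (s * y + c * p)) * c) (y + (z - (s * y + c * p)) * s) \<partial>?N \<partial>?N \<partial>?N \<partial>gs I)"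
      \<comment> \<open>The induction hypothesis is used twice: here it makes the coordinate along v
        an independent p, and after the planar rotation it absorbs p again.\<close>
      unfolding e by (subst insert.IH[OF v1, symmetric]) (simp_all only: vx H', measurable)
    also have "\<dots> = (\<integral>\<^sup>+x. \<integral>\<^sup>+p. \<integral>\<^sup>+y. H x p y \<partial>?N \<partial>?N \<partial>gs I)"
      by (intro nn_integral_cong rot)
    also have "\<dots> = (\<integral>\<^sup>+x. \<integral>\<^sup>+p. \<integral>\<^sup>+y. F ((\<lambda>i\<in>I. x i + (p - ?v x) * v i)(j := y)) \<partial>?N \<partial>?N \<partial>gs I)"
      unfolding H_def ..
    also have "(\<integral>\<^sup>+x. \<integral>\<^sup>+p. \<integral>\<^sup>+y. F ((\<lambda>i\<in>I. x i + (p - ?v x) * v i)(j := y)) \<partial>?N \<partial>?N \<partial>gs I)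
        = (\<integral>\<^sup>+x. \<integral>\<^sup>+y. F (x(j := y)) \<partial>?N \<partial>gs I)"
      by (rule insert.IH[OF v1, of "\<lambda>x. \<integral>\<^sup>+y. F (x(j:=y)) \<partial>?N"])
         (rule m)
    also have "\<dots> = (\<integral>\<^sup>+x. F x \<partial>gs (insert j I))"
      by (subst GS.product_nn_integral_insert) (use fin in auto)
    finally show ?thesis unfolding L .
  qed
qed

text \<open>One direction at a time. By orthonormality the replacements along J leave the coordinate
  along the new \<open>u j\<close> untouched (\<open>uT\<close>), so the successive replacements add
  up to the simultaneous one.\<close>

lemma gs_resample_family:
  fixes F :: "('i => real) => ennreal" and u :: "'j => 'i => real"
  assumes "finite J" "finite I"
    and "\<And>j l. j \<in> J ==> l \<in> J ==> (\<Sum>i\<in>I. u j i * u l i) = (if j = l then 1 else 0)"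
    and "F \<in> borel_measurable (PiM I (\<lambda>_. borel))"
  shows "(\<integral>\<^sup>+x. \<integral>\<^sup>+z. F (\<lambda>i\<in>I. x i + (\<Sum>j\<in>J. (z j - (\<Sum>l\<in>I. u j l * x l)) * u j i)) \<partial>gs J \<partial>gs I) = (\<integral>\<^sup>+x. F x \<partial>gs I)"
  using assms
proof (induction J arbitrary: F rule: finite_induct)
  case empty
  have "F (\<lambda>i\<in>I. x i) = F x" if "x \<in> space (gs I)" for x
    using that by (intro arg_cong[of _ _ F]) (auto simp: space_PiM)
  then have "(\<integral>\<^sup>+x. F (\<lambda>i\<in>I. x i) \<partial>gs I) = (\<integral>\<^sup>+x. F x \<partial>gs I)" by (intro nn_integral_cong)
  then show ?case by (simp add: GS.nn_integral_empty restrict_def)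
next
  case (insert j J)
  note [measurable] = insert.prems(3)
  let ?N = "sn"
  let ?T = "\<lambda>x z. \<lambda>i\<in>I. x i + (\<Sum>j\<in>J. (z j - (\<Sum>l\<in>I. u j l * x l)) * u j i)"
  define F1 where "F1 x = (\<integral>\<^sup>+y. F (\<lambda>i\<in>I. x i + (y - (\<Sum>l\<in>I. u j l * x l)) * u j i) \<partial>?N)" for x
  have [measurable]: "F1 \<in> borel_measurable (PiM I (\<lambda>_. borel))" unfolding F1_def by measurable
  have uT: "(\<Sum>l\<in>I. u j l * ?T x z l) = (\<Sum>l\<in>I. u j l * x l)" for x z
  proof -
    have "(\<Sum>l\<in>I. u j l * ?T x z l) = (\<Sum>l\<in>I. u j l * x l) + (\<Sum>l\<in>I. \<Sum>m\<in>J. (z m - (\<Sum>l\<in>I. u m l * x l)) * (u j l * u m l))"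
      by (simp add: distrib_left sum.distrib sum_distrib_left mult_ac)
    also have "(\<Sum>l\<in>I. \<Sum>m\<in>J. (z m - (\<Sum>l\<in>I. u m l * x l)) * (u j l * u m l))
        = (\<Sum>m\<in>J. (z m - (\<Sum>l\<in>I. u m l * x l)) * (\<Sum>l\<in>I. u j l * u m l))"
      by (subst sum.swap) (simp add: sum_distrib_left)
    also have "\<dots> = 0"
      by (rule sum.neutral) (use insert.prems(2) insert.hyps in auto)
    finally show ?thesis by simp
  qed
  have T: "F (\<lambda>i\<in>I. ?T x z i + (y - (\<Sum>l\<in>I. u j l * ?T x z l)) * u j i)
     = F (\<lambda>i\<in>I. x i + (\<Sum>m\<in>insert j J. ((z(j:=y)) m - (\<Sum>l\<in>I. u m l * x l)) * u m i))" for x y z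
  proof -
    have "(\<Sum>m\<in>J. ((z(j:=y)) m - (\<Sum>l\<in>I. u m l * x l)) * u m i) = (\<Sum>m\<in>J. (z m - (\<Sum>l\<in>I. u m l * x l)) * u m i)" for i
      by (rule sum.cong) (use insert.hyps in auto)
    then show ?thesis unfolding uT
      using insert.hyps by (intro arg_cong[of _ _ F] ext) (simp add: algebra_simps restrict_def)
  qed
  have [measurable]: "(\<lambda>z. F (\<lambda>i\<in>I. x i + (\<Sum>m\<in>insert j J. (z m - (\<Sum>l\<in>I. u m l * x l)) * u m i)))
      \<in> borel_measurable (PiM (insert j J) (\<lambda>_. borel))" for x
    using insert.hyps by measurable
  have "(\<integral>\<^sup>+x. F x \<partial>gs I) = (\<integral>\<^sup>+x. F1 x \<partial>gs I)"
    unfolding F1_def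
    by (rule gs_resample[symmetric]) (use insert.prems(1) insert.prems(2)[of j j] in \<open>auto simp: power2_eq_square\<close>)
  also have "\<dots> = (\<integral>\<^sup>+x. \<integral>\<^sup>+z. F1 (?T x z) \<partial>gs J \<partial>gs I)"
    by (rule insert.IH[symmetric]) (use insert.prems in auto)
  also have "\<dots> = (\<integral>\<^sup>+x. \<integral>\<^sup>+z. \<integral>\<^sup>+y. F (\<lambda>i\<in>I. x i + (\<Sum>m\<in>insert j J. ((z(j:=y)) m - (\<Sum>l\<in>I. u m l * x l)) * u m i)) \<partial>?N \<partial>gs J \<partial>gs I)"
    unfolding F1_def T ..
  also have "\<dots> = (\<integral>\<^sup>+x. \<integral>\<^sup>+z. F (\<lambda>i\<in>I. x i + (\<Sum>m\<in>insert j J. (z m - (\<Sum>l\<in>I. u m l * x l)) * u m i)) \<partial>gs (insert j J) \<partial>gs I)"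
    by (intro nn_integral_cong GS.product_nn_integral_insert[symmetric]) (use insert.hyps in auto)
  finally show ?case by (rule sym)
qed

text \<open>After resampling along the family the coordinates are exactly the fresh z, so their law
  can be read off without a basis of the whole space.\<close>

lemma gs_coordinates:
  fixes F :: "('j => real) => ennreal" and u :: "'j => 'i => real"
  assumes fin: "finite J" "finite I"
    and on: "\<And>j l. j \<in> J ==> l \<in> J ==> (\<Sum>i\<in>I. u j i * u l i) = (if j = l then 1 else 0)"
    and [measurable]: "F \<in> borel_measurable (PiM J (\<lambda>_. borel))"
  shows "(\<integral>\<^sup>+x. F (\<lambda>j\<in>J. \<Sum>i\<in>I. u j i * x i) \<partial>gs I) = (\<integral>\<^sup>+z. F z \<partial>gs J)"
proof -
  let ?T = "\<lambda>x z. \<lambda>i\<in>I. x i + (\<Sum>j\<in>J. (z j - (\<Sum>l\<in>I. u j l * x l)) * u j i)"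
  have "(\<lambda>j\<in>J. \<Sum>i\<in>I. u j i * ?T x z i) = z" if "z \<in> space (gs J)" for x z
  proof
    fix j
    show "(\<lambda>j\<in>J. \<Sum>i\<in>I. u j i * ?T x z i) j = z j"
    proof (cases "j \<in> J")
      case True
      have "(\<Sum>l\<in>I. u j l * ?T x z l) = (\<Sum>l\<in>I. u j l * x l) + (\<Sum>l\<in>I. \<Sum>m\<in>J. (z m - (\<Sum>l\<in>I. u m l * x l)) * (u j l * u m l))"
        by (simp add: distrib_left sum.distrib sum_distrib_left mult_ac)
      also have "(\<Sum>l\<in>I. \<Sum>m\<in>J. (z m - (\<Sum>l\<in>I. u m l * x l)) * (u j l * u m l))
          = (\<Sum>m\<in>J. (z m - (\<Sum>l\<in>I. u m l * x l)) * (\<Sum>l\<in>I. u j l * u m l))"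
        by (subst sum.swap) (simp add: sum_distrib_left)
      also have "\<dots> = (\<Sum>m\<in>J. if m = j then z j - (\<Sum>l\<in>I. u j l * x l) else 0)"
        by (rule sum.cong) (use on True in auto)
      also have "\<dots> = z j - (\<Sum>l\<in>I. u j l * x l)" using fin True by simp
      finally show ?thesis using True by simp
    qed (use that in \<open>auto simp: space_PiM\<close>)
  qed
  then have "(\<integral>\<^sup>+x. \<integral>\<^sup>+z. F z \<partial>gs J \<partial>gs I) = (\<integral>\<^sup>+x. \<integral>\<^sup>+z. F (\<lambda>j\<in>J. \<Sum>i\<in>I. u j i * ?T x z i) \<partial>gs J \<partial>gs I)"
    by (intro nn_integral_cong) simp
  also have "\<dots> = (\<integral>\<^sup>+x. F (\<lambda>j\<in>J. \<Sum>i\<in>I. u j i * x i) \<partial>gs I)"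
    by (rule gs_resample_family[OF fin on]) measurable
  finally show ?thesis
    by simp
qed

text \<open>Gram-Schmidt applied to the coefficient vectors a and b: p is the length of a, r the
  component of b along a, and t the length of the rest. The joint law therefore depends on the Gram
  matrix only.\<close>

lemma gs_two_functionals:
  fixes G :: "real => real => ennreal" and a b :: "'i => real"
  assumes fin: "finite I"
    and aa: "(\<Sum>i\<in>I. (a i)\<^sup>2) = p\<^sup>2" "p > 0"
    and ab: "(\<Sum>i\<in>I. a i * b i) = p * r"
    and bb: "(\<Sum>i\<in>I. (b i)\<^sup>2) = r\<^sup>2 + t\<^sup>2"
    and G[measurable]: "case_prod G \<in> borel_measurable (borel \<Otimes>\<^sub>M borel)"
  shows "(\<integral>\<^sup>+x. G (\<Sum>i\<in>I. a i * x i) (\<Sum>i\<in>I. b i * x i) \<partial>gs I)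
    = (\<integral>\<^sup>+z. \<integral>\<^sup>+z'. G (p * z) (r * z + t * z') \<partial>sn \<partial>sn)"
proof -
  let ?N = "sn"
  define u where "u i = a i / p" for i
  define v where "v i = b i - r * u i" for i
  have uu: "(\<Sum>i\<in>I. u i * u i) = 1"
    using aa by (simp add: u_def sum_divide_distrib[symmetric] power2_eq_square)
  have ub: "(\<Sum>i\<in>I. u i * b i) = r"
    using aa ab by (simp add: u_def sum_divide_distrib[symmetric])
  have uv: "(\<Sum>i\<in>I. u i * v i) = 0"
    using uu ub by (simp add: v_def right_diff_distrib sum_subtractf mult.left_commute sum_distrib_left[symmetric])
  have vv: "(\<Sum>i\<in>I. v i * v i) = t\<^sup>2"
  proof -
    have "(\<Sum>i\<in>I. v i * v i) = (\<Sum>i\<in>I. (b i)\<^sup>2 - 2 * r * (u i * b i) + r\<^sup>2 * (u i * u i))"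
      by (rule sum.cong) (auto simp: v_def power2_eq_square algebra_simps)
    also have "\<dots> = (\<Sum>i\<in>I. (b i)\<^sup>2) - 2 * r * (\<Sum>i\<in>I. u i * b i) + r\<^sup>2 * (\<Sum>i\<in>I. u i * u i)"
      by (simp add: sum.distrib sum_subtractf sum_distrib_left)
    finally show ?thesis using bb uu ub by (simp add: power2_eq_square algebra_simps)
  qed
  have a: "(\<Sum>i\<in>I. a i * x i) = p * (\<Sum>i\<in>I. u i * x i)" for x
    using aa(2) by (simp add: u_def sum_distrib_left)
  have b: "(\<Sum>i\<in>I. b i * x i) = r * (\<Sum>i\<in>I. u i * x i) + (\<Sum>i\<in>I. v i * x i)" for x
    by (simp add: v_def sum_distrib_left left_diff_distrib sum_subtractf mult.assoc)
  show ?thesis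
  proof (cases "t = 0")
    \<comment> \<open>b is a multiple of a, so there is only one orthonormal direction to pass
      to.\<close>
    case True
    then have v0: "v i = 0" if "i \<in> I" for i
      using vv that fin by (simp add: sum_nonneg_eq_0_iff)
    have "(\<integral>\<^sup>+x. G (\<Sum>i\<in>I. a i * x i) (\<Sum>i\<in>I. b i * x i) \<partial>gs I) = (\<integral>\<^sup>+x. G (p * (\<Sum>i\<in>I. u i * x i)) (r * (\<Sum>i\<in>I. u i * x i)) \<partial>gs I)"
      unfolding a b using v0 by simp
    also have "\<dots> = (\<integral>\<^sup>+z. G (p * z ()) (r * z ()) \<partial>gs {()})"
      by (subst gs_coordinates[of "{()}" I "\<lambda>_. u" "\<lambda>z. G (p * z ()) (r * z ())", symmetric]) (use fin uu in auto)
    also have "\<dots> = (\<integral>\<^sup>+z. G (p * z) (r * z) \<partial>?N)"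
      by (rule GS.product_nn_integral_singleton) simp
    finally show ?thesis using True by simp
  next
    case False
    define w where "w j = (if j then u else (\<lambda>i. v i / t))" for j
    have "(\<integral>\<^sup>+x. G (\<Sum>i\<in>I. a i * x i) (\<Sum>i\<in>I. b i * x i) \<partial>gs I)
       = (\<integral>\<^sup>+x. (\<lambda>z. G (p * z True) (r * z True + t * z False)) (\<lambda>j\<in>{True,False}. \<Sum>i\<in>I. w j i * x i) \<partial>gs I)"
      unfolding a b using False by (simp add: w_def sum_divide_distrib[symmetric])
    also have "\<dots> = (\<integral>\<^sup>+z. G (p * z True) (r * z True + t * z False) \<partial>gs {True,False})"
      by (rule gs_coordinates)
         (use fin uu uv vv False in \<open>auto simp: w_def sum_divide_distrib[symmetric] power2_eq_square mult.commute\<close>)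
    also have "\<dots> = (\<integral>\<^sup>+x. \<integral>\<^sup>+y. G (p * y) (r * y + t * x False) \<partial>?N \<partial>gs {False})"
      by (subst GS.product_nn_integral_insert) auto
    also have "\<dots> = (\<integral>\<^sup>+z'. \<integral>\<^sup>+y. G (p * y) (r * y + t * z') \<partial>?N \<partial>?N)"
      by (rule GS.product_nn_integral_singleton) simp
    also have "\<dots> = (\<integral>\<^sup>+z. \<integral>\<^sup>+z'. G (p * z) (r * z + t * z') \<partial>?N \<partial>?N)"
      by (rule nn_integral_swap) (auto intro: SN.sigma_finite_measure_axioms)
    finally show ?thesis .
  qed
qed

text \<open>A rotation by 45 degrees in every coordinate. It is what turns zeta = (xi + eta) / sqrt
  2 back into a standard Gaussian vector.\<close>

lemma gs_half_sum:
  fixes F :: "('i => real) => ennreal"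
  assumes "finite I" "F \<in> borel_measurable (PiM I (\<lambda>_. borel))"
  shows "(\<integral>\<^sup>+x. \<integral>\<^sup>+y. F (\<lambda>i\<in>I. (x i + y i) / sqrt 2) \<partial>gs I \<partial>gs I) = (\<integral>\<^sup>+x. F x \<partial>gs I)"
  using assms
proof (induction I arbitrary: F rule: finite_induct)
  case empty
  then show ?case by (simp add: GS.nn_integral_empty restrict_def)
next
  case (insert j I)
  note [measurable] = insert.prems
  note fin = insert.hyps
  let ?N = "sn"
  let ?h = "\<lambda>I x y. (\<lambda>i\<in>I. (x i + y i) / sqrt 2)"
  have e: "?h (insert j I) (x(j:=p)) (y(j:=r)) = (?h I x y)(j := (p + r) / sqrt 2)" for x y p r
    using fin by (auto simp: restrict_def fun_eq_iff)
  have [measurable]: "(\<lambda>q. F ((f q)(j := g q))) \<in> borel_measurable M"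
    if "f \<in> measurable M (PiM I (\<lambda>_. borel))" "g \<in> borel_measurable M" for M f g
    using that by (intro measurable_pair_PiM_insert) auto
  have "(\<integral>\<^sup>+x. \<integral>\<^sup>+y. F (?h (insert j I) x y) \<partial>gs (insert j I) \<partial>gs (insert j I))
     = (\<integral>\<^sup>+x. \<integral>\<^sup>+p. \<integral>\<^sup>+y. F (?h (insert j I) (x(j:=p)) y) \<partial>gs (insert j I) \<partial>?N \<partial>gs I)"
    by (subst GS.product_nn_integral_insert)
       (use fin in \<open>auto intro!: sigma_finite_measure.borel_measurable_nn_integral sigma_finite_gs\<close>)
  also have "\<dots> = (\<integral>\<^sup>+x. \<integral>\<^sup>+p. \<integral>\<^sup>+y. \<integral>\<^sup>+r. F ((?h I x y)(j := (p + r) / sqrt 2)) \<partial>?N \<partial>gs I \<partial>?N \<partial>gs I)"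
    by (intro nn_integral_cong, subst GS.product_nn_integral_insert) (use fin e in auto)
  also have "\<dots> = (\<integral>\<^sup>+x. \<integral>\<^sup>+y. \<integral>\<^sup>+p. \<integral>\<^sup>+r. F ((?h I x y)(j := (p + r) / sqrt 2)) \<partial>?N \<partial>?N \<partial>gs I \<partial>gs I)"
  proof (rule nn_integral_cong)
    fix x assume "x \<in> space (gs I)"
    then have [measurable]: "(\<lambda>_. x) \<in> measurable M (PiM I (\<lambda>_. borel))" for M :: "((real \<times> ('i => real)) \<times> real) measure"
      by (auto simp: space_PiM)
    show "(\<integral>\<^sup>+p. \<integral>\<^sup>+y. \<integral>\<^sup>+r. F ((?h I x y)(j := (p + r) / sqrt 2)) \<partial>?N \<partial>gs I \<partial>?N)
        = (\<integral>\<^sup>+y. \<integral>\<^sup>+p. \<integral>\<^sup>+r. F ((?h I x y)(j := (p + r) / sqrt 2)) \<partial>?N \<partial>?N \<partial>gs I)"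
      by (rule nn_integral_swap) (simp_all add: sigma_finite_gs SN.sigma_finite_measure_axioms)
  qed
  also have "\<dots> = (\<integral>\<^sup>+x. \<integral>\<^sup>+y. \<integral>\<^sup>+p. F ((?h I x y)(j := p)) \<partial>?N \<partial>gs I \<partial>gs I)"
  proof (rule nn_integral_cong, rule nn_integral_cong)
    fix x y
    have [measurable]: "(\<lambda>z. F ((?h I x y)(j:=z))) \<in> borel_measurable borel"
      by measurable
    have "(1/sqrt 2)\<^sup>2 + (1/sqrt 2)\<^sup>2 = (1::real)" by (simp add: power2_eq_square)
    from sn_rotation[OF this, of "\<lambda>p r. F ((?h I x y)(j:=p))"]
    show "(\<integral>\<^sup>+p. \<integral>\<^sup>+r. F ((?h I x y)(j := (p + r) / sqrt 2)) \<partial>?N \<partial>?N) = (\<integral>\<^sup>+p. F ((?h I x y)(j := p)) \<partial>?N)"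
      by (simp add: add_divide_distrib)
  qed
  also have "\<dots> = (\<integral>\<^sup>+x. \<integral>\<^sup>+p. F (x(j := p)) \<partial>?N \<partial>gs I)"
    by (rule insert.IH) measurable
  also have "\<dots> = (\<integral>\<^sup>+x. F x \<partial>gs (insert j I))"
    by (subst GS.product_nn_integral_insert) (use fin in auto)
  finally show ?case .
qed

section \<open>Moments, exponential moments and integration by parts\<close>

lemma sn_integrable_quartic:
  fixes f :: "real => real"
  assumes [measurable]: "f \<in> borel_measurable borel" and "\<And>x. \<bar>f x\<bar> <= a + b * x^4"
  shows "integrable sn f"
proof (rule Bochner_Integration.integrable_bound)
  show "integrable sn (\<lambda>x. a + b * x^4)"
    using integrable_std_normal_distribution_moment[of 4] by simp
  show "AE x in sn. norm (f x) <= norm (a + b * x ^ 4)"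
    using assms(2) by (intro always_eventually allI) (auto intro: order_trans[OF _ abs_ge_self])
qed measurable

lemma sn_integrable_quadratic:
  fixes f :: "real => real"
  assumes "f \<in> borel_measurable borel" and "\<And>x. \<bar>f x\<bar> <= a + b * x^2" and "b >= 0"
  shows "integrable sn f"
proof (rule sn_integrable_quartic[OF assms(1)])
  fix x :: real
  have "(x\<^sup>2 - 1)\<^sup>2 = x^4 - 2 * x^2 + 1" by algebra
  moreover have "0 <= (x\<^sup>2 - 1)\<^sup>2" "0 <= x\<^sup>2" by simp_all
  ultimately have "x^2 <= 1 + x^4" by linarith
  then have "b * x^2 <= b * (1 + x^4)" using assms(3) by (rule mult_left_mono)
  then show "\<bar>f x\<bar> <= (a + b) + b * x^4" using assms(2)[of x] by (simp add: algebra_simps)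
qed

lemma sn_integrable_linear:
  fixes f :: "real => real"
  assumes "f \<in> borel_measurable borel" and "\<And>x. \<bar>f x\<bar> <= a + b * \<bar>x\<bar>" and "b >= 0"
  shows "integrable sn f"
proof (rule sn_integrable_quadratic[OF assms(1) _ assms(3)])
  fix x :: real
  have "0 <= (\<bar>x\<bar> - 1)\<^sup>2" by simp
  then have "2 * \<bar>x\<bar> <= 1 + x^2" by (simp add: power2_eq_square algebra_simps)
  then have "\<bar>x\<bar> <= 1 + x^2" by (smt (verit) zero_le_power2)
  then have "b * \<bar>x\<bar> <= b * (1 + x^2)" using assms(3) by (rule mult_left_mono)
  then show "\<bar>f x\<bar> <= (a + b) + b * x^2" using assms(2)[of x] by (simp add: algebra_simps)
qed

lemma sn_moments:
  "(\<integral>x. x \<partial>sn) = 0" "(\<integral>x. x\<^sup>2 \<partial>sn) = 1"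
  "(\<integral>x. x^4 \<partial>sn) = 3"
  using integral_std_normal_distribution_moment_odd[of 1] std_normal_distribution_even_moments(1)[of 1]
    std_normal_distribution_even_moments(1)[of 2]
  by (auto simp: fact_numeral)

lemma sn_integrable_pow [simp]:
  "integrable sn (\<lambda>x. x^k)" "integrable sn (\<lambda>x. x)"
  using integrable_std_normal_distribution_moment[of k] integrable_std_normal_distribution_moment[of 1] by auto

lemma sn_prob_UNIV [simp]: "measure sn UNIV = 1"
  using SN.prob_space by simp

lemma sn_mgf: "(\<integral>\<^sup>+x. ennreal (exp (t * x)) \<partial>sn) = ennreal (exp (t\<^sup>2 / 2))"
proof -
  have e: "std_normal_density x * exp (t * x) = exp (t\<^sup>2/2) * normal_density t 1 x" for x
  proof -
    have "exp (- x\<^sup>2/2) * exp (t * x) = exp (t\<^sup>2/2) * exp (- (x - t)\<^sup>2/2)"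
      unfolding exp_add[symmetric] by (simp add: power2_eq_square field_simps)
    then show ?thesis by (simp add: normal_density_def)
  qed
  have "(\<integral>\<^sup>+x. ennreal (exp (t * x)) \<partial>sn)
     = (\<integral>\<^sup>+x. ennreal (exp (t\<^sup>2/2)) * ennreal (normal_density t 1 x) \<partial>lborel)"
    by (subst nn_integral_sn) (auto simp: ennreal_mult[symmetric] e)
  also have "\<dots> = ennreal (exp (t\<^sup>2/2)) * (\<integral>\<^sup>+x. ennreal (normal_density t 1 x) \<partial>lborel)"
    by (rule nn_integral_cmult) auto
  also have "(\<integral>\<^sup>+x. ennreal (normal_density t 1 x) \<partial>lborel) = 1"
    by (subst nn_integral_eq_integral) auto
  finally show ?thesis by simp
qed

text \<open>The exponent 1/4 turns the standard density into sqrt 2 times the density with variance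
  2. This is the price paid for each linearized coordinate in
  \<open>sum_spins_quadratic\<close>.\<close>

lemma sn_exp_square:
  "(\<integral>\<^sup>+x. ennreal (exp (x\<^sup>2 / 4)) \<partial>sn) = ennreal (sqrt 2)"
proof -
  have e: "std_normal_density x * exp (x\<^sup>2/4) = sqrt 2 * normal_density 0 (sqrt 2) x" for x
    by (simp add: normal_density_def exp_add[symmetric] real_sqrt_mult field_simps)
  have "(\<integral>\<^sup>+x. ennreal (exp (x\<^sup>2 / 4)) \<partial>sn)
     = (\<integral>\<^sup>+x. ennreal (sqrt 2) * ennreal (normal_density 0 (sqrt 2) x) \<partial>lborel)"
    by (subst nn_integral_sn) (auto simp: ennreal_mult[symmetric] e)
  also have "\<dots> = ennreal (sqrt 2) * (\<integral>\<^sup>+x. ennreal (normal_density 0 (sqrt 2) x) \<partial>lborel)"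
    by (rule nn_integral_cmult) auto
  also have "(\<integral>\<^sup>+x. ennreal (normal_density 0 (sqrt 2) x) \<partial>lborel) = 1"
    by (subst nn_integral_eq_integral) auto
  finally show ?thesis by simp
qed

text \<open>The fundamental theorem of calculus on the whole line for g times the Gaussian density;
  the boundary terms vanish because g is bounded.\<close>

lemma sn_integration_by_parts:
  fixes g g' :: "real => real"
  assumes d: "\<And>x. (g has_real_derivative g' x) (at x)"
    and c: "\<And>x. isCont g' x" and B: "\<And>x. \<bar>g x\<bar> <= B" "\<And>x. \<bar>g' x\<bar> <= B"
  shows "(\<integral>x. x * g x \<partial>sn) = (\<integral>x. g' x \<partial>sn)"
proof -
  let ?d = std_normal_density
  have "continuous_on UNIV g'" "continuous_on UNIV g"
    using c DERIV_isCont[OF d] by (auto simp: continuous_on_eq_continuous_at)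
  then have [measurable]: "g' \<in> borel_measurable borel" "g \<in> borel_measurable borel"
    by (auto intro: borel_measurable_continuous_onI)
  have B0: "0 <= B" using B(1)[of 0] by linarith
  have i1: "integrable sn g'"
    by (rule sn_integrable_linear[where a=B and b=0]) (use B in auto)
  have i2: "integrable sn (\<lambda>x. x * g x)"
    by (rule sn_integrable_linear[where a=0 and b=B])
       (use B B0 in \<open>auto simp: abs_mult mult.commute[of B] intro: mult_left_mono\<close>)
  have dd: "(?d has_real_derivative (- x * ?d x)) (at x)" for x
    unfolding std_normal_density_def by (auto intro!: derivative_eq_intros simp: field_simps)
  have "(LBINT x=-\<infinity>..\<infinity>. ?d x * g' x - ?d x * (x * g x)) = 0 - 0"
  proof (rule interval_integral_FTC_integrable[where F="\<lambda>x. g x * ?d x"])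
    show "((\<lambda>x. g x * ?d x) has_vector_derivative ?d x * g' x - ?d x * (x * g x)) (at x)" for x
      unfolding has_real_derivative_iff_has_vector_derivative[symmetric]
      by (rule DERIV_cong[OF DERIV_mult[OF d dd]]) (simp add: algebra_simps)
    show "isCont (\<lambda>x. ?d x * g' x - ?d x * (x * g x)) x" for x
      using DERIV_isCont[OF dd] DERIV_isCont[OF d] c by (intro continuous_intros) auto
    have "integrable lborel (\<lambda>x. ?d x * g' x - ?d x * (x * g x))"
      using i1 i2 by (simp add: integrable_density)
    then show "set_integrable lborel (einterval (- \<infinity>) \<infinity>) (\<lambda>x. ?d x * g' x - ?d x * (x * g x))"
      by (simp add: set_integrable_def)
    have l: "((\<lambda>x. B * ?d x) \<longlongrightarrow> 0) at_top" "((\<lambda>x. B * ?d x) \<longlongrightarrow> 0) at_bot"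
      unfolding std_normal_density_def by real_asymp+
    have "((\<lambda>x. g x * ?d x) \<longlongrightarrow> 0) at_top"
      by (rule Lim_null_comparison[OF _ l(1)]) (use B in \<open>auto simp: abs_mult intro!: always_eventually mult_right_mono\<close>)
    then show "(((\<lambda>x. g x * ?d x) \<circ> real_of_ereal) \<longlongrightarrow> 0) (at_left \<infinity>)"
      unfolding ereal_tendsto_simps1 .
    have "((\<lambda>x. g x * ?d x) \<longlongrightarrow> 0) at_bot"
      by (rule Lim_null_comparison[OF _ l(2)]) (use B in \<open>auto simp: abs_mult intro!: always_eventually mult_right_mono\<close>)
    then show "(((\<lambda>x. g x * ?d x) \<circ> real_of_ereal) \<longlongrightarrow> 0) (at_right (-\<infinity>))"
      unfolding ereal_tendsto_simps1 .
  qed auto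
  then have "(\<integral>x. ?d x * g' x - ?d x * (x * g x) \<partial>lborel) = 0"
    by (simp add: interval_lebesgue_integral_def set_lebesgue_integral_def)
  moreover have "integrable lborel (\<lambda>x. ?d x * g' x)" "integrable lborel (\<lambda>x. ?d x * (x * g x))"
    using i1 i2 by (auto simp: integrable_density)
  ultimately show ?thesis
    by (simp add: integral_density)
qed

section \<open>Laws of linear functionals and independence of coordinates\<close>

lemma measure_eqI_nn_integral:
  assumes "sets M = sets N"
    and "\<And>F. F \<in> borel_measurable M ==> (\<integral>\<^sup>+x. F x \<partial>M) = (\<integral>\<^sup>+x. F x \<partial>N)"
  shows "M = N"
proof (rule measure_eqI[OF assms(1)])
  fix A assume "A \<in> sets M"
  then show "emeasure M A = emeasure N A"
    using assms(2)[of "indicator A"] assms(1) by simp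
qed

text \<open>In the form of an equality of laws the fact transfers Bochner integrals too, with no
  integrability conditions to discharge.\<close>

lemma gs_two_functionals_distr:
  fixes a b :: "'i => real"
  assumes fin: "finite I"
    and aa: "(\<Sum>i\<in>I. (a i)\<^sup>2) = p\<^sup>2" "p > 0"
    and ab: "(\<Sum>i\<in>I. a i * b i) = p * r"
    and bb: "(\<Sum>i\<in>I. (b i)\<^sup>2) = r\<^sup>2 + t\<^sup>2"
  shows "distr (gs I) (borel \<Otimes>\<^sub>M borel) (\<lambda>x. (\<Sum>i\<in>I. a i * x i, \<Sum>i\<in>I. b i * x i))
     = distr (sn \<Otimes>\<^sub>M sn) (borel \<Otimes>\<^sub>M borel) (\<lambda>(z, z'). (p * z, r * z + t * z'))"
proof (rule measure_eqI_nn_integral)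
  fix F :: "real \<times> real => ennreal"
  assume "F \<in> borel_measurable (distr (gs I) (borel \<Otimes>\<^sub>M borel) (\<lambda>x. (\<Sum>i\<in>I. a i * x i, \<Sum>i\<in>I. b i * x i)))"
  then have F[measurable]: "F \<in> borel_measurable (borel \<Otimes>\<^sub>M borel)" by simp
  have "(\<integral>\<^sup>+x. F x \<partial>distr (gs I) (borel \<Otimes>\<^sub>M borel) (\<lambda>x. (\<Sum>i\<in>I. a i * x i, \<Sum>i\<in>I. b i * x i)))
      = (\<integral>\<^sup>+x. F (\<Sum>i\<in>I. a i * x i, \<Sum>i\<in>I. b i * x i) \<partial>gs I)"
    by (rule nn_integral_distr) measurable
  also have "\<dots> = (\<integral>\<^sup>+z. \<integral>\<^sup>+z'. F (p * z, r * z + t * z') \<partial>sn \<partial>sn)"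
    using F by (intro gs_two_functionals[OF assms, of "curry F", unfolded curry_def]) simp
  also have "\<dots> = (\<integral>\<^sup>+x. F (case x of (z, z') => (p * z, r * z + t * z')) \<partial>(sn \<Otimes>\<^sub>M sn))"
    by (subst SN.nn_integral_fst[symmetric]) auto
  also have "\<dots> = (\<integral>\<^sup>+x. F x \<partial>distr (sn \<Otimes>\<^sub>M sn) (borel \<Otimes>\<^sub>M borel) (\<lambda>(z, z'). (p * z, r * z + t * z')))"
    by (rule nn_integral_distr[symmetric]) measurable
  finally show "(\<integral>\<^sup>+x. F x \<partial>distr (gs I) (borel \<Otimes>\<^sub>M borel) (\<lambda>x. (\<Sum>i\<in>I. a i * x i, \<Sum>i\<in>I. b i * x i))) =
    (\<integral>\<^sup>+x. F x \<partial>distr (sn \<Otimes>\<^sub>M sn) (borel \<Otimes>\<^sub>M borel) (\<lambda>(z, z'). (p * z, r * z + t * z')))" .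
qed simp

lemma gs_integral_two_functionals:
  fixes a b :: "'i => real" and f :: "real => real => real"
  assumes "finite I" "(\<Sum>i\<in>I. (a i)\<^sup>2) = p\<^sup>2" "p > 0" "(\<Sum>i\<in>I. a i * b i) = p * r"
    "(\<Sum>i\<in>I. (b i)\<^sup>2) = r\<^sup>2 + t\<^sup>2"
    and [measurable]: "case_prod f \<in> borel_measurable (borel \<Otimes>\<^sub>M borel)"
  shows "(\<integral>x. f (\<Sum>i\<in>I. a i * x i) (\<Sum>i\<in>I. b i * x i) \<partial>gs I)
     = (\<integral>x. f (p * fst x) (r * fst x + t * snd x) \<partial>(sn \<Otimes>\<^sub>M sn))"
proof -
  have "(\<integral>x. f (\<Sum>i\<in>I. a i * x i) (\<Sum>i\<in>I. b i * x i) \<partial>gs I)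
    = (\<integral>x. case_prod f x \<partial>distr (gs I) (borel \<Otimes>\<^sub>M borel) (\<lambda>x. (\<Sum>i\<in>I. a i * x i, \<Sum>i\<in>I. b i * x i)))"
    by (subst integral_distr) auto
  also have "\<dots> = (\<integral>x. f (p * fst x) (r * fst x + t * snd x) \<partial>(sn \<Otimes>\<^sub>M sn))"
    unfolding gs_two_functionals_distr[OF assms(1-5)]
    by (subst integral_distr) (auto simp: case_prod_beta')
  finally show ?thesis .
qed

lemma gs_integral_functional:
  fixes a :: "'i => real" and f :: "real => real"
  assumes "finite I" "(\<Sum>i\<in>I. (a i)\<^sup>2) = p\<^sup>2" "p > 0"
    and [measurable]: "f \<in> borel_measurable borel"
  shows "(\<integral>x. f (\<Sum>i\<in>I. a i * x i) \<partial>gs I) = (\<integral>x. f (p * x) \<partial>sn)"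
proof -
  interpret P: pair_prob_space sn sn ..
  have "(\<integral>x. f (\<Sum>i\<in>I. a i * x i) \<partial>gs I)
     = (\<integral>x. f (p * fst x) \<partial>(sn \<Otimes>\<^sub>M sn))"
    using assms by (subst gs_integral_two_functionals[where b=a and r=p and t=0 and f="\<lambda>x y. f x"])
      (auto simp: power2_eq_square)
  also have "\<dots> = (\<integral>x. f (p * x) \<partial>distr (sn \<Otimes>\<^sub>M sn) sn fst)"
    by (subst integral_distr) auto
  also have "distr (sn \<Otimes>\<^sub>M sn) sn fst = sn"
    by (rule SN.distr_pair_fst)
  finally show ?thesis .
qed

lemma gs_integral_coordinate_pair:
  fixes F G :: "real => real"
  assumes fin: "finite I" and i: "i \<in> I" "l \<in> I" "i ~= l"
    and int: "integrable sn F" "integrable sn G"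
  shows "(\<integral>x. F (x i) * G (x l) \<partial>gs I) = (\<integral>x. F x \<partial>sn) * (\<integral>x. G x \<partial>sn)"
    "integrable (gs I) (\<lambda>x. F (x i) * G (x l))"
proof -
  let ?f = "\<lambda>m y. (if m = i then F y else if m = l then G y else 1)"
  have p: "(\<Prod>m\<in>I. if m = i then A else if m = l then B else 1) = A * B" for A B :: real
  proof -
    have "(\<Prod>m\<in>I. if m = i then A else if m = l then B else 1) = (\<Prod>m\<in>I. (if m = i then A else 1) * (if m = l then B else 1))"
      by (rule prod.cong) (use i in auto)
    then show ?thesis using fin i by (simp add: prod.distrib)
  qed
  have int': "integrable sn (?f m)" for m
    using int by (cases "m = i"; cases "m = l") auto
  have "(\<integral>x. (\<Prod>m\<in>I. ?f m (x m)) \<partial>gs I) = (\<Prod>m\<in>I. integral\<^sup>L sn (?f m))"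
    by (rule GS.product_integral_prod[OF fin int'])
  moreover have pf: "(\<Prod>m\<in>I. ?f m (x m)) = F (x i) * G (x l)" for x
    unfolding p[symmetric] by (rule prod.cong) auto
  moreover have "integral\<^sup>L sn (?f m) = (if m = i then integral\<^sup>L sn F else if m = l then integral\<^sup>L sn G else 1)" for m
    by (simp add: sn_prob_UNIV)
  ultimately show "(\<integral>x. F (x i) * G (x l) \<partial>gs I) = (\<integral>x. F x \<partial>sn) * (\<integral>x. G x \<partial>sn)"
    by (simp add: p)
  have "integrable (gs I) (\<lambda>x. \<Prod>m\<in>I. ?f m (x m))"
    by (rule GS.product_integrable_prod[OF fin int'])
  then show "integrable (gs I) (\<lambda>x. F (x i) * G (x l))"
    unfolding pf .
qed

lemma gs_distr_coordinate:
  "finite I ==> i \<in> I ==> distr (gs I) sn (\<lambda>x. x i) = sn"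
  by (rule distr_PiM_component) (auto intro: SN.prob_space_axioms)

lemma gs_integral_coordinate:
  fixes F :: "real => real"
  assumes "finite I" "i \<in> I" and [measurable]: "F \<in> borel_measurable borel"
  shows "(\<integral>x. F (x i) \<partial>gs I) = (\<integral>x. F x \<partial>sn)"
    "integrable (gs I) (\<lambda>x. F (x i)) \<longleftrightarrow> integrable sn F"
proof -
  have "(\<integral>x. F (x i) \<partial>gs I) = (\<integral>x. F x \<partial>distr (gs I) sn (\<lambda>x. x i))"
    by (subst integral_distr) (use assms in auto)
  then show "(\<integral>x. F (x i) \<partial>gs I) = (\<integral>x. F x \<partial>sn)"
    using assms by (simp add: gs_distr_coordinate)
  have "integrable (distr (gs I) sn (\<lambda>x. x i)) F \<longleftrightarrow> integrable (gs I) (\<lambda>x. F (x i))"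
    by (subst integrable_distr_eq) (use assms in auto)
  then show "integrable (gs I) (\<lambda>x. F (x i)) \<longleftrightarrow> integrable sn F"
    using assms by (simp add: gs_distr_coordinate)
qed

text \<open>The products of distinct centered summands integrate to 0, and the variance of each
  summand is at most its second moment. This is the only source of laws of large numbers
  below.\<close>

lemma gs_sum_second_moment:
  fixes F :: "'i => real => real"
  assumes fin: "finite I" and [measurable]: "\<And>i. F i \<in> borel_measurable borel"
    and int: "\<And>i. integrable sn (\<lambda>x. (F i x)\<^sup>2)"
  shows "integrable (gs I) (\<lambda>x. (\<Sum>i\<in>I. F i (x i) - (\<integral>y. F i y \<partial>sn))\<^sup>2)"
    "(\<integral>x. (\<Sum>i\<in>I. F i (x i) - (\<integral>y. F i y \<partial>sn))\<^sup>2 \<partial>gs I) <= (\<Sum>i\<in>I. \<integral>x. (F i x)\<^sup>2 \<partial>sn)"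
proof -
  let ?N = "sn"
  define G where "G i x = F i x - (\<integral>y. F i y \<partial>?N)" for i x
  have intF: "integrable ?N (F i)" for i
    by (rule SN.square_integrable_imp_integrable) (use int in auto)
  have intG: "integrable ?N (G i)" for i unfolding G_def using intF by simp
  have G0: "(\<integral>y. G i y \<partial>?N) = 0" for i
    unfolding G_def using intF by (simp add: sn_prob_UNIV)
  have [measurable]: "G i \<in> borel_measurable borel" for i unfolding G_def by measurable
  have G2: "integrable ?N (\<lambda>x. G i x * G i x)" and G2b: "(\<integral>x. G i x * G i x \<partial>?N) <= (\<integral>x. (F i x)\<^sup>2 \<partial>?N)" for i
  proof -
    have e: "G i x * G i x = (F i x)\<^sup>2 - 2 * (\<integral>y. F i y \<partial>?N) * F i x + (\<integral>y. F i y \<partial>?N)\<^sup>2" for x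
      by (simp add: G_def power2_eq_square algebra_simps)
    show "integrable ?N (\<lambda>x. G i x * G i x)" unfolding e using int intF by simp
    have "(\<integral>x. G i x * G i x \<partial>?N) = (\<integral>x. (F i x)\<^sup>2 \<partial>?N) - 2 * (\<integral>y. F i y \<partial>?N) * (\<integral>y. F i y \<partial>?N) + (\<integral>y. F i y \<partial>?N)\<^sup>2"
      unfolding e using int intF by (simp add: sn_prob_UNIV)
    also have "\<dots> = (\<integral>x. (F i x)\<^sup>2 \<partial>?N) - (\<integral>y. F i y \<partial>?N)\<^sup>2" by (simp add: power2_eq_square)
    finally show "(\<integral>x. G i x * G i x \<partial>?N) <= (\<integral>x. (F i x)\<^sup>2 \<partial>?N)" by simp
  qed
  have e: "(\<Sum>i\<in>I. G i (x i))\<^sup>2 = (\<Sum>i\<in>I. \<Sum>l\<in>I. G i (x i) * G l (x l))" for x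
    by (simp add: power2_eq_square sum_product)
  have il: "integrable (gs I) (\<lambda>x. G i (x i) * G l (x l))" if "i \<in> I" "l \<in> I" for i l
  proof (cases "i = l")
    case True
    then show ?thesis using gs_integral_coordinate(2)[OF fin that(1), of "\<lambda>x. G i x * G i x"] G2 by simp
  qed (use gs_integral_coordinate_pair(2)[OF fin that _ intG intG] in simp)
  have v: "(\<integral>x. G i (x i) * G l (x l) \<partial>gs I) <= (if l = i then (\<integral>x. (F i x)\<^sup>2 \<partial>?N) else 0)" if "i \<in> I" "l \<in> I" for i l
  proof (cases "i = l")
    case True
    then show ?thesis using gs_integral_coordinate(1)[OF fin that(1), of "\<lambda>x. G i x * G i x"] G2b by simp
  qed (use gs_integral_coordinate_pair(1)[OF fin that _ intG intG] G0 in simp)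
  show "integrable (gs I) (\<lambda>x. (\<Sum>i\<in>I. F i (x i) - (\<integral>y. F i y \<partial>?N))\<^sup>2)"
    unfolding G_def[symmetric] e by (intro Bochner_Integration.integrable_sum il)
  have "(\<integral>x. (\<Sum>i\<in>I. G i (x i))\<^sup>2 \<partial>gs I) = (\<Sum>i\<in>I. \<Sum>l\<in>I. \<integral>x. G i (x i) * G l (x l) \<partial>gs I)"
    unfolding e using il by (simp add: Bochner_Integration.integral_sum integrable_sum)
  also have "\<dots> <= (\<Sum>i\<in>I. \<Sum>l\<in>I. (if l = i then (\<integral>x. (F i x)\<^sup>2 \<partial>?N) else 0))"
    by (intro sum_mono v)
  also have "\<dots> = (\<Sum>i\<in>I. \<integral>x. (F i x)\<^sup>2 \<partial>?N)" using fin by simp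
  finally show "(\<integral>x. (\<Sum>i\<in>I. F i (x i) - (\<integral>y. F i y \<partial>?N))\<^sup>2 \<partial>gs I) <= (\<Sum>i\<in>I. \<integral>x. (F i x)\<^sup>2 \<partial>?N)"
    unfolding G_def .
qed

section \<open>The replica symmetric formula and the fixed point\<close>

interpretation SN2: pair_prob_space sn sn ..

text \<open>A pair of Gaussians is treated as a vector indexed by booleans, so that the facts on
  linear functionals and on coordinates of \<open>gs\<close> apply to it.\<close>

lemma pair_eq_gs: "distr (gs UNIV) (borel \<Otimes>\<^sub>M borel) (\<lambda>x. (x True, x False)) = distr (sn \<Otimes>\<^sub>M sn) (borel \<Otimes>\<^sub>M borel) (\<lambda>x. x)"
  using gs_two_functionals_distr[of "UNIV::bool set" "\<lambda>i. if i then 1 else 0" 1 "\<lambda>i. if i then 0 else 1" 0 1]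
  by (simp add: UNIV_bool case_prod_beta')

lemma pair_integral_eq_gs:
  fixes f :: "real => real => real"
  assumes [measurable]: "case_prod f \<in> borel_measurable (borel \<Otimes>\<^sub>M borel)"
  shows "(\<integral>x. f (fst x) (snd x) \<partial>(sn \<Otimes>\<^sub>M sn)) = (\<integral>x. f (x True) (x False) \<partial>gs UNIV)"
    and "integrable (sn \<Otimes>\<^sub>M sn) (\<lambda>x. f (fst x) (snd x)) \<longleftrightarrow> integrable (gs UNIV) (\<lambda>x. f (x True) (x False))"
proof -
  have "(\<integral>x. f (fst x) (snd x) \<partial>(sn \<Otimes>\<^sub>M sn)) = (\<integral>x. f (fst x) (snd x) \<partial>distr (sn \<Otimes>\<^sub>M sn) (borel \<Otimes>\<^sub>M borel) (\<lambda>x. x))"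
    by (subst integral_distr) auto
  also have "\<dots> = (\<integral>x. f (x True) (x False) \<partial>gs UNIV)"
    unfolding pair_eq_gs[symmetric] by (subst integral_distr) auto
  finally show "(\<integral>x. f (fst x) (snd x) \<partial>(sn \<Otimes>\<^sub>M sn)) = (\<integral>x. f (x True) (x False) \<partial>gs UNIV)" .
  have "integrable (sn \<Otimes>\<^sub>M sn) (\<lambda>x. f (fst x) (snd x)) \<longleftrightarrow> integrable (distr (sn \<Otimes>\<^sub>M sn) (borel \<Otimes>\<^sub>M borel) (\<lambda>x. x)) (\<lambda>x. f (fst x) (snd x))"
    by (subst integrable_distr_eq) auto
  also have "\<dots> \<longleftrightarrow> integrable (gs UNIV) (\<lambda>x. f (x True) (x False))"
    unfolding pair_eq_gs[symmetric] by (subst integrable_distr_eq) auto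
  finally show "integrable (sn \<Otimes>\<^sub>M sn) (\<lambda>x. f (fst x) (snd x)) \<longleftrightarrow> integrable (gs UNIV) (\<lambda>x. f (x True) (x False))" .
qed

lemma pair_integral_mult:
  fixes F G :: "real => real"
  assumes "integrable sn F" "integrable sn G"
  shows "(\<integral>x. F (fst x) * G (snd x) \<partial>(sn \<Otimes>\<^sub>M sn)) = (\<integral>x. F x \<partial>sn) * (\<integral>x. G x \<partial>sn)"
    "integrable (sn \<Otimes>\<^sub>M sn) (\<lambda>x. F (fst x) * G (snd x))"
proof -
  have [measurable]: "F \<in> borel_measurable borel" "G \<in> borel_measurable borel"
    using assms[THEN borel_measurable_integrable] by simp_all
  show "(\<integral>x. F (fst x) * G (snd x) \<partial>(sn \<Otimes>\<^sub>M sn)) = (\<integral>x. F x \<partial>sn) * (\<integral>x. G x \<partial>sn)"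
    using pair_integral_eq_gs(1)[of "\<lambda>x y. F x * G y"] gs_integral_coordinate_pair(1)[of "UNIV::bool set" True False F G] assms
    by simp
  show "integrable (sn \<Otimes>\<^sub>M sn) (\<lambda>x. F (fst x) * G (snd x))"
    using pair_integral_eq_gs(2)[of "\<lambda>x y. F x * G y"] gs_integral_coordinate_pair(2)[of "UNIV::bool set" True False F G] assms
    by simp
qed

lemma pair_integral_fst_snd:
  fixes F :: "real => real"
  assumes "integrable sn F"
  shows "(\<integral>x. F (fst x) \<partial>(sn \<Otimes>\<^sub>M sn)) = (\<integral>x. F x \<partial>sn)" "integrable (sn \<Otimes>\<^sub>M sn) (\<lambda>x. F (fst x))"
    "(\<integral>x. F (snd x) \<partial>(sn \<Otimes>\<^sub>M sn)) = (\<integral>x. F x \<partial>sn)" "integrable (sn \<Otimes>\<^sub>M sn) (\<lambda>x. F (snd x))"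
  using pair_integral_mult[OF assms, of "\<lambda>_. 1"] pair_integral_mult[OF _ assms, of "\<lambda>_. 1"] by auto

lemma sn_integral_add:
  fixes f :: "real => real"
  assumes "s\<^sup>2 + t\<^sup>2 = p\<^sup>2" "p > 0" and [measurable]: "f \<in> borel_measurable borel"
  shows "(\<integral>x. f (p * x) \<partial>sn) = (\<integral>x. f (s * fst x + t * snd x) \<partial>(sn \<Otimes>\<^sub>M sn))"
proof -
  have "(\<integral>x. f (s * fst x + t * snd x) \<partial>(sn \<Otimes>\<^sub>M sn)) = (\<integral>x. f (\<Sum>i\<in>UNIV. (if i then s else t) * x i) \<partial>gs UNIV)"
    by (subst pair_integral_eq_gs(1)[of "\<lambda>x y. f (s * x + t * y)"]) (auto simp: UNIV_bool add.commute)
  also have "\<dots> = (\<integral>x. f (p * x) \<partial>sn)"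
    by (rule gs_integral_functional) (use assms in \<open>auto simp: UNIV_bool add.commute\<close>)
  finally show ?thesis by simp
qed

lemma sn_integral_reflect:
  fixes f :: "real => real"
  assumes [measurable]: "f \<in> borel_measurable borel"
  shows "(\<integral>x. f (- x) \<partial>sn) = (\<integral>x. f x \<partial>sn)"
  using gs_integral_functional[of "{()}" "\<lambda>_. -1" 1 f] gs_integral_coordinate(1)[of "{()}" "()" "\<lambda>x. f (-x)"]
  by simp

section \<open>Bounds and Taylor estimates for tanh and ln cosh\<close>

lemma tanh_bounds: "\<bar>tanh (x::real)\<bar> <= 1" "(tanh (x::real))\<^sup>2 <= 1" "0 <= 1 - (tanh (x::real))\<^sup>2"
proof -
  show "\<bar>tanh (x::real)\<bar> <= 1" using tanh_real_bounds[of x] by (auto simp: abs_le_iff)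
  then show "(tanh (x::real))\<^sup>2 <= 1" by (simp add: abs_square_le_1)
  then show "0 <= 1 - (tanh (x::real))\<^sup>2" by simp
qed

lemma DERIV_tanh_real: "(tanh has_real_derivative 1 - (tanh x)\<^sup>2) (at x)" for x :: real
  by (auto intro!: derivative_eq_intros)

lemma tanh_lipschitz: "\<bar>tanh x - tanh y\<bar> <= \<bar>x - y\<bar>" for x y :: real
  using field_differentiable_bound[of "UNIV::real set" tanh "\<lambda>x. 1 - (tanh x)\<^sup>2" 1 x y] DERIV_tanh_real tanh_bounds(2)
  by (auto intro: has_field_derivative_at_within)

lemma DERIV_ln_cosh: "((\<lambda>x. ln (cosh x)) has_real_derivative tanh x) (at x)" for x :: real
  by (auto intro!: derivative_eq_intros simp: tanh_def)

lemma ln_cosh_lipschitz: "\<bar>ln (cosh x) - ln (cosh y)\<bar> <= \<bar>x - y\<bar>" for x y :: real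
  using field_differentiable_bound[of "UNIV::real set" "\<lambda>x. ln (cosh x)" tanh 1 x y] DERIV_ln_cosh tanh_bounds(1)
  by (auto intro: has_field_derivative_at_within)

lemma ln_cosh_bound: "\<bar>ln (cosh x)\<bar> <= \<bar>x\<bar>" for x :: real
  using ln_cosh_lipschitz[of x 0] by simp

lemma measurable_tanh [measurable]: "(tanh :: real => real) \<in> borel_measurable borel"
  by (intro borel_measurable_continuous_onI continuous_intros) auto

lemma measurable_cosh [measurable]: "(cosh :: real => real) \<in> borel_measurable borel"
  by (intro borel_measurable_continuous_onI continuous_intros)

lemma taylor2:
  fixes f f' f'' :: "real => real"
  assumes "\<And>x. (f has_real_derivative f' x) (at x)" "\<And>x. (f' has_real_derivative f'' x) (at x)" "\<And>x. \<bar>f'' x\<bar> <= M"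
  shows "\<bar>f (a + x) - f a - f' a * x\<bar> <= M / 2 * x\<^sup>2"
proof (cases "x = 0")
  case False
  define d where "d m = (if m = 0 then f else if m = 1 then f' else f'')" for m :: nat
  have "\<exists>t. (if a + x < a then a + x < t \<and> t < a else a < t \<and> t < a + x) \<and>
      f (a + x) = (\<Sum>m<2. d m a / fact m * (a + x - a)^m) + d 2 t / fact 2 * (a + x - a)^2"
    by (rule Taylor[where a="min a (a+x)" and b="max a (a+x)"])
       (use assms False in \<open>auto simp: d_def less_2_cases_iff\<close>)
  then obtain t where "f (a + x) = (\<Sum>m<2. d m a / fact m * x^m) + d 2 t / fact 2 * x^2" by auto
  then have e: "f (a + x) - f a - f' a * x = f'' t / 2 * x\<^sup>2"
    by (simp add: d_def numeral_2_eq_2)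
  have "\<bar>f'' t / 2 * x\<^sup>2\<bar> <= M / 2 * x\<^sup>2"
    using assms(3)[of t] by (simp add: abs_mult mult_right_mono)
  then show ?thesis unfolding e .
qed simp

lemma taylor3:
  fixes f f' f'' g :: "real => real"
  assumes "\<And>x. (f has_real_derivative f' x) (at x)" "\<And>x. (f' has_real_derivative f'' x) (at x)"
    "\<And>x. (f'' has_real_derivative g x) (at x)" "\<And>x. \<bar>g x\<bar> <= M"
  shows "\<bar>f (a + x) - f a - f' a * x - f'' a / 2 * x\<^sup>2\<bar> <= M / 6 * \<bar>x\<bar>^3"
proof (cases "x = 0")
  case False
  define d where "d m = (if m = 0 then f else if m = 1 then f' else if m = 2 then f'' else g)" for m :: nat
  have "\<exists>t. (if a + x < a then a + x < t \<and> t < a else a < t \<and> t < a + x) \<and>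
      f (a + x) = (\<Sum>m<3. d m a / fact m * (a + x - a)^m) + d 3 t / fact 3 * (a + x - a)^3"
  proof (rule Taylor[where a="min a (a+x)" and b="max a (a+x)"])
    show "\<forall>m t. m < 3 \<and> min a (a + x) <= t \<and> t <= max a (a + x) --> (d m has_real_derivative d (Suc m) t) (at t)"
    proof (intro allI impI)
      fix m t assume "m < (3::nat) \<and> min a (a + x) <= t \<and> t <= max a (a + x)"
      then have "m = 0 \<or> m = 1 \<or> m = 2" by auto
      then show "(d m has_real_derivative d (Suc m) t) (at t)" using assms by (auto simp: d_def)
    qed
  qed (use False in \<open>auto simp: d_def\<close>)
  then obtain t where "f (a + x) = (\<Sum>m<3. d m a / fact m * x^m) + d 3 t / fact 3 * x^3" by auto
  then have e: "f (a + x) - f a - f' a * x - f'' a / 2 * x\<^sup>2 = g t / 6 * x^3"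
    by (simp add: d_def numeral_3_eq_3 numeral_2_eq_2)
  have "\<bar>g t / 6 * x^3\<bar> <= M / 6 * \<bar>x\<bar>^3"
    using assms(4)[of t] by (simp add: abs_mult power_abs mult_right_mono)
  then show ?thesis unfolding e .
qed simp

text \<open>With u the square of tanh, the second derivative is 2 (1 - u) (1 - 3 u), and |1 - 3 u|
  <= 1 + u on [0, 1] bounds it by 2. When x is an independent centered Gaussian the linear term
  averages out, so this remainder alone gives the Lipschitz constant of \<open>F\<close>.\<close>

lemma tanh_square_taylor: "\<bar>(tanh (a + x))\<^sup>2 - (tanh a)\<^sup>2 - 2 * tanh a * (1 - (tanh a)\<^sup>2) * x\<bar> <= x\<^sup>2" for a x :: real
proof -
  have "\<bar>(tanh (a + x))\<^sup>2 - (tanh a)\<^sup>2 - 2 * tanh a * (1 - (tanh a)\<^sup>2) * x\<bar> <= 2 / 2 * x\<^sup>2"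
  proof (rule taylor2[where f''="\<lambda>x. 2 * (1 - (tanh x)\<^sup>2) * (1 - 3 * (tanh x)\<^sup>2)"])
    fix x :: real
    show "((\<lambda>x. (tanh x)\<^sup>2) has_real_derivative 2 * tanh x * (1 - (tanh x)\<^sup>2)) (at x)"
      by (auto intro!: derivative_eq_intros)
    show "((\<lambda>a. 2 * tanh a * (1 - (tanh a)\<^sup>2)) has_real_derivative 2 * (1 - (tanh x)\<^sup>2) * (1 - 3 * (tanh x)\<^sup>2)) (at x)"
      by (auto intro!: derivative_eq_intros simp: power2_eq_square algebra_simps)
    define u where "u = (tanh x)\<^sup>2"
    have u: "0 <= u" "u <= 1" using tanh_bounds(2) by (auto simp: u_def)
    have "\<bar>1 - 3 * u\<bar> <= 1 + u" "0 <= 1 - u" using u by linarith+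
    then have "\<bar>(1 - u) * (1 - 3 * u)\<bar> <= (1 - u) * (1 + u)"
      by (simp add: abs_mult mult_left_mono)
    also have "\<dots> <= 1" using u by (simp add: algebra_simps)
    finally have "2 * \<bar>(1 - u) * (1 - 3 * u)\<bar> <= 2" by simp
    then show "\<bar>2 * (1 - (tanh x)\<^sup>2) * (1 - 3 * (tanh x)\<^sup>2)\<bar> <= 2"
      unfolding u_def abs_mult mult.assoc by simp
  qed
  then show ?thesis by simp
qed

lemma ln_cosh_taylor2: "\<bar>ln (cosh (a + x)) - ln (cosh a) - tanh a * x\<bar> <= 1 / 2 * x\<^sup>2" for a x :: real
  by (rule taylor2[where f''="\<lambda>x. 1 - (tanh x)\<^sup>2"])
     (use DERIV_ln_cosh DERIV_tanh_real tanh_bounds in \<open>auto simp: abs_le_iff intro: order_trans[of _ 1]\<close>)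

lemma ln_cosh_taylor3: "\<bar>ln (cosh (a + x)) - ln (cosh a) - tanh a * x - (1 - (tanh a)\<^sup>2) / 2 * x\<^sup>2\<bar> <= \<bar>x\<bar>^3" for a x :: real
proof -
  have "\<bar>ln (cosh (a + x)) - ln (cosh a) - tanh a * x - (1 - (tanh a)\<^sup>2) / 2 * x\<^sup>2\<bar> <= 2 / 6 * \<bar>x\<bar>^3"
  proof (rule taylor3[where g="\<lambda>x. - 2 * tanh x * (1 - (tanh x)\<^sup>2)"])
    fix x :: real
    show "((\<lambda>a. 1 - (tanh a)\<^sup>2) has_real_derivative - 2 * tanh x * (1 - (tanh x)\<^sup>2)) (at x)"
      by (auto intro!: derivative_eq_intros)
    have "\<bar>tanh x\<bar> * (1 - (tanh x)\<^sup>2) <= 1 * 1"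
      by (rule mult_mono) (use tanh_bounds[of x] in auto)
    then show "\<bar>- 2 * tanh x * (1 - (tanh x)\<^sup>2)\<bar> <= 2" using tanh_bounds(3)[of x] by (simp add: abs_mult)
  qed (auto simp: DERIV_ln_cosh DERIV_tanh_real)
  also have "\<dots> <= 1 * \<bar>x\<bar>^3" by (rule mult_right_mono) auto
  finally show ?thesis by simp
qed

lemma sn_integrable_bounded:
  fixes f :: "real => real"
  assumes "f \<in> borel_measurable borel" "\<And>x. \<bar>f x\<bar> <= B"
  shows "integrable sn f"
  by (rule sn_integrable_linear[where a=B and b=0]) (use assms in auto)

section \<open>The fixed point q and the replica symmetric functional\<close>

locale sk_params =
  fixes \<beta> h :: real
  assumes beta_pos: "0 < \<beta>" and beta_le: "\<beta> <= 1 / 32" and h_pos: "0 < h"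
begin

definition "F q = gauss_E (\<lambda>z. (tanh (h + \<beta> * sqrt q * z))\<^sup>2)"

lemma beta_sq_less: "\<beta>\<^sup>2 < 1" "\<beta>\<^sup>2 <= \<beta>" "\<beta> < 1"
proof -
  have "\<beta> * \<beta> <= 1 * \<beta>" by (rule mult_right_mono) (use beta_pos beta_le in auto)
  then show "\<beta>\<^sup>2 <= \<beta>" by (simp add: power2_eq_square)
  then show "\<beta>\<^sup>2 < 1" "\<beta> < 1" using beta_le by linarith+
qed

text \<open>Couples the fields of variance q and q' by an independent Gaussian increment of variance
  q' - q. Differences in q are then estimated by Taylor expansion in the increment, with no
  differentiation under the integral.\<close>

lemma field_split:
  fixes f :: "real => real"
  assumes "0 <= q" "q <= q'" "q' > 0" and [measurable]: "f \<in> borel_measurable borel"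
  shows "(\<integral>z. f (h + \<beta> * sqrt q' * z) \<partial>sn)
    = (\<integral>x. f (h + \<beta> * sqrt q * fst x + \<beta> * sqrt (q' - q) * snd x) \<partial>(sn \<Otimes>\<^sub>M sn))"
  using sn_integral_add[of "sqrt q" "sqrt (q' - q)" "sqrt q'" "\<lambda>x. f (h + \<beta> * x)"] assms
  by (simp add: algebra_simps)

text \<open>In the coupling of \<open>field_split\<close> the linear Taylor term is a product of
  independent factors, one of them centered, so it vanishes; the remainder is at most the variance
  beta^2 (q' - q) of the increment.\<close>

lemma F_lipschitz_aux:
  assumes q: "0 <= q" "q <= q'" shows "\<bar>F q' - F q\<bar> <= \<beta>\<^sup>2 * (q' - q)"
proof (cases "q' > 0")
  case True
  let ?P = "sn \<Otimes>\<^sub>M sn"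
  let ?a = "\<lambda>z. h + \<beta> * sqrt q * z"
  let ?D = "\<lambda>z. 2 * tanh (?a z) * (1 - (tanh (?a z))\<^sup>2)"
  let ?x = "\<lambda>z. \<beta> * sqrt (q' - q) * z"
  have iF: "integrable sn (\<lambda>z. (tanh (?a z))\<^sup>2)"
    by (rule sn_integrable_bounded[where B=1]) (use tanh_bounds in auto)
  have Db: "\<bar>?D z\<bar> <= 2" for z
  proof -
    have "\<bar>tanh (?a z)\<bar> * (1 - (tanh (?a z))\<^sup>2) <= 1 * 1"
      by (rule mult_mono) (use tanh_bounds in auto)
    then show ?thesis using tanh_bounds(3)[of "?a z"] by (simp add: abs_mult)
  qed
  have iD: "integrable sn ?D"
    by (rule sn_integrable_bounded[where B=2]) (use Db in auto)
  have i2: "integrable ?P (\<lambda>x. ?D (fst x) * ?x (snd x))" and z2: "(\<integral>x. ?D (fst x) * ?x (snd x) \<partial>?P) = 0"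
    using pair_integral_mult[OF iD, of ?x] by (auto simp: sn_moments)
  have i3: "integrable ?P (\<lambda>x. (?x (snd x))\<^sup>2)" and v3: "(\<integral>x. (?x (snd x))\<^sup>2 \<partial>?P) = \<beta>\<^sup>2 * (q' - q)"
    using pair_integral_fst_snd[of "\<lambda>z. (?x z)\<^sup>2"] q by (auto simp: power_mult_distrib sn_moments)
  have i1: "integrable ?P (\<lambda>x. (tanh (?a (fst x) + ?x (snd x)))\<^sup>2)"
    by (rule SN2.P.integrable_const_bound[where B=1]) (use tanh_bounds in auto)
  have iF': "integrable ?P (\<lambda>x. (tanh (?a (fst x)))\<^sup>2)" and vF: "(\<integral>x. (tanh (?a (fst x)))\<^sup>2 \<partial>?P) = F q"
    using pair_integral_fst_snd[OF iF] by (auto simp: F_def gauss_E_def)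
  define R where "R x = (tanh (?a (fst x) + ?x (snd x)))\<^sup>2 - (tanh (?a (fst x)))\<^sup>2 - ?D (fst x) * ?x (snd x)" for x
  have iR: "integrable ?P R"
    unfolding R_def by (intro Bochner_Integration.integrable_diff i1 i2 iF')
  have "(\<integral>x. R x \<partial>?P) = (\<integral>x. (tanh (?a (fst x) + ?x (snd x)))\<^sup>2 \<partial>?P) - (\<integral>x. (tanh (?a (fst x)))\<^sup>2 \<partial>?P) - 0"
    unfolding R_def by (simp only: Bochner_Integration.integral_diff Bochner_Integration.integrable_diff i1 i2 iF' z2)
  also have "\<dots> = F q' - F q"
    unfolding vF using field_split[OF q True, of "\<lambda>x. (tanh x)\<^sup>2"] by (simp add: F_def gauss_E_def)
  finally have eq: "(\<integral>x. R x \<partial>?P) = F q' - F q" .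
  have R: "\<bar>R x\<bar> <= (?x (snd x))\<^sup>2" for x
    using tanh_square_taylor[of "?a (fst x)" "?x (snd x)"] unfolding R_def .
  have "(\<integral>x. \<bar>R x\<bar> \<partial>?P) <= (\<integral>x. (?x (snd x))\<^sup>2 \<partial>?P)"
    by (rule integral_mono[OF integrable_abs[OF iR] i3 R])
  then have "\<bar>\<integral>x. R x \<partial>?P\<bar> <= (\<integral>x. (?x (snd x))\<^sup>2 \<partial>?P)"
    by (rule order_trans[OF integral_abs_bound])
  then show ?thesis unfolding v3 eq .
next
  case False
  then have "q = 0" "q' = 0" using q by linarith+
  then show ?thesis by simp
qed

lemma F_lipschitz:
  assumes "0 <= q" "0 <= q'" shows "\<bar>F q' - F q\<bar> <= \<beta>\<^sup>2 * \<bar>q' - q\<bar>"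
proof (cases "q <= q'")
  case True
  then show ?thesis using F_lipschitz_aux[OF assms(1) True] by simp
next
  case False
  then have "q' <= q" by simp
  from F_lipschitz_aux[OF assms(2) this] show ?thesis using False by (simp add: abs_minus_commute)
qed

lemma F_le_1: "F q <= 1" and F_nonneg: "0 <= F q"
proof -
  have "integrable sn (\<lambda>z. (tanh (h + \<beta> * sqrt q * z))\<^sup>2)"
    by (rule sn_integrable_bounded[where B=1]) (use tanh_bounds in auto)
  then have "F q <= (\<integral>z. 1 \<partial>sn)" unfolding F_def gauss_E_def
    by (intro integral_mono) (use tanh_bounds in auto)
  then show "F q <= 1" by simp
  show "0 <= F q" unfolding F_def gauss_E_def by (rule integral_nonneg_AE) simp
qed

lemma fixpoint_unique:
  assumes "0 <= q" "q = F q" "0 <= q'" "q' = F q'" shows "q = q'"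
proof (rule ccontr)
  assume "q ~= q'"
  then have "\<beta>\<^sup>2 * \<bar>q' - q\<bar> < 1 * \<bar>q' - q\<bar>"
    by (intro mult_strict_right_mono) (use beta_sq_less in auto)
  moreover have "\<bar>q' - q\<bar> <= \<beta>\<^sup>2 * \<bar>q' - q\<bar>"
    using F_lipschitz[OF assms(1,3)] unfolding assms(2)[symmetric] assms(4)[symmetric] .
  ultimately show False by simp
qed

lemma F_0: "F 0 = (tanh h)\<^sup>2"
  by (simp add: F_def gauss_E_def)

definition "Q = q_fix \<beta> h"

lemma Q: "Q > 0" "Q = F Q" "Q <= 1"
proof -
  have cont: "continuous_on {0..1} (\<lambda>q. q - F q)"
  proof -
    have "(\<beta>\<^sup>2)-lipschitz_on {0..1} F"
      using F_lipschitz by (intro lipschitz_onI) (auto simp: dist_real_def abs_minus_commute)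
    then show ?thesis by (intro continuous_intros lipschitz_on_continuous_on)
  qed
  \<comment> \<open>Intermediate value theorem for q - F q on [0, 1]: negative at 0 because h > 0,
    and nonnegative at 1 because F is at most 1.\<close>
  have "tanh h > 0" using h_pos by simp
  then have "0 - F 0 < 0" by (simp add: F_0)
  then have "\<exists>q\<ge>0. q <= 1 \<and> q - F q = 0"
    by (intro IVT' cont) (use F_le_1[of 1] in auto)
  then obtain q where q0: "0 <= q" "q - F q = 0" by blast
  have q: "0 <= q" "q = F q" using q0 by (simp_all only: right_minus_eq)
  have "q ~= 0" using \<open>0 - F 0 < 0\<close> q0(2) by auto
  then have qp: "q > 0" using q(1) by simp
  have "\<exists>!q. q > 0 \<and> q = gauss_E (\<lambda>z. (tanh (h + \<beta> * sqrt q * z))\<^sup>2)"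
    unfolding F_def[symmetric]
  proof (rule ex1I[of _ q])
    show "q > 0 \<and> q = F q" by (intro conjI qp q(2))
    fix q' assume a: "q' > 0 \<and> q' = F q'"
    show "q' = q" by (rule fixpoint_unique[OF less_imp_le[OF conjunct1[OF a]] conjunct2[OF a] q])
  qed
  from theI'[OF this] have Q2: "Q > 0 \<and> Q = F Q" unfolding Q_def q_fix_def F_def .
  from Q2 show "Q > 0" by (rule conjunct1)
  from Q2 show "Q = F Q" by (rule conjunct2)
  then show "Q <= 1" using F_le_1[of Q] by (rule ssubst)
qed

definition "V q = gauss_E (\<lambda>z. ln (cosh (h + \<beta> * sqrt q * z)))"

lemma sn_abs_cube: "integrable sn (\<lambda>z. \<bar>z\<bar>^3)" "(\<integral>z. \<bar>z\<bar>^3 \<partial>sn) <= 4"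
proof -
  have b: "\<bar>z\<bar>^3 <= 1 + z^4" for z :: real
  proof (cases "\<bar>z\<bar> <= 1")
    case True
    then have "\<bar>z\<bar>^3 <= 1" by (simp add: power_le_one)
    then show ?thesis by (smt (verit) zero_le_even_power even_numeral)
  next
    case False
    then have "\<bar>z\<bar>^3 <= \<bar>z\<bar>^4" by (intro power_increasing) auto
    then show ?thesis by simp
  qed
  show i: "integrable sn (\<lambda>z. \<bar>z\<bar>^3)"
    by (rule sn_integrable_quartic[where a=1 and b=1]) (use b in auto)
  have "(\<integral>z. \<bar>z\<bar>^3 \<partial>sn) <= (\<integral>z. 1 + z^4 \<partial>sn)"
    by (rule integral_mono[OF i _ b]) simp
  then show "(\<integral>z. \<bar>z\<bar>^3 \<partial>sn) <= 4" by (simp add: sn_moments)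
qed

text \<open>The coupling of \<open>field_split\<close>, one order further than for \<open>F\<close>.
  The linear term vanishes, the quadratic one gives beta^2 / 2 (q' - q) (1 - F q), and the cubic
  remainder is of order (q' - q)^(3/2), with E|Z|^3 <= 4 as the constant.\<close>

lemma V_expansion:
  assumes q: "0 <= q" "q <= q'"
  shows "\<bar>V q' - V q - \<beta>\<^sup>2 / 2 * (q' - q) * (1 - F q)\<bar> <= 4 * sqrt (q' - q)^3"
proof (cases "q' > 0")
  case True
  let ?P = "sn \<Otimes>\<^sub>M sn"
  let ?a = "\<lambda>z. h + \<beta> * sqrt q * z"
  let ?x = "\<lambda>z. \<beta> * sqrt (q' - q) * z"
  let ?L = "\<lambda>x. ln (cosh x)"
  have iL: "integrable sn (\<lambda>z. ?L (c + d * z))" for c d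
  proof (rule sn_integrable_linear[where a="\<bar>c\<bar>" and b="\<bar>d\<bar>"])
    fix z show "\<bar>?L (c + d * z)\<bar> <= \<bar>c\<bar> + \<bar>d\<bar> * \<bar>z\<bar>"
      using ln_cosh_bound[of "c + d*z"] abs_triangle_ineq[of c "d*z"] by (simp add: abs_mult)
  qed auto
  have iL': "integrable ?P (\<lambda>x. ?L (?a (fst x)))" and vL: "(\<integral>x. ?L (?a (fst x)) \<partial>?P) = V q"
    using pair_integral_fst_snd[OF iL[of h "\<beta> * sqrt q"]] by (auto simp: V_def gauss_E_def)
  have iT: "integrable sn (\<lambda>z. tanh (?a z))"
    by (rule sn_integrable_bounded[where B=1]) (use tanh_bounds in auto)
  have iS: "integrable sn (\<lambda>z. (1 - (tanh (?a z))\<^sup>2) / 2)" and iT2: "integrable sn (\<lambda>z. (tanh (?a z))\<^sup>2)"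
  proof -
    show "integrable sn (\<lambda>z. (tanh (?a z))\<^sup>2)"
      by (rule sn_integrable_bounded[where B=1]) (use tanh_bounds in auto)
    then show "integrable sn (\<lambda>z. (1 - (tanh (?a z))\<^sup>2) / 2)" by simp
  qed
  have vS: "(\<integral>z. (1 - (tanh (?a z))\<^sup>2) / 2 \<partial>sn) = (1 - F q) / 2"
    using iT2 by (simp add: F_def gauss_E_def)
  have i2: "integrable ?P (\<lambda>x. tanh (?a (fst x)) * ?x (snd x))" and z2: "(\<integral>x. tanh (?a (fst x)) * ?x (snd x) \<partial>?P) = 0"
    using pair_integral_mult[OF iT, of ?x] by (auto simp: sn_moments)
  have ix2: "integrable sn (\<lambda>z. (?x z)\<^sup>2)" "(\<integral>z. (?x z)\<^sup>2 \<partial>sn) = \<beta>\<^sup>2 * (q' - q)"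
    using q by (auto simp: power_mult_distrib sn_moments)
  have i3: "integrable ?P (\<lambda>x. (1 - (tanh (?a (fst x)))\<^sup>2) / 2 * (?x (snd x))\<^sup>2)"
    and v3: "(\<integral>x. (1 - (tanh (?a (fst x)))\<^sup>2) / 2 * (?x (snd x))\<^sup>2 \<partial>?P) = (1 - F q) / 2 * (\<beta>\<^sup>2 * (q' - q))"
    using pair_integral_mult[OF iS ix2(1)] vS ix2(2) by auto
  have ix: "integrable sn (\<lambda>z. \<bar>?x z\<bar>^3)" and vx: "(\<integral>z. \<bar>?x z\<bar>^3 \<partial>sn) <= 4 * sqrt (q' - q)^3"
  proof -
    show "integrable sn (\<lambda>z. \<bar>?x z\<bar>^3)" using sn_abs_cube by (simp add: abs_mult power_mult_distrib)
    have "(\<integral>z. \<bar>?x z\<bar>^3 \<partial>sn) = (\<beta>^3 * sqrt (q' - q)^3) * (\<integral>z. \<bar>z\<bar>^3 \<partial>sn)"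
      using q beta_pos sn_abs_cube by (simp add: abs_mult power_mult_distrib)
    also have "\<dots> <= (1 * sqrt (q' - q)^3) * 4"
      by (intro mult_mono mult_right_mono sn_abs_cube) (use q beta_pos beta_le in \<open>auto intro: power_le_one\<close>)
    finally show "(\<integral>z. \<bar>?x z\<bar>^3 \<partial>sn) <= 4 * sqrt (q' - q)^3" by simp
  qed
  have ix': "integrable ?P (\<lambda>x. \<bar>?x (snd x)\<bar>^3)" "(\<integral>x. \<bar>?x (snd x)\<bar>^3 \<partial>?P) = (\<integral>z. \<bar>?x z\<bar>^3 \<partial>sn)"
    using pair_integral_fst_snd[OF ix] by auto
  have i1: "integrable ?P (\<lambda>x. ?L (?a (fst x) + ?x (snd x)))"
  proof (rule Bochner_Integration.integrable_bound)
    show "integrable ?P (\<lambda>x. (\<bar>?L (?a (fst x))\<bar> + 1) + \<bar>?x (snd x)\<bar>)"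
      using iL' pair_integral_fst_snd[of ?x] by (intro Bochner_Integration.integrable_add) auto
    show "AE x in ?P. norm (?L (?a (fst x) + ?x (snd x))) <= norm ((\<bar>?L (?a (fst x))\<bar> + 1) + \<bar>?x (snd x)\<bar>)"
    proof (intro always_eventually allI)
      fix x :: "real \<times> real"
      show "norm (?L (?a (fst x) + ?x (snd x))) <= norm ((\<bar>?L (?a (fst x))\<bar> + 1) + \<bar>?x (snd x)\<bar>)"
        using ln_cosh_lipschitz[of "?a (fst x) + ?x (snd x)" "?a (fst x)"] by simp
    qed
  qed measurable
  define R where "R x = ?L (?a (fst x) + ?x (snd x)) - ?L (?a (fst x)) - tanh (?a (fst x)) * ?x (snd x) - (1 - (tanh (?a (fst x)))\<^sup>2) / 2 * (?x (snd x))\<^sup>2" for x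
  have iR: "integrable ?P R"
    unfolding R_def by (intro Bochner_Integration.integrable_diff i1 i2 i3 iL')
  have "(\<integral>x. R x \<partial>?P) = (\<integral>x. ?L (?a (fst x) + ?x (snd x)) \<partial>?P) - (\<integral>x. ?L (?a (fst x)) \<partial>?P) - 0 - (1 - F q) / 2 * (\<beta>\<^sup>2 * (q' - q))"
    unfolding R_def
    by (simp only: Bochner_Integration.integral_diff Bochner_Integration.integrable_diff i1 i2 i3 iL' z2 v3)
  also have "\<dots> = V q' - V q - \<beta>\<^sup>2 / 2 * (q' - q) * (1 - F q)"
    unfolding vL using field_split[OF q True, of ?L] by (simp add: V_def gauss_E_def)
  finally have eq: "(\<integral>x. R x \<partial>?P) = V q' - V q - \<beta>\<^sup>2 / 2 * (q' - q) * (1 - F q)" .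
  have R: "\<bar>R x\<bar> <= \<bar>?x (snd x)\<bar>^3" for x
    using ln_cosh_taylor3[of "?a (fst x)" "?x (snd x)"] unfolding R_def .
  have "(\<integral>x. \<bar>R x\<bar> \<partial>?P) <= (\<integral>x. \<bar>?x (snd x)\<bar>^3 \<partial>?P)"
    by (rule integral_mono[OF integrable_abs[OF iR] ix'(1) R])
  also have "\<dots> <= 4 * sqrt (q' - q)^3" unfolding ix'(2) by (rule vx)
  finally have "\<bar>\<integral>x. R x \<partial>?P\<bar> <= 4 * sqrt (q' - q)^3"
    by (rule order_trans[OF integral_abs_bound])
  then show ?thesis unfolding eq .
next
  case False
  then have "q = 0" "q' = 0" using q by linarith+
  then show ?thesis by simp
qed

end

context sk_params
begin

definition "G q = V q + \<beta>\<^sup>2 * (1 - q)\<^sup>2 / 4"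

text \<open>\<open>V_expansion\<close> is centered at the smaller argument. For q' < q the Lipschitz
  bound on \<open>F\<close> moves the center from q' to q at the cost of a term of order (q' - q)^2,
  which is below the error already present.\<close>

lemma G_expansion:
  assumes "0 <= q" "0 <= q'"
  shows "\<bar>G q' - G q - \<beta>\<^sup>2 / 2 * (q - F q) * (q' - q)\<bar> <= (4 * sqrt \<bar>q' - q\<bar> + \<bar>q' - q\<bar>) * \<bar>q' - q\<bar>"
proof -
  let ?d = "\<bar>q' - q\<bar>"
  have V: "\<bar>V q' - V q - \<beta>\<^sup>2 / 2 * (q' - q) * (1 - F q)\<bar> <= 4 * (sqrt ?d * ?d) + 1 / 2 * ?d\<^sup>2"
  proof (cases "q <= q'")
    case True
    then have "sqrt (q' - q)^3 = sqrt ?d * ?d" by (simp add: power3_eq_cube)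
    then show ?thesis using V_expansion[OF assms(1) True] zero_le_power2[of ?d] by linarith
  next
    case False
    then have "sqrt (q - q')^3 = sqrt ?d * ?d" by (simp add: power3_eq_cube)
    then have V': "\<bar>V q - V q' - \<beta>\<^sup>2 / 2 * (q - q') * (1 - F q')\<bar> <= 4 * (sqrt ?d * ?d)"
      using V_expansion[OF assms(2), of q] False by simp
    have "\<bar>\<beta>\<^sup>2 / 2 * (q - q') * (F q - F q')\<bar> = \<beta>\<^sup>2 / 2 * (?d * \<bar>F q - F q'\<bar>)"
      using False by (simp add: abs_mult)
    also have "\<dots> <= 1 / 2 * (?d * (1 * ?d))"
    proof (intro mult_mono)
      show "\<bar>F q - F q'\<bar> <= 1 * ?d"
        unfolding abs_minus_commute[of q'] by (rule order_trans[OF F_lipschitz[OF assms(2,1)] mult_right_mono]) (use beta_sq_less in auto)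
    qed (use beta_sq_less in auto)
    finally have "\<bar>\<beta>\<^sup>2 / 2 * (q - q') * (F q - F q')\<bar> <= 1 / 2 * ?d\<^sup>2" by (simp add: power2_eq_square)
    moreover have "V q' - V q - \<beta>\<^sup>2 / 2 * (q' - q) * (1 - F q)
        = - (V q - V q' - \<beta>\<^sup>2 / 2 * (q - q') * (1 - F q')) - \<beta>\<^sup>2 / 2 * (q - q') * (F q - F q')"
      by (simp add: field_simps)
    ultimately show ?thesis using V' by linarith
  qed
  have e: "G q' - G q - \<beta>\<^sup>2 / 2 * (q - F q) * (q' - q) = V q' - V q - \<beta>\<^sup>2 / 2 * (q' - q) * (1 - F q) + \<beta>\<^sup>2 / 4 * (q' - q)\<^sup>2"
    by (simp add: G_def power2_eq_square field_simps)
  have "\<beta>\<^sup>2 / 4 * ?d\<^sup>2 <= 1 / 4 * ?d\<^sup>2"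
    by (rule mult_right_mono) (use beta_sq_less in auto)
  then have "\<bar>\<beta>\<^sup>2 / 4 * (q' - q)\<^sup>2\<bar> <= 1 / 4 * ?d\<^sup>2" by (simp add: abs_mult)
  with V have "\<bar>V q' - V q - \<beta>\<^sup>2 / 2 * (q' - q) * (1 - F q)\<bar> + \<bar>\<beta>\<^sup>2 / 4 * (q' - q)\<^sup>2\<bar>
      <= (4 * (sqrt ?d * ?d) + 1 / 2 * ?d\<^sup>2) + 1 / 4 * ?d\<^sup>2"
    by (rule add_mono)
  also have "\<dots> <= 4 * (sqrt ?d * ?d) + ?d\<^sup>2" by simp
  also have "\<dots> = (4 * sqrt ?d + ?d) * ?d" by (simp only: power2_eq_square algebra_simps)
  finally show ?thesis unfolding e by (rule order_trans[OF abs_triangle_ineq])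
qed

text \<open>Dividing \<open>G_expansion\<close> by q' - q leaves an error that tends to 0. The
  derivative is a multiple of q - F q: stationarity of the replica symmetric functional is the fixed
  point equation. At q = 0 the derivative is one-sided.\<close>

lemma G_derivative:
  assumes "0 <= q" shows "(G has_real_derivative \<beta>\<^sup>2 / 2 * (q - F q)) (at q within {0..})"
  unfolding has_field_derivative_iff
proof (rule LIM_zero_cancel, rule Lim_null_comparison)
  show "\<forall>\<^sub>F q' in at q within {0..}. norm ((G q' - G q) / (q' - q) - \<beta>\<^sup>2 / 2 * (q - F q)) <= 4 * sqrt \<bar>q' - q\<bar> + \<bar>q' - q\<bar>"
    unfolding eventually_at_filter
  proof (intro always_eventually allI impI)
    fix q' assume n: "q' ~= q" and q': "q' \<in> {0..}"
    then have "(G q' - G q) / (q' - q) - \<beta>\<^sup>2 / 2 * (q - F q) = (G q' - G q - \<beta>\<^sup>2 / 2 * (q - F q) * (q' - q)) / (q' - q)"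
      by (simp add: field_simps)
    then show "norm ((G q' - G q) / (q' - q) - \<beta>\<^sup>2 / 2 * (q - F q)) <= 4 * sqrt \<bar>q' - q\<bar> + \<bar>q' - q\<bar>"
      using G_expansion[OF assms, of q'] n q' by (simp add: abs_divide pos_divide_le_eq)
  qed
  have "((\<lambda>q'. 4 * sqrt \<bar>q' - q\<bar> + \<bar>q' - q\<bar>) \<longlongrightarrow> 4 * sqrt \<bar>q - q\<bar> + \<bar>q - q\<bar>) (at q within {0..})"
    by (intro tendsto_intros)
  then show "((\<lambda>q'. 4 * sqrt \<bar>q' - q\<bar> + \<bar>q' - q\<bar>) \<longlongrightarrow> 0) (at q within {0..})" by simp
qed

text \<open>F contracts towards its fixed point, so F q lies strictly closer to Q than q does. Hence
  \<open>G\<close> decreases before Q and increases after it.\<close>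

lemma F_sign: "q > Q ==> q - F q > 0" "0 <= q ==> q < Q ==> q - F q < 0"
proof -
  have *: "\<bar>F q - Q\<bar> < \<bar>q - Q\<bar>" if "0 <= q" "q ~= Q"
  proof -
    have "\<beta>\<^sup>2 * \<bar>q - Q\<bar> < 1 * \<bar>q - Q\<bar>"
      by (intro mult_strict_right_mono) (use that beta_sq_less in auto)
    moreover have "\<bar>F q - Q\<bar> <= \<beta>\<^sup>2 * \<bar>q - Q\<bar>"
      using F_lipschitz[of Q q] Q(1) that unfolding Q(2)[symmetric] by simp
    ultimately show ?thesis by simp
  qed
  show "q > Q ==> q - F q > 0" "0 <= q ==> q < Q ==> q - F q < 0"
    using * Q(1) by auto
qed

lemma G_min: assumes "0 <= q" shows "G Q <= G q"
proof -
  have D: "(G has_derivative (\<lambda>y. \<beta>\<^sup>2 / 2 * (x - F x) * y)) (at x within {a..b})" if "0 <= a" "a <= x" for a b x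
    by (rule has_derivative_subset[OF G_derivative[unfolded has_field_derivative_def]]) (use that in auto)
  have mvt: "\<exists>x\<in>{a<..<b}. G b - G a = \<beta>\<^sup>2 / 2 * (x - F x) * (b - a)" if "0 <= a" "a < b" for a b
    by (rule mvt_simple[OF that(2)]) (use D that in auto)
  show ?thesis
  proof (rule linorder_cases[of q Q])
    assume "q < Q"
    from mvt[OF assms this] obtain x where x: "q < x" "x < Q" "G Q - G q = \<beta>\<^sup>2 / 2 * (x - F x) * (Q - q)" by auto
    have "\<beta>\<^sup>2 / 2 * (x - F x) * (Q - q) <= 0"
      using F_sign(2)[of x] x assms \<open>q < Q\<close> by (intro mult_nonpos_nonneg mult_nonneg_nonpos) auto
    then show ?thesis using x by simp
  next
    assume "q > Q"
    then obtain x where x: "Q < x" "x < q" "G q - G Q = \<beta>\<^sup>2 / 2 * (x - F x) * (q - Q)" using mvt[of Q q] Q(1) by auto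
    have "\<beta>\<^sup>2 / 2 * (x - F x) * (q - Q) >= 0"
      using F_sign(1)[of x] x \<open>q > Q\<close> by (intro mult_nonneg_nonneg) auto
    then show ?thesis using x by simp
  qed simp
qed

lemma RS_eq: "RS \<beta> h = V Q + \<beta>\<^sup>2 * (1 - Q)\<^sup>2 / 4"
proof -
  have "(INF q\<in>{0..}. G q) = G Q"
    by (rule cInf_eq_minimum) (use Q(1) G_min in \<open>auto intro: less_imp_le\<close>)
  then show ?thesis by (simp add: RS_def G_def V_def)
qed

end

section \<open>The overlap function psi and the sequences rho and gamma\<close>

lemma triple_eq_gs:
  "distr (sn \<Otimes>\<^sub>M (sn \<Otimes>\<^sub>M sn)) (borel \<Otimes>\<^sub>M (borel \<Otimes>\<^sub>M borel)) (\<lambda>x. x)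
    = distr (gs {0,2,3::nat}) (borel \<Otimes>\<^sub>M (borel \<Otimes>\<^sub>M borel)) (\<lambda>x. (x 0, x 2, x 3))"
proof (rule measure_eqI_nn_integral)
  fix F :: "real \<times> real \<times> real => ennreal"
  assume "F \<in> borel_measurable (distr (sn \<Otimes>\<^sub>M (sn \<Otimes>\<^sub>M sn)) (borel \<Otimes>\<^sub>M (borel \<Otimes>\<^sub>M borel)) (\<lambda>x. x))"
  then have [measurable]: "F \<in> borel_measurable (borel \<Otimes>\<^sub>M (borel \<Otimes>\<^sub>M borel))" by simp
  have "(\<integral>\<^sup>+x. F x \<partial>distr (sn \<Otimes>\<^sub>M (sn \<Otimes>\<^sub>M sn)) (borel \<Otimes>\<^sub>M (borel \<Otimes>\<^sub>M borel)) (\<lambda>x. x))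
      = (\<integral>\<^sup>+x. F x \<partial>(sn \<Otimes>\<^sub>M (sn \<Otimes>\<^sub>M sn)))"
    by (rule nn_integral_distr) measurable
  also have "\<dots> = (\<integral>\<^sup>+a. \<integral>\<^sup>+b. \<integral>\<^sup>+c. F (a, b, c) \<partial>sn \<partial>sn \<partial>sn)"
    by (subst SN2.nn_integral_fst[symmetric]) (auto simp: SN.nn_integral_fst[symmetric])
  also have "\<dots> = (\<integral>\<^sup>+x. F (x 0, x 2, x 3) \<partial>gs (insert 0 (insert 2 {3::nat})))"
  proof -
    have 1: "(\<integral>\<^sup>+c. F (a, b, c) \<partial>sn) = (\<integral>\<^sup>+x. F (a, b, x 3) \<partial>gs {3::nat})" for a b
      by (rule GS.product_nn_integral_singleton[symmetric]) measurable
    have 2: "(\<integral>\<^sup>+b. \<integral>\<^sup>+x. F (a, b, x 3) \<partial>gs {3::nat} \<partial>sn) = (\<integral>\<^sup>+x. F (a, x 2, x 3) \<partial>gs (insert 2 {3::nat}))" for a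
      by (subst GS.product_nn_integral_insert_rev) simp_all
    have 3: "(\<integral>\<^sup>+a. \<integral>\<^sup>+x. F (a, x 2, x 3) \<partial>gs (insert 2 {3::nat}) \<partial>sn) = (\<integral>\<^sup>+x. F (x 0, x 2, x 3) \<partial>gs (insert 0 (insert 2 {3::nat})))"
      by (subst GS.product_nn_integral_insert_rev) simp_all
    show ?thesis unfolding 1 2 3 ..
  qed
  also have "\<dots> = (\<integral>\<^sup>+x. F x \<partial>distr (gs {0,2,3::nat}) (borel \<Otimes>\<^sub>M (borel \<Otimes>\<^sub>M borel)) (\<lambda>x. (x 0, x 2, x 3)))"
    by (rule nn_integral_distr[symmetric]) measurable
  finally show "(\<integral>\<^sup>+x. F x \<partial>distr (sn \<Otimes>\<^sub>M (sn \<Otimes>\<^sub>M sn)) (borel \<Otimes>\<^sub>M (borel \<Otimes>\<^sub>M borel)) (\<lambda>x. x))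
     = (\<integral>\<^sup>+x. F x \<partial>distr (gs {0,2,3::nat}) (borel \<Otimes>\<^sub>M (borel \<Otimes>\<^sub>M borel)) (\<lambda>x. (x 0, x 2, x 3)))" .
qed simp

lemma triple_integral_eq_gs:
  fixes f :: "real \<times> real \<times> real => real"
  assumes [measurable]: "f \<in> borel_measurable (borel \<Otimes>\<^sub>M (borel \<Otimes>\<^sub>M borel))"
  shows "(\<integral>x. f x \<partial>(sn \<Otimes>\<^sub>M (sn \<Otimes>\<^sub>M sn))) = (\<integral>x. f (x 0, x 2, x 3) \<partial>gs {0,2,3::nat})"
proof -
  have "(\<integral>x. f x \<partial>(sn \<Otimes>\<^sub>M (sn \<Otimes>\<^sub>M sn))) = (\<integral>x. f x \<partial>distr (sn \<Otimes>\<^sub>M (sn \<Otimes>\<^sub>M sn)) (borel \<Otimes>\<^sub>M (borel \<Otimes>\<^sub>M borel)) (\<lambda>x. x))"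
    by (subst integral_distr) auto
  then show ?thesis unfolding triple_eq_gs by (subst (asm) integral_distr) auto
qed

context sk_params
begin

lemma Th_measurable [measurable]: "Th \<beta> h \<in> borel_measurable borel"
  unfolding Th_def by measurable

lemma Th_bound: "\<bar>Th \<beta> h x\<bar> <= 1"
  unfolding Th_def by (rule tanh_bounds)

lemma Th_gs:
  fixes a :: "'i => real"
  assumes "finite I" "(\<Sum>i\<in>I. (a i)\<^sup>2) = Q"
  shows "(\<integral>x. (Th \<beta> h (\<Sum>i\<in>I. a i * x i))\<^sup>2 \<partial>gs I) = Q"
    "(\<integral>x. Th \<beta> h (\<Sum>i\<in>I. a i * x i) \<partial>gs I) = gamma_1 \<beta> h"
    "(\<integral>x. ln (cosh (h + \<beta> * (\<Sum>i\<in>I. a i * x i))) \<partial>gs I) = V Q"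
proof -
  have q: "(\<Sum>i\<in>I. (a i)\<^sup>2) = (sqrt Q)\<^sup>2" "sqrt Q > 0" using assms Q(1) by auto
  note g = gs_integral_functional[OF assms(1) q]
  show "(\<integral>x. (Th \<beta> h (\<Sum>i\<in>I. a i * x i))\<^sup>2 \<partial>gs I) = Q"
    unfolding g[of "\<lambda>x. (Th \<beta> h x)\<^sup>2", simplified]
    by (subst (2) Q(2)) (simp add: F_def gauss_E_def Th_def mult.assoc)
  show "(\<integral>x. Th \<beta> h (\<Sum>i\<in>I. a i * x i) \<partial>gs I) = gamma_1 \<beta> h"
    using g[of "Th \<beta> h"] by (simp add: gamma_1_def Q_def[symmetric] gauss_E_def Th_def mult.assoc)
  show "(\<integral>x. ln (cosh (h + \<beta> * (\<Sum>i\<in>I. a i * x i))) \<partial>gs I) = V Q"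
    using g[of "\<lambda>x. ln (cosh (h + \<beta> * x))"] by (simp add: V_def gauss_E_def mult.assoc)
qed

abbreviation "J3 \<equiv> {0,2,3::nat}"

text \<open>The arguments of the two factors in \<open>psi\<close> as linear functionals on one
  Gaussian vector: index 0 carries the shared Gaussian, index 2 the private one of the first factor
  and index 3 that of the second.\<close>

definition "ca t = (\<lambda>i::nat. if i = 0 then sqrt t else if i = 2 then sqrt (Q - t) else 0)"
definition "cb t = (\<lambda>i::nat. if i = 0 then sqrt t else if i = 3 then sqrt (Q - t) else 0)"

lemma ca_cb:
  assumes "0 <= t" "t <= Q"
  shows "(\<Sum>i\<in>J3. (ca t i)\<^sup>2) = Q" "(\<Sum>i\<in>J3. (cb t i)\<^sup>2) = Q" "(\<Sum>i\<in>J3. ca t i * cb t i) = t"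
    "(\<Sum>i\<in>J3. ca t i * x i) = sqrt t * x 0 + sqrt (Q - t) * x 2"
    "(\<Sum>i\<in>J3. cb t i * x i) = sqrt t * x 0 + sqrt (Q - t) * x 3"
  using assms by (auto simp: ca_def cb_def)

lemma psi_eq_J3:
  assumes "0 <= t" "t <= Q"
  shows "psi \<beta> h t = (\<integral>x. Th \<beta> h (\<Sum>i\<in>J3. ca t i * x i) * Th \<beta> h (\<Sum>i\<in>J3. cb t i * x i) \<partial>gs J3)"
  unfolding ca_cb(4,5)[OF assms] psi_def Let_def Q_def[symmetric]
  by (subst triple_integral_eq_gs) (auto simp: case_prod_beta')

text \<open>Only the Gram matrix of the two functionals matters: both the given pair and the pair
  \<open>ca t\<close>, \<open>cb t\<close> have variances Q and covariance t, so
  \<open>gs_integral_two_functionals\<close> brings both integrals to the same normal form.\<close>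

lemma psi_eq:
  fixes a b :: "'i => real"
  assumes I: "finite I" and t: "0 <= t" "t < Q"
    and ab: "(\<Sum>i\<in>I. (a i)\<^sup>2) = Q" "(\<Sum>i\<in>I. (b i)\<^sup>2) = Q" "(\<Sum>i\<in>I. a i * b i) = t"
  shows "(\<integral>x. Th \<beta> h (\<Sum>i\<in>I. a i * x i) * Th \<beta> h (\<Sum>i\<in>I. b i * x i) \<partial>gs I) = psi \<beta> h t"
proof -
  let ?p = "sqrt Q" and ?r = "t / sqrt Q" and ?t = "sqrt (Q - t\<^sup>2 / Q)"
  have p: "?p\<^sup>2 = Q" "?p > 0" using Q(1) by auto
  have r: "?p * ?r = t" using Q(1) by simp
  have "t\<^sup>2 <= Q\<^sup>2" using t by (intro power_mono) auto
  then have "t\<^sup>2 / Q <= Q" using Q(1) by (simp add: pos_divide_le_eq power2_eq_square)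
  then have tt: "?r\<^sup>2 + ?t\<^sup>2 = Q" using Q(1) by (simp add: power_divide)
  note c = ca_cb[OF t(1) less_imp_le[OF t(2)]]
  let ?f = "\<lambda>x y. Th \<beta> h x * Th \<beta> h y"
  have 1: "(\<integral>x. ?f (\<Sum>i\<in>I. a i * x i) (\<Sum>i\<in>I. b i * x i) \<partial>gs I)
     = (\<integral>x. ?f (?p * fst x) (?r * fst x + ?t * snd x) \<partial>(sn \<Otimes>\<^sub>M sn))"
    by (rule gs_integral_two_functionals[OF I trans[OF ab(1) p(1)[symmetric]] p(2) trans[OF ab(3) r[symmetric]] trans[OF ab(2) tt[symmetric]]]) measurable
  have 2: "(\<integral>x. ?f (\<Sum>i\<in>J3. ca t i * x i) (\<Sum>i\<in>J3. cb t i * x i) \<partial>gs J3)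
     = (\<integral>x. ?f (?p * fst x) (?r * fst x + ?t * snd x) \<partial>(sn \<Otimes>\<^sub>M sn))"
    by (rule gs_integral_two_functionals[OF _ trans[OF c(1) p(1)[symmetric]] p(2) trans[OF c(3) r[symmetric]] trans[OF c(2) tt[symmetric]]]) measurable
  show ?thesis using t unfolding 1 by (subst psi_eq_J3) (auto simp only: 2 less_imp_le)
qed

text \<open>With A and B the two factors in \<open>psi\<close>, 2 (Q - psi t) is the mean of (A -
  B)^2. The Lipschitz bound on tanh compares it with beta^2 (Q - t) (x 2 - x 3)^2, which gives the
  contraction. It cannot vanish: A = B almost surely would force x 2 = x 3 almost surely.\<close>

lemma psi_bounds:
  assumes t: "0 <= t" "t < Q"
  shows "psi \<beta> h t < Q" "Q - psi \<beta> h t <= \<beta>\<^sup>2 * (Q - t)"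
proof -
  note cc = ca_cb[of t]
  have tq: "0 <= t" "t <= Q" using t by auto
  interpret g: prob_space "gs J3" by (rule prob_space_gs)
  define A where "A x = Th \<beta> h (\<Sum>i\<in>J3. ca t i * x i)" for x
  define B where "B x = Th \<beta> h (\<Sum>i\<in>J3. cb t i * x i)" for x
  have [measurable]: "A \<in> borel_measurable (PiM J3 (\<lambda>_. borel))" "B \<in> borel_measurable (PiM J3 (\<lambda>_. borel))"
    unfolding A_def B_def by measurable
  have AB: "\<bar>A x\<bar> <= 1" "\<bar>B x\<bar> <= 1" for x by (simp_all only: A_def B_def Th_bound)
  have i: "integrable (gs J3) (\<lambda>x. A x * A x)" "integrable (gs J3) (\<lambda>x. B x * B x)" "integrable (gs J3) (\<lambda>x. A x * B x)"
    by (rule g.integrable_const_bound[where B=1], unfold real_norm_def abs_mult, intro AE_I2 mult_le_one abs_ge_zero AB, measurable)+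
  have vA: "(\<integral>x. A x * A x \<partial>gs J3) = Q" using Th_gs(1)[OF _ cc(1)[OF tq]] by (simp only: A_def power2_eq_square finite.intros)
  have vB: "(\<integral>x. B x * B x \<partial>gs J3) = Q" using Th_gs(1)[OF _ cc(2)[OF tq]] by (simp only: B_def power2_eq_square finite.intros)
  have e: "(A x - B x)\<^sup>2 = A x * A x + B x * B x - 2 * (A x * B x)" for x
    by (simp add: power2_eq_square algebra_simps)
  have iD: "integrable (gs J3) (\<lambda>x. (A x - B x)\<^sup>2)" unfolding e using i by simp
  have D: "(\<integral>x. (A x - B x)\<^sup>2 \<partial>gs J3) = 2 * (Q - psi \<beta> h t)"
    unfolding e using i vA vB psi_eq_J3[OF tq, folded A_def B_def] by simp
  have w: "(\<Sum>i\<in>J3. ca t i * x i) - (\<Sum>i\<in>J3. cb t i * x i) = sqrt (Q - t) * (x 2 - x 3)" for x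
    unfolding ca_cb(4,5)[OF tq] by (simp add: algebra_simps)
  have e12: "(x 2 - x 3)\<^sup>2 = (x 2)\<^sup>2 + (x 3)\<^sup>2 - 2 * (x 2 * x 3)" for x :: "nat => real"
    by (simp add: power2_eq_square algebra_simps)
  have i12: "integrable (gs J3) (\<lambda>x. (x 2)\<^sup>2)" "integrable (gs J3) (\<lambda>x. (x 3)\<^sup>2)" "integrable (gs J3) (\<lambda>x. x 2 * x 3)"
    using gs_integral_coordinate(2)[of J3 2 "\<lambda>x. x\<^sup>2"] gs_integral_coordinate(2)[of J3 3 "\<lambda>x. x\<^sup>2"]
      gs_integral_coordinate_pair(2)[of J3 2 3 "\<lambda>x. x" "\<lambda>x. x"] by auto
  have i12': "integrable (gs J3) (\<lambda>x. (x 2 - x 3)\<^sup>2)" unfolding e12 using i12 by simp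
  have v12: "(\<integral>x. (x 2 - x 3)\<^sup>2 \<partial>gs J3) = 2"
    unfolding e12 using i12 gs_integral_coordinate(1)[of J3 2 "\<lambda>x. x\<^sup>2"] gs_integral_coordinate(1)[of J3 3 "\<lambda>x. x\<^sup>2"]
      gs_integral_coordinate_pair(1)[of J3 2 3 "\<lambda>x. x" "\<lambda>x. x"] by (simp add: sn_moments)
  have b: "(A x - B x)\<^sup>2 <= \<beta>\<^sup>2 * (Q - t) * (x 2 - x 3)\<^sup>2" for x
  proof -
    have "\<bar>A x - B x\<bar> <= \<bar>\<beta> * (sqrt (Q - t) * (x 2 - x 3))\<bar>"
      unfolding A_def B_def Th_def w[symmetric] by (rule order_trans[OF tanh_lipschitz]) (simp add: right_diff_distrib)
    then have "(A x - B x)\<^sup>2 <= (\<beta> * (sqrt (Q - t) * (x 2 - x 3)))\<^sup>2" by (simp only: abs_le_square_iff)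
    then show ?thesis using t by (simp add: power_mult_distrib)
  qed
  have "(\<integral>x. (A x - B x)\<^sup>2 \<partial>gs J3) <= (\<integral>x. \<beta>\<^sup>2 * (Q - t) * (x 2 - x 3)\<^sup>2 \<partial>gs J3)"
    by (rule integral_mono) (use iD i12' b in auto)
  then show "Q - psi \<beta> h t <= \<beta>\<^sup>2 * (Q - t)" using D i12' v12 by simp
  have "0 <= (\<integral>x. (A x - B x)\<^sup>2 \<partial>gs J3)" by (rule integral_nonneg_AE) simp
  moreover have "(\<integral>x. (A x - B x)\<^sup>2 \<partial>gs J3) ~= 0"
  proof
    assume "(\<integral>x. (A x - B x)\<^sup>2 \<partial>gs J3) = 0"
    then have "AE x in gs J3. (A x - B x)\<^sup>2 = 0"
      by (subst (asm) integral_nonneg_eq_0_iff_AE[OF iD]) auto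
    then have "AE x in gs J3. (x 2 - x 3)\<^sup>2 = (0::real)"
    proof (rule AE_mp, intro AE_I2 impI)
      fix x :: "nat => real" assume "(A x - B x)\<^sup>2 = 0"
      then have "tanh (h + \<beta> * (\<Sum>i\<in>J3. ca t i * x i)) = tanh (h + \<beta> * (\<Sum>i\<in>J3. cb t i * x i))"
        by (simp only: A_def B_def Th_def power2_eq_square mult_eq_0_iff eq_iff_diff_eq_0[symmetric] simp_thms)
      then have "h + \<beta> * (\<Sum>i\<in>J3. ca t i * x i) = h + \<beta> * (\<Sum>i\<in>J3. cb t i * x i)"
        by (simp only: tanh_real_eq_iff)
      then have "sqrt (Q - t) * (x 2 - x 3) = 0" unfolding w[symmetric] using beta_pos by simp
      then show "(x 2 - x 3)\<^sup>2 = 0" using t by simp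
    qed
    then have "(\<integral>x. (x 2 - x 3)\<^sup>2 \<partial>gs J3) = (\<integral>x. 0 \<partial>gs J3)"
      by (intro integral_cong_AE) auto
    then show False using v12 by simp
  qed
  ultimately have "0 < 2 * (Q - psi \<beta> h t)" unfolding D by (simp only: less_le) auto
  then show "psi \<beta> h t < Q" by simp
qed

text \<open>Positivity by symmetrization: tanh(h + y) + tanh(h - y) > 0 for h > 0. The upper bound
  holds because the square of gamma_1 is psi(0), to which \<open>psi_bounds\<close> applies.\<close>

lemma gamma_1_bounds: "0 < gamma_1 \<beta> h" "(gamma_1 \<beta> h)\<^sup>2 < Q"
proof -
  let ?f = "\<lambda>z. tanh (h + \<beta> * sqrt Q * z)"
  have g: "gamma_1 \<beta> h = (\<integral>z. ?f z \<partial>sn)" by (simp add: gamma_1_def Q_def gauss_E_def)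
  have i: "integrable sn ?f" "integrable sn (\<lambda>z. ?f (-z))"
    by (rule sn_integrable_bounded[where B=1]; use tanh_bounds in auto)+
  have pos: "?f z + ?f (-z) > 0" for z
  proof -
    have "tanh (- h - \<beta> * sqrt Q * z) < ?f (- z)" using h_pos by simp
    moreover have "tanh (- h - \<beta> * sqrt Q * z) = - ?f z" by (metis add_uminus_conv_diff minus_add_distrib tanh_minus)
    ultimately show ?thesis by simp
  qed
  have "2 * gamma_1 \<beta> h = (\<integral>z. ?f z + ?f (-z) \<partial>sn)"
    using i sn_integral_reflect[of ?f] by (simp add: g)
  also have "\<dots> > 0"
  proof -
    have "(\<integral>z. 0 \<partial>sn) < (\<integral>z. ?f z + ?f (-z) \<partial>sn)"
      by (rule SN.integral_less_AE_space) (use i pos in auto)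
    then show ?thesis by (simp only: Bochner_Integration.integral_zero)
  qed
  finally show "0 < gamma_1 \<beta> h" by simp
  have "psi \<beta> h 0 = (\<integral>x. Th \<beta> h (sqrt Q * x 2) * Th \<beta> h (sqrt Q * x 3) \<partial>gs J3)"
    using psi_eq_J3[of 0] ca_cb(4,5)[of 0] Q(1) by simp
  also have "\<dots> = (\<integral>z. ?f z \<partial>sn) * (\<integral>z. ?f z \<partial>sn)"
    using gs_integral_coordinate_pair(1)[of J3 2 3 ?f ?f] i by (simp add: Th_def mult.assoc)
  finally show "(gamma_1 \<beta> h)\<^sup>2 < Q" using psi_bounds(1)[of 0] Q(1) by (simp add: g power2_eq_square)
qed

text \<open>The distances of Gamma_(k-1)^2 and of rho_k from their common limit q. In these
  quantities the recursion for gamma is purely algebraic.\<close>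

definition "dd k = Q - Gam_sq \<beta> h (k - 1)"
definition "ee k = Q - rho \<beta> h k"

lemma gam_eq:
  assumes "1 <= k" "0 < dd k"
  shows "gam \<beta> h k = (dd k - ee k) / sqrt (dd k)"
proof (cases "k = 1")
  case True
  have "sqrt Q > 0" "sqrt Q * sqrt Q = Q" using Q(1) by auto
  then show ?thesis unfolding True
    by (subst gam.simps) (simp add: dd_def ee_def Gam_sq_def Q_def[symmetric] field_simps)
next
  case False
  have "{1..<k} = {1..k-1}" using assms by auto
  then show ?thesis using False assms
    by (subst gam.simps) (simp add: dd_def ee_def Gam_sq_def Q_def[symmetric])
qed

lemma dd_Suc: "dd (Suc (Suc k)) = dd (Suc k) - (gam \<beta> h (Suc k))\<^sup>2"
  by (simp add: dd_def Gam_sq_def)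

text \<open>Contains the known chain Gamma_(k-1)^2 < rho_k < q and a geometric rate. With d = dd and
  e = ee at one step, the next d equals e (2 - e / d), which exceeds e because e < d, whereas the
  next e is at most beta^2 e by \<open>psi_bounds\<close>; so the order is preserved.\<close>

lemma ee_dd: "0 < ee (Suc k) \<and> ee (Suc k) < dd (Suc k) \<and> ee (Suc k) <= (\<beta>\<^sup>2)^k"
proof (induction k)
  case 0
  have "sqrt Q > 0" "sqrt Q * sqrt Q = Q" using Q(1) by auto
  moreover have "gamma_1 \<beta> h < sqrt Q" using gamma_1_bounds by (intro real_less_rsqrt) auto
  ultimately have "sqrt Q * gamma_1 \<beta> h < Q" "0 < sqrt Q * gamma_1 \<beta> h"
    using gamma_1_bounds mult_strict_left_mono[of "gamma_1 \<beta> h" "sqrt Q" "sqrt Q"] by auto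
  then show ?case using Q(3) by (simp add: dd_def ee_def Gam_sq_def Q_def[symmetric])
next
  case (Suc k)
  let ?e = "ee (Suc k)" and ?d = "dd (Suc k)"
  have IH: "0 < ?e" "?e < ?d" "?e <= (\<beta>\<^sup>2)^k" "0 < ?d" using Suc by auto
  have r: "0 <= rho \<beta> h (Suc k)" "rho \<beta> h (Suc k) < Q"
  proof -
    have "0 <= Gam_sq \<beta> h k" unfolding Gam_sq_def by (rule sum_nonneg) simp
    then show "0 <= rho \<beta> h (Suc k)" "rho \<beta> h (Suc k) < Q" using IH by (simp_all add: ee_def dd_def)
  qed
  have e: "ee (Suc (Suc k)) = Q - psi \<beta> h (rho \<beta> h (Suc k))" by (simp add: ee_def)
  have e1: "0 < ee (Suc (Suc k))" "ee (Suc (Suc k)) <= \<beta>\<^sup>2 * ?e"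
    using psi_bounds[OF r] unfolding e by (auto simp: ee_def)
  have "(gam \<beta> h (Suc k))\<^sup>2 = (?d - ?e)\<^sup>2 / ?d"
    using IH by (simp add: gam_eq power_divide)
  then have d: "dd (Suc (Suc k)) = ?e * (2 - ?e / ?d)"
    unfolding dd_Suc using IH by (simp add: power2_eq_square field_simps)
  have "?e * 1 < ?e * (2 - ?e / ?d)" using IH by (intro mult_strict_left_mono) auto
  then have "?e < dd (Suc (Suc k))" unfolding d by simp
  moreover have "\<beta>\<^sup>2 * ?e < 1 * ?e" using IH beta_sq_less by (intro mult_strict_right_mono) auto
  moreover have "\<beta>\<^sup>2 * ?e <= \<beta>\<^sup>2 * (\<beta>\<^sup>2)^k" using IH by (intro mult_left_mono) auto
  ultimately show ?case using e1 by auto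
qed

lemma dd_pos: "1 <= k ==> 0 < dd k"
  using ee_dd[of "k - 1"] by auto

text \<open>The same identity d' = e (2 - e / d) <= 2 e converts the geometric decay of q - rho into
  that of q - Gamma^2.\<close>

lemma dd_le: "dd (Suc (Suc k)) <= 2 * (\<beta>\<^sup>2)^k"
proof -
  let ?e = "ee (Suc k)" and ?d = "dd (Suc k)"
  have IH: "0 < ?e" "?e < ?d" "?e <= (\<beta>\<^sup>2)^k" "0 < ?d" using ee_dd[of k] by auto
  have "(gam \<beta> h (Suc k))\<^sup>2 = (?d - ?e)\<^sup>2 / ?d"
    using IH by (simp add: gam_eq power_divide)
  then have "dd (Suc (Suc k)) = ?e * (2 - ?e / ?d)"
    unfolding dd_Suc using IH by (simp add: power2_eq_square field_simps)
  also have "\<dots> <= ?e * 2" using IH by (intro mult_left_mono) auto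
  finally show ?thesis using IH by simp
qed

lemma dd_tendsto: "dd \<longlonglongrightarrow> 0"
proof -
  have "(\<lambda>k. (\<beta>\<^sup>2)^k) \<longlonglongrightarrow> 0"
    by (rule LIMSEQ_power_zero) (use beta_sq_less(1) in simp)
  then have "(\<lambda>k. 2 * (\<beta>\<^sup>2)^k) \<longlonglongrightarrow> 2 * 0"
    by (rule tendsto_mult_left)
  then have l: "(\<lambda>k. 2 * (\<beta>\<^sup>2)^k) \<longlonglongrightarrow> 0" by simp
  have "(\<lambda>k. dd (Suc (Suc k))) \<longlonglongrightarrow> 0"
  proof (rule real_tendsto_sandwich[OF _ _ tendsto_const l])
    show "\<forall>\<^sub>F k in sequentially. 0 <= dd (Suc (Suc k))"
      by (intro always_eventually allI less_imp_le dd_pos) simp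
    show "\<forall>\<^sub>F k in sequentially. dd (Suc (Suc k)) <= 2 * (\<beta>\<^sup>2)^k"
      by (intro always_eventually allI dd_le)
  qed
  then have "(\<lambda>k. dd (Suc k)) \<longlonglongrightarrow> 0" by (rule LIMSEQ_imp_Suc[of "\<lambda>k. dd (Suc k)"])
  then show ?thesis by (rule LIMSEQ_imp_Suc)
qed

lemma gam_sqrt_dd: "1 <= k ==> gam \<beta> h k * sqrt (dd k) = rho \<beta> h k - Gam_sq \<beta> h (k - 1)"
  using dd_pos[of k] gam_eq[of k] by (simp add: dd_def ee_def)

lemma gam_bounds: "1 <= k ==> 0 <= gam \<beta> h k" "1 <= k ==> gam \<beta> h k <= sqrt (dd k)"
proof -
  assume k: "1 <= k"
  note b = ee_dd[of "k - 1"] gam_eq[OF k dd_pos[OF k]] dd_pos[OF k]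
  have k': "Suc (k - 1) = k" using k by simp
  show "0 <= gam \<beta> h k" unfolding b(2) using b(1) unfolding k' by (intro divide_nonneg_nonneg) auto
  have "dd k - ee k <= sqrt (dd k) * sqrt (dd k)" using b(1,3) unfolding k' by simp
  then show "gam \<beta> h k <= sqrt (dd k)" unfolding b(2) using b(3) by (simp only: pos_divide_le_eq real_sqrt_gt_zero)
qed

lemma rho_bounds: "1 <= k ==> 0 <= rho \<beta> h k" "1 <= k ==> rho \<beta> h k < Q"
proof -
  assume k: "1 <= k"
  have "0 <= Gam_sq \<beta> h (k - 1)" unfolding Gam_sq_def by (rule sum_nonneg) simp
  then show "0 <= rho \<beta> h k" "rho \<beta> h k < Q" using ee_dd[of "k-1"] k by (auto simp: ee_def dd_def)
qed

end

section \<open>Deflation and resampling of the disorder\<close>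

declare it_g.simps [simp del] it_m.simps [simp del] it_phi.simps [simp del] it_xi.simps [simp del]
  it_eta.simps [simp del] it_zeta.simps [simp del]

section \<open>Inner products and the algebra of deflation\<close>

lemma ip_commute: "ip N x y = ip N y x"
  by (simp add: ip_def mult.commute)

lemma ip_linear:
  "ip N (\<lambda>i. x i + y i) z = ip N x z + ip N y z" "ip N (\<lambda>i. x i - y i) z = ip N x z - ip N y z"
  "ip N (\<lambda>i. c * x i) z = c * ip N x z" "ip N (\<lambda>i. x i * c) z = c * ip N x z" "ip N (\<lambda>i. x i / c) z = ip N x z / c"
  "ip N (\<lambda>i. 0) z = 0"
  "ip N z (\<lambda>i. x i + y i) = ip N z x + ip N z y" "ip N z (\<lambda>i. x i - y i) = ip N z x - ip N z y"
  "ip N z (\<lambda>i. c * x i) = c * ip N z x" "ip N z (\<lambda>i. x i * c) = c * ip N z x" "ip N z (\<lambda>i. x i / c) = ip N z x / c"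
  "ip N z (\<lambda>i. 0) = 0"
  by (simp_all add: ip_def sum.distrib sum_subtractf distrib_left distrib_right left_diff_distrib right_diff_distrib
      add_divide_distrib diff_divide_distrib sum_distrib_left sum_divide_distrib mult_ac)

lemma ip_sum: "ip N (\<lambda>i. \<Sum>s\<in>S. f s i) z = (\<Sum>s\<in>S. ip N (f s) z)" "ip N z (\<lambda>i. \<Sum>s\<in>S. f s i) = (\<Sum>s\<in>S. ip N z (f s))"
proof -
  show "ip N (\<lambda>i. \<Sum>s\<in>S. f s i) z = (\<Sum>s\<in>S. ip N (f s) z)"
    unfolding ip_def sum_distrib_right sum_divide_distrib by (rule sum.swap)
  show "ip N z (\<lambda>i. \<Sum>s\<in>S. f s i) = (\<Sum>s\<in>S. ip N z (f s))"
    unfolding ip_def sum_distrib_left sum_divide_distrib by (rule sum.swap)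
qed

lemma ip_self_nonneg: "0 <= ip N x x"
  unfolding ip_def by (intro divide_nonneg_nonneg sum_nonneg) auto

lemma ip_self_eq_0: "ip N x x = 0 ==> i < N ==> x i = 0"
  by (simp add: ip_def sum_nonneg_eq_0_iff)

lemma ip_zero: "(\<And>i. i < N ==> x i = 0) ==> ip N x y = 0" "(\<And>i. i < N ==> x i = 0) ==> ip N y x = 0"
  by (simp_all add: ip_def)

lemma ip_cong: "(\<And>i. i < N ==> x i = x' i) ==> (\<And>i. i < N ==> y i = y' i) ==> ip N x y = ip N x' y'"
  unfolding ip_def by (intro arg_cong2[of _ _ _ _ "(/)"] sum.cong) auto

text \<open>Covers the degenerate Gram-Schmidt step: when the residual vanishes on the sites, the
  normalized vector is 0 there.\<close>

definition unit_or_zero :: "nat => vect => bool" where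
  "unit_or_zero N x \<longleftrightarrow> ip N x x = 1 \<or> (\<forall>i<N. x i = 0)"

lemma unit_or_zero_mult: "unit_or_zero N x ==> ip N y x * ip N x x = ip N y x"
  by (auto simp: unit_or_zero_def ip_zero)

lemma mult_mv_zero: "(\<And>i. i < N ==> x i = 0) ==> mult_mv N g x = (\<lambda>_. 0)"
  by (simp add: mult_mv_def)

lemma ip_adjoint: "ip N (mult_mv N (transp_m g) x) y = ip N x (mult_mv N g y)"
proof -
  have "(\<Sum>i<N. (\<Sum>j<N. g j i * x j) * y i) = (\<Sum>j<N. \<Sum>i<N. g j i * x j * y i)"
    unfolding sum_distrib_right by (rule sum.swap)
  also have "\<dots> = (\<Sum>i<N. x i * (\<Sum>j<N. g i j * y j))"
    by (simp add: sum_distrib_left mult_ac)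
  finally show ?thesis by (simp add: ip_def mult_mv_def transp_m_def)
qed

text \<open>One update of the recursion. It is (I - P) g (I - P) with P = \<open>tens N p p\<close>,
  which is the orthogonal projection onto p when p is a unit vector.\<close>

definition deflate :: "nat => vect => matr => matr" where
  "deflate N p g = (\<lambda>i j. g i j - (tens N (mult_mv N g p) p i j + tens N p (mult_mv N (transp_m g) p) i j
      - ip N p (mult_mv N g p) * tens N p p i j))"

lemma transp_deflate: "transp_m (deflate N p g) = deflate N p (transp_m g)"
proof -
  have "ip N p (mult_mv N g p) = ip N p (mult_mv N (transp_m g) p)"
    using ip_adjoint[of N g p p] by (simp add: ip_commute)
  then show ?thesis
    by (simp add: deflate_def transp_m_def[of "\<lambda>i j. _ i j - _ i j"] tens_def mult.commute) (simp add: transp_m_def add.commute)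
qed

lemma sum_mult_ip: "(\<Sum>j<N. c * x j / real N * y j) = c * ip N x y"
  by (simp add: ip_def sum_distrib_left sum_divide_distrib mult_ac)

lemma mult_mv_deflate:
  "mult_mv N (deflate N p g) y i = mult_mv N g y i - mult_mv N g p i * ip N p y - p i * ip N p (mult_mv N g y)
     + ip N p (mult_mv N g p) * p i * ip N p y"
proof -
  have "mult_mv N (deflate N p g) y i = mult_mv N g y i - ((\<Sum>j<N. mult_mv N g p i * p j / real N * y j)
      + (\<Sum>j<N. p i * mult_mv N (transp_m g) p j / real N * y j) - (\<Sum>j<N. (ip N p (mult_mv N g p) * p i) * p j / real N * y j))"
    unfolding mult_mv_def[of N "deflate N p g"] mult_mv_def[of N g y]
    unfolding deflate_def tens_def
    by (simp add: algebra_simps sum.distrib sum_subtractf)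
  then show ?thesis unfolding sum_mult_ip ip_adjoint by simp
qed

lemma deflate_kills:
  assumes "unit_or_zero N p" shows "mult_mv N (deflate N p g) p = (\<lambda>_. 0)"
proof (cases "ip N p p = 1")
  case True
  then show ?thesis by (intro ext) (simp add: mult_mv_deflate)
next
  case False
  then show ?thesis using assms by (intro mult_mv_zero) (auto simp: unit_or_zero_def)
qed

lemma deflate_preserves_null:
  assumes "ip N p y = 0" "mult_mv N g y = (\<lambda>_. 0)" shows "mult_mv N (deflate N p g) y = (\<lambda>_. 0)"
  using assms by (intro ext) (simp add: mult_mv_deflate ip_linear)

lemma deflate_of_null:
  assumes "mult_mv N g p = (\<lambda>_. 0)" "mult_mv N (transp_m g) p = (\<lambda>_. 0)" shows "deflate N p g = g"
  unfolding deflate_def assms tens_def by (simp add: ip_linear)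

lemma mult_mv_linear:
  "mult_mv N (\<lambda>i j. g i j - g' i j) x = (\<lambda>i. mult_mv N g x i - mult_mv N g' x i)"
  "mult_mv N (\<lambda>i j. g i j + g' i j) x = (\<lambda>i. mult_mv N g x i + mult_mv N g' x i)"
  by (simp_all add: mult_mv_def left_diff_distrib sum_subtractf distrib_right sum.distrib)

lemma transp_linear:
  "transp_m (\<lambda>i j. g i j - g' i j) = (\<lambda>i j. transp_m g i j - transp_m g' i j)"
  "transp_m (\<lambda>i j. g i j + g' i j) = (\<lambda>i j. transp_m g i j + transp_m g' i j)"
  by (simp_all add: transp_m_def)

lemma deflate_linear:
  "deflate N p (\<lambda>i j. g i j - g' i j) = (\<lambda>i j. deflate N p g i j - deflate N p g' i j)"
  "deflate N p (\<lambda>i j. g i j + g' i j) = (\<lambda>i j. deflate N p g i j + deflate N p g' i j)"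
  unfolding deflate_def mult_mv_linear transp_linear ip_linear tens_def
  by (auto simp: fun_eq_iff algebra_simps diff_divide_distrib add_divide_distrib)

text \<open>Under orthogonality the double deflation expands to an expression that is symmetric in p
  and r.\<close>

lemma deflate_commute:
  assumes "ip N p r = 0" shows "deflate N p (deflate N r g) = deflate N r (deflate N p g)"
proof -
  have o: "ip N r p = 0" using assms by (simp add: ip_commute)
  have e: "deflate N p (deflate N r g) i j
      = g i j - mult_mv N g r i * r j / N - r i * mult_mv N (transp_m g) r j / N + ip N r (mult_mv N g r) * r i * r j / N
        - mult_mv N g p i * p j / N - p i * mult_mv N (transp_m g) p j / N + ip N p (mult_mv N g p) * p i * p j / N
        + r i * p j * ip N r (mult_mv N g p) / N + p i * r j * ip N p (mult_mv N g r) / N"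
    if "ip N p r = 0" "ip N r p = 0" for p r :: vect and i j
  proof -
    have 1: "mult_mv N (deflate N r g) p = (\<lambda>i. mult_mv N g p i - r i * ip N r (mult_mv N g p))"
      "mult_mv N (transp_m (deflate N r g)) p = (\<lambda>i. mult_mv N (transp_m g) p i - r i * ip N p (mult_mv N g r))"
      unfolding transp_deflate using that
      by (auto simp: fun_eq_iff mult_mv_deflate) (metis ip_adjoint ip_commute)
    have 2: "ip N p (\<lambda>i. mult_mv N g p i - r i * ip N r (mult_mv N g p)) = ip N p (mult_mv N g p)"
      unfolding ip_linear using that by simp
    show ?thesis
      unfolding deflate_def[of N p] 1 2 tens_def by (simp add: deflate_def tens_def algebra_simps diff_divide_distrib add_divide_distrib)
  qed
  show ?thesis unfolding fun_eq_iff e[OF assms o] e[OF o assms] by (simp add: algebra_simps)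
qed

section \<open>Revealed directions and pathwise invariance under resampling\<close>

lemma it_phi_orthogonal_unit:
  assumes N: "N >= 1"
  shows "(\<forall>s\<in>{1..k}. unit_or_zero N (it_phi \<beta> h N A s)) \<and>
    (\<forall>s\<in>{1..k}. \<forall>t\<in>{1..k}. s ~= t --> ip N (it_phi \<beta> h N A s) (it_phi \<beta> h N A t) = 0)"
proof (induction k)
  case (Suc k)
  let ?P = "it_phi \<beta> h N A"
  show ?case
  proof (cases k)
    case 0
    have "ip N (?P 1) (?P 1) = 1" using N by (simp add: it_phi.simps ip_def)
    then show ?thesis using 0 by (auto simp: unit_or_zero_def)
  next
    case (Suc l)
    define m where "m = it_m \<beta> h N A (Suc k)"
    define r where "r = (\<lambda>i. m i - (\<Sum>s = 1..k. ip N m (?P s) * ?P s i))"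
    have P: "?P (Suc k) = (\<lambda>i. r i / nrm N r)"
      unfolding Suc it_phi.simps Let_def r_def m_def by simp
    have o: "ip N r (?P t) = 0" if "t \<in> {1..k}" for t
    proof -
      have "(\<Sum>s = 1..k. ip N m (?P s) * ip N (?P s) (?P t)) = (\<Sum>s = 1..k. if s = t then ip N m (?P t) * ip N (?P t) (?P t) else 0)"
        by (rule sum.cong) (use Suc.IH that in auto)
      also have "\<dots> = ip N m (?P t)" using that Suc.IH by (simp add: unit_or_zero_mult)
      finally show ?thesis unfolding r_def ip_linear ip_sum by simp
    qed
    have o': "ip N (?P (Suc k)) (?P t) = 0" "ip N (?P t) (?P (Suc k)) = 0" if "t \<in> {1..k}" for t
      using o[OF that] unfolding P by (simp_all add: ip_linear ip_commute[of N _ r])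
    have u: "unit_or_zero N (?P (Suc k))"
    proof (cases "ip N r r = 0")
      case True
      then show ?thesis using ip_self_eq_0[OF True] unfolding P by (auto simp: unit_or_zero_def)
    next
      case False
      then have "ip N (?P (Suc k)) (?P (Suc k)) = 1"
        unfolding P ip_linear using ip_self_nonneg[of N r] by (simp add: nrm_def)
      then show ?thesis by (simp add: unit_or_zero_def)
    qed
    show ?thesis using Suc.IH o' u by (auto simp: atLeastAtMostSuc_conv)
  qed
qed simp

lemma it_phi_unit_or_zero: "N >= 1 ==> s >= 1 ==> unit_or_zero N (it_phi \<beta> h N A s)"
  using it_phi_orthogonal_unit[of N s \<beta> h A] by auto

lemma it_phi_orthogonal: "N >= 1 ==> s >= 1 ==> t >= 1 ==> s ~= t ==> ip N (it_phi \<beta> h N A s) (it_phi \<beta> h N A t) = 0"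
  using it_phi_orthogonal_unit[of N "max s t" \<beta> h A] by auto

text \<open>The directions come from \<open>A\<close> and the projected matrix is \<open>g\<close>.
  Separating the two makes it possible to project an independent matrix along directions revealed by
  \<open>A\<close>; with \<open>g = A\<close> it is the recursion itself.\<close>

primrec deflates :: "real => real => nat => nat => matr => matr => matr" where
  "deflates \<beta> h N 0 A g = g"
| "deflates \<beta> h N (Suc k) A g = deflate N (it_phi \<beta> h N A (Suc k)) (deflates \<beta> h N k A g)"

lemma it_g_eq_deflates: "it_g \<beta> h N A (Suc k) = deflates \<beta> h N k A A"
proof (induction k)
  case (Suc k)
  then show ?case by (simp add: it_g.simps(3) Let_def it_xi.simps it_eta.simps deflate_def)
qed (simp add: it_g.simps)

lemma transp_deflates: "transp_m (deflates \<beta> h N k A g) = deflates \<beta> h N k A (transp_m g)"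
  by (induction k) (auto simp: transp_deflate)

lemma deflates_null:
  assumes "N >= 1" "s \<in> {1..k}"
  shows "mult_mv N (deflates \<beta> h N k A g) (it_phi \<beta> h N A s) = (\<lambda>_. 0)"
  using assms(2)
proof (induction k)
  case (Suc k)
  show ?case
  proof (cases "s = Suc k")
    case True
    then show ?thesis using it_phi_unit_or_zero[OF assms(1)] by (simp add: deflate_kills)
  next
    case False
    then show ?thesis using Suc it_phi_orthogonal[OF assms(1), of "Suc k" s] by (auto intro!: deflate_preserves_null)
  qed
qed simp

lemma deflates_linear:
  "deflates \<beta> h N k A (\<lambda>i j. g i j - g' i j) = (\<lambda>i j. deflates \<beta> h N k A g i j - deflates \<beta> h N k A g' i j)"
  "deflates \<beta> h N k A (\<lambda>i j. g i j + g' i j) = (\<lambda>i j. deflates \<beta> h N k A g i j + deflates \<beta> h N k A g' i j)"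
  by (induction k) (auto simp: deflate_linear)

lemma deflates_of_null:
  assumes "\<And>s. s \<in> {1..k} ==> mult_mv N g (it_phi \<beta> h N A s) = (\<lambda>_. 0)"
    "\<And>s. s \<in> {1..k} ==> mult_mv N (transp_m g) (it_phi \<beta> h N A s) = (\<lambda>_. 0)"
  shows "deflates \<beta> h N k A g = g"
  using assms by (induction k) (auto simp: deflate_of_null)

lemma deflates_cong:
  assumes "\<And>s. s \<in> {1..k} ==> it_phi \<beta> h N A s = it_phi \<beta> h N B s"
  shows "deflates \<beta> h N k A g = deflates \<beta> h N k B g"
  using assms by (induction k) auto

lemma deflates_deflate:
  assumes "\<And>s. s \<in> {1..k} ==> ip N p (it_phi \<beta> h N A s) = 0"
  shows "deflates \<beta> h N k A (deflate N p g) = deflate N p (deflates \<beta> h N k A g)"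
  using assms
proof (induction k)
  case (Suc k)
  have "ip N (it_phi \<beta> h N A (Suc k)) p = 0" using Suc.prems[of "Suc k"] by (simp add: ip_commute)
  from deflate_commute[OF this] show ?case using Suc by simp
qed simp

text \<open>The disorder with the part orthogonal to the first \<open>k\<close> directions taken from a second matrix.\<close>
definition resample :: "real => real => nat => nat => matr => matr => matr" where
  "resample \<beta> h N k A g = (\<lambda>i j. A i j + deflates \<beta> h N k A (\<lambda>i j. g i j - A i j) i j)"

text \<open>The difference X between the resampled and the original matrix annihilates phi^(1), ...,
  phi^(k) from both sides and is unchanged by deflation along them. So g^(s) only changes by X for s
  <= k + 1, and xi^(s), eta^(s) do not change for s <= k. Since phi^(k+1) is computed from zeta^(1),
  ..., zeta^(k), it is preserved as well.\<close>

lemma resample_invariants: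
  fixes \<beta> h :: real and N k :: nat and A g :: matr
  assumes N: "N >= 1"
  defines "R \<equiv> resample \<beta> h N k A g"
  shows "s <= k + 1 ==> it_phi \<beta> h N R s = it_phi \<beta> h N A s"
    and "s <= k ==> it_xi \<beta> h N R s = it_xi \<beta> h N A s"
    and "s <= k ==> it_eta \<beta> h N R s = it_eta \<beta> h N A s"
proof -
  let ?P = "it_phi \<beta> h N"
  define X where "X = deflates \<beta> h N k A (\<lambda>i j. g i j - A i j)"
  have R: "R = (\<lambda>i j. A i j + X i j)" by (simp add: R_def resample_def X_def)
  have X1: "mult_mv N X (?P A s) = (\<lambda>_. 0)" if "s \<in> {1..k}" for s
    unfolding X_def by (rule deflates_null[OF N that])
  have X2: "mult_mv N (transp_m X) (?P A s) = (\<lambda>_. 0)" if "s \<in> {1..k}" for s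
    unfolding X_def transp_deflates by (rule deflates_null[OF N that])
  have "(s <= k + 1 --> ?P R s = ?P A s) \<and> (s <= k --> it_xi \<beta> h N R s = it_xi \<beta> h N A s \<and> it_eta \<beta> h N R s = it_eta \<beta> h N A s)"
  proof (induction s rule: less_induct)
    case (less s)
    have z: "it_zeta \<beta> h N R t = it_zeta \<beta> h N A t" if "t < s" "t <= k" for t
      using less[OF that(1)] that(2) by (simp add: it_zeta.simps)
    have p: "?P R s = ?P A s" if "s <= k + 1"
    proof -
      consider "s = 0" | "s = 1" | l where "s = Suc (Suc l)" by (metis One_nat_def not0_implies_Suc)
      then show ?thesis
      proof cases
        case 3
        have m: "it_m \<beta> h N R s = it_m \<beta> h N A s"
          unfolding 3 it_m.simps Let_def using z that 3 by simp
        have "(\<Sum>t=1..Suc l. ip N (it_m \<beta> h N A s) (?P R t) * ?P R t i) = (\<Sum>t=1..Suc l. ip N (it_m \<beta> h N A s) (?P A t) * ?P A t i)" for i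
          by (rule sum.cong) (use less that 3 in auto)
        then show ?thesis unfolding 3 it_phi.simps Let_def using m unfolding 3 by simp
      qed (simp_all add: it_phi.simps)
    qed
    have x: "it_xi \<beta> h N R s = it_xi \<beta> h N A s \<and> it_eta \<beta> h N R s = it_eta \<beta> h N A s" if s: "s <= k"
    proof (cases s)
      case 0
      then show ?thesis using p by (simp add: it_xi.simps it_eta.simps it_phi.simps mult_mv_def)
    next
      case (Suc l)
      have "it_g \<beta> h N R s = deflates \<beta> h N l A R"
        unfolding Suc it_g_eq_deflates by (rule deflates_cong) (use less s Suc in auto)
      also have "\<dots> = (\<lambda>i j. it_g \<beta> h N A s i j + deflates \<beta> h N l A X i j)"
        unfolding R deflates_linear Suc it_g_eq_deflates ..
      also have "deflates \<beta> h N l A X = X"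
        by (rule deflates_of_null) (use X1 X2 s Suc in auto)
      finally have g: "it_g \<beta> h N R s = (\<lambda>i j. it_g \<beta> h N A s i j + X i j)" .
      have "?P R s = ?P A s" using p s by simp
      moreover have "s \<in> {1..k}" using s Suc by auto
      ultimately show ?thesis
        by (simp add: it_xi.simps it_eta.simps g transp_linear mult_mv_linear X1 X2)
    qed
    show ?case using p x by simp
  qed
  then show "s <= k + 1 ==> ?P R s = ?P A s" "s <= k ==> it_xi \<beta> h N R s = it_xi \<beta> h N A s" "s <= k ==> it_eta \<beta> h N R s = it_eta \<beta> h N A s"
    by auto
qed

text \<open>The directions up to k are unchanged, and the deflated original cancels in
  \<open>resample\<close>. Thus the matrix of step k + 1 is the projection of the fresh matrix
  alone.\<close>

lemma it_g_resample:
  assumes N: "N >= 1"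
  shows "it_g \<beta> h N (resample \<beta> h N k A g) (Suc k) = deflates \<beta> h N k A g"
proof -
  define X where "X = deflates \<beta> h N k A (\<lambda>i j. g i j - A i j)"
  have R: "resample \<beta> h N k A g = (\<lambda>i j. A i j + X i j)" by (simp add: resample_def X_def)
  have X1: "mult_mv N X (it_phi \<beta> h N A s) = (\<lambda>_. 0)" if "s \<in> {1..k}" for s
    unfolding X_def by (rule deflates_null[OF N that])
  have X2: "mult_mv N (transp_m X) (it_phi \<beta> h N A s) = (\<lambda>_. 0)" if "s \<in> {1..k}" for s
    unfolding X_def transp_deflates by (rule deflates_null[OF N that])
  have "it_g \<beta> h N (resample \<beta> h N k A g) (Suc k) = deflates \<beta> h N k A (resample \<beta> h N k A g)"
    unfolding it_g_eq_deflates by (rule deflates_cong) (use resample_invariants(1)[OF N] in auto)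
  also have "\<dots> = (\<lambda>i j. deflates \<beta> h N k A A i j + X i j)"
    unfolding R deflates_linear using deflates_of_null[of k N X \<beta> h A] X1 X2 by simp
  also have "\<dots> = deflates \<beta> h N k A g" unfolding X_def deflates_linear by simp
  finally show ?thesis .
qed

text \<open>Two successive resamplings amount to one at level k whose fresh matrix keeps the part of
  g seen by phi^(k+1) and takes the rest from g'. Since phi^(k+1) depends on \<open>A\<close> only,
  for fixed \<open>A\<close> the passage to level k + 1 concerns one deterministic direction, which
  is the case treated by \<open>Gm_redraw\<close>.\<close>

lemma resample_step:
  fixes \<beta> h :: real and N k :: nat and A g g' :: matr
  assumes N: "N >= 1"
  defines "p \<equiv> it_phi \<beta> h N A (Suc k)"
  shows "resample \<beta> h N (Suc k) (resample \<beta> h N k A g) g'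
     = resample \<beta> h N k A (\<lambda>i j. g i j - deflate N p g i j + deflate N p g' i j)"
proof -
  let ?B = "resample \<beta> h N k A g" and ?c = "deflates \<beta> h N k A"
  have c: "deflates \<beta> h N k ?B = ?c"
    by (intro ext, rule fun_cong, rule fun_cong, rule deflates_cong) (use resample_invariants(1)[OF N] in auto)
  have p: "it_phi \<beta> h N ?B (Suc k) = p" unfolding p_def using resample_invariants(1)[OF N] by auto
  have cc: "?c (?c Y) = ?c Y" for Y
    by (rule deflates_of_null) (auto simp: deflates_null[OF N] transp_deflates)
  have cB: "?c ?B = ?c g"
    unfolding resample_def deflates_linear cc by simp
  have pc: "?c (deflate N p Y) = deflate N p (?c Y)" for Y
    by (rule deflates_deflate) (use it_phi_orthogonal[OF N, of "Suc k"] in \<open>auto simp: p_def\<close>)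
  have "resample \<beta> h N (Suc k) ?B g' = (\<lambda>i j. ?B i j + (deflate N p (?c g') i j - deflate N p (?c g) i j))"
    unfolding resample_def[of \<beta> h N "Suc k"] deflates.simps c p deflates_linear deflate_linear cB ..
  also have "\<dots> = resample \<beta> h N k A (\<lambda>i j. g i j - deflate N p g i j + deflate N p g' i j)"
    unfolding resample_def[of \<beta> h N k A] deflates_linear pc by (simp add: algebra_simps)
  finally show ?thesis .
qed

section \<open>Measurability of the iteration\<close>

lemma borel_measurable_vect:
  fixes f :: "'a => vect"
  shows "(\<And>i. (\<lambda>x. f x i) \<in> borel_measurable M) ==> f \<in> borel_measurable M"
  by (rule measurable_coordinatewise_then_product)

lemma borel_measurable_matr:
  fixes f :: "'a => matr"
  shows "(\<And>i j. (\<lambda>x. f x i j) \<in> borel_measurable M) ==> f \<in> borel_measurable M"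
  by (rule measurable_coordinatewise_then_product)+

lemma vect_entry:
  fixes f :: "'a => vect"
  shows "f \<in> borel_measurable M ==> (\<lambda>x. f x i) \<in> borel_measurable M"
  by (erule measurable_compose) measurable

lemma matr_entry:
  fixes f :: "'a => matr"
  assumes "f \<in> borel_measurable M" shows "(\<lambda>x. f x i j) \<in> borel_measurable M"
proof -
  have "(\<lambda>x. f x i) \<in> borel_measurable M"
    by (rule measurable_compose[OF assms]) measurable
  then show ?thesis by (rule vect_entry)
qed

lemma mult_mv_measurable:
  assumes [measurable]: "\<And>i j. (\<lambda>x. g x i j) \<in> borel_measurable M" "\<And>i. (\<lambda>x. p x i) \<in> borel_measurable M"
  shows "(\<lambda>x. mult_mv N (g x) (p x) i) \<in> borel_measurable M" "(\<lambda>x. mult_mv N (transp_m (g x)) (p x) i) \<in> borel_measurable M"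
  unfolding mult_mv_def transp_m_def by measurable

lemma ip_measurable:
  assumes "\<And>i. i < N ==> (\<lambda>x. q x i) \<in> borel_measurable M" "\<And>i. i < N ==> (\<lambda>x. p x i) \<in> borel_measurable M"
  shows "(\<lambda>x. ip N (p x) (q x)) \<in> borel_measurable M"
  unfolding ip_def
  by (intro borel_measurable_divide borel_measurable_sum borel_measurable_times borel_measurable_const) (use assms in auto)

lemma deflate_measurable:
  assumes [measurable]: "\<And>i j. (\<lambda>x. g x i j) \<in> borel_measurable M" "\<And>i. (\<lambda>x. p x i) \<in> borel_measurable M"
  shows "(\<lambda>x. deflate N (p x) (g x) i j) \<in> borel_measurable M"
  unfolding deflate_def tens_def
  by (intro borel_measurable_diff borel_measurable_add borel_measurable_times borel_measurable_divide borel_measurable_const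
      mult_mv_measurable ip_measurable assms)

text \<open>The set S of sites allows two uses: all indices for Borel measurability in the matrix,
  and the first N sites for measurability with respect to G_k, where only those entries of xi and
  eta are generators.\<close>

lemma it_m_measurable:
  assumes S: "{..<N} \<subseteq> S"
    and xi: "\<And>t i. i \<in> S ==> 1 <= t ==> t <= k ==> (\<lambda>x. it_xi \<beta> h N (g x) t i) \<in> borel_measurable M"
    and eta: "\<And>t i. i \<in> S ==> 1 <= t ==> t <= k ==> (\<lambda>x. it_eta \<beta> h N (g x) t i) \<in> borel_measurable M"
    and s: "s <= Suc k" and i: "i \<in> S"
  shows "(\<lambda>x. it_m \<beta> h N (g x) s i) \<in> borel_measurable M"
proof -
  have z: "(\<lambda>x. it_zeta \<beta> h N (g x) t i) \<in> borel_measurable M" if "1 <= t" "t <= k" for t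
    unfolding it_zeta.simps by (intro borel_measurable_divide borel_measurable_add borel_measurable_const xi eta i that)
  consider "s = 0" | "s = Suc 0" | l where "s = Suc (Suc l)" by (metis not0_implies_Suc)
  then show ?thesis
  proof cases
    case 3
    show ?thesis unfolding 3 it_m.simps Let_def
      by (rule measurable_compose[OF _ measurable_tanh],
          intro borel_measurable_add borel_measurable_times borel_measurable_sum borel_measurable_const z)
         (use s 3 in auto)
  qed (simp_all add: it_m.simps)
qed

lemma it_phi_measurable:
  assumes S: "{..<N} \<subseteq> S"
    and xi: "\<And>t i. i \<in> S ==> 1 <= t ==> t <= k ==> (\<lambda>x. it_xi \<beta> h N (g x) t i) \<in> borel_measurable M"
    and eta: "\<And>t i. i \<in> S ==> 1 <= t ==> t <= k ==> (\<lambda>x. it_eta \<beta> h N (g x) t i) \<in> borel_measurable M"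
    and s: "s <= Suc k" and i: "i \<in> S"
  shows "(\<lambda>x. it_phi \<beta> h N (g x) s i) \<in> borel_measurable M"
  using s i
proof (induction s arbitrary: i rule: less_induct)
  case (less s)
  note m = it_m_measurable[OF S xi eta less.prems(1)]
  consider "s = 0" | "s = Suc 0" | l where "s = Suc (Suc l)" by (metis not0_implies_Suc)
  then show ?case
  proof cases
    case 3
    define r where "r x i = it_m \<beta> h N (g x) s i - (\<Sum>t=1..Suc l. ip N (it_m \<beta> h N (g x) s) (it_phi \<beta> h N (g x) t) * it_phi \<beta> h N (g x) t i)" for x i
    have r: "(\<lambda>x. r x i) \<in> borel_measurable M" if "i \<in> S" for i
      unfolding r_def
      by (intro borel_measurable_diff borel_measurable_sum borel_measurable_times m ip_measurable less.IH) (use 3 less.prems S that in auto)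
    have "(\<lambda>x. r x i / nrm N (r x)) \<in> borel_measurable M"
      unfolding nrm_def by (intro borel_measurable_divide borel_measurable_sqrt ip_measurable r measurable_compose[OF _ borel_measurable_sqrt])
        (use S less.prems in auto)
    moreover have "it_phi \<beta> h N (g x) s i = r x i / nrm N (r x)" for x
    proof -
      have "r x = (\<lambda>i. r x i)" by simp
      then show ?thesis unfolding r_def 3 it_phi.simps Let_def by simp
    qed
    ultimately show ?thesis by simp
  qed (simp_all add: it_phi.simps)
qed

lemma it_xi_eta_measurable_aux:
  "(\<forall>i j. (\<lambda>A. it_g \<beta> h N A k i j) \<in> borel_measurable borel) \<and> (\<forall>i. (\<lambda>A. it_xi \<beta> h N A k i) \<in> borel_measurable borel)
    \<and> (\<forall>i. (\<lambda>A. it_eta \<beta> h N A k i) \<in> borel_measurable borel)"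
proof (induction k rule: less_induct)
  case (less k)
  have id: "(\<lambda>A::matr. A i j) \<in> borel_measurable borel" for i j by (rule matr_entry) simp
  have p: "(\<lambda>A. it_phi \<beta> h N A k i) \<in> borel_measurable borel" for i
  proof (cases k)
    case (Suc l)
    show ?thesis by (rule it_phi_measurable[where k=l and S=UNIV]) (use less Suc in auto)
  qed (simp add: it_phi.simps)
  consider "k = 0" | "k = Suc 0" | l where "k = Suc (Suc l)" by (metis not0_implies_Suc)
  then have g: "(\<lambda>A. it_g \<beta> h N A k i j) \<in> borel_measurable borel" for i j
  proof cases
    case 3
    have p': "(\<lambda>A. it_phi \<beta> h N A (Suc l) i) \<in> borel_measurable borel" for i
      by (rule it_phi_measurable[where k=l and S=UNIV]) (use less 3 in auto)
    have "(\<lambda>A. deflate N (it_phi \<beta> h N A (Suc l)) (it_g \<beta> h N A (Suc l)) i j) \<in> borel_measurable borel"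
      by (rule deflate_measurable) (use less 3 p' in auto)
    then show ?thesis unfolding 3 it_g.simps Let_def deflate_def it_xi.simps it_eta.simps .
  qed (simp_all add: it_g.simps id)
  show ?case unfolding it_xi.simps it_eta.simps using g mult_mv_measurable[OF g p] by auto
qed

lemma it_measurable:
  "(\<lambda>A. it_xi \<beta> h N A k i) \<in> borel_measurable borel" "(\<lambda>A. it_eta \<beta> h N A k i) \<in> borel_measurable borel"
  "(\<lambda>A. it_phi \<beta> h N A k i) \<in> borel_measurable borel" "(\<lambda>A. it_m \<beta> h N A k i) \<in> borel_measurable borel"
  "(\<lambda>A. it_zeta \<beta> h N A k i) \<in> borel_measurable borel"
proof -
  note * = it_xi_eta_measurable_aux[of \<beta> h N]
  show 1: "(\<lambda>A. it_xi \<beta> h N A k i) \<in> borel_measurable borel" "(\<lambda>A. it_eta \<beta> h N A k i) \<in> borel_measurable borel" for i k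
    using * by auto
  show "(\<lambda>A. it_phi \<beta> h N A k i) \<in> borel_measurable borel"
    by (rule it_phi_measurable[where k=k and S=UNIV]) (use 1 in auto)
  show "(\<lambda>A. it_m \<beta> h N A k i) \<in> borel_measurable borel"
    by (rule it_m_measurable[where k=k and S=UNIV]) (use 1 in auto)
  show "(\<lambda>A. it_zeta \<beta> h N A k i) \<in> borel_measurable borel"
    unfolding it_zeta.simps by (intro borel_measurable_divide borel_measurable_add borel_measurable_const 1)
qed

lemma deflates_measurable:
  assumes f: "f \<in> borel_measurable M" and g: "\<And>i j. (\<lambda>x. g x i j) \<in> borel_measurable M"
  shows "(\<lambda>x. deflates \<beta> h N k (f x) (g x) i j) \<in> borel_measurable M"
proof (induction k arbitrary: i j)
  case (Suc k)
  show ?case unfolding deflates.simps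
    by (rule deflate_measurable[OF Suc]) (rule measurable_compose[OF f it_measurable(3)])
qed (simp add: g)

lemma resample_measurable:
  assumes f: "f \<in> borel_measurable M" and g: "g \<in> borel_measurable M"
  shows "(\<lambda>x. resample \<beta> h N k (f x) (g x)) \<in> borel_measurable M"
  unfolding resample_def
  by (intro borel_measurable_matr borel_measurable_add deflates_measurable f borel_measurable_diff matr_entry[OF f] matr_entry[OF g])

section \<open>Dependence on the N by N block\<close>

definition meq :: "nat => matr => matr => bool" where
  "meq N A B \<longleftrightarrow> (\<forall>i<N. \<forall>j<N. A i j = B i j)"

definition veq :: "nat => vect => vect => bool" where
  "veq N x y \<longleftrightarrow> (\<forall>i<N. x i = y i)"

lemma meq_refl [simp]: "meq N A A" and veq_refl [simp]: "veq N x x"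
  by (auto simp: meq_def veq_def)

lemma mult_mv_veq:
  assumes "meq N A B" "veq N x y"
  shows "veq N (mult_mv N A x) (mult_mv N B y)" "veq N (mult_mv N (transp_m A) x) (mult_mv N (transp_m B) y)"
  using assms unfolding veq_def meq_def mult_mv_def transp_m_def by (auto intro!: sum.cong)

lemma ip_veq: "veq N x x' ==> veq N y y' ==> ip N x y = ip N x' y'"
  by (rule ip_cong) (auto simp: veq_def)

lemma deflate_meq:
  assumes A: "meq N A B" and p: "veq N p r" shows "meq N (deflate N p A) (deflate N r B)"
proof -
  note m = mult_mv_veq[OF A p]
  show ?thesis
    unfolding meq_def deflate_def tens_def ip_veq[OF p m(1)]
    using A p m by (auto simp: meq_def veq_def)
qed

lemma it_veq:
  assumes AB: "meq N A B"
  shows "meq N (it_g \<beta> h N A k) (it_g \<beta> h N B k) \<and> veq N (it_phi \<beta> h N A k) (it_phi \<beta> h N B k) \<and>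
    veq N (it_xi \<beta> h N A k) (it_xi \<beta> h N B k) \<and> veq N (it_eta \<beta> h N A k) (it_eta \<beta> h N B k)"
proof (induction k rule: less_induct)
  case (less k)
  have z: "veq N (it_zeta \<beta> h N A t) (it_zeta \<beta> h N B t)" if "t < k" for t
    using less[OF that] by (auto simp: it_zeta.simps veq_def)
  consider "k = 0" | "k = Suc 0" | l where "k = Suc (Suc l)" by (metis not0_implies_Suc)
  then have gp: "meq N (it_g \<beta> h N A k) (it_g \<beta> h N B k) \<and> veq N (it_phi \<beta> h N A k) (it_phi \<beta> h N B k)"
  proof cases
    case 3
    let ?l = "Suc l"
    have l: "?l < k" using 3 by simp
    have e: "it_g \<beta> h N A k = deflate N (it_phi \<beta> h N A ?l) (it_g \<beta> h N A ?l)" for A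
      unfolding 3 it_g.simps Let_def deflate_def it_xi.simps it_eta.simps ..
    have m: "veq N (it_m \<beta> h N A k) (it_m \<beta> h N B k)"
      unfolding veq_def
    proof (intro allI impI)
      fix i assume i: "i < N"
      have "(\<Sum>s = 1..<?l. gam \<beta> h s * it_zeta \<beta> h N A s i) = (\<Sum>s = 1..<?l. gam \<beta> h s * it_zeta \<beta> h N B s i)"
        by (rule sum.cong) (use z i 3 in \<open>auto simp: veq_def\<close>)
      then show "it_m \<beta> h N A k i = it_m \<beta> h N B k i"
        unfolding 3 it_m.simps Let_def using z[OF l] i by (simp add: veq_def)
    qed
    define r where "r A = (\<lambda>i. it_m \<beta> h N A k i - (\<Sum>s = 1..?l. ip N (it_m \<beta> h N A k) (it_phi \<beta> h N A s) * it_phi \<beta> h N A s i))" for A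
    have r: "veq N (r A) (r B)"
      unfolding veq_def r_def
    proof (intro allI impI)
      fix i assume i: "i < N"
      have "(\<Sum>s = 1..?l. ip N (it_m \<beta> h N A k) (it_phi \<beta> h N A s) * it_phi \<beta> h N A s i)
         = (\<Sum>s = 1..?l. ip N (it_m \<beta> h N B k) (it_phi \<beta> h N B s) * it_phi \<beta> h N B s i)"
      proof (rule sum.cong)
        fix s assume "s \<in> {1..?l}"
        then have p: "veq N (it_phi \<beta> h N A s) (it_phi \<beta> h N B s)" using less[of s] 3 by auto
        show "ip N (it_m \<beta> h N A k) (it_phi \<beta> h N A s) * it_phi \<beta> h N A s i = ip N (it_m \<beta> h N B k) (it_phi \<beta> h N B s) * it_phi \<beta> h N B s i"
          unfolding ip_veq[OF m p] using p i by (simp add: veq_def)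
      qed simp
      then show "it_m \<beta> h N A k i - (\<Sum>s = 1..?l. ip N (it_m \<beta> h N A k) (it_phi \<beta> h N A s) * it_phi \<beta> h N A s i)
         = it_m \<beta> h N B k i - (\<Sum>s = 1..?l. ip N (it_m \<beta> h N B k) (it_phi \<beta> h N B s) * it_phi \<beta> h N B s i)"
        using m i by (simp add: veq_def)
    qed
    have p: "it_phi \<beta> h N A k = (\<lambda>i. r A i / nrm N (r A))" for A
      unfolding r_def 3 it_phi.simps Let_def ..
    have "veq N (it_phi \<beta> h N A k) (it_phi \<beta> h N B k)"
      unfolding p nrm_def ip_veq[OF r r] using r by (simp add: veq_def)
    moreover have "meq N (it_g \<beta> h N A k) (it_g \<beta> h N B k)"
      unfolding e by (rule deflate_meq) (use less[OF l] in auto)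
    ultimately show ?thesis by simp
  qed (use AB in \<open>simp_all add: it_g.simps it_phi.simps\<close>)
  then show ?case unfolding it_xi.simps it_eta.simps using mult_mv_veq by blast
qed

lemma deflates_meq:
  assumes "meq N A B" "meq N g g'" shows "meq N (deflates \<beta> h N k A g) (deflates \<beta> h N k B g')"
proof (induction k)
  case (Suc k)
  show ?case unfolding deflates.simps by (rule deflate_meq[OF Suc]) (use it_veq[OF assms(1)] in auto)
qed (use assms in simp)

lemma resample_meq:
  assumes A: "meq N A B" and g: "meq N g g'" shows "meq N (resample \<beta> h N k A g) (resample \<beta> h N k B g')"
proof -
  have "meq N (\<lambda>i j. g i j - A i j) (\<lambda>i j. g' i j - B i j)" using A g by (simp add: meq_def)
  from deflates_meq[OF A this] show ?thesis using A by (simp add: meq_def resample_def)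
qed

text \<open>The disorder is specified only on the first N sites and is arbitrary elsewhere, whereas
  \<open>Gm N\<close> lives on matrices that vanish elsewhere. Functions with this property have the
  same law under both.\<close>

definition on_block :: "nat => (matr => 'b) => bool" where
  "on_block N F \<longleftrightarrow> (\<forall>A B. meq N A B --> F A = F B)"

lemma on_blockD: "on_block N F ==> meq N A B ==> F A = F B"
  by (auto simp: on_block_def)

section \<open>The Gaussian vector and matrix; refreshing and redrawing\<close>

definition Gv :: "nat => vect measure" where
  "Gv N = distr (gs {..<N}) borel (\<lambda>x i. if i < N then x i else 0)"

text \<open>Extended by 0 outside the block, because the iteration is defined on matrices with all
  natural indices.\<close>

definition Gm :: "nat => matr measure" where
  "Gm N = distr (gs ({..<N} \<times> {..<N})) borel (\<lambda>x i j. if i < N \<and> j < N then x (i, j) / sqrt (real N) else 0)"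

lemma Gv_emb: "(\<lambda>x i. if i < N then x i else 0) \<in> measurable (PiM {..<N} (\<lambda>_. borel)) (borel :: vect measure)"
proof (rule borel_measurable_vect)
  fix i show "(\<lambda>x. if i < N then x i else 0) \<in> borel_measurable (PiM {..<N} (\<lambda>_. borel :: real measure))"
    by (cases "i < N") (auto intro: measurable_component_singleton)
qed

lemma Gm_emb: "(\<lambda>x i j. if i < N \<and> j < N then x (i, j) / sqrt (real N) else 0)
   \<in> measurable (PiM ({..<N} \<times> {..<N}) (\<lambda>_. borel)) (borel :: matr measure)"
proof (rule borel_measurable_matr)
  fix i j show "(\<lambda>x. if i < N \<and> j < N then x (i, j) / sqrt (real N) else 0) \<in> borel_measurable (PiM ({..<N} \<times> {..<N}) (\<lambda>_. borel :: real measure))"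
    by (cases "i < N \<and> j < N") (auto intro!: measurable_component_singleton borel_measurable_divide)
qed

lemma sets_Gv [measurable_cong, simp]: "sets (Gv N) = sets borel" and space_Gv [simp]: "space (Gv N) = UNIV"
  by (auto simp: Gv_def)

lemma sets_Gm [measurable_cong, simp]: "sets (Gm N) = sets borel" and space_Gm [simp]: "space (Gm N) = UNIV"
  by (auto simp: Gm_def)

lemma prob_space_Gv: "prob_space (Gv N)"
  unfolding Gv_def by (rule prob_space.prob_space_distr[OF prob_space_gs]) (use Gv_emb in \<open>simp cong: measurable_cong_sets\<close>)

lemma prob_space_Gm: "prob_space (Gm N)"
  unfolding Gm_def by (rule prob_space.prob_space_distr[OF prob_space_gs]) (use Gm_emb in \<open>simp cong: measurable_cong_sets\<close>)

global_interpretation Gv: prob_space "Gv N" for N by (rule prob_space_Gv)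
global_interpretation Gm: prob_space "Gm N" for N by (rule prob_space_Gm)

lemma emeasure_Gv_UNIV [simp]: "emeasure (Gv N) UNIV = 1" and emeasure_Gm_UNIV [simp]: "emeasure (Gm N) UNIV = 1"
  using Gv.emeasure_space_1[of N] Gm.emeasure_space_1[of N] by simp_all

lemma nn_integral_Gv:
  assumes "F \<in> borel_measurable borel"
  shows "(\<integral>\<^sup>+x. F x \<partial>Gv N) = (\<integral>\<^sup>+x. F (\<lambda>i. if i < N then x i else 0) \<partial>gs {..<N})"
  unfolding Gv_def by (rule nn_integral_distr) (use Gv_emb assms in \<open>simp_all cong: measurable_cong_sets\<close>)

lemma nn_integral_Gm:
  assumes "F \<in> borel_measurable borel"
  shows "(\<integral>\<^sup>+x. F x \<partial>Gm N) = (\<integral>\<^sup>+x. F (\<lambda>i j. if i < N \<and> j < N then x (i, j) / sqrt (real N) else 0) \<partial>gs ({..<N} \<times> {..<N}))"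
  unfolding Gm_def by (rule nn_integral_distr) (use Gm_emb assms in \<open>simp_all cong: measurable_cong_sets\<close>)

text \<open>For a unit vector p this is the rank-one correction after which the matrix maps p to w.
  \<open>colrep\<close> does the same for the transposed matrix and v.\<close>

definition rowrep :: "nat => vect => vect => matr => matr" where
  "rowrep N p w g = (\<lambda>i j. g i j + (w i - (\<Sum>b<N. g i b * p b)) * p j / real N)"

definition colrep :: "nat => vect => vect => matr => matr" where
  "colrep N p v g = (\<lambda>i j. g i j + (v j - (\<Sum>a<N. p a * g a j)) * p i / real N)"

lemma rowrep_measurable:
  assumes [measurable]: "\<And>i j. (\<lambda>x. g x i j) \<in> borel_measurable M" "\<And>i. (\<lambda>x. w x i) \<in> borel_measurable M"
  shows "(\<lambda>x. rowrep N p (w x) (g x) i j) \<in> borel_measurable M"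
  unfolding rowrep_def by measurable

lemma colrep_measurable:
  assumes [measurable]: "\<And>i j. (\<lambda>x. g x i j) \<in> borel_measurable M" "\<And>i. (\<lambda>x. w x i) \<in> borel_measurable M"
  shows "(\<lambda>x. colrep N p (w x) (g x) i j) \<in> borel_measurable M"
  unfolding colrep_def by measurable

text \<open>The vectors e_j tensor p, divided by sqrt N, form an orthonormal family among the N^2
  entries, and the coordinates along it are the entries of g p. Replacing them by an independent w
  is an instance of \<open>gs_resample_family\<close>.\<close>

lemma Gm_resample_rows:
  assumes N: "N >= 1" and p: "ip N p p = 1"
    and F[measurable]: "F \<in> borel_measurable borel" and block: "on_block N F"
  shows "(\<integral>\<^sup>+A. F A \<partial>Gm N) = (\<integral>\<^sup>+A. \<integral>\<^sup>+w. F (rowrep N p w A) \<partial>Gv N \<partial>Gm N)"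
proof -
  let ?I = "{..<N} \<times> {..<N}" and ?J = "{..<N}"
  let ?e = "\<lambda>x i j. if i < N \<and> j < N then x (i, j) / sqrt (real N) else 0"
  let ?v = "\<lambda>x i. if i < N then x i else (0::real)"
  define u where "u j l = (if fst l = j then p (snd l) / sqrt (real N) else 0)" for j :: nat and l :: "nat \<times> nat"
  have N0: "real N > 0" "sqrt (real N) * sqrt (real N) = real N" using N by auto
  have pp: "(\<Sum>i<N. p i * p i) = real N" using p N0 by (simp add: ip_def)
  have on: "(\<Sum>l\<in>?I. u j l * u m l) = (if j = m then 1 else 0)" if "j \<in> ?J" "m \<in> ?J" for j m
  proof -
    have "(\<Sum>l\<in>?I. u j l * u m l) = (\<Sum>a<N. \<Sum>b<N. u j (a, b) * u m (a, b))"
      by (simp add: sum.cartesian_product)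
    also have "\<dots> = (\<Sum>a<N. if a = j then (if j = m then (\<Sum>b<N. p b * p b / real N) else 0) else 0)"
      by (rule sum.cong) (auto simp: u_def)
    also have "\<dots> = (if j = m then (\<Sum>b<N. p b * p b / real N) else 0)" using that by simp
    also have "(\<Sum>b<N. p b * p b / real N) = 1" using pp N0 by (simp add: sum_divide_distrib[symmetric])
    finally show ?thesis .
  qed
  have ux: "(\<Sum>l\<in>?I. u j l * x l) = (\<Sum>b<N. ?e x j b * p b)" if "j < N" for j and x :: "nat \<times> nat => real"
  proof -
    have "(\<Sum>l\<in>?I. u j l * x l) = (\<Sum>a<N. \<Sum>b<N. u j (a, b) * x (a, b))"
      by (simp add: sum.cartesian_product)
    also have "\<dots> = (\<Sum>a<N. if a = j then (\<Sum>b<N. p b / sqrt (real N) * x (j, b)) else 0)"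
      by (rule sum.cong) (auto simp: u_def)
    also have "\<dots> = (\<Sum>b<N. ?e x j b * p b)" using that by (simp add: mult.commute)
    finally show ?thesis .
  qed
  have e: "F (?e (\<lambda>i\<in>?I. x i + (\<Sum>j\<in>?J. (z j - (\<Sum>l\<in>?I. u j l * x l)) * u j i))) = F (rowrep N p (?v z) (?e x))" for x z
  proof (rule on_blockD[OF block], unfold meq_def, intro allI impI)
    fix i j assume ij: "i < N" "j < N"
    have "(\<Sum>m\<in>?J. (z m - (\<Sum>l\<in>?I. u m l * x l)) * u m (i, j)) = (\<Sum>m\<in>?J. if m = i then (z i - (\<Sum>l\<in>?I. u i l * x l)) * (p j / sqrt (real N)) else 0)"
      by (rule sum.cong) (auto simp: u_def)
    also have "\<dots> = (z i - (\<Sum>b<N. ?e x i b * p b)) * (p j / sqrt (real N))" using ij ux by simp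
    finally show "?e (\<lambda>i\<in>?I. x i + (\<Sum>j\<in>?J. (z j - (\<Sum>l\<in>?I. u j l * x l)) * u j i)) i j = rowrep N p (?v z) (?e x) i j"
      using ij N0 by (simp add: rowrep_def add_divide_distrib del: real_sqrt_mult_self)
  qed
  have Fe: "(\<lambda>x. F (?e x)) \<in> borel_measurable (PiM ?I (\<lambda>_. borel))"
    by (rule measurable_compose[OF Gm_emb F])
  have R: "(\<lambda>x. F (rowrep N p (snd x) (fst x))) \<in> borel_measurable (borel \<Otimes>\<^sub>M borel)"
    by (rule measurable_compose[OF _ F]) (intro borel_measurable_matr rowrep_measurable; simp add: matr_entry vect_entry)
  have R1: "(\<lambda>w. F (rowrep N p w A)) \<in> borel_measurable borel" for A
    using measurable_compose[OF measurable_Pair1' R, of A] by simp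
  have R2: "(\<lambda>A. \<integral>\<^sup>+w. F (rowrep N p w A) \<partial>Gv N) \<in> borel_measurable borel"
    by (rule Gv.borel_measurable_nn_integral) (use R in \<open>simp add: case_prod_beta' cong: measurable_cong_sets\<close>)
  have "(\<integral>\<^sup>+A. F A \<partial>Gm N) = (\<integral>\<^sup>+x. F (?e x) \<partial>gs ?I)"
    by (rule nn_integral_Gm) simp
  also have "\<dots> = (\<integral>\<^sup>+x. \<integral>\<^sup>+z. F (?e (\<lambda>i\<in>?I. x i + (\<Sum>j\<in>?J. (z j - (\<Sum>l\<in>?I. u j l * x l)) * u j i))) \<partial>gs ?J \<partial>gs ?I)"
    by (rule gs_resample_family[symmetric, OF _ _ on Fe]) auto
  also have "\<dots> = (\<integral>\<^sup>+x. \<integral>\<^sup>+w. F (rowrep N p w (?e x)) \<partial>Gv N \<partial>gs ?I)"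
    unfolding e by (simp only: nn_integral_Gv[OF R1])
  also have "\<dots> = (\<integral>\<^sup>+A. \<integral>\<^sup>+w. F (rowrep N p w A) \<partial>Gv N \<partial>Gm N)"
    by (rule nn_integral_Gm[symmetric, OF R2])
  finally show ?thesis .
qed

lemma Gm_resample_columns:
  assumes N: "N >= 1" and p: "ip N p p = 1"
    and F[measurable]: "F \<in> borel_measurable borel" and block: "on_block N F"
  shows "(\<integral>\<^sup>+A. F A \<partial>Gm N) = (\<integral>\<^sup>+A. \<integral>\<^sup>+w. F (colrep N p w A) \<partial>Gv N \<partial>Gm N)"
proof -
  let ?I = "{..<N} \<times> {..<N}" and ?J = "{..<N}"
  let ?e = "\<lambda>x i j. if i < N \<and> j < N then x (i, j) / sqrt (real N) else 0"
  let ?v = "\<lambda>x i. if i < N then x i else (0::real)"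
  define u where "u j l = (if snd l = j then p (fst l) / sqrt (real N) else 0)" for j :: nat and l :: "nat \<times> nat"
  have N0: "real N > 0" "sqrt (real N) * sqrt (real N) = real N" using N by auto
  have pp: "(\<Sum>i<N. p i * p i) = real N" using p N0 by (simp add: ip_def)
  have on: "(\<Sum>l\<in>?I. u j l * u m l) = (if j = m then 1 else 0)" if "j \<in> ?J" "m \<in> ?J" for j m
  proof -
    have "(\<Sum>l\<in>?I. u j l * u m l) = (\<Sum>a<N. \<Sum>b<N. u j (a, b) * u m (a, b))"
      by (simp add: sum.cartesian_product)
    also have "\<dots> = (\<Sum>b<N. \<Sum>a<N. u j (a, b) * u m (a, b))" by (rule sum.swap)
    also have "\<dots> = (\<Sum>a<N. if a = j then (if j = m then (\<Sum>b<N. p b * p b / real N) else 0) else 0)"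
      by (rule sum.cong) (auto simp: u_def)
    also have "\<dots> = (if j = m then (\<Sum>b<N. p b * p b / real N) else 0)" using that by simp
    also have "(\<Sum>b<N. p b * p b / real N) = 1" using pp N0 by (simp add: sum_divide_distrib[symmetric])
    finally show ?thesis .
  qed
  have ux: "(\<Sum>l\<in>?I. u j l * x l) = (\<Sum>a<N. p a * ?e x a j)" if "j < N" for j and x :: "nat \<times> nat => real"
  proof -
    have "(\<Sum>l\<in>?I. u j l * x l) = (\<Sum>a<N. \<Sum>b<N. u j (a, b) * x (a, b))"
      by (simp add: sum.cartesian_product)
    also have "\<dots> = (\<Sum>b<N. \<Sum>a<N. u j (a, b) * x (a, b))" by (rule sum.swap)
    also have "\<dots> = (\<Sum>b<N. if b = j then (\<Sum>a<N. p a / sqrt (real N) * x (a, j)) else 0)"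
      by (rule sum.cong) (auto simp: u_def)
    also have "\<dots> = (\<Sum>a<N. p a * ?e x a j)" using that by (simp add: mult.commute)
    finally show ?thesis .
  qed
  have e: "F (?e (\<lambda>i\<in>?I. x i + (\<Sum>j\<in>?J. (z j - (\<Sum>l\<in>?I. u j l * x l)) * u j i))) = F (colrep N p (?v z) (?e x))" for x z
  proof (rule on_blockD[OF block], unfold meq_def, intro allI impI)
    fix i j assume ij: "i < N" "j < N"
    have "(\<Sum>m\<in>?J. (z m - (\<Sum>l\<in>?I. u m l * x l)) * u m (i, j)) = (\<Sum>m\<in>?J. if m = j then (z j - (\<Sum>l\<in>?I. u j l * x l)) * (p i / sqrt (real N)) else 0)"
      by (rule sum.cong) (auto simp: u_def)
    also have "\<dots> = (z j - (\<Sum>a<N. p a * ?e x a j)) * (p i / sqrt (real N))" using ij ux by simp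
    finally show "?e (\<lambda>i\<in>?I. x i + (\<Sum>j\<in>?J. (z j - (\<Sum>l\<in>?I. u j l * x l)) * u j i)) i j = colrep N p (?v z) (?e x) i j"
      using ij N0 by (simp add: colrep_def add_divide_distrib del: real_sqrt_mult_self)
  qed
  have Fe: "(\<lambda>x. F (?e x)) \<in> borel_measurable (PiM ?I (\<lambda>_. borel))"
    by (rule measurable_compose[OF Gm_emb F])
  have R: "(\<lambda>x. F (colrep N p (snd x) (fst x))) \<in> borel_measurable (borel \<Otimes>\<^sub>M borel)"
    by (rule measurable_compose[OF _ F]) (intro borel_measurable_matr colrep_measurable; simp add: matr_entry vect_entry)
  have R1: "(\<lambda>w. F (colrep N p w A)) \<in> borel_measurable borel" for A
    using measurable_compose[OF measurable_Pair1' R, of A] by simp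
  have R2: "(\<lambda>A. \<integral>\<^sup>+w. F (colrep N p w A) \<partial>Gv N) \<in> borel_measurable borel"
    by (rule Gv.borel_measurable_nn_integral) (use R in \<open>simp add: case_prod_beta' cong: measurable_cong_sets\<close>)
  have "(\<integral>\<^sup>+A. F A \<partial>Gm N) = (\<integral>\<^sup>+x. F (?e x) \<partial>gs ?I)"
    by (rule nn_integral_Gm) simp
  also have "\<dots> = (\<integral>\<^sup>+x. \<integral>\<^sup>+z. F (?e (\<lambda>i\<in>?I. x i + (\<Sum>j\<in>?J. (z j - (\<Sum>l\<in>?I. u j l * x l)) * u j i))) \<partial>gs ?J \<partial>gs ?I)"
    by (rule gs_resample_family[symmetric, OF _ _ on Fe]) auto
  also have "\<dots> = (\<integral>\<^sup>+x. \<integral>\<^sup>+w. F (colrep N p w (?e x)) \<partial>Gv N \<partial>gs ?I)"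
    unfolding e by (simp only: nn_integral_Gv[OF R1])
  also have "\<dots> = (\<integral>\<^sup>+A. \<integral>\<^sup>+w. F (colrep N p w A) \<partial>Gv N \<partial>Gm N)"
    by (rule nn_integral_Gm[symmetric, OF R2])
  finally show ?thesis .
qed

text \<open>A matrix with \<open>refresh N p w v g p = w + (\<langle>v, p\<rangle> - \<langle>p, w\<rangle>) p\<close> and \<open>(refresh N p w v g)\<^sup>T p = v\<close>.\<close>
definition refresh :: "nat => vect => vect => vect => matr => matr" where
  "refresh N p w v g = (\<lambda>i j. deflate N p g i j + (tens N w p i j + tens N p v i j - ip N p w * tens N p p i j))"

lemma refresh_eq: "refresh N p w v g = colrep N p v (rowrep N p w g)"
proof (intro ext)
  fix i j
  have t: "(\<Sum>a<N. g a j * p a) = mult_mv N (transp_m g) p j" and t': "(\<Sum>b<N. g a b * p b) = mult_mv N g p a" for a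
    by (simp_all add: mult_mv_def transp_m_def)
  have "(\<Sum>a<N. p a * rowrep N p w g a j) = (\<Sum>a<N. g a j * p a) + (\<Sum>a<N. (p a * w a - p a * mult_mv N g p a) / real N * p j)"
    unfolding rowrep_def sum.distrib[symmetric] t' by (rule sum.cong) (simp_all add: algebra_simps)
  also have "\<dots> = mult_mv N (transp_m g) p j + (ip N p w - ip N p (mult_mv N g p)) * p j"
    unfolding sum_distrib_right[symmetric] sum_divide_distrib[symmetric] sum_subtractf t
    by (simp add: ip_def diff_divide_distrib)
  finally have S: "(\<Sum>a<N. p a * rowrep N p w g a j) = \<dots>" .
  show "refresh N p w v g i j = colrep N p v (rowrep N p w g) i j"
    unfolding colrep_def S unfolding rowrep_def t' refresh_def deflate_def tens_def
    by (simp add: algebra_simps add_divide_distrib diff_divide_distrib)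
qed

lemma refresh_measurable:
  assumes [measurable]: "\<And>i j. (\<lambda>x. g x i j) \<in> borel_measurable M" "\<And>i. (\<lambda>x. w x i) \<in> borel_measurable M"
    "\<And>i. (\<lambda>x. v x i) \<in> borel_measurable M" "\<And>i. (\<lambda>x. p x i) \<in> borel_measurable M"
  shows "(\<lambda>x. refresh N (p x) (w x) (v x) (g x) i j) \<in> borel_measurable M"
  unfolding refresh_def tens_def
  by (intro borel_measurable_diff borel_measurable_add borel_measurable_times borel_measurable_divide borel_measurable_const
      deflate_measurable ip_measurable assms)

lemma colrep_meq: "meq N A B ==> meq N (colrep N p w A) (colrep N p w B)"
  by (auto simp: meq_def colrep_def)

lemma refresh_zero: "(\<forall>i<N. p i = 0) ==> meq N (refresh N p w v g) g"
  by (auto simp: meq_def refresh_eq colrep_def rowrep_def)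

text \<open>For a unit p the image of p is replaced first and the image under the transposed matrix
  afterwards; the second replacement settles the entry that both share. For p = 0 the block is not
  changed at all.\<close>

lemma Gm_refresh:
  assumes N: "N >= 1" and p: "unit_or_zero N p"
    and F[measurable]: "F \<in> borel_measurable borel" and block: "on_block N F"
  shows "(\<integral>\<^sup>+A. F A \<partial>Gm N) = (\<integral>\<^sup>+A. \<integral>\<^sup>+w. \<integral>\<^sup>+v. F (refresh N p w v A) \<partial>Gv N \<partial>Gv N \<partial>Gm N)"
proof (cases "ip N p p = 1")
  case True
  define H where "H A = (\<integral>\<^sup>+v. F (colrep N p v A) \<partial>Gv N)" for A
  have R: "(\<lambda>x. F (colrep N p (snd x) (fst x))) \<in> borel_measurable (borel \<Otimes>\<^sub>M borel)"
    by (rule measurable_compose[OF _ F]) (intro borel_measurable_matr colrep_measurable; simp add: matr_entry vect_entry)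
  have H: "H \<in> borel_measurable borel"
    unfolding H_def by (rule Gv.borel_measurable_nn_integral) (use R in \<open>simp add: case_prod_beta' cong: measurable_cong_sets\<close>)
  have bH: "on_block N H"
    unfolding on_block_def H_def using on_blockD[OF block colrep_meq] by (auto intro!: nn_integral_cong)
  have "(\<integral>\<^sup>+A. F A \<partial>Gm N) = (\<integral>\<^sup>+A. H A \<partial>Gm N)"
    unfolding H_def by (rule Gm_resample_columns[OF N True F block])
  also have "\<dots> = (\<integral>\<^sup>+A. \<integral>\<^sup>+w. H (rowrep N p w A) \<partial>Gv N \<partial>Gm N)"
    by (rule Gm_resample_rows[OF N True H bH])
  finally show ?thesis unfolding H_def refresh_eq .
next
  case False
  then have "F (refresh N p w v A) = F A" for w v A
    using p refresh_zero by (intro on_blockD[OF block]) (auto simp: unit_or_zero_def)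
  then show ?thesis by simp
qed

lemma mult_mv_tens: "mult_mv N (tens N a b) x = (\<lambda>i. a i * ip N b x)"
  by (simp add: mult_mv_def tens_def ip_def sum_distrib_left sum_divide_distrib mult_ac)

lemma transp_tens: "transp_m (tens N a b) = tens N b a"
  by (simp add: transp_m_def tens_def mult.commute)

lemma mult_mv_scale: "mult_mv N (\<lambda>i j. c * g i j) x = (\<lambda>i. c * mult_mv N g x i)"
  by (simp add: mult_mv_def sum_distrib_left mult.assoc)

lemma transp_scale: "transp_m (\<lambda>i j. c * g i j) = (\<lambda>i j. c * transp_m g i j)"
  by (simp add: transp_m_def)

lemma refresh_mult:
  assumes p: "ip N p p = 1"
  shows "mult_mv N (refresh N p w v g) p = (\<lambda>i. w i + (ip N v p - ip N p w) * p i)"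
    "mult_mv N (transp_m (refresh N p w v g)) p = v"
proof -
  have u: "unit_or_zero N p" using p by (simp add: unit_or_zero_def)
  show "mult_mv N (refresh N p w v g) p = (\<lambda>i. w i + (ip N v p - ip N p w) * p i)"
    unfolding refresh_def mult_mv_linear mult_mv_scale mult_mv_tens deflate_kills[OF u] p by (simp add: algebra_simps)
  show "mult_mv N (transp_m (refresh N p w v g)) p = v"
    unfolding refresh_def transp_linear transp_scale mult_mv_linear mult_mv_scale transp_tens mult_mv_tens transp_deflate deflate_kills[OF u] p
    by (simp add: ip_commute)
qed

text \<open>Refreshing alters only what p sees, so the part projected away from p still belongs to
  the old matrix. This is the independence exploited in \<open>Gm_redraw\<close>.\<close>

lemma deflate_refresh:
  assumes p: "ip N p p = 1" shows "deflate N p (refresh N p w v g) = deflate N p g"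
proof (intro ext)
  fix i j
  have "ip N p (\<lambda>i. w i + (ip N v p - ip N p w) * p i) = ip N v p"
    unfolding ip_linear p by simp
  then show "deflate N p (refresh N p w v g) i j = deflate N p g i j"
    unfolding deflate_def[of N p "refresh N p w v g"] refresh_mult[OF p]
    by (simp add: refresh_def tens_def algebra_simps add_divide_distrib diff_divide_distrib)
qed

text \<open>In the representation of \<open>Gm_refresh\<close> the part of the matrix seen by p is a
  function of w and v, and the part projected away from p is a function of the old matrix. The two
  are independent, so the latter may come from an independent copy.\<close>

lemma Gm_redraw:
  assumes N: "N >= 1" and p: "unit_or_zero N p"
    and F[measurable]: "F \<in> borel_measurable borel" and block: "on_block N F"
  shows "(\<integral>\<^sup>+g. \<integral>\<^sup>+g'. F (\<lambda>i j. g i j - deflate N p g i j + deflate N p g' i j) \<partial>Gm N \<partial>Gm N) = (\<integral>\<^sup>+g. F g \<partial>Gm N)"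
proof -
  define H where "H g = (\<integral>\<^sup>+g'. F (\<lambda>i j. g i j - deflate N p g i j + deflate N p g' i j) \<partial>Gm N)" for g
  have H: "H \<in> borel_measurable borel"
  proof -
    have "(\<lambda>x. F (\<lambda>i j. fst x i j - deflate N p (fst x) i j + deflate N p (snd x) i j)) \<in> borel_measurable (borel \<Otimes>\<^sub>M borel)"
      by (rule measurable_compose[OF _ F])
         (intro borel_measurable_matr borel_measurable_add borel_measurable_diff deflate_measurable; simp add: matr_entry)
    then show ?thesis unfolding H_def
      by (intro Gm.borel_measurable_nn_integral) (simp add: case_prod_beta' cong: measurable_cong_sets)
  qed
  have bH: "on_block N H"
    unfolding on_block_def
  proof (intro allI impI)
    fix A B assume AB: "meq N A B"
    show "H A = H B" unfolding H_def
    proof (intro nn_integral_cong on_blockD[OF block])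
      fix g' show "meq N (\<lambda>i j. A i j - deflate N p A i j + deflate N p g' i j) (\<lambda>i j. B i j - deflate N p B i j + deflate N p g' i j)"
        using deflate_meq[OF AB veq_refl, of p] AB by (simp add: meq_def)
    qed
  qed
  \<comment> \<open>The old matrix g no longer appears on the right, because its projected part is
    exchanged for that of g'. Integration over g is then trivial, and Fubini restores the order of
    integration.\<close>
  have H0: "H (refresh N p w v g) = (\<integral>\<^sup>+g'. F (refresh N p w v g') \<partial>Gm N)" for w v g
    unfolding H_def
  proof (intro nn_integral_cong on_blockD[OF block])
    fix g'
    show "meq N (\<lambda>i j. refresh N p w v g i j - deflate N p (refresh N p w v g) i j + deflate N p g' i j) (refresh N p w v g')"
    proof (cases "ip N p p = 1")
      case True
      show ?thesis unfolding deflate_refresh[OF True] by (simp add: refresh_def meq_def)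
    next
      case False
      then have z: "\<forall>i<N. p i = 0" using p by (auto simp: unit_or_zero_def)
      have "meq N (deflate N p Y) Y" for Y using z by (auto simp: meq_def deflate_def tens_def)
      then show ?thesis using refresh_zero[OF z] by (simp add: meq_def)
    qed
  qed
  have R: "(\<lambda>x. F (refresh N p (f x) (f' x) (g x))) \<in> borel_measurable M"
    if "f \<in> borel_measurable M" "f' \<in> borel_measurable M" "g \<in> borel_measurable M" for f f' g and M :: "'z measure"
  proof (rule measurable_compose[OF _ F], rule borel_measurable_matr, rule refresh_measurable)
    show "(\<lambda>x. g x i j) \<in> borel_measurable M" for i j by (rule matr_entry[OF that(3)])
    show "(\<lambda>x. f x i) \<in> borel_measurable M" for i by (rule vect_entry[OF that(1)])
    show "(\<lambda>x. f' x i) \<in> borel_measurable M" for i by (rule vect_entry[OF that(2)])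
  qed simp
  have K1: "(\<lambda>x. F (refresh N p (fst (fst x)) (snd (fst x)) (snd x))) \<in> borel_measurable ((Gv N \<Otimes>\<^sub>M Gv N) \<Otimes>\<^sub>M Gm N)"
    by (rule R) measurable
  have K2: "(\<lambda>x. \<integral>\<^sup>+g. F (refresh N p (fst x) (snd x) g) \<partial>Gm N) \<in> borel_measurable (Gv N \<Otimes>\<^sub>M Gv N)"
    by (rule Gm.borel_measurable_nn_integral) (use K1 in \<open>simp only: case_prod_beta'\<close>)
  have "(\<integral>\<^sup>+g. H g \<partial>Gm N) = (\<integral>\<^sup>+A. \<integral>\<^sup>+w. \<integral>\<^sup>+v. H (refresh N p w v A) \<partial>Gv N \<partial>Gv N \<partial>Gm N)"
    by (rule Gm_refresh[OF N p H bH])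
  also have "\<dots> = (\<integral>\<^sup>+w. \<integral>\<^sup>+v. \<integral>\<^sup>+g. F (refresh N p w v g) \<partial>Gm N \<partial>Gv N \<partial>Gv N)"
    unfolding H0 by simp
  also have "\<dots> = (\<integral>\<^sup>+x. \<integral>\<^sup>+g. F (refresh N p (fst x) (snd x) g) \<partial>Gm N \<partial>(Gv N \<Otimes>\<^sub>M Gv N))"
    using Gv.nn_integral_fst[OF K2] by simp
  also have "\<dots> = (\<integral>\<^sup>+g. \<integral>\<^sup>+x. F (refresh N p (fst x) (snd x) g) \<partial>(Gv N \<Otimes>\<^sub>M Gv N) \<partial>Gm N)"
  proof (rule nn_integral_swap)
    interpret P: pair_prob_space "Gv N" "Gv N" ..
    show "sigma_finite_measure (Gv N \<Otimes>\<^sub>M Gv N)" "sigma_finite_measure (Gm N)"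
      by (intro Gm.sigma_finite_measure_axioms P.P.sigma_finite_measure_axioms)+
    show "(\<lambda>(x, g). F (refresh N p (fst x) (snd x) g)) \<in> borel_measurable ((Gv N \<Otimes>\<^sub>M Gv N) \<Otimes>\<^sub>M Gm N)"
      unfolding case_prod_beta' by (rule K1)
  qed
  also have "\<dots> = (\<integral>\<^sup>+A. \<integral>\<^sup>+w. \<integral>\<^sup>+v. F (refresh N p w v A) \<partial>Gv N \<partial>Gv N \<partial>Gm N)"
  proof (rule nn_integral_cong)
    fix g
    have "(\<lambda>x. F (refresh N p (fst x) (snd x) g)) \<in> borel_measurable (Gv N \<Otimes>\<^sub>M Gv N)"
      by (rule R) measurable
    from Gv.nn_integral_fst[OF this] show "(\<integral>\<^sup>+x. F (refresh N p (fst x) (snd x) g) \<partial>(Gv N \<Otimes>\<^sub>M Gv N)) = (\<integral>\<^sup>+w. \<integral>\<^sup>+v. F (refresh N p w v g) \<partial>Gv N \<partial>Gv N)"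
      by simp
  qed
  also have "\<dots> = (\<integral>\<^sup>+g. F g \<partial>Gm N)"
    by (rule Gm_refresh[OF N p F block, symmetric])
  finally show ?thesis unfolding H_def .
qed

lemma resample_block: "on_block N F ==> on_block N (\<lambda>g. F (resample \<beta> h N k A g))"
  unfolding on_block_def using resample_meq[OF meq_refl] by blast

lemma resample_measurable2:
  assumes F: "F \<in> borel_measurable borel"
  shows "(\<lambda>x. F (resample \<beta> h N k (fst x) (snd x))) \<in> borel_measurable (borel \<Otimes>\<^sub>M borel)"
  by (intro measurable_compose[OF resample_measurable F]) simp_all

text \<open>The induction hypothesis is used in both directions. It introduces an inner resampling
  at level k; for fixed \<open>A\<close>, \<open>resample_step\<close> and \<open>Gm_redraw\<close>
  then remove the resampling at level k + 1; finally it removes level k.\<close>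

lemma Gm_resample:
  assumes N: "N >= 1" and "F \<in> borel_measurable borel" "on_block N F"
  shows "(\<integral>\<^sup>+A. F A \<partial>Gm N) = (\<integral>\<^sup>+A. \<integral>\<^sup>+g. F (resample \<beta> h N k A g) \<partial>Gm N \<partial>Gm N)"
  using assms(2,3)
proof (induction k arbitrary: F)
  case 0
  then show ?case by (simp add: resample_def)
next
  case (Suc k)
  note F = Suc.prems(1) and block = Suc.prems(2)
  let ?R = "resample \<beta> h N"
  define H where "H A = (\<integral>\<^sup>+g. F (?R (Suc k) A g) \<partial>Gm N)" for A
  have H: "H \<in> borel_measurable borel"
    unfolding H_def by (rule Gm.borel_measurable_nn_integral)
      (use resample_measurable2[OF F] in \<open>simp add: case_prod_beta' cong: measurable_cong_sets\<close>)
  have bH: "on_block N H"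
    unfolding on_block_def H_def by (intro allI impI nn_integral_cong on_blockD[OF block] resample_meq) simp_all
  have "(\<integral>\<^sup>+A. H A \<partial>Gm N) = (\<integral>\<^sup>+A. \<integral>\<^sup>+g. H (?R k A g) \<partial>Gm N \<partial>Gm N)"
    by (rule Suc.IH[OF H bH])
  also have "\<dots> = (\<integral>\<^sup>+A. \<integral>\<^sup>+g. F (?R k A g) \<partial>Gm N \<partial>Gm N)"
  proof (rule nn_integral_cong)
    fix A
    have "(\<lambda>g. F (?R k A g)) \<in> borel_measurable borel"
      by (intro measurable_compose[OF resample_measurable F]) simp_all
    from Gm_redraw[OF N it_phi_unit_or_zero[OF N] this resample_block[OF block], of "Suc k" \<beta> h A]
    show "(\<integral>\<^sup>+g. H (?R k A g) \<partial>Gm N) = (\<integral>\<^sup>+g. F (?R k A g) \<partial>Gm N)"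
      unfolding H_def resample_step[OF N] by simp
  qed
  also have "\<dots> = (\<integral>\<^sup>+A. F A \<partial>Gm N)" by (rule Suc.IH[OF F block, symmetric])
  finally show ?case unfolding H_def ..
qed

text \<open>The fresh matrix is itself refreshed along phi^(k+1). Conditionally on the first k steps
  this makes xi^(k+1) and eta^(k+1) explicit functions of the independent vectors w and v.\<close>

lemma Gm_resample_refresh:
  assumes N: "N >= 1" and F: "F \<in> borel_measurable borel" and block: "on_block N F"
  shows "(\<integral>\<^sup>+A. F A \<partial>Gm N) = (\<integral>\<^sup>+A. \<integral>\<^sup>+g. \<integral>\<^sup>+w. \<integral>\<^sup>+v. F (resample \<beta> h N k A (refresh N (it_phi \<beta> h N A (Suc k)) w v g)) \<partial>Gv N \<partial>Gv N \<partial>Gm N \<partial>Gm N)"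
  unfolding Gm_resample[OF N F block, of \<beta> h k]
  by (intro nn_integral_cong Gm_refresh[OF N it_phi_unit_or_zero[OF N] _ resample_block[OF block]]
      measurable_compose[OF resample_measurable F]) simp_all

section \<open>The conditional expectation of the partition function\<close>

definition Wexp :: "real => real => nat => nat => matr => vect => real" where
  "Wexp \<beta> h N k A \<sigma> = real N * (\<beta> * (\<Sum>s=1..k. ip N \<sigma> (it_phi \<beta> h N A s) * ip N \<sigma> (it_zeta \<beta> h N A s))
     - \<beta> / sqrt 2 * (\<Sum>s=1..k. ip N (it_phi \<beta> h N A s) (it_xi \<beta> h N A s) * (ip N \<sigma> (it_phi \<beta> h N A s))\<^sup>2)
     + \<beta>\<^sup>2 / 4 * (1 - (\<Sum>s=1..k. (ip N \<sigma> (it_phi \<beta> h N A s))\<^sup>2))\<^sup>2) + h * (\<Sum>i<N. \<sigma> i)"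

text \<open>In the exponent \<open>Wexp\<close> the first two sums are the revealed part of the
  quadratic form. The term with beta^2 / 4 is the logarithmic moment generating function of the
  unrevealed part, whose variance is N times the square of the squared norm of sigma off phi^(1),
  ..., phi^(k).\<close>

definition Wpart :: "real => real => nat => nat => matr => real" where
  "Wpart \<beta> h N k A = (\<Sum>\<sigma>\<in>{..<N} \<rightarrow>\<^sub>E {-1, 1}. exp (Wexp \<beta> h N k A \<sigma>)) / 2 ^ N"

definition qform :: "nat => matr => vect => real" where
  "qform N g x = (\<Sum>i<N. \<Sum>j<N. g i j * x i * x j)"

lemma qform_eq: "qform N g x = real N * ip N x (mult_mv N g x)"
proof -
  have "qform N g x = (\<Sum>i<N. x i * mult_mv N g x i)"
    by (simp add: qform_def mult_mv_def sum_distrib_left mult_ac)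
  then show ?thesis by (cases "N = 0") (simp_all add: ip_def)
qed

lemma qform_linear:
  "qform N (\<lambda>i j. g i j + g' i j) x = qform N g x + qform N g' x"
  "qform N (\<lambda>i j. g i j - g' i j) x = qform N g x - qform N g' x"
  "qform N (\<lambda>i j. c * g i j) x = c * qform N g x"
  by (simp_all add: qform_def distrib_right left_diff_distrib sum.distrib sum_subtractf sum_distrib_left mult.assoc)

lemma qform_tens: "qform N (tens N a b) x = real N * (ip N x a * ip N x b)"
  unfolding qform_eq mult_mv_tens ip_linear by (simp add: ip_commute mult.commute)

lemma mult_mv_vlinear:
  "mult_mv N g (\<lambda>i. x i - c * y i) i = mult_mv N g x i - c * mult_mv N g y i"
  by (simp add: mult_mv_def right_diff_distrib sum_subtractf sum_distrib_left mult_ac)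

lemma qform_deflate: "qform N (deflate N p g) x = qform N g (\<lambda>i. x i - ip N p x * p i)"
proof -
  have a: "ip N p (mult_mv N (transp_m g) x) = ip N x (mult_mv N g p)"
    using ip_adjoint[of N g x p] by (simp add: ip_commute)
  have "qform N (deflate N p g) x = real N * (ip N x (mult_mv N g x) - ip N x (mult_mv N g p) * ip N p x
      - ip N x p * ip N p (mult_mv N g x) + ip N p (mult_mv N g p) * ip N x p * ip N p x)"
  proof -
    have "mult_mv N (deflate N p g) x = (\<lambda>i. mult_mv N g x i - ip N p x * mult_mv N g p i
       - ip N p (mult_mv N g x) * p i + (ip N p (mult_mv N g p) * ip N p x) * p i)"
      by (intro ext) (simp add: mult_mv_deflate algebra_simps)
    then show ?thesis unfolding qform_eq ip_linear by (simp add: ip_linear algebra_simps)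
  qed
  also have "\<dots> = qform N g (\<lambda>i. x i - ip N p x * p i)"
  proof -
    have "mult_mv N g (\<lambda>i. x i - ip N p x * p i) = (\<lambda>i. mult_mv N g x i - ip N p x * mult_mv N g p i)"
      by (intro ext mult_mv_vlinear)
    then show ?thesis unfolding qform_eq by (simp add: ip_linear ip_commute[of N x p] algebra_simps)
  qed
  finally show ?thesis .
qed

text \<open>y is the projection of x away from the directions, built one
  \<open>qform_deflate\<close> at a time. Only its norm is recorded, because the moment generating
  function in \<open>Gm_mgf\<close> depends on nothing else.\<close>

lemma qform_deflates:
  assumes N: "N >= 1"
  shows "\<exists>y. (\<forall>g. qform N (deflates \<beta> h N k A g) x = qform N g y) \<and>
     ip N y y = ip N x x - (\<Sum>s=1..k. (ip N x (it_phi \<beta> h N A s))\<^sup>2)"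
proof (induction k arbitrary: x)
  case 0
  show ?case by (intro exI[of _ x]) simp
next
  case (Suc k)
  let ?P = "it_phi \<beta> h N A"
  let ?p = "?P (Suc k)"
  define x' where "x' = (\<lambda>i. x i - ip N ?p x * ?p i)"
  obtain y where y: "\<And>g. qform N (deflates \<beta> h N k A g) x' = qform N g y"
    "ip N y y = ip N x' x' - (\<Sum>s=1..k. (ip N x' (?P s))\<^sup>2)" using Suc[of x'] by blast
  have "ip N x' (?P s) = ip N x (?P s)" if "s \<in> {1..k}" for s
    unfolding x'_def ip_linear using it_phi_orthogonal[OF N, of "Suc k" s] that by auto
  then have "(\<Sum>s=1..k. (ip N x' (?P s))\<^sup>2) = (\<Sum>s=1..k. (ip N x (?P s))\<^sup>2)" by simp
  moreover have "ip N x' x' = ip N x x - (ip N x ?p)\<^sup>2"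
  proof -
    have "ip N x' x' = ip N x x - 2 * (ip N x ?p)\<^sup>2 + (ip N x ?p * (ip N x ?p * ip N ?p ?p))"
      unfolding x'_def ip_linear by (simp add: ip_commute[of N ?p x] power2_eq_square algebra_simps)
    then show ?thesis
      using unit_or_zero_mult[OF it_phi_unit_or_zero[OF N], of "Suc k" x] by (simp add: power2_eq_square)
  qed
  ultimately have "ip N y y = ip N x x - (\<Sum>s=1..Suc k. (ip N x (?P s))\<^sup>2)" using y(2) by simp
  moreover have "\<forall>g. qform N (deflates \<beta> h N (Suc k) A g) x = qform N g y"
    using y(1) by (simp add: qform_deflate x'_def)
  ultimately show ?case by blast
qed

text \<open>Telescoping: the step from g^(s) to g^(s+1) removes three rank-one terms, and the two
  that involve xi and eta combine to sqrt 2 times zeta.\<close>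

lemma qform_revealed:
  "qform N A x - qform N (deflates \<beta> h N k A A) x = real N * (\<Sum>s=1..k.
      sqrt 2 * ip N x (it_phi \<beta> h N A s) * ip N x (it_zeta \<beta> h N A s) - ip N (it_phi \<beta> h N A s) (it_xi \<beta> h N A s) * (ip N x (it_phi \<beta> h N A s))\<^sup>2)"
proof (induction k)
  case (Suc k)
  let ?g = "deflates \<beta> h N k A A" and ?p = "it_phi \<beta> h N A (Suc k)"
  have xe: "it_xi \<beta> h N A (Suc k) = mult_mv N ?g ?p" "it_eta \<beta> h N A (Suc k) = mult_mv N (transp_m ?g) ?p"
    by (simp_all add: it_xi.simps it_eta.simps it_g_eq_deflates)
  have "qform N ?g x - qform N (deflate N ?p ?g) x = real N * (ip N x (mult_mv N ?g ?p) * ip N x ?p + ip N x ?p * ip N x (mult_mv N (transp_m ?g) ?p)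
     - ip N ?p (mult_mv N ?g ?p) * (ip N x ?p * ip N x ?p))"
    unfolding deflate_def qform_linear qform_tens by (simp add: algebra_simps)
  also have "ip N x (mult_mv N ?g ?p) * ip N x ?p + ip N x ?p * ip N x (mult_mv N (transp_m ?g) ?p) = sqrt 2 * ip N x ?p * ip N x (it_zeta \<beta> h N A (Suc k))"
    unfolding it_zeta.simps xe ip_linear by (simp add: field_simps)
  finally have "qform N ?g x - qform N (deflate N ?p ?g) x = real N * (sqrt 2 * ip N x ?p * ip N x (it_zeta \<beta> h N A (Suc k)) - ip N ?p (it_xi \<beta> h N A (Suc k)) * (ip N x ?p)\<^sup>2)"
    unfolding xe by (simp add: power2_eq_square)
  then show ?case using Suc by (simp add: algebra_simps)
qed simp

text \<open>A product over the N^2 independent entries of variance 1/N; the variances add up to the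
  sum over i, j of x_i^2 x_j^2 / N.\<close>

lemma Gm_mgf:
  assumes N: "N >= 1"
  shows "(\<integral>\<^sup>+g. ennreal (exp (c * qform N g x)) \<partial>Gm N) = ennreal (exp (c\<^sup>2 / 2 * (real N * (ip N x x)\<^sup>2)))"
proof -
  let ?I = "{..<N} \<times> {..<N}"
  let ?t = "\<lambda>(i, j). c * x i * x j / sqrt (real N)"
  have [measurable]: "(\<lambda>g::matr. g i j) \<in> borel_measurable borel" for i j by (rule matr_entry) simp
  have "(\<integral>\<^sup>+g. ennreal (exp (c * qform N g x)) \<partial>Gm N)
     = (\<integral>\<^sup>+y. ennreal (exp (c * qform N (\<lambda>i j. if i < N \<and> j < N then y (i, j) / sqrt (real N) else 0) x)) \<partial>gs ?I)"
    by (rule nn_integral_Gm) (simp add: qform_def)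
  also have "\<dots> = (\<integral>\<^sup>+y. (\<Prod>l\<in>?I. ennreal (exp (?t l * y l))) \<partial>gs ?I)"
  proof (rule nn_integral_cong)
    fix y :: "nat \<times> nat => real"
    have "c * qform N (\<lambda>i j. if i < N \<and> j < N then y (i, j) / sqrt (real N) else 0) x = (\<Sum>i<N. \<Sum>j<N. ?t (i, j) * y (i, j))"
      unfolding qform_def sum_distrib_left by (intro sum.cong) auto
    also have "\<dots> = (\<Sum>l\<in>?I. ?t l * y l)" by (simp add: sum.cartesian_product case_prod_beta')
    finally show "ennreal (exp (c * qform N (\<lambda>i j. if i < N \<and> j < N then y (i, j) / sqrt (real N) else 0) x)) = (\<Prod>l\<in>?I. ennreal (exp (?t l * y l)))"
      by (simp add: exp_sum prod_ennreal)
  qed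
  also have "\<dots> = (\<Prod>l\<in>?I. \<integral>\<^sup>+y. ennreal (exp (?t l * y)) \<partial>sn)"
    by (rule GS.product_nn_integral_prod) auto
  also have "\<dots> = ennreal (exp (\<Sum>l\<in>?I. (?t l)\<^sup>2 / 2))"
    unfolding sn_mgf by (simp add: exp_sum prod_ennreal)
  also have "(\<Sum>l\<in>?I. (?t l)\<^sup>2 / 2) = (\<Sum>i<N. \<Sum>j<N. c\<^sup>2 / (2 * real N) * ((x i * x i) * (x j * x j)))"
    by (simp add: sum.cartesian_product case_prod_beta' power_divide power_mult_distrib power2_eq_square mult_ac)
  also have "\<dots> = c\<^sup>2 / (2 * real N) * ((\<Sum>i<N. x i * x i) * (\<Sum>j<N. x j * x j))"
  proof -
    have "(\<Sum>i<N. x i * x i) * (\<Sum>j<N. x j * x j) = (\<Sum>i<N. \<Sum>j<N. (x i * x i) * (x j * x j))"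
      by (rule sum_product)
    then show ?thesis by (simp only: sum_distrib_left)
  qed
  also have "\<dots> = c\<^sup>2 / 2 * (real N * (ip N x x)\<^sup>2)"
    using N by (simp add: ip_def power2_eq_square)
  finally show ?thesis .
qed

lemma partition_fn_eq: "partition_fn \<beta> h N A = (\<Sum>\<sigma>\<in>{..<N} \<rightarrow>\<^sub>E {-1, 1}. exp (\<beta> / sqrt 2 * qform N A \<sigma> + h * (\<Sum>i<N. \<sigma> i))) / 2 ^ N"
  by (simp add: partition_fn_def qform_def)

lemma spin_norm: "N >= 1 ==> \<sigma> \<in> {..<N} \<rightarrow>\<^sub>E {-1, 1} ==> ip N \<sigma> \<sigma> = 1"
proof -
  assume N: "N >= 1" and s: "\<sigma> \<in> {..<N} \<rightarrow>\<^sub>E {-1, 1::real}"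
  have "(\<Sum>i<N. \<sigma> i * \<sigma> i) = (\<Sum>i<N. 1)"
  proof (rule sum.cong)
    fix i assume "i \<in> {..<N}"
    then have "\<sigma> i \<in> {-1, 1}" using s by (auto simp: PiE_def Pi_def)
    then show "\<sigma> i * \<sigma> i = 1" by auto
  qed simp
  then show "ip N \<sigma> \<sigma> = 1" using N by (simp add: ip_def)
qed

text \<open>For fixed \<open>A\<close> only the quadratic form of the projected fresh matrix is
  random. For a spin vector, of norm 1, its exponential moment follows from
  \<open>qform_deflates\<close> and \<open>Gm_mgf\<close>.\<close>

lemma partition_fn_resample:
  assumes N: "N >= 1"
  shows "(\<integral>\<^sup>+g. ennreal (partition_fn \<beta> h N (resample \<beta> h N k A g)) \<partial>Gm N) = ennreal (Wpart \<beta> h N k A)"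
proof -
  let ?S = "{..<N} \<rightarrow>\<^sub>E {-1, 1::real}"
  let ?d = "deflates \<beta> h N k A"
  define c where "c \<sigma> = \<beta> / sqrt 2 * (qform N A \<sigma> - qform N (?d A) \<sigma>) + h * (\<Sum>i<N. \<sigma> i)" for \<sigma>
  have [measurable]: "(\<lambda>g::matr. g i j) \<in> borel_measurable borel" for i j by (rule matr_entry) simp
  have fS: "finite ?S" by (intro finite_PiE) auto
  have Z: "ennreal (partition_fn \<beta> h N (resample \<beta> h N k A g)) = (\<Sum>\<sigma>\<in>?S. ennreal (exp (c \<sigma>) / 2 ^ N) * ennreal (exp (\<beta> / sqrt 2 * qform N (?d g) \<sigma>)))" for g
  proof -
    have q: "qform N (resample \<beta> h N k A g) \<sigma> = qform N A \<sigma> - qform N (?d A) \<sigma> + qform N (?d g) \<sigma>" for \<sigma>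
      unfolding resample_def deflates_linear qform_linear by simp
    have e: "exp (\<beta> / sqrt 2 * qform N (resample \<beta> h N k A g) \<sigma> + h * (\<Sum>i<N. \<sigma> i)) = exp (c \<sigma>) * exp (\<beta> / sqrt 2 * qform N (?d g) \<sigma>)" for \<sigma>
      unfolding q c_def exp_add[symmetric] by (simp only: algebra_simps)
    have "ennreal (partition_fn \<beta> h N (resample \<beta> h N k A g)) = ennreal (\<Sum>\<sigma>\<in>?S. exp (c \<sigma>) / 2 ^ N * exp (\<beta> / sqrt 2 * qform N (?d g) \<sigma>))"
      unfolding partition_fn_eq e sum_divide_distrib by simp
    also have "\<dots> = (\<Sum>\<sigma>\<in>?S. ennreal (exp (c \<sigma>) / 2 ^ N * exp (\<beta> / sqrt 2 * qform N (?d g) \<sigma>)))"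
      by (rule sum_ennreal[symmetric]) simp
    also have "\<dots> = (\<Sum>\<sigma>\<in>?S. ennreal (exp (c \<sigma>) / 2 ^ N) * ennreal (exp (\<beta> / sqrt 2 * qform N (?d g) \<sigma>)))"
      by (intro sum.cong refl ennreal_mult) simp_all
    finally show ?thesis .
  qed
  have md: "(\<lambda>g. qform N (?d g) \<sigma>) \<in> borel_measurable borel" for \<sigma>
    unfolding qform_def
    by (intro borel_measurable_sum borel_measurable_times borel_measurable_const deflates_measurable) simp_all
  have I: "(\<integral>\<^sup>+g. ennreal (exp (\<beta> / sqrt 2 * qform N (?d g) \<sigma>)) \<partial>Gm N)
     = ennreal (exp (\<beta>\<^sup>2 / 4 * (real N * (1 - (\<Sum>s=1..k. (ip N \<sigma> (it_phi \<beta> h N A s))\<^sup>2))\<^sup>2)))" if \<sigma>: "\<sigma> \<in> ?S" for \<sigma>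
  proof -
    obtain y where y: "\<And>g. qform N (?d g) \<sigma> = qform N g y" "ip N y y = ip N \<sigma> \<sigma> - (\<Sum>s=1..k. (ip N \<sigma> (it_phi \<beta> h N A s))\<^sup>2)"
      using qform_deflates[OF N, of \<beta> h k A \<sigma>] by blast
    show ?thesis unfolding y(1) Gm_mgf[OF N] y(2) spin_norm[OF N \<sigma>] by (simp add: power_divide)
  qed
  have "(\<integral>\<^sup>+g. ennreal (partition_fn \<beta> h N (resample \<beta> h N k A g)) \<partial>Gm N)
     = (\<Sum>\<sigma>\<in>?S. ennreal (exp (c \<sigma>) / 2 ^ N) * (\<integral>\<^sup>+g. ennreal (exp (\<beta> / sqrt 2 * qform N (?d g) \<sigma>)) \<partial>Gm N))"
    unfolding Z
    by (subst nn_integral_sum) (use md in \<open>auto intro!: sum.cong nn_integral_cmult cong: measurable_cong_sets\<close>)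
  also have "\<dots> = (\<Sum>\<sigma>\<in>?S. ennreal (exp (Wexp \<beta> h N k A \<sigma>) / 2 ^ N))"
  proof (rule sum.cong[OF refl])
    fix \<sigma> assume \<sigma>: "\<sigma> \<in> ?S"
    have "c \<sigma> + \<beta>\<^sup>2 / 4 * (real N * (1 - (\<Sum>s=1..k. (ip N \<sigma> (it_phi \<beta> h N A s))\<^sup>2))\<^sup>2) = Wexp \<beta> h N k A \<sigma>"
      unfolding c_def qform_revealed Wexp_def sum_subtractf mult.assoc sum_distrib_left[symmetric] by (simp add: field_simps)
    then have "exp (c \<sigma>) * exp (\<beta>\<^sup>2 / 4 * (real N * (1 - (\<Sum>s=1..k. (ip N \<sigma> (it_phi \<beta> h N A s))\<^sup>2))\<^sup>2)) = exp (Wexp \<beta> h N k A \<sigma>)"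
      by (simp only: exp_add[symmetric])
    then show "ennreal (exp (c \<sigma>) / 2 ^ N) * (\<integral>\<^sup>+g. ennreal (exp (\<beta> / sqrt 2 * qform N (?d g) \<sigma>)) \<partial>Gm N) = ennreal (exp (Wexp \<beta> h N k A \<sigma>) / 2 ^ N)"
      unfolding I[OF \<sigma>] by (subst ennreal_mult[symmetric]) (simp_all add: mult.commute)
  qed
  also have "\<dots> = ennreal (Wpart \<beta> h N k A)"
    unfolding Wpart_def sum_divide_distrib by (rule sum_ennreal) simp
  finally show ?thesis .
qed

text \<open>Stated from the measurability of xi and eta on the sites alone, so that it yields
  measurability with respect to G_k as well as Borel measurability.\<close>

lemma Wpart_measurable:
  assumes xi: "\<And>t i. i < N ==> 1 <= t ==> t <= k ==> (\<lambda>x. it_xi \<beta> h N (g x) t i) \<in> borel_measurable M"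
    and eta: "\<And>t i. i < N ==> 1 <= t ==> t <= k ==> (\<lambda>x. it_eta \<beta> h N (g x) t i) \<in> borel_measurable M"
  shows "(\<lambda>x. Wpart \<beta> h N k (g x)) \<in> borel_measurable M"
proof -
  have p: "(\<lambda>x. it_phi \<beta> h N (g x) t i) \<in> borel_measurable M" if "t \<in> {1..k}" "i < N" for t i
    by (rule it_phi_measurable[where k=k and S="{..<N}"]) (use that xi eta in auto)
  have z: "(\<lambda>x. it_zeta \<beta> h N (g x) t i) \<in> borel_measurable M" if "t \<in> {1..k}" "i < N" for t i
    unfolding it_zeta.simps by (intro borel_measurable_divide borel_measurable_add borel_measurable_const xi eta) (use that in auto)
  show ?thesis unfolding Wpart_def Wexp_def
    by (intro borel_measurable_divide borel_measurable_sum borel_measurable_const measurable_compose[OF _ borel_measurable_exp]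
       borel_measurable_add borel_measurable_times borel_measurable_diff borel_measurable_power ip_measurable p z)
      (use xi in auto)
qed

lemma Wpart_block: "on_block N (Wpart \<beta> h N k)"
  unfolding on_block_def
proof (intro allI impI)
  fix A B assume AB: "meq N A B"
  have e: "veq N (it_phi \<beta> h N A s) (it_phi \<beta> h N B s)" "veq N (it_xi \<beta> h N A s) (it_xi \<beta> h N B s)"
    "veq N (it_zeta \<beta> h N A s) (it_zeta \<beta> h N B s)" for s
    using it_veq[OF AB, of \<beta> h s] by (auto simp: it_zeta.simps veq_def)
  show "Wpart \<beta> h N k A = Wpart \<beta> h N k B"
    unfolding Wpart_def Wexp_def ip_veq[OF veq_refl e(1)] ip_veq[OF veq_refl e(3)] ip_veq[OF e(1) e(2)] ..
qed

lemma partition_fn_block: "on_block N (partition_fn \<beta> h N)"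
  unfolding on_block_def partition_fn_def meq_def by (auto intro!: sum.cong arg_cong[of _ _ exp])

lemma partition_fn_measurable: "partition_fn \<beta> h N \<in> borel_measurable borel"
proof -
  have [measurable]: "(\<lambda>g::matr. g i j) \<in> borel_measurable borel" for i j by (rule matr_entry) simp
  show ?thesis unfolding partition_fn_def by measurable
qed

lemma Wpart_pos: "0 < Wpart \<beta> h N k A"
  unfolding Wpart_def by (intro divide_pos_pos sum_pos) (auto intro!: finite_PiE simp: PiE_eq_empty_iff)

lemma Wpart_borel: "Wpart \<beta> h N k \<in> borel_measurable borel"
  by (rule Wpart_measurable) (use it_measurable in auto)

section \<open>From the disorder to the conditional expectation\<close>

lemma distr_gaussian_disorder:
  assumes N: "N >= 1" and M: "gaussian_disorder M N g"
  defines "tr \<equiv> \<lambda>\<omega> i j. if i < N \<and> j < N then g \<omega> i j else 0"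
  shows "tr \<in> borel_measurable M" "distr M borel tr = Gm N"
proof -
  interpret prob_space M using M by (simp add: gaussian_disorder_def)
  let ?I = "{..<N} \<times> {..<N}"
  let ?X = "\<lambda>(i, j) \<omega>. g \<omega> i j"
  have ind: "indep_vars (\<lambda>_. borel) ?X ?I" using M by (simp add: gaussian_disorder_def)
  have D: "distributed M lborel (\<lambda>\<omega>. g \<omega> i j) (normal_density 0 (1 / sqrt (real N)))" if "i < N" "j < N" for i j
    using M that by (simp add: gaussian_disorder_def)
  have rv: "(\<lambda>\<omega>. g \<omega> i j) \<in> borel_measurable M" if "i < N" "j < N" for i j
    using distributed_measurable[OF D[OF that]] by simp
  show tr: "tr \<in> borel_measurable M"
    unfolding tr_def
  proof (rule borel_measurable_matr)
    fix i j show "(\<lambda>\<omega>. if i < N \<and> j < N then g \<omega> i j else 0) \<in> borel_measurable M"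
      by (cases "i < N \<and> j < N") (use rv in auto)
  qed
  \<comment> \<open>Multiplication by sqrt N standardizes the entries, so that their joint law is
    literally the product measure \<open>gs\<close>.\<close>
  define Y where "Y l \<omega> = sqrt (real N) * ?X l \<omega>" for l :: "nat \<times> nat" and \<omega>
  have indY: "indep_vars (\<lambda>_. borel) Y ?I"
    unfolding Y_def by (rule indep_vars_compose2[OF ind]) simp
  have rvY: "Y l \<in> borel_measurable M" if "l \<in> ?I" for l
    using indY that by (auto simp: indep_vars_def2)
  have dY: "distr M borel (Y l) = sn" if l: "l \<in> ?I" for l
  proof -
    obtain i j where ij: "l = (i, j)" "i < N" "j < N" using l by auto
    have "distributed M lborel (\<lambda>\<omega>. (g \<omega> i j - 0) / (1 / sqrt (real N))) std_normal_density"
      using normal_standard_normal_convert[of "1 / sqrt (real N)" "\<lambda>\<omega>. g \<omega> i j" 0] D[OF ij(2,3)] N by simp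
    then have "distr M lborel (\<lambda>\<omega>. (g \<omega> i j - 0) / (1 / sqrt (real N))) = sn"
      by (rule distributed_distr_eq_density)
    moreover have "(\<lambda>\<omega>. (g \<omega> i j - 0) / (1 / sqrt (real N))) = Y l"
      by (auto simp: Y_def ij mult.commute)
    moreover have "distr M lborel (Y l) = distr M borel (Y l)" by (rule distr_cong) simp_all
    ultimately show ?thesis by simp
  qed
  have "?I ~= {}" using N by (auto simp: lessThan_empty_iff)
  then have P: "distr M (PiM ?I (\<lambda>_. borel)) (\<lambda>\<omega>. \<lambda>l\<in>?I. Y l \<omega>) = PiM ?I (\<lambda>l. distr M borel (Y l))"
    using indep_vars_iff_distr_eq_PiM'[of ?I Y "\<lambda>_. borel"] indY rvY by simp
  have P': "PiM ?I (\<lambda>l. distr M borel (Y l)) = gs ?I"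
    by (rule PiM_cong) (use dY in auto)
  let ?e = "\<lambda>x i j. if i < N \<and> j < N then x (i, j) / sqrt (real N) else 0"
  have "Gm N = distr (distr M (PiM ?I (\<lambda>_. borel)) (\<lambda>\<omega>. \<lambda>l\<in>?I. Y l \<omega>)) borel ?e"
    unfolding Gm_def P P' ..
  also have "\<dots> = distr M borel (?e \<circ> (\<lambda>\<omega>. \<lambda>l\<in>?I. Y l \<omega>))"
    by (rule distr_distr[OF Gm_emb]) (intro measurable_restrict rvY)
  also have "?e \<circ> (\<lambda>\<omega>. \<lambda>l\<in>?I. Y l \<omega>) = tr"
    using N by (auto simp: tr_def Y_def fun_eq_iff)
  finally show "distr M borel tr = Gm N" ..
qed

lemma on_block_comp2:
  assumes "on_block N F" "on_block N F'" shows "on_block N (\<lambda>A. f (F A) (F' A))"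
  unfolding on_block_def
proof (intro allI impI)
  fix A B assume "meq N A B"
  then have "F A = F B" "F' A = F' B" using assms by (auto dest: on_blockD)
  then show "f (F A) (F' A) = f (F B) (F' B)" by simp
qed

lemma on_block_trunc:
  "on_block N F ==> F (\<lambda>i j. if i < N \<and> j < N then g i j else 0) = F g"
  by (rule on_blockD) (auto simp: meq_def)

lemma nn_integral_disorder:
  assumes N: "N >= 1" and M: "gaussian_disorder M N g" and F: "F \<in> borel_measurable borel" "on_block N F"
  shows "(\<integral>\<^sup>+\<omega>. F (g \<omega>) \<partial>M) = (\<integral>\<^sup>+A. F A \<partial>Gm N)"
proof -
  note d = distr_gaussian_disorder[OF N M]
  have "(\<integral>\<^sup>+A. F A \<partial>Gm N) = (\<integral>\<^sup>+\<omega>. F (\<lambda>i j. if i < N \<and> j < N then g \<omega> i j else 0) \<partial>M)"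
    unfolding d(2)[symmetric] by (rule nn_integral_distr[OF d(1)]) (use F in simp)
  then show ?thesis unfolding on_block_trunc[OF F(2)] ..
qed

lemma measurable_disorder:
  assumes N: "N >= 1" and M: "gaussian_disorder M N g" and F: "F \<in> borel_measurable borel" "on_block N F"
  shows "(\<lambda>\<omega>. F (g \<omega>)) \<in> borel_measurable M"
  using measurable_compose[OF distr_gaussian_disorder(1)[OF N M] F(1)] unfolding on_block_trunc[OF F(2)] .

text \<open>The candidate is G_k-measurable, and the averaging identity over an event of G_k is
  \<open>Gm_resample\<close>: such events are invariant under resampling, so their indicator leaves
  the inner integral, which \<open>partition_fn_resample\<close> evaluates.\<close>

lemma cond_exp_partition_fn:
  assumes N: "N >= 1" and M: "gaussian_disorder M N g"
  shows "AE \<omega> in M. real_cond_exp M (sigma_G \<beta> h M N g k) (\<lambda>\<omega>. partition_fn \<beta> h N (g \<omega>)) \<omega> = Wpart \<beta> h N k (g \<omega>)"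
proof -
  interpret prob_space M using M by (simp add: gaussian_disorder_def)
  let ?G = "sigma_G \<beta> h M N g k"
  let ?Z = "partition_fn \<beta> h N" and ?W = "Wpart \<beta> h N k" and ?R = "resample \<beta> h N k"
  define gens where "gens = (\<Union>m\<in>{1..k}. \<Union>i\<in>{..<N}.
        {(\<lambda>\<omega>. it_xi \<beta> h N (g \<omega>) m i) -` B \<inter> space M | B. B \<in> sets borel} \<union>
        {(\<lambda>\<omega>. it_eta \<beta> h N (g \<omega>) m i) -` B \<inter> space M | B. B \<in> sets borel})"
  have G: "?G = sigma (space M) gens" by (simp add: sigma_G_def gens_def)
  have gP: "gens \<subseteq> Pow (space M)" by (auto simp: gens_def)
  have sG: "sets ?G = sigma_sets (space M) gens" "space ?G = space M"
    unfolding G using gP by (simp_all add: sets_measure_of space_measure_of)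
  \<comment> \<open>Events of G_k, described in the space of matrices: the preimage of a Borel set
    that depends on the block only and is invariant under resampling. The generators have this
    property by \<open>resample_invariants\<close>, and it survives complements and countable
    unions.\<close>
  define good where "good S \<longleftrightarrow> (\<exists>C\<in>sets borel. on_block N (\<lambda>A. A \<in> C) \<and> (\<forall>A X. ?R A X \<in> C \<longleftrightarrow> A \<in> C) \<and> S = {\<omega>\<in>space M. g \<omega> \<in> C})" for S
  have blk: "on_block N (\<lambda>A. it_xi \<beta> h N A m i)" "on_block N (\<lambda>A. it_eta \<beta> h N A m i)" if "i < N" for m i
    using it_veq that by (auto simp: on_block_def veq_def)
  have good: "good S" if "S \<in> sigma_sets (space M) gens" for S
    using that
  proof induction
    case (Basic S)
    then obtain m i B where m: "m \<in> {1..k}" "i < N" "B \<in> sets borel"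
      and S: "S = (\<lambda>\<omega>. it_xi \<beta> h N (g \<omega>) m i) -` B \<inter> space M \<or> S = (\<lambda>\<omega>. it_eta \<beta> h N (g \<omega>) m i) -` B \<inter> space M"
      unfolding gens_def by blast
    from S show ?case
    proof
      assume S: "S = (\<lambda>\<omega>. it_xi \<beta> h N (g \<omega>) m i) -` B \<inter> space M"
      have "(\<lambda>A. it_xi \<beta> h N A m i) -` B \<in> sets borel"
        using measurable_sets[OF it_measurable(1) m(3)] by simp
      then show "good S" unfolding good_def S using m blk(1)[OF m(2), of m] resample_invariants(2)[OF N, of m k]
        by (intro bexI[of _ "(\<lambda>A. it_xi \<beta> h N A m i) -` B"]) (auto simp: on_block_def)
    next
      assume S: "S = (\<lambda>\<omega>. it_eta \<beta> h N (g \<omega>) m i) -` B \<inter> space M"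
      have "(\<lambda>A. it_eta \<beta> h N A m i) -` B \<in> sets borel"
        using measurable_sets[OF it_measurable(2) m(3)] by simp
      then show "good S" unfolding good_def S using m blk(2)[OF m(2), of m] resample_invariants(3)[OF N, of m k]
        by (intro bexI[of _ "(\<lambda>A. it_eta \<beta> h N A m i) -` B"]) (auto simp: on_block_def)
    qed
  next
    case Empty
    show ?case unfolding good_def by (intro bexI[of _ "{}"]) (auto simp: on_block_def)
  next
    case (Compl S)
    then obtain C where "C \<in> sets borel" "on_block N (\<lambda>A. A \<in> C)" "\<And>A X. ?R A X \<in> C \<longleftrightarrow> A \<in> C" "S = {\<omega>\<in>space M. g \<omega> \<in> C}"
      unfolding good_def by blast
    then show ?case unfolding good_def by (intro bexI[of _ "- C"]) (auto simp: on_block_def)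
  next
    case (Union a)
    then have "\<forall>n. \<exists>C. C \<in> sets borel \<and> on_block N (\<lambda>A. A \<in> C) \<and> (\<forall>A X. ?R A X \<in> C \<longleftrightarrow> A \<in> C) \<and> a n = {\<omega>\<in>space M. g \<omega> \<in> C}"
      unfolding good_def by blast
    from choice[OF this] obtain C where "\<forall>n. C n \<in> sets borel \<and> on_block N (\<lambda>A. A \<in> C n) \<and> (\<forall>A X. ?R A X \<in> C n \<longleftrightarrow> A \<in> C n) \<and> a n = {\<omega>\<in>space M. g \<omega> \<in> C n}" ..
    then have C: "\<And>n. C n \<in> sets borel" "\<And>n. on_block N (\<lambda>A. A \<in> C n)" "\<And>n A X. ?R A X \<in> C n \<longleftrightarrow> A \<in> C n" "\<And>n. a n = {\<omega>\<in>space M. g \<omega> \<in> C n}"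
      by blast+
    have "(\<Union>n. C n) \<in> sets borel" using C(1) by auto
    moreover have "on_block N (\<lambda>A. A \<in> (\<Union>n. C n))" using C(2) by (auto simp: on_block_def)
    ultimately show ?case unfolding good_def using C(3,4) by (intro bexI[of _ "\<Union>n. C n"]) auto
  qed
  have Z0: "0 <= ?Z A" for A unfolding partition_fn_def by (simp add: sum_nonneg)
  have I: "(\<integral>\<^sup>+\<omega>. ennreal (indicator S \<omega> * ?Z (g \<omega>)) \<partial>M) = (\<integral>\<^sup>+\<omega>. ennreal (indicator S \<omega> * ?W (g \<omega>)) \<partial>M) \<and> S \<in> sets M" if "good S" for S
  proof -
    from that[unfolded good_def] obtain C where C0: "C \<in> sets borel"
      "on_block N (\<lambda>A. A \<in> C) \<and> (\<forall>A X. ?R A X \<in> C \<longleftrightarrow> A \<in> C) \<and> S = {\<omega>\<in>space M. g \<omega> \<in> C}"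
      by (rule bexE)
    note C = C0(1) C0(2)[THEN conjunct1] C0(2)[THEN conjunct2, THEN conjunct1, rule_format] C0(2)[THEN conjunct2, THEN conjunct2]
    have iC: "indicator S \<omega> = (indicator C (g \<omega>) :: real)" if "\<omega> \<in> space M" for \<omega>
      using that C(4) by (auto simp: indicator_def)
    have mC: "(indicator C :: matr => real) \<in> borel_measurable borel" using C(1) by simp
    have bC: "on_block N (indicator C :: matr => real)"
      unfolding on_block_def
    proof (intro allI impI)
      fix A B assume "meq N A B"
      then have "(A \<in> C) = (B \<in> C)" by (rule on_blockD[OF C(2)])
      then show "(indicator C A :: real) = indicator C B" by (simp only: indicator_def)
    qed
    have m1: "(\<lambda>A. ennreal (indicator C A * ?Z A)) \<in> borel_measurable borel" "(\<lambda>A. ennreal (indicator C A * ?W A)) \<in> borel_measurable borel"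
      using mC partition_fn_measurable[of \<beta> h N] Wpart_borel[of \<beta> h N k] by measurable
    have b1: "on_block N (\<lambda>A. ennreal (indicator C A * ?Z A))" "on_block N (\<lambda>A. ennreal (indicator C A * ?W A))"
      by (rule on_block_comp2[OF bC partition_fn_block, where f="\<lambda>x y. ennreal (x * y)"],
          rule on_block_comp2[OF bC Wpart_block, where f="\<lambda>x y. ennreal (x * y)"])
    have "(\<integral>\<^sup>+\<omega>. ennreal (indicator S \<omega> * ?Z (g \<omega>)) \<partial>M) = (\<integral>\<^sup>+\<omega>. ennreal (indicator C (g \<omega>) * ?Z (g \<omega>)) \<partial>M)"
      by (intro nn_integral_cong) (simp add: iC)
    also have "\<dots> = (\<integral>\<^sup>+A. ennreal (indicator C A * ?Z A) \<partial>Gm N)"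
      by (rule nn_integral_disorder[OF N M m1(1) b1(1)])
    also have "\<dots> = (\<integral>\<^sup>+A. \<integral>\<^sup>+X. ennreal (indicator C (?R A X) * ?Z (?R A X)) \<partial>Gm N \<partial>Gm N)"
      by (rule Gm_resample[OF N m1(1) b1(1)])
    also have "\<dots> = (\<integral>\<^sup>+A. ennreal (indicator C A * ?W A) \<partial>Gm N)"
    proof (rule nn_integral_cong)
      fix A
      have "(indicator C (?R A X) :: real) = indicator C A" for X using C(3) by (simp add: indicator_def)
      then have "(\<integral>\<^sup>+X. ennreal (indicator C (?R A X) * ?Z (?R A X)) \<partial>Gm N) = (\<integral>\<^sup>+X. ennreal (indicator C A) * ennreal (?Z (?R A X)) \<partial>Gm N)"
        by (simp only: ennreal_mult[OF indicator_pos_le Z0])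
      also have "\<dots> = ennreal (indicator C A) * (\<integral>\<^sup>+X. ennreal (?Z (?R A X)) \<partial>Gm N)"
        by (rule nn_integral_cmult)
           (use measurable_compose[OF resample_measurable partition_fn_measurable, of "\<lambda>_. A" _ "\<lambda>x. x"] in \<open>simp cong: measurable_cong_sets\<close>)
      also have "\<dots> = ennreal (indicator C A * ?W A)"
        unfolding partition_fn_resample[OF N] by (simp only: ennreal_mult[OF indicator_pos_le less_imp_le[OF Wpart_pos]])
      finally show "(\<integral>\<^sup>+X. ennreal (indicator C (?R A X) * ?Z (?R A X)) \<partial>Gm N) = ennreal (indicator C A * ?W A)" .
    qed
    also have "\<dots> = (\<integral>\<^sup>+\<omega>. ennreal (indicator C (g \<omega>) * ?W (g \<omega>)) \<partial>M)"
      by (rule nn_integral_disorder[OF N M m1(2) b1(2), symmetric])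
    also have "\<dots> = (\<integral>\<^sup>+\<omega>. ennreal (indicator S \<omega> * ?W (g \<omega>)) \<partial>M)"
      by (intro nn_integral_cong) (simp add: iC)
    finally have eq: "(\<integral>\<^sup>+\<omega>. ennreal (indicator S \<omega> * ?Z (g \<omega>)) \<partial>M) = (\<integral>\<^sup>+\<omega>. ennreal (indicator S \<omega> * ?W (g \<omega>)) \<partial>M)" .
    have "(\<lambda>\<omega>. indicator C (g \<omega>) :: real) \<in> borel_measurable M"
      by (rule measurable_disorder[OF N M mC bC])
    then have "{\<omega>\<in>space M. indicator C (g \<omega>) = (1::real)} \<in> sets M" by measurable
    moreover have "{\<omega>\<in>space M. indicator C (g \<omega>) = (1::real)} = S" by (auto simp: C(4) indicator_def)
    ultimately show ?thesis using eq by simp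
  qed
  have mZ: "(\<lambda>\<omega>. ?Z (g \<omega>)) \<in> borel_measurable M" by (rule measurable_disorder[OF N M partition_fn_measurable partition_fn_block])
  have mW: "(\<lambda>\<omega>. ?W (g \<omega>)) \<in> borel_measurable M" by (rule measurable_disorder[OF N M Wpart_borel Wpart_block])
  have "subalgebra M ?G"
    unfolding subalgebra_def sG
  proof (intro conjI subsetI refl)
    fix S assume "S \<in> sigma_sets (space M) gens"
    then show "S \<in> sets M" using I[OF good] by simp
  qed
  then interpret finite_measure_subalgebra M ?G by unfold_locales
  have iZ: "integrable M (\<lambda>\<omega>. ?Z (g \<omega>))"
  proof (rule integrableI_nonneg[OF mZ])
    have "(\<integral>\<^sup>+\<omega>. ennreal (?Z (g \<omega>)) \<partial>M) = (\<integral>\<^sup>+A. ennreal (?Z A) \<partial>Gm N)"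
      by (rule nn_integral_disorder[OF N M]) (use partition_fn_measurable[of \<beta> h N] on_block_comp2[OF partition_fn_block partition_fn_block, where f="\<lambda>x y. ennreal x"] in auto)
    also have "\<dots> = ennreal (Wpart \<beta> h N 0 (\<lambda>_ _. 0))"
      \<comment> \<open>At k = 0 nothing is revealed and \<open>resample\<close> returns the fresh
        matrix, so the formula gives the unconditional mean, which is finite.\<close>
      using partition_fn_resample[OF N, of \<beta> h 0 "\<lambda>_ _. 0"] by (simp add: resample_def)
    finally show "(\<integral>\<^sup>+\<omega>. ennreal (?Z (g \<omega>)) \<partial>M) < \<infinity>" by simp
  qed (simp add: Z0)
  have iW: "integrable M (\<lambda>\<omega>. ?W (g \<omega>))"
  proof (rule integrableI_nonneg[OF mW])
    have "good (space M)" by (rule good[OF sigma_sets_top])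
    from I[OF this] have "(\<integral>\<^sup>+\<omega>. ennreal (?Z (g \<omega>)) \<partial>M) = (\<integral>\<^sup>+\<omega>. ennreal (?W (g \<omega>)) \<partial>M)"
      by (simp cong: nn_integral_cong)
    moreover have "(\<integral>\<^sup>+\<omega>. ennreal (?Z (g \<omega>)) \<partial>M) < \<infinity>"
      using iZ Z0 by (simp add: integrable_iff_bounded)
    ultimately show "(\<integral>\<^sup>+\<omega>. ennreal (?W (g \<omega>)) \<partial>M) < \<infinity>" by simp
  qed (simp add: less_imp_le[OF Wpart_pos])
  show ?thesis
  proof (rule real_cond_exp_charact)
    fix S assume "S \<in> sets ?G"
    then have S: "(\<integral>\<^sup>+\<omega>. ennreal (indicator S \<omega> * ?Z (g \<omega>)) \<partial>M) = (\<integral>\<^sup>+\<omega>. ennreal (indicator S \<omega> * ?W (g \<omega>)) \<partial>M)" "S \<in> sets M"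
      using I good sG by auto
    have "(\<integral>\<omega>. indicator S \<omega> * ?Z (g \<omega>) \<partial>M) = enn2real (\<integral>\<^sup>+\<omega>. ennreal (indicator S \<omega> * ?Z (g \<omega>)) \<partial>M)"
      by (rule integral_eq_nn_integral) (use S(2) mZ Z0 in auto)
    moreover have "(\<integral>\<omega>. indicator S \<omega> * ?W (g \<omega>) \<partial>M) = enn2real (\<integral>\<^sup>+\<omega>. ennreal (indicator S \<omega> * ?W (g \<omega>)) \<partial>M)"
      by (rule integral_eq_nn_integral) (use S(2) mW less_imp_le[OF Wpart_pos] in auto)
    ultimately show "(\<integral>\<omega>\<in>S. ?Z (g \<omega>) \<partial>M) = (\<integral>\<omega>\<in>S. ?W (g \<omega>) \<partial>M)"
      unfolding set_lebesgue_integral_def real_scaleR_def using S(1) by simp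
  next
    have gen: "(\<lambda>\<omega>. f (g \<omega>)) \<in> borel_measurable ?G"
      if "\<And>B. B \<in> sets borel ==> (\<lambda>\<omega>. f (g \<omega>)) -` B \<inter> space M \<in> gens" for f :: "matr => real"
      by (rule measurableI) (use that sG in \<open>auto intro: sigma_sets.Basic\<close>)
    show "(\<lambda>\<omega>. ?W (g \<omega>)) \<in> borel_measurable ?G"
    proof (rule Wpart_measurable)
      fix t i assume ti: "i < N" "1 <= t" "t <= k"
      show "(\<lambda>\<omega>. it_xi \<beta> h N (g \<omega>) t i) \<in> borel_measurable ?G" "(\<lambda>\<omega>. it_eta \<beta> h N (g \<omega>) t i) \<in> borel_measurable ?G"
      proof (rule gen[of "\<lambda>A. it_xi \<beta> h N A t i"], unfold gens_def, rule UN_I[of t], use ti in simp, rule UN_I[of i], use ti in simp, blast)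
        show "(\<lambda>\<omega>. it_eta \<beta> h N (g \<omega>) t i) \<in> borel_measurable ?G"
          by (rule gen[of "\<lambda>A. it_eta \<beta> h N A t i"], unfold gens_def, rule UN_I[of t], use ti in simp, rule UN_I[of i], use ti in simp, blast)
      qed
    qed
  qed (rule iZ iW)+
qed

lemma nn_integral_cond_exp_partition_fn:
  assumes N: "N >= 1" and M: "gaussian_disorder M N g"
  shows "(\<integral>\<^sup>+\<omega>. ennreal \<bar>ln (real_cond_exp M (sigma_G \<beta> h M N g k) (\<lambda>\<omega>. partition_fn \<beta> h N (g \<omega>)) \<omega>) / real N - c\<bar> \<partial>M)
    = (\<integral>\<^sup>+A. ennreal \<bar>ln (Wpart \<beta> h N k A) / real N - c\<bar> \<partial>Gm N)"
proof -
  have m: "(\<lambda>A. ennreal \<bar>ln (Wpart \<beta> h N k A) / real N - c\<bar>) \<in> borel_measurable borel"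
    using Wpart_borel[of \<beta> h N k] by measurable
  have b: "on_block N (\<lambda>A. ennreal \<bar>ln (Wpart \<beta> h N k A) / real N - c\<bar>)"
    by (rule on_block_comp2[OF Wpart_block Wpart_block, where f="\<lambda>x y. ennreal \<bar>ln x / real N - c\<bar>"])
  have "AE \<omega> in M. ennreal \<bar>ln (real_cond_exp M (sigma_G \<beta> h M N g k) (\<lambda>\<omega>. partition_fn \<beta> h N (g \<omega>)) \<omega>) / real N - c\<bar>
      = ennreal \<bar>ln (Wpart \<beta> h N k (g \<omega>)) / real N - c\<bar>"
    using cond_exp_partition_fn[OF N M, of \<beta> h k] by eventually_elim simp
  then have "(\<integral>\<^sup>+\<omega>. ennreal \<bar>ln (real_cond_exp M (sigma_G \<beta> h M N g k) (\<lambda>\<omega>. partition_fn \<beta> h N (g \<omega>)) \<omega>) / real N - c\<bar> \<partial>M)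
     = (\<integral>\<^sup>+\<omega>. ennreal \<bar>ln (Wpart \<beta> h N k (g \<omega>)) / real N - c\<bar> \<partial>M)"
    by (rule nn_integral_cong_AE)
  also have "\<dots> = (\<integral>\<^sup>+A. ennreal \<bar>ln (Wpart \<beta> h N k A) / real N - c\<bar> \<partial>Gm N)"
    by (rule nn_integral_disorder[OF N M m b])
  finally show ?thesis .
qed

section \<open>Law of large numbers for the iteration\<close>

locale prob_seq =
  fixes M :: "nat => 'a measure"
  assumes prob: "\<And>N. prob_space (M N)"
begin

text \<open>Convergence in probability with measurability built in. Only constant limits occur, so
  the space may change with N; it is used for the matrices alone and for the matrices together with
  two fresh vectors.\<close>

definition cvp :: "(nat => 'a => real) => real => bool" where
  "cvp X c \<longleftrightarrow> (\<forall>N. X N \<in> borel_measurable (M N)) \<and>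
     (\<forall>\<epsilon>>0. (\<lambda>N. measure (M N) {x \<in> space (M N). \<epsilon> < \<bar>X N x - c\<bar>}) \<longlonglongrightarrow> 0)"

lemma cvp_measurable: "cvp X c ==> X N \<in> borel_measurable (M N)"
  by (simp add: cvp_def)

lemma cvp_tendsto: "cvp X c ==> 0 < \<epsilon> ==> (\<lambda>N. measure (M N) {x \<in> space (M N). \<epsilon> < \<bar>X N x - c\<bar>}) \<longlonglongrightarrow> 0"
  by (simp add: cvp_def)

text \<open>A union bound over the two exceptional events. The probabilistic claim is reduced to a
  pointwise epsilon-delta implication for large N, from which the closure rules below
  follow.\<close>

lemma cvp_dominated2:
  assumes X: "cvp X c" and Y: "cvp Y d" and Z: "\<And>N. Z N \<in> borel_measurable (M N)"
    and dom: "\<And>\<epsilon>. 0 < \<epsilon> ==> \<exists>\<delta>>0. \<forall>\<^sub>F N in sequentially. \<forall>x\<in>space (M N).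
        \<bar>X N x - c\<bar> <= \<delta> --> \<bar>Y N x - d\<bar> <= \<delta> --> \<bar>Z N x - l\<bar> <= \<epsilon>"
  shows "cvp Z l"
  unfolding cvp_def
proof (intro conjI allI impI Z)
  fix \<epsilon> :: real assume "0 < \<epsilon>"
  from dom[OF this] obtain \<delta> where \<delta>: "\<delta> > 0" and ev: "\<forall>\<^sub>F N in sequentially. \<forall>x\<in>space (M N).
        \<bar>X N x - c\<bar> <= \<delta> --> \<bar>Y N x - d\<bar> <= \<delta> --> \<bar>Z N x - l\<bar> <= \<epsilon>" by blast
  let ?SX = "\<lambda>N. {x \<in> space (M N). \<delta> < \<bar>X N x - c\<bar>}" and ?SY = "\<lambda>N. {x \<in> space (M N). \<delta> < \<bar>Y N x - d\<bar>}"
  have m: "?SX N \<in> sets (M N)" "?SY N \<in> sets (M N)" for N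
  proof -
    have [measurable]: "X N \<in> borel_measurable (M N)" "Y N \<in> borel_measurable (M N)"
      using cvp_measurable[OF X] cvp_measurable[OF Y] .
    show "?SX N \<in> sets (M N)" "?SY N \<in> sets (M N)" by measurable
  qed
  have lim: "(\<lambda>N. measure (M N) (?SX N) + measure (M N) (?SY N)) \<longlonglongrightarrow> 0"
    using tendsto_add[OF cvp_tendsto[OF X \<delta>] cvp_tendsto[OF Y \<delta>]] by simp
  show "(\<lambda>N. measure (M N) {x \<in> space (M N). \<epsilon> < \<bar>Z N x - l\<bar>}) \<longlonglongrightarrow> 0"
  proof (rule real_tendsto_sandwich[OF _ _ tendsto_const lim])
    show "\<forall>\<^sub>F N in sequentially. measure (M N) {x \<in> space (M N). \<epsilon> < \<bar>Z N x - l\<bar>} <= measure (M N) (?SX N) + measure (M N) (?SY N)"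
      using ev
    proof eventually_elim
      case (elim N)
      interpret prob_space "M N" by (rule prob)
      have "prob {x \<in> space (M N). \<epsilon> < \<bar>Z N x - l\<bar>} <= prob (?SX N \<union> ?SY N)"
      proof (rule finite_measure_mono)
        show "{x \<in> space (M N). \<epsilon> < \<bar>Z N x - l\<bar>} \<subseteq> ?SX N \<union> ?SY N"
        proof
          fix x assume "x \<in> {x \<in> space (M N). \<epsilon> < \<bar>Z N x - l\<bar>}"
          then have x: "x \<in> space (M N)" "\<not> \<bar>Z N x - l\<bar> <= \<epsilon>" by auto
          with elim[rule_format, OF x(1)] have "\<not> \<bar>X N x - c\<bar> <= \<delta> \<or> \<not> \<bar>Y N x - d\<bar> <= \<delta>" by blast
          then show "x \<in> ?SX N \<union> ?SY N" using x by auto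
        qed
      qed (use m in auto)
      also have "\<dots> <= prob (?SX N) + prob (?SY N)" by (rule measure_Un_le) (use m in auto)
      finally show ?case .
    qed
  qed (auto intro!: always_eventually)
qed

lemma cvp_continuous2:
  fixes g :: "real => real => real"
  assumes X: "cvp X c" and Y: "cvp Y d" and g: "isCont (\<lambda>p. g (fst p) (snd p)) (c, d)"
    and m: "\<And>N. (\<lambda>x. g (X N x) (Y N x)) \<in> borel_measurable (M N)"
  shows "cvp (\<lambda>N x. g (X N x) (Y N x)) (g c d)"
proof (rule cvp_dominated2[OF X Y m])
  fix \<epsilon> :: real assume "0 < \<epsilon>"
  with g obtain r where r: "r > 0" "\<And>p. dist p (c, d) < r ==> dist (g (fst p) (snd p)) (g c d) < \<epsilon>"
    unfolding continuous_at_eps_delta by force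
  show "\<exists>\<delta>>0. \<forall>\<^sub>F N in sequentially. \<forall>x\<in>space (M N). \<bar>X N x - c\<bar> <= \<delta> --> \<bar>Y N x - d\<bar> <= \<delta> --> \<bar>g (X N x) (Y N x) - g c d\<bar> <= \<epsilon>"
  proof (intro exI[of _ "r/3"] conjI always_eventually allI ballI impI)
    fix N x assume b: "\<bar>X N x - c\<bar> <= r/3" "\<bar>Y N x - d\<bar> <= r/3"
    have "dist (X N x, Y N x) (c, d) <= \<bar>X N x - c\<bar> + \<bar>Y N x - d\<bar>"
      unfolding dist_Pair_Pair dist_real_def by (rule sqrt_sum_squares_le_sum[OF abs_ge_zero abs_ge_zero])
    also have "\<dots> < r" using b r(1) by linarith
    finally show "\<bar>g (X N x) (Y N x) - g c d\<bar> <= \<epsilon>" using r(2)[of "(X N x, Y N x)"] by (simp add: dist_real_def)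
  qed (use r in auto)
qed

lemma cvp_add:
  assumes "cvp X c" "cvp Y d"
  shows "cvp (\<lambda>N x. X N x + Y N x) (c + d)"
  by (rule cvp_continuous2[OF assms(1,2), of "(+)"])
     (use assms in \<open>auto intro!: borel_measurable_add cvp_measurable[OF assms(1)] cvp_measurable[OF assms(2)] continuous_intros\<close>)

lemma cvp_diff:
  assumes "cvp X c" "cvp Y d"
  shows "cvp (\<lambda>N x. X N x - Y N x) (c - d)"
  by (rule cvp_continuous2[OF assms(1,2), of "(-)"])
     (use assms in \<open>auto intro!: borel_measurable_diff cvp_measurable[OF assms(1)] cvp_measurable[OF assms(2)] continuous_intros\<close>)

lemma cvp_mult:
  assumes "cvp X c" "cvp Y d"
  shows "cvp (\<lambda>N x. X N x * Y N x) (c * d)"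
  by (rule cvp_continuous2[OF assms(1,2), of "(*)"])
     (use assms in \<open>auto intro!: borel_measurable_times cvp_measurable[OF assms(1)] cvp_measurable[OF assms(2)] continuous_intros\<close>)

lemma cvp_divide:
  assumes "cvp X c" "cvp Y d" "d ~= 0"
  shows "cvp (\<lambda>N x. X N x / Y N x) (c / d)"
  by (rule cvp_continuous2[OF assms(1,2), of "(/)"])
     (use assms in \<open>auto intro!: borel_measurable_divide cvp_measurable[OF assms(1)] cvp_measurable[OF assms(2)] continuous_intros\<close>)

lemma cvp_const: "cvp (\<lambda>N x. c) c"
  by (simp add: cvp_def)

lemma cvp_eventually_cong:
  assumes X: "cvp X c" and Y: "\<And>N. Y N \<in> borel_measurable (M N)"
    and eq: "\<forall>\<^sub>F N in sequentially. \<forall>x\<in>space (M N). Y N x = X N x"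
  shows "cvp Y c"
proof (rule cvp_dominated2[OF X X Y])
  fix \<epsilon> :: real assume "0 < \<epsilon>"
  show "\<exists>\<delta>>0. \<forall>\<^sub>F N in sequentially. \<forall>x\<in>space (M N). \<bar>X N x - c\<bar> <= \<delta> --> \<bar>X N x - c\<bar> <= \<delta> --> \<bar>Y N x - c\<bar> <= \<epsilon>"
    by (intro exI[of _ \<epsilon>] conjI \<open>0 < \<epsilon>\<close> eventually_mono[OF eq]) simp
qed

lemma cvp_uminus: "cvp X c ==> cvp (\<lambda>N x. - X N x) (- c)"
  using cvp_diff[OF cvp_const[of 0]] by force

lemma cvp_cmult: "cvp X c ==> cvp (\<lambda>N x. a * X N x) (a * c)"
  by (rule cvp_mult[OF cvp_const])

lemma cvp_power2: "cvp X c ==> cvp (\<lambda>N x. (X N x)\<^sup>2) (c\<^sup>2)"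
  unfolding power2_eq_square by (rule cvp_mult)

lemma cvp_abs:
  assumes "cvp X c" shows "cvp (\<lambda>N x. \<bar>X N x\<bar>) \<bar>c\<bar>"
  by (rule cvp_continuous2[OF assms assms, of "\<lambda>x y. \<bar>x\<bar>"])
     (auto intro!: borel_measurable_abs cvp_measurable[OF assms] continuous_intros)

lemma cvp_sqrt:
  assumes "cvp X c" shows "cvp (\<lambda>N x. sqrt (X N x)) (sqrt c)"
  by (rule cvp_continuous2[OF assms assms, of "\<lambda>x y. sqrt x"])
     (auto intro!: measurable_compose[OF cvp_measurable[OF assms] borel_measurable_sqrt] continuous_intros)

lemma cvp_sum:
  assumes "finite S" "\<And>s. s \<in> S ==> cvp (X s) (c s)"
  shows "cvp (\<lambda>N x. \<Sum>s\<in>S. X s N x) (\<Sum>s\<in>S. c s)"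
  using assms
proof (induction S rule: finite_induct)
  case (insert s S)
  show ?case unfolding sum.insert[OF insert.hyps] by (rule cvp_add) (use insert in auto)
qed (simp add: cvp_const)

lemma cvp_sandwich:
  assumes Y: "cvp Y 0" and X: "\<And>N. X N \<in> borel_measurable (M N)"
    and le: "\<forall>\<^sub>F N in sequentially. \<forall>x\<in>space (M N). \<bar>X N x - c\<bar> <= Y N x"
  shows "cvp X c"
proof (rule cvp_dominated2[OF Y Y X])
  fix \<epsilon> :: real assume "0 < \<epsilon>"
  show "\<exists>\<delta>>0. \<forall>\<^sub>F N in sequentially. \<forall>x\<in>space (M N). \<bar>Y N x - 0\<bar> <= \<delta> --> \<bar>Y N x - 0\<bar> <= \<delta> --> \<bar>X N x - c\<bar> <= \<epsilon>"
  proof (intro exI[of _ \<epsilon>] conjI \<open>0 < \<epsilon>\<close> eventually_mono[OF le] ballI impI)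
    fix N x assume a: "\<forall>x\<in>space (M N). \<bar>X N x - c\<bar> <= Y N x" "x \<in> space (M N)" "\<bar>Y N x - 0\<bar> <= \<epsilon>"
    have "\<bar>X N x - c\<bar> <= Y N x" using a by blast
    then show "\<bar>X N x - c\<bar> <= \<epsilon>" using a(3) by linarith
  qed
qed

text \<open>Applied with U the squared norm of phi^(k+1): that norm is 0 or 1, so closeness to 1
  means equality and the degenerate case is discarded.\<close>

lemma cvp_on_event:
  assumes Y: "cvp Y c" and U: "cvp U u" and X: "\<And>N. X N \<in> borel_measurable (M N)" and \<delta>: "0 < \<delta>"
    and eq: "\<forall>\<^sub>F N in sequentially. \<forall>x\<in>space (M N). \<bar>U N x - u\<bar> <= \<delta> --> X N x = Y N x"
  shows "cvp X c"
proof (rule cvp_dominated2[OF Y U X])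
  fix \<epsilon> :: real assume e: "0 < \<epsilon>"
  show "\<exists>\<delta>>0. \<forall>\<^sub>F N in sequentially. \<forall>x\<in>space (M N). \<bar>Y N x - c\<bar> <= \<delta> --> \<bar>U N x - u\<bar> <= \<delta> --> \<bar>X N x - c\<bar> <= \<epsilon>"
  proof (intro exI[of _ "min \<epsilon> \<delta>"] conjI eventually_mono[OF eq] ballI impI)
    fix N x assume a: "\<forall>x\<in>space (M N). \<bar>U N x - u\<bar> <= \<delta> --> X N x = Y N x" "x \<in> space (M N)"
      "\<bar>Y N x - c\<bar> <= min \<epsilon> \<delta>" "\<bar>U N x - u\<bar> <= min \<epsilon> \<delta>"
    have "X N x = Y N x" using a by simp
    then show "\<bar>X N x - c\<bar> <= \<epsilon>" using a(3) by simp
  qed (use e \<delta> in simp)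
qed

lemma cvp_markov:
  assumes Y: "\<And>N. Y N \<in> borel_measurable (M N)" and nn: "\<And>N x. 0 <= Y N x"
    and le: "\<forall>\<^sub>F N in sequentially. (\<integral>\<^sup>+x. ennreal (Y N x) \<partial>M N) <= ennreal (e N)" and e: "e \<longlonglongrightarrow> 0"
  shows "cvp Y 0"
  unfolding cvp_def
proof (intro conjI allI impI Y)
  fix \<epsilon> :: real assume \<epsilon>: "0 < \<epsilon>"
  have lim: "(\<lambda>N. \<bar>e N\<bar> / \<epsilon>) \<longlonglongrightarrow> 0"
    using tendsto_divide[OF tendsto_rabs[OF e] tendsto_const[of \<epsilon>]] \<epsilon> by simp
  show "(\<lambda>N. measure (M N) {x \<in> space (M N). \<epsilon> < \<bar>Y N x - 0\<bar>}) \<longlonglongrightarrow> 0"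
  proof (rule real_tendsto_sandwich[OF _ _ tendsto_const lim])
    show "\<forall>\<^sub>F N in sequentially. measure (M N) {x \<in> space (M N). \<epsilon> < \<bar>Y N x - 0\<bar>} <= \<bar>e N\<bar> / \<epsilon>"
      using le
    proof eventually_elim
      case (elim N)
      interpret prob_space "M N" by (rule prob)
      have [measurable]: "Y N \<in> borel_measurable (M N)" by (rule Y)
      let ?S = "{x \<in> space (M N). \<epsilon> < \<bar>Y N x - 0\<bar>}"
      have "ennreal \<epsilon> * emeasure (M N) ?S = (\<integral>\<^sup>+x. ennreal \<epsilon> * indicator ?S x \<partial>M N)"
        by (subst nn_integral_cmult_indicator) auto
      also have "\<dots> <= (\<integral>\<^sup>+x. ennreal (Y N x) \<partial>M N)"
        by (rule nn_integral_mono) (use nn in \<open>auto simp: indicator_def intro!: ennreal_leI\<close>)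
      also have "\<dots> <= ennreal \<bar>e N\<bar>" using elim by (rule order_trans) (simp add: ennreal_leI)
      finally have "ennreal (\<epsilon> * prob ?S) <= ennreal \<bar>e N\<bar>"
        using \<epsilon> by (simp add: emeasure_eq_measure ennreal_mult)
      then have "\<epsilon> * prob ?S <= \<bar>e N\<bar>" by simp
      then show ?case using \<epsilon> by (simp add: pos_le_divide_eq mult.commute)
    qed
  qed (auto intro!: always_eventually)
qed

text \<open>Young's inequality on the exceptional event S gives |y| <= eta + t y^2 / 2 + 1_S / (2
  t). The second moment controls the middle term, and the probability of S, eventually below t eta,
  the last one.\<close>

lemma limsup_expectation:
  assumes Y: "\<And>N. Y N \<in> borel_measurable (M N)" and \<eta>: "0 < \<eta>" and B: "0 <= B"
    and lim: "(\<lambda>N. measure (M N) {x \<in> space (M N). \<eta> < \<bar>Y N x\<bar>}) \<longlonglongrightarrow> 0"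
    and sq: "\<forall>\<^sub>F N in sequentially. (\<integral>\<^sup>+x. ennreal ((Y N x)\<^sup>2) \<partial>M N) <= ennreal B"
  shows "limsup (\<lambda>N. \<integral>\<^sup>+x. ennreal \<bar>Y N x\<bar> \<partial>M N) <= ennreal (2 * \<eta>)"
proof (rule Limsup_bounded)
  \<comment> \<open>With this t the second moment contributes at most eta / 2, and the exceptional
    event another eta / 2.\<close>
  define t where "t = \<eta> / (B + 1)"
  have t: "0 < t" "t * B <= \<eta>" using \<eta> B by (auto simp: t_def pos_divide_le_eq field_simps)
  have "\<forall>\<^sub>F N in sequentially. measure (M N) {x \<in> space (M N). \<eta> < \<bar>Y N x\<bar>} < t * \<eta>"
    using order_tendstoD(2)[OF lim, of "t * \<eta>"] t \<eta> by simp
  with sq show "\<forall>\<^sub>F N in sequentially. (\<integral>\<^sup>+x. ennreal \<bar>Y N x\<bar> \<partial>M N) <= ennreal (2 * \<eta>)"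
  proof eventually_elim
    case (elim N)
    interpret prob_space "M N" by (rule prob)
    have [measurable]: "Y N \<in> borel_measurable (M N)" by (rule Y)
    let ?S = "{x \<in> space (M N). \<eta> < \<bar>Y N x\<bar>}"
    have le: "\<bar>y\<bar> <= \<eta> + (t / 2 * y\<^sup>2 + 1 / (2 * t) * indicator ?S x)" if "y = Y N x" "x \<in> space (M N)" for y x
    proof (cases "x \<in> ?S")
      case True
      have "0 <= (t * \<bar>y\<bar> - 1)\<^sup>2" by simp
      then have "2 * t * \<bar>y\<bar> <= t * (t * y\<^sup>2) + 1" by (simp add: power2_eq_square algebra_simps)
      then have "(2 * t * \<bar>y\<bar>) / (2 * t) <= (t * (t * y\<^sup>2) + 1) / (2 * t)" using t by (intro divide_right_mono) auto
      then have "\<bar>y\<bar> <= t / 2 * y\<^sup>2 + 1 / (2 * t)" using t by (simp add: add_divide_distrib)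
      then show ?thesis using True \<eta> by simp
    next
      case False
      have "0 <= t / 2 * y\<^sup>2" using t by simp
      then show ?thesis using False that by simp
    qed
    have "(\<integral>\<^sup>+x. ennreal \<bar>Y N x\<bar> \<partial>M N) <= (\<integral>\<^sup>+x. ennreal \<eta> + (ennreal (t / 2) * ennreal ((Y N x)\<^sup>2) + ennreal (1 / (2 * t)) * indicator ?S x) \<partial>M N)"
    proof (rule nn_integral_mono)
      fix x assume x: "x \<in> space (M N)"
      have "ennreal \<bar>Y N x\<bar> <= ennreal (\<eta> + (t / 2 * (Y N x)\<^sup>2 + 1 / (2 * t) * indicator ?S x))"
        by (rule ennreal_leI) (rule le[OF refl x])
      also have "\<dots> = ennreal \<eta> + (ennreal (t / 2) * ennreal ((Y N x)\<^sup>2) + ennreal (1 / (2 * t)) * indicator ?S x)"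
      proof -
        have "ennreal (t / 2 * (Y N x)\<^sup>2) = ennreal (t / 2) * ennreal ((Y N x)\<^sup>2)"
          by (rule ennreal_mult) (use t in auto)
        moreover have "ennreal (1 / (2 * t) * indicator ?S x) = ennreal (1 / (2 * t)) * indicator ?S x"
          by (simp add: indicator_def)
        moreover have "0 <= t / 2 * (Y N x)\<^sup>2" "0 <= 1 / (2 * t) * (indicator ?S x :: real)"
          using t by (auto simp: indicator_def)
        ultimately show ?thesis using \<eta> by (simp only: ennreal_plus add_nonneg_nonneg less_imp_le)
      qed
      finally show "ennreal \<bar>Y N x\<bar> <= ennreal \<eta> + (ennreal (t / 2) * ennreal ((Y N x)\<^sup>2) + ennreal (1 / (2 * t)) * indicator ?S x)" .
    qed
    also have "\<dots> = ennreal \<eta> + (ennreal (t / 2) * (\<integral>\<^sup>+x. ennreal ((Y N x)\<^sup>2) \<partial>M N) + ennreal (1 / (2 * t)) * emeasure (M N) ?S)"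
      by (simp add: nn_integral_add nn_integral_cmult emeasure_space_1 nn_integral_cmult_indicator)
    also have "\<dots> <= ennreal \<eta> + (ennreal (t / 2) * ennreal B + ennreal (1 / (2 * t)) * ennreal (t * \<eta>))"
      unfolding emeasure_eq_measure by (intro add_left_mono add_mono mult_left_mono elim ennreal_leI) (use elim in auto)
    also have "\<dots> = ennreal (\<eta> + (t / 2 * B + 1 / (2 * t) * (t * \<eta>)))"
    proof -
      have "ennreal (t / 2 * B) = ennreal (t / 2) * ennreal B" "ennreal (1 / (2 * t) * (t * \<eta>)) = ennreal (1 / (2 * t)) * ennreal (t * \<eta>)"
        by (rule ennreal_mult; use t \<eta> B in auto)+
      moreover have "0 <= t / 2 * B" "0 <= 1 / (2 * t) * (t * \<eta>)" using t \<eta> B by auto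
      ultimately show ?thesis using \<eta> by (simp only: ennreal_plus add_nonneg_nonneg less_imp_le)
    qed
    also have "\<dots> <= ennreal (2 * \<eta>)"
      using t by (intro ennreal_leI) simp
    finally show ?case .
  qed
qed

end

section \<open>Tame functions and their Gaussian averages\<close>

definition tame_bound :: "real => (real => real => real) => bool" where
  "tame_bound L f \<longleftrightarrow> 0 <= L \<and> (\<forall>x y. \<bar>f x y\<bar> <= L * (1 + \<bar>x\<bar> + \<bar>y\<bar>)) \<and>
    (\<forall>x y x' y'. \<bar>f x y - f x' y'\<bar> <= L * (1 + \<bar>x\<bar> + \<bar>y\<bar> + \<bar>x'\<bar> + \<bar>y'\<bar>) * (\<bar>x - x'\<bar> + \<bar>y - y'\<bar>))"

text \<open>Linear growth with a Lipschitz constant that may itself grow linearly. The class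
  contains tanh times a linear factor, is closed under averaging over one Gaussian, and has second
  moments controlled by the norms of the arguments.\<close>

definition tame :: "(real => real => real) => bool" where
  "tame f \<longleftrightarrow> (\<exists>L. tame_bound L f)"

lemma tame_measurable:
  assumes "tame f" shows "case_prod f \<in> borel_measurable (borel \<Otimes>\<^sub>M borel)"
proof -
  obtain L where L: "tame_bound L f" using assms by (auto simp: tame_def)
  have "isCont (\<lambda>p. f (fst p) (snd p)) q" for q
    unfolding isCont_def
  proof (rule LIM_zero_cancel, rule Lim_null_comparison)
    show "\<forall>\<^sub>F p in at q. norm (f (fst p) (snd p) - f (fst q) (snd q)) <= L * (1 + \<bar>fst p\<bar> + \<bar>snd p\<bar> + \<bar>fst q\<bar> + \<bar>snd q\<bar>) * (\<bar>fst p - fst q\<bar> + \<bar>snd p - snd q\<bar>)"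
      using L by (intro always_eventually allI) (simp add: tame_bound_def)
    have "((\<lambda>p. L * (1 + \<bar>fst p\<bar> + \<bar>snd p\<bar> + \<bar>fst q\<bar> + \<bar>snd q\<bar>) * (\<bar>fst p - fst q\<bar> + \<bar>snd p - snd q\<bar>)) \<longlongrightarrow>
        L * (1 + \<bar>fst q\<bar> + \<bar>snd q\<bar> + \<bar>fst q\<bar> + \<bar>snd q\<bar>) * (\<bar>fst q - fst q\<bar> + \<bar>snd q - snd q\<bar>)) (at q)"
      by (intro tendsto_intros)
    then show "((\<lambda>p. L * (1 + \<bar>fst p\<bar> + \<bar>snd p\<bar> + \<bar>fst q\<bar> + \<bar>snd q\<bar>) * (\<bar>fst p - fst q\<bar> + \<bar>snd p - snd q\<bar>)) \<longlongrightarrow> 0) (at q)"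
      by simp
  qed
  then have "continuous_on UNIV (\<lambda>p. f (fst p) (snd p))" by (simp add: continuous_on_eq_continuous_at)
  then have "(\<lambda>p. f (fst p) (snd p)) \<in> borel_measurable borel" by (rule borel_measurable_continuous_onI)
  then show ?thesis by (simp add: borel_prod case_prod_beta')
qed

lemma tame_measurable2:
  assumes "tame f" "g \<in> borel_measurable M" "g' \<in> borel_measurable M"
  shows "(\<lambda>x. f (g x) (g' x)) \<in> borel_measurable M"
  using measurable_compose[OF measurable_Pair[OF assms(2,3)] tame_measurable[OF assms(1)]] by simp

lemma sn_abs_le_1: "(\<integral>z. \<bar>z\<bar> \<partial>sn) <= 1"
proof -
  have b: "\<bar>z\<bar> <= (1 + z\<^sup>2) / 2" for z :: real
  proof -
    have "0 <= (\<bar>z\<bar> - 1)\<^sup>2" by simp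
    then show ?thesis by (simp add: power2_eq_square algebra_simps)
  qed
  have "(\<integral>z. \<bar>z\<bar> \<partial>sn) <= (\<integral>z. (1 + z\<^sup>2) / 2 \<partial>sn)"
    by (rule integral_mono) (use b in auto)
  then show ?thesis by (simp add: sn_moments)
qed

text \<open>Integrates out the newest Gaussian coordinate, which enters the two linear combinations
  with coefficients a and b.\<close>

definition smear :: "real => real => (real => real => real) => real => real => real" where
  "smear a b f x y = (\<integral>z. f (x + a * z) (y + b * z) \<partial>sn)"

lemma tame_growth:
  assumes L: "tame_bound L f"
  shows "\<bar>f (x + a * z) (y + b * z)\<bar> <= L * (1 + \<bar>x\<bar> + \<bar>y\<bar>) + L * (\<bar>a\<bar> + \<bar>b\<bar>) * \<bar>z\<bar>"
proof -
  have "\<bar>f (x + a * z) (y + b * z)\<bar> <= L * (1 + \<bar>x + a * z\<bar> + \<bar>y + b * z\<bar>)"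
    using L by (simp add: tame_bound_def)
  also have "\<dots> <= L * (1 + (\<bar>x\<bar> + \<bar>a\<bar> * \<bar>z\<bar>) + (\<bar>y\<bar> + \<bar>b\<bar> * \<bar>z\<bar>))"
    using L abs_triangle_ineq[of x "a * z"] abs_triangle_ineq[of y "b * z"]
    by (intro mult_left_mono add_mono) (auto simp: abs_mult tame_bound_def)
  finally show ?thesis by (simp add: algebra_simps)
qed

lemma tame_sn_integrable:
  assumes L: "tame_bound L f" shows "integrable sn (\<lambda>z. f (x + a * z) (y + b * z))"
proof (rule sn_integrable_linear)
  have "tame f" using L by (auto simp: tame_def)
  then show "(\<lambda>z. f (x + a * z) (y + b * z)) \<in> borel_measurable borel" by (rule tame_measurable2) auto
  show "\<bar>f (x + a * z) (y + b * z)\<bar> <= L * (1 + \<bar>x\<bar> + \<bar>y\<bar>) + L * (\<bar>a\<bar> + \<bar>b\<bar>) * \<bar>z\<bar>" for z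
    by (rule tame_growth[OF L])
  show "0 <= L * (\<bar>a\<bar> + \<bar>b\<bar>)" using L by (simp add: tame_bound_def)
qed

text \<open>Closure of the class under averaging is what lets the law of large numbers proceed by
  induction on k. The new constant L (1 + 2 c) uses only E|z| <= 1.\<close>

lemma tame_smear:
  assumes "tame f" shows "tame (smear a b f)"
proof -
  obtain L where L: "tame_bound L f" using assms by (auto simp: tame_def)
  have L0: "0 <= L" using L by (simp add: tame_bound_def)
  define c where "c = \<bar>a\<bar> + \<bar>b\<bar>"
  have c0: "0 <= c" by (simp add: c_def)
  note int = tame_sn_integrable[OF L]
  define L' where "L' = L * (1 + 2 * c)"
  have iz: "integrable sn (\<lambda>z. \<bar>z\<bar>)" using sn_integrable_pow(2) by (rule integrable_abs)
  have "\<bar>smear a b f x y\<bar> <= L' * (1 + \<bar>x\<bar> + \<bar>y\<bar>)" for x y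
  proof -
    have "\<bar>smear a b f x y\<bar> <= (\<integral>z. \<bar>f (x + a * z) (y + b * z)\<bar> \<partial>sn)"
      unfolding smear_def by (rule integral_abs_bound)
    also have "\<dots> <= (\<integral>z. L * (1 + \<bar>x\<bar> + \<bar>y\<bar>) + L * c * \<bar>z\<bar> \<partial>sn)"
      by (rule integral_mono) (use int iz tame_growth[OF L] in \<open>auto simp: c_def\<close>)
    also have "\<dots> = L * (1 + \<bar>x\<bar> + \<bar>y\<bar>) + L * c * (\<integral>z. \<bar>z\<bar> \<partial>sn)" using iz by simp
    also have "\<dots> <= L * (1 + \<bar>x\<bar> + \<bar>y\<bar>) + L * c * 1"
      by (intro add_left_mono mult_left_mono sn_abs_le_1) (use L0 c0 in auto)
    also have "\<dots> <= L * (1 + \<bar>x\<bar> + \<bar>y\<bar>) + L * (2 * c) * (1 + \<bar>x\<bar> + \<bar>y\<bar>)"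
    proof (intro add_left_mono)
      have "L * c * 1 <= L * (2 * c) * (1 + \<bar>x\<bar> + \<bar>y\<bar>)"
        by (intro mult_mono) (use L0 c0 in auto)
      then show "L * c * 1 <= L * (2 * c) * (1 + \<bar>x\<bar> + \<bar>y\<bar>)" .
    qed
    also have "\<dots> = L' * (1 + \<bar>x\<bar> + \<bar>y\<bar>)" by (simp add: L'_def algebra_simps)
    finally show ?thesis .
  qed
  moreover have "\<bar>smear a b f x y - smear a b f x' y'\<bar> <= L' * (1 + \<bar>x\<bar> + \<bar>y\<bar> + \<bar>x'\<bar> + \<bar>y'\<bar>) * (\<bar>x - x'\<bar> + \<bar>y - y'\<bar>)" for x y x' y'
  proof -
    let ?d = "\<bar>x - x'\<bar> + \<bar>y - y'\<bar>" and ?S = "1 + \<bar>x\<bar> + \<bar>y\<bar> + \<bar>x'\<bar> + \<bar>y'\<bar>"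
    have pw: "\<bar>f (x + a * z) (y + b * z) - f (x' + a * z) (y' + b * z)\<bar> <= L * ?S * ?d + L * (2 * c) * ?d * \<bar>z\<bar>" for z
    proof -
      have "\<bar>f (x + a * z) (y + b * z) - f (x' + a * z) (y' + b * z)\<bar>
          <= L * (1 + \<bar>x + a * z\<bar> + \<bar>y + b * z\<bar> + \<bar>x' + a * z\<bar> + \<bar>y' + b * z\<bar>) * (\<bar>x + a * z - (x' + a * z)\<bar> + \<bar>y + b * z - (y' + b * z)\<bar>)"
        using L unfolding tame_bound_def by blast
      also have "\<dots> <= L * (?S + 2 * c * \<bar>z\<bar>) * ?d"
      proof (intro mult_mono mult_left_mono)
        have "\<bar>x + a * z\<bar> <= \<bar>x\<bar> + \<bar>a\<bar> * \<bar>z\<bar>" "\<bar>y + b * z\<bar> <= \<bar>y\<bar> + \<bar>b\<bar> * \<bar>z\<bar>"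
          "\<bar>x' + a * z\<bar> <= \<bar>x'\<bar> + \<bar>a\<bar> * \<bar>z\<bar>" "\<bar>y' + b * z\<bar> <= \<bar>y'\<bar> + \<bar>b\<bar> * \<bar>z\<bar>"
          by (rule order_trans[OF abs_triangle_ineq], simp add: abs_mult)+
        moreover have "2 * c * \<bar>z\<bar> = 2 * (\<bar>a\<bar> * \<bar>z\<bar>) + 2 * (\<bar>b\<bar> * \<bar>z\<bar>)" by (simp add: c_def algebra_simps)
        ultimately show "1 + \<bar>x + a * z\<bar> + \<bar>y + b * z\<bar> + \<bar>x' + a * z\<bar> + \<bar>y' + b * z\<bar> <= ?S + 2 * c * \<bar>z\<bar>" by linarith
      qed (use L0 c0 in auto)
      also have "\<dots> = L * ?S * ?d + L * (2 * c) * ?d * \<bar>z\<bar>" by (simp only: algebra_simps)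
      finally show ?thesis .
    qed
    have "smear a b f x y - smear a b f x' y' = (\<integral>z. f (x + a * z) (y + b * z) - f (x' + a * z) (y' + b * z) \<partial>sn)"
      unfolding smear_def using int by simp
    then have "\<bar>smear a b f x y - smear a b f x' y'\<bar> <= (\<integral>z. \<bar>f (x + a * z) (y + b * z) - f (x' + a * z) (y' + b * z)\<bar> \<partial>sn)"
      using integral_abs_bound[of sn "\<lambda>z. f (x + a * z) (y + b * z) - f (x' + a * z) (y' + b * z)"] by simp
    also have "\<dots> <= (\<integral>z. L * ?S * ?d + L * (2 * c) * ?d * \<bar>z\<bar> \<partial>sn)"
      by (rule integral_mono) (use int iz pw in auto)
    also have "\<dots> = L * ?S * ?d + L * (2 * c) * ?d * (\<integral>z. \<bar>z\<bar> \<partial>sn)" using iz by simp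
    also have "\<dots> <= L * ?S * ?d + L * (2 * c) * ?d * ?S"
      by (intro add_left_mono mult_left_mono order_trans[OF sn_abs_le_1]) (use L0 c0 in auto)
    also have "\<dots> = L' * ?S * ?d" unfolding L'_def by (simp only: algebra_simps)
    finally show ?thesis .
  qed
  ultimately have "tame_bound L' (smear a b f)" using L0 c0 by (auto simp: tame_bound_def L'_def)
  then show ?thesis by (auto simp: tame_def)
qed

text \<open>The limit of the empirical averages: zeta^(1), ..., zeta^(k) behave site by site like
  independent standard Gaussians.\<close>

definition Ef :: "nat => (real => real => real) => (nat => real) => (nat => real) => real" where
  "Ef k f a b = (\<integral>x. f (\<Sum>s=1..k. a s * x s) (\<Sum>s=1..k. b s * x s) \<partial>gs {1..k})"

lemma tame_gs_integrable:
  assumes f: "tame f" and I: "finite I"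
  shows "integrable (gs I) (\<lambda>x. f (\<Sum>s\<in>I. a s * x s) (\<Sum>s\<in>I. b s * x s))"
proof -
  obtain L where L: "tame_bound L f" using f by (auto simp: tame_def)
  interpret g: prob_space "gs I" by (rule prob_space_gs)
  have i: "integrable (gs I) (\<lambda>x. L * (1 + (\<Sum>s\<in>I. \<bar>a s * x s\<bar>) + (\<Sum>s\<in>I. \<bar>b s * x s\<bar>)))"
    using I gs_integral_coordinate(2)[OF I, of _ "\<lambda>x. x"]
    by (intro integrable_mult_right Bochner_Integration.integrable_add Bochner_Integration.integrable_sum integrable_abs) auto
  show ?thesis
  proof (rule Bochner_Integration.integrable_bound[OF i])
    show "(\<lambda>x. f (\<Sum>s\<in>I. a s * x s) (\<Sum>s\<in>I. b s * x s)) \<in> borel_measurable (gs I)"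
      by (rule tame_measurable2[OF f]) measurable
    show "AE x in gs I. norm (f (\<Sum>s\<in>I. a s * x s) (\<Sum>s\<in>I. b s * x s)) <= norm (L * (1 + (\<Sum>s\<in>I. \<bar>a s * x s\<bar>) + (\<Sum>s\<in>I. \<bar>b s * x s\<bar>)))"
    proof (rule AE_I2)
      fix x :: "'a => real"
      have "\<bar>f (\<Sum>s\<in>I. a s * x s) (\<Sum>s\<in>I. b s * x s)\<bar> <= L * (1 + \<bar>\<Sum>s\<in>I. a s * x s\<bar> + \<bar>\<Sum>s\<in>I. b s * x s\<bar>)"
        using L by (simp add: tame_bound_def)
      also have "\<dots> <= L * (1 + (\<Sum>s\<in>I. \<bar>a s * x s\<bar>) + (\<Sum>s\<in>I. \<bar>b s * x s\<bar>))"
        using L by (intro mult_left_mono add_mono sum_abs order_refl) (simp add: tame_bound_def)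
      finally show "norm (f (\<Sum>s\<in>I. a s * x s) (\<Sum>s\<in>I. b s * x s)) <= norm (L * (1 + (\<Sum>s\<in>I. \<bar>a s * x s\<bar>) + (\<Sum>s\<in>I. \<bar>b s * x s\<bar>)))"
        unfolding real_norm_def by (rule order_trans[OF _ abs_ge_self])
    qed
  qed
qed

text \<open>Fubini in the last coordinate. It matches one step of the iteration, in which averaging
  over the fresh vector replaces f by its smeared version.\<close>

lemma Ef_Suc:
  assumes f: "tame f" shows "Ef (Suc k) f a b = Ef k (smear (a (Suc k)) (b (Suc k)) f) a b"
proof -
  let ?F = "\<lambda>x. f (\<Sum>s=1..Suc k. a s * x s) (\<Sum>s=1..Suc k. b s * x s)"
  have s: "{1..Suc k} = insert (Suc k) {1..k}" by auto
  have "integrable (gs {1..Suc k}) ?F" by (rule tame_gs_integrable[OF f]) simp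
  then have "Ef (Suc k) f a b = (\<integral>x. (\<integral>y. ?F (x(Suc k := y)) \<partial>sn) \<partial>gs {1..k})"
    unfolding Ef_def s by (intro GS.product_integral_insert) auto
  also have "\<dots> = Ef k (smear (a (Suc k)) (b (Suc k)) f) a b"
    unfolding Ef_def smear_def by simp
  finally show ?thesis .
qed

lemma Gv_second_moment:
  assumes F[measurable]: "\<And>i. F i \<in> borel_measurable borel" and int: "\<And>i. integrable sn (\<lambda>x. (F i x)\<^sup>2)"
  shows "(\<integral>\<^sup>+\<omega>. ennreal ((\<Sum>i<N. F i (\<omega> i) - (\<integral>y. F i y \<partial>sn))\<^sup>2) \<partial>Gv N) <= ennreal (\<Sum>i<N. \<integral>x. (F i x)\<^sup>2 \<partial>sn)"
proof -
  note g = gs_sum_second_moment[of "{..<N}" F, OF finite_lessThan F int]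
  have [measurable]: "(\<lambda>\<omega>::vect. \<omega> i) \<in> borel_measurable borel" for i by (rule vect_entry) simp
  have "(\<integral>\<^sup>+\<omega>. ennreal ((\<Sum>i<N. F i (\<omega> i) - (\<integral>y. F i y \<partial>sn))\<^sup>2) \<partial>Gv N)
     = (\<integral>\<^sup>+x. ennreal ((\<Sum>i<N. F i (if i < N then x i else 0) - (\<integral>y. F i y \<partial>sn))\<^sup>2) \<partial>gs {..<N})"
    by (rule nn_integral_Gv) measurable
  also have "\<dots> = (\<integral>\<^sup>+x. ennreal ((\<Sum>i<N. F i (x i) - (\<integral>y. F i y \<partial>sn))\<^sup>2) \<partial>gs {..<N})"
    by (intro nn_integral_cong arg_cong[of _ _ ennreal] arg_cong[of _ _ "\<lambda>x. x\<^sup>2"] sum.cong) auto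
  also have "\<dots> = ennreal (\<integral>x. (\<Sum>i<N. F i (x i) - (\<integral>y. F i y \<partial>sn))\<^sup>2 \<partial>gs {..<N})"
    by (rule nn_integral_eq_integral[OF g(1)]) simp
  also have "\<dots> <= ennreal (\<Sum>i<N. \<integral>x. (F i x)\<^sup>2 \<partial>sn)" by (rule ennreal_leI[OF g(2)])
  finally show ?thesis .
qed

lemma Gv_ip_square: "(\<integral>\<^sup>+\<omega>. ennreal ((ip N y \<omega>)\<^sup>2) \<partial>Gv N) <= ennreal (ip N y y / real N)"
proof -
  define F where "F i x = y i / real N * x" for i and x :: real
  have F0: "(\<integral>x. F i x \<partial>sn) = 0" for i by (simp add: F_def sn_moments)
  have F2: "(F i x)\<^sup>2 = (y i / real N)\<^sup>2 * x\<^sup>2" for i x by (simp add: F_def power_mult_distrib power_divide)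
  have "(\<integral>\<^sup>+\<omega>. ennreal ((\<Sum>i<N. F i (\<omega> i) - (\<integral>y. F i y \<partial>sn))\<^sup>2) \<partial>Gv N) <= ennreal (\<Sum>i<N. \<integral>x. (F i x)\<^sup>2 \<partial>sn)"
    by (rule Gv_second_moment) (simp add: F_def, simp add: F2)
  also have "(\<Sum>i<N. \<integral>x. (F i x)\<^sup>2 \<partial>sn) = ip N y y / real N"
  proof -
    have "(\<integral>x. (F i x)\<^sup>2 \<partial>sn) = (y i / real N)\<^sup>2" for i unfolding F2 by (simp add: sn_moments)
    then show ?thesis by (simp add: ip_def power_divide power2_eq_square sum_divide_distrib)
  qed
  also have "(\<lambda>\<omega>. \<Sum>i<N. F i (\<omega> i) - (\<integral>y. F i y \<partial>sn)) = ip N y"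
    unfolding F0 by (auto simp: F_def ip_def sum_divide_distrib)
  finally show ?thesis .
qed

lemma Gv_norm:
  assumes N: "N >= 1" shows "(\<integral>\<^sup>+\<omega>. ennreal ((ip N \<omega> \<omega> - 1)\<^sup>2) \<partial>Gv N) <= ennreal (3 / real N)"
proof -
  define F where "F i x = x\<^sup>2 / real N" for i :: nat and x :: real
  have F0: "(\<integral>x. F i x \<partial>sn) = 1 / real N" for i by (simp add: F_def sn_moments)
  have F2: "(F i x)\<^sup>2 = x^4 / (real N)\<^sup>2" for i x by (simp add: F_def power_divide)
  have "(\<integral>\<^sup>+\<omega>. ennreal ((\<Sum>i<N. F i (\<omega> i) - (\<integral>y. F i y \<partial>sn))\<^sup>2) \<partial>Gv N) <= ennreal (\<Sum>i<N. \<integral>x. (F i x)\<^sup>2 \<partial>sn)"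
    by (rule Gv_second_moment) (simp add: F_def, simp add: F2)
  also have "(\<Sum>i<N. \<integral>x. (F i x)\<^sup>2 \<partial>sn) = 3 / real N"
    unfolding F2 using N by (simp add: sn_moments power2_eq_square)
  also have "(\<lambda>\<omega>. \<Sum>i<N. F i (\<omega> i) - (\<integral>y. F i y \<partial>sn)) = (\<lambda>\<omega>. ip N \<omega> \<omega> - 1)"
    unfolding F0 using N by (auto simp: F_def ip_def sum_divide_distrib sum_subtractf power2_eq_square)
  finally show ?thesis .
qed

lemma Gv_half_sum:
  assumes F[measurable]: "F \<in> borel_measurable borel"
  shows "(\<integral>\<^sup>+w. \<integral>\<^sup>+v. F (\<lambda>i. (w i + v i) / sqrt 2) \<partial>Gv N \<partial>Gv N) = (\<integral>\<^sup>+\<omega>. F \<omega> \<partial>Gv N)"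
proof -
  let ?e = "\<lambda>x i. if i < N then x i else (0::real)"
  have R: "(\<lambda>x. F (\<lambda>i. (f x i + g x i) / sqrt 2)) \<in> borel_measurable M"
    if "f \<in> borel_measurable M" "g \<in> borel_measurable M" for f g and M :: "'z measure"
  proof (rule measurable_compose[OF _ F], rule borel_measurable_vect)
    show "(\<lambda>x. (f x i + g x i) / sqrt 2) \<in> borel_measurable M" for i
      using vect_entry[OF that(1), of i] vect_entry[OF that(2), of i] by measurable
  qed
  have R2: "(\<lambda>w. \<integral>\<^sup>+v. F (\<lambda>i. (w i + v i) / sqrt 2) \<partial>Gv N) \<in> borel_measurable borel"
  proof (rule Gv.borel_measurable_nn_integral)
    have "(\<lambda>x. F (\<lambda>i. (fst x i + snd x i) / sqrt 2)) \<in> borel_measurable (borel \<Otimes>\<^sub>M Gv N)" by (rule R) measurable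
    then show "(\<lambda>(w, v). F (\<lambda>i. (w i + v i) / sqrt 2)) \<in> borel_measurable (borel \<Otimes>\<^sub>M Gv N)" by (simp only: case_prod_beta')
  qed
  have e: "(\<lambda>i. (?e x i + ?e y i) / sqrt 2) = ?e (\<lambda>i\<in>{..<N}. (x i + y i) / sqrt 2)" for x y
    by auto
  have "(\<integral>\<^sup>+w. \<integral>\<^sup>+v. F (\<lambda>i. (w i + v i) / sqrt 2) \<partial>Gv N \<partial>Gv N)
     = (\<integral>\<^sup>+x. \<integral>\<^sup>+v. F (\<lambda>i. (?e x i + v i) / sqrt 2) \<partial>Gv N \<partial>gs {..<N})"
    by (rule nn_integral_Gv[OF R2])
  also have "\<dots> = (\<integral>\<^sup>+x. \<integral>\<^sup>+y. F (\<lambda>i. (?e x i + ?e y i) / sqrt 2) \<partial>gs {..<N} \<partial>gs {..<N})"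
    by (intro nn_integral_cong nn_integral_Gv R) simp_all
  also have "\<dots> = (\<integral>\<^sup>+x. F (?e x) \<partial>gs {..<N})"
    unfolding e by (rule gs_half_sum) (simp, rule measurable_compose[OF Gv_emb F])
  also have "\<dots> = (\<integral>\<^sup>+\<omega>. F \<omega> \<partial>Gv N)" by (rule nn_integral_Gv[OF F, symmetric])
  finally show ?thesis .
qed

lemma Gv_smear:
  fixes a b :: real and p q :: vect
  assumes L: "tame_bound L f" and N: "N >= 1"
  defines "c \<equiv> \<bar>a\<bar> + \<bar>b\<bar>"
  shows "(\<integral>\<^sup>+\<omega>. ennreal (((\<Sum>i<N. f (p i + a * \<omega> i) (q i + b * \<omega> i)) / real N - (\<Sum>i<N. smear a b f (p i) (q i)) / real N)\<^sup>2) \<partial>Gv N)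
    <= ennreal (4 * L\<^sup>2 * (1 + ip N p p + ip N q q + c\<^sup>2) / real N)"
proof -
  have f: "tame f" using L by (auto simp: tame_def)
  define F where "F i x = f (p i + a * x) (q i + b * x) / real N" for i x
  have F0: "(\<integral>x. F i x \<partial>sn) = smear a b f (p i) (q i) / real N" for i by (simp add: F_def smear_def)
  have mF: "F i \<in> borel_measurable borel" for i
    unfolding F_def by (intro borel_measurable_divide tame_measurable2[OF f]) measurable
  have sq: "(1 + u + v + w)\<^sup>2 <= 4 * (1 + u\<^sup>2 + v\<^sup>2 + w\<^sup>2)" for u v w :: real
  proof -
    have "4 * (1 + u\<^sup>2 + v\<^sup>2 + w\<^sup>2) - (1 + u + v + w)\<^sup>2 = (1-u)\<^sup>2 + (1-v)\<^sup>2 + (1-w)\<^sup>2 + (u-v)\<^sup>2 + (u-w)\<^sup>2 + (v-w)\<^sup>2"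
      by (simp add: power2_eq_square algebra_simps)
    moreover have "0 <= (1-u)\<^sup>2 + (1-v)\<^sup>2 + (1-w)\<^sup>2 + (u-v)\<^sup>2 + (u-w)\<^sup>2 + (v-w)\<^sup>2" by simp
    ultimately show ?thesis by linarith
  qed
  have b: "(F i x)\<^sup>2 <= 4 * L\<^sup>2 / (real N)\<^sup>2 * (1 + (p i)\<^sup>2 + (q i)\<^sup>2 + c\<^sup>2 * x\<^sup>2)" for i x
  proof -
    have "\<bar>f (p i + a * x) (q i + b * x)\<bar> <= L * (1 + \<bar>p i\<bar> + \<bar>q i\<bar> + c * \<bar>x\<bar>)"
      using tame_growth[OF L, of "p i" a x "q i" b] by (simp add: c_def algebra_simps)
    then have "\<bar>f (p i + a * x) (q i + b * x)\<bar>\<^sup>2 <= (L * (1 + \<bar>p i\<bar> + \<bar>q i\<bar> + c * \<bar>x\<bar>))\<^sup>2" by (rule power_mono) simp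
    also have "\<dots> = L\<^sup>2 * (1 + \<bar>p i\<bar> + \<bar>q i\<bar> + c * \<bar>x\<bar>)\<^sup>2" by (rule power_mult_distrib)
    also have "\<dots> <= L\<^sup>2 * (4 * (1 + \<bar>p i\<bar>\<^sup>2 + \<bar>q i\<bar>\<^sup>2 + (c * \<bar>x\<bar>)\<^sup>2))" by (rule mult_left_mono[OF sq]) simp
    also have "\<dots> = 4 * L\<^sup>2 * (1 + (p i)\<^sup>2 + (q i)\<^sup>2 + c\<^sup>2 * x\<^sup>2)" by (simp add: power_mult_distrib)
    finally have "(f (p i + a * x) (q i + b * x))\<^sup>2 <= 4 * L\<^sup>2 * (1 + (p i)\<^sup>2 + (q i)\<^sup>2 + c\<^sup>2 * x\<^sup>2)" by simp
    from divide_right_mono[OF this, of "(real N)\<^sup>2"] show ?thesis by (simp add: F_def power_divide)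
  qed
  have i2: "integrable sn (\<lambda>x. (F i x)\<^sup>2)" for i
  proof (rule sn_integrable_quadratic)
    show "\<bar>(F i x)\<^sup>2\<bar> <= 4 * L\<^sup>2 / (real N)\<^sup>2 * (1 + (p i)\<^sup>2 + (q i)\<^sup>2) + 4 * L\<^sup>2 / (real N)\<^sup>2 * c\<^sup>2 * x\<^sup>2" for x
      using b[of i x] by (simp add: algebra_simps add_divide_distrib)
  qed (use mF in auto)
  have "(\<integral>x. (F i x)\<^sup>2 \<partial>sn) <= 4 * L\<^sup>2 / (real N)\<^sup>2 * (1 + (p i)\<^sup>2 + (q i)\<^sup>2 + c\<^sup>2)" for i
  proof -
    have "(\<integral>x. (F i x)\<^sup>2 \<partial>sn) <= (\<integral>x. 4 * L\<^sup>2 / (real N)\<^sup>2 * (1 + (p i)\<^sup>2 + (q i)\<^sup>2 + c\<^sup>2 * x\<^sup>2) \<partial>sn)"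
      by (rule integral_mono[OF i2 _ b]) simp
    then show ?thesis by (simp add: sn_moments)
  qed
  then have "(\<Sum>i<N. \<integral>x. (F i x)\<^sup>2 \<partial>sn) <= (\<Sum>i<N. 4 * L\<^sup>2 / (real N)\<^sup>2 * (1 + (p i)\<^sup>2 + (q i)\<^sup>2 + c\<^sup>2))"
    by (intro sum_mono)
  also have "\<dots> = 4 * L\<^sup>2 * (1 + ip N p p + ip N q q + c\<^sup>2) / real N"
  proof -
    have "(\<Sum>i<N. 1 + (p i)\<^sup>2 + (q i)\<^sup>2 + c\<^sup>2) = real N * (1 + ip N p p + ip N q q + c\<^sup>2)"
      using N by (simp add: sum.distrib ip_def power2_eq_square algebra_simps)
    then have "4 * L\<^sup>2 / (real N)\<^sup>2 * (\<Sum>i<N. 1 + (p i)\<^sup>2 + (q i)\<^sup>2 + c\<^sup>2) = 4 * L\<^sup>2 * (1 + ip N p p + ip N q q + c\<^sup>2) / real N"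
      using N by (simp add: power2_eq_square)
    then show ?thesis by (simp only: sum_distrib_left)
  qed
  finally have S: "(\<Sum>i<N. \<integral>x. (F i x)\<^sup>2 \<partial>sn) <= 4 * L\<^sup>2 * (1 + ip N p p + ip N q q + c\<^sup>2) / real N" .
  have "(\<integral>\<^sup>+\<omega>. ennreal ((\<Sum>i<N. F i (\<omega> i) - (\<integral>y. F i y \<partial>sn))\<^sup>2) \<partial>Gv N) <= ennreal (4 * L\<^sup>2 * (1 + ip N p p + ip N q q + c\<^sup>2) / real N)"
    by (rule order_trans[OF Gv_second_moment[OF mF i2] ennreal_leI[OF S]])
  also have "(\<lambda>\<omega>. \<Sum>i<N. F i (\<omega> i) - (\<integral>y. F i y \<partial>sn)) = (\<lambda>\<omega>. (\<Sum>i<N. f (p i + a * \<omega> i) (q i + b * \<omega> i)) / real N - (\<Sum>i<N. smear a b f (p i) (q i)) / real N)"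
    unfolding F0 by (auto simp: F_def sum_subtractf sum_divide_distrib)
  finally show ?thesis .
qed

text \<open>The space that carries one step of the iteration: the matrix with its first k steps, and
  the two independent vectors from which xi^(k+1) and eta^(k+1) are built.\<close>

definition PN :: "nat => (matr \<times> vect \<times> vect) measure" where
  "PN N = Gm N \<Otimes>\<^sub>M (Gv N \<Otimes>\<^sub>M Gv N)"

lemma sets_PN [simp, measurable_cong]: "sets (PN N) = sets (borel \<Otimes>\<^sub>M (borel \<Otimes>\<^sub>M borel))"
  unfolding PN_def by (intro sets_pair_measure_cong) simp_all

lemma space_PN [simp]: "space (PN N) = UNIV"
  by (simp add: PN_def space_pair_measure)

lemma prob_space_PN: "prob_space (PN N)"
proof -
  interpret V: pair_prob_space "Gv N" "Gv N" ..
  interpret P: pair_prob_space "Gm N" "Gv N \<Otimes>\<^sub>M Gv N" ..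
  show ?thesis unfolding PN_def by (rule P.P.prob_space_axioms)
qed

global_interpretation G: prob_seq Gm by (rule prob_seq.intro) (rule prob_space_Gm)
global_interpretation P: prob_seq PN by (rule prob_seq.intro) (rule prob_space_PN)

lemma nn_integral_PN:
  assumes F: "F \<in> borel_measurable (borel \<Otimes>\<^sub>M (borel \<Otimes>\<^sub>M borel))"
  shows "(\<integral>\<^sup>+x. F x \<partial>PN N) = (\<integral>\<^sup>+A. \<integral>\<^sup>+w. \<integral>\<^sup>+v. F (A, w, v) \<partial>Gv N \<partial>Gv N \<partial>Gm N)"
proof -
  interpret V: pair_prob_space "Gv N" "Gv N" ..
  have m: "F \<in> borel_measurable (Gm N \<Otimes>\<^sub>M (Gv N \<Otimes>\<^sub>M Gv N))"
    using F sets_PN[of N] unfolding PN_def by (simp cong: measurable_cong_sets)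
  have "(\<integral>\<^sup>+x. F x \<partial>PN N) = (\<integral>\<^sup>+A. \<integral>\<^sup>+y. F (A, y) \<partial>(Gv N \<Otimes>\<^sub>M Gv N) \<partial>Gm N)"
    unfolding PN_def by (rule V.P.nn_integral_fst[OF m, symmetric])
  also have "\<dots> = (\<integral>\<^sup>+A. \<integral>\<^sup>+w. \<integral>\<^sup>+v. F (A, w, v) \<partial>Gv N \<partial>Gv N \<partial>Gm N)"
  proof (rule nn_integral_cong)
    fix A
    have "(\<lambda>y. F (A, y)) \<in> borel_measurable (Gv N \<Otimes>\<^sub>M Gv N)"
      by (rule measurable_compose[OF _ m]) (simp add: measurable_Pair1')
    from Gv.nn_integral_fst[OF this] show "(\<integral>\<^sup>+y. F (A, y) \<partial>(Gv N \<Otimes>\<^sub>M Gv N)) = (\<integral>\<^sup>+w. \<integral>\<^sup>+v. F (A, w, v) \<partial>Gv N \<partial>Gv N)" by simp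
  qed
  finally show ?thesis .
qed

lemma PN_entry:
  "(\<lambda>x. fst x) \<in> borel_measurable (PN N)" "(\<lambda>x. fst x i j) \<in> borel_measurable (PN N)"
  "(\<lambda>x. fst (snd x) i) \<in> borel_measurable (PN N)" "(\<lambda>x. snd (snd x) i) \<in> borel_measurable (PN N)"
proof -
  show 1: "(\<lambda>x. fst x) \<in> borel_measurable (PN N)" by measurable
  show "(\<lambda>x. fst x i j) \<in> borel_measurable (PN N)" by (rule matr_entry[OF 1])
  have "(\<lambda>x. fst (snd x)) \<in> borel_measurable (PN N)" by measurable
  then show "(\<lambda>x. fst (snd x) i) \<in> borel_measurable (PN N)" by (rule vect_entry)
  have "(\<lambda>x. snd (snd x)) \<in> borel_measurable (PN N)" by measurable
  then show "(\<lambda>x. snd (snd x) i) \<in> borel_measurable (PN N)" by (rule vect_entry)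
qed

lemma PN_lift:
  assumes X: "G.cvp X c" shows "P.cvp (\<lambda>N x. X N (fst x)) c"
  unfolding P.cvp_def
proof (intro conjI allI impI)
  have m: "X N \<in> borel_measurable borel" for N using G.cvp_measurable[OF X, of N] by (simp cong: measurable_cong_sets)
  show "(\<lambda>x. X N (fst x)) \<in> borel_measurable (PN N)" for N by (rule measurable_compose[OF PN_entry(1) m])
  fix \<epsilon> :: real assume \<epsilon>: "0 < \<epsilon>"
  have "measure (PN N) {x \<in> space (PN N). \<epsilon> < \<bar>X N (fst x) - c\<bar>} = measure (Gm N) {A \<in> space (Gm N). \<epsilon> < \<bar>X N A - c\<bar>}" for N
  proof -
    let ?S = "{A. \<epsilon> < \<bar>X N A - c\<bar>}"
    have [measurable]: "X N \<in> borel_measurable borel" by (rule m)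
    have S: "?S \<in> sets borel" by measurable
    have iS: "(\<lambda>x. indicator ?S (fst x) :: ennreal) \<in> borel_measurable (borel \<Otimes>\<^sub>M (borel \<Otimes>\<^sub>M borel))"
      by (rule measurable_compose[OF measurable_fst]) (use S in simp)
    have S': "{x. \<epsilon> < \<bar>X N (fst x) - c\<bar>} \<in> sets (PN N)"
      using measurable_sets[OF PN_entry(1), of ?S N] S by (simp add: vimage_def)
    have "emeasure (PN N) {x. \<epsilon> < \<bar>X N (fst x) - c\<bar>} = (\<integral>\<^sup>+x. indicator ?S (fst x) \<partial>PN N)"
      unfolding nn_integral_indicator[OF S', symmetric] by (rule nn_integral_cong) (simp split: split_indicator)
    also have "\<dots> = (\<integral>\<^sup>+A. indicator ?S A \<partial>Gm N)"
      by (subst nn_integral_PN[OF iS]) simp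
    also have "\<dots> = emeasure (Gm N) ?S" by (rule nn_integral_indicator) (use S in simp)
    finally show ?thesis by (simp add: measure_def)
  qed
  then show "(\<lambda>N. measure (PN N) {x \<in> space (PN N). \<epsilon> < \<bar>X N (fst x) - c\<bar>}) \<longlonglongrightarrow> 0"
    using G.cvp_tendsto[OF X \<epsilon>] by simp
qed

text \<open>By \<open>Gm_resample_refresh\<close> a quantity of the disorder has the law of its
  version on the resampled and refreshed matrix. If that version depends on A, w, v alone, it can be
  studied on \<open>PN N\<close>.\<close>

lemma PN_transfer:
  assumes Y: "\<And>N. Y N \<in> borel_measurable borel" and blk: "\<And>N. on_block N (Y N)"
    and eq: "\<And>N A g w v. N >= 1 ==> Y N (resample \<beta> h N k A (refresh N (it_phi \<beta> h N A (Suc k)) w v g)) = Y' N (A, w, v)"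
    and Y': "P.cvp Y' c"
  shows "G.cvp Y c"
  unfolding G.cvp_def
proof (intro conjI allI impI)
  show "Y N \<in> borel_measurable (Gm N)" for N using Y by (simp cong: measurable_cong_sets)
  fix \<epsilon> :: real assume \<epsilon>: "0 < \<epsilon>"
  have "measure (Gm N) {A \<in> space (Gm N). \<epsilon> < \<bar>Y N A - c\<bar>} = measure (PN N) {x \<in> space (PN N). \<epsilon> < \<bar>Y' N x - c\<bar>}" if N: "N >= 1" for N
  proof -
    let ?S = "{y. \<epsilon> < \<bar>y - c\<bar>}"
    have S: "?S \<in> sets borel" by measurable
    have [measurable]: "Y N \<in> borel_measurable borel" by (rule Y)
    have mY': "Y' N \<in> borel_measurable (borel \<Otimes>\<^sub>M (borel \<Otimes>\<^sub>M borel))"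
      using P.cvp_measurable[OF Y', of N] by (simp cong: measurable_cong_sets)
    have i1: "(\<lambda>A. indicator ?S (Y N A) :: ennreal) \<in> borel_measurable borel" by (rule measurable_compose[OF Y]) (use S in simp)
    have i2: "(\<lambda>x. indicator ?S (Y' N x) :: ennreal) \<in> borel_measurable (borel \<Otimes>\<^sub>M (borel \<Otimes>\<^sub>M borel))"
      by (rule measurable_compose[OF mY']) (use S in simp)
    have b: "on_block N (\<lambda>A. indicator ?S (Y N A) :: ennreal)"
      by (rule on_block_comp2[OF blk blk, where f="\<lambda>x y. indicator ?S x"])
    have S1: "{A. \<epsilon> < \<bar>Y N A - c\<bar>} \<in> sets (Gm N)" by simp
    have S2: "{x. \<epsilon> < \<bar>Y' N x - c\<bar>} \<in> sets (PN N)"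
      using measurable_sets[OF mY', of ?S] S by (simp add: vimage_def space_pair_measure)
    have "emeasure (Gm N) {A. \<epsilon> < \<bar>Y N A - c\<bar>} = (\<integral>\<^sup>+A. indicator ?S (Y N A) \<partial>Gm N)"
      unfolding nn_integral_indicator[OF S1, symmetric] by (rule nn_integral_cong) (simp split: split_indicator)
    also have "\<dots> = (\<integral>\<^sup>+A. \<integral>\<^sup>+g. \<integral>\<^sup>+w. \<integral>\<^sup>+v. indicator ?S (Y N (resample \<beta> h N k A (refresh N (it_phi \<beta> h N A (Suc k)) w v g))) \<partial>Gv N \<partial>Gv N \<partial>Gm N \<partial>Gm N)"
      by (rule Gm_resample_refresh[OF N i1 b])
    also have "\<dots> = (\<integral>\<^sup>+A. \<integral>\<^sup>+w. \<integral>\<^sup>+v. indicator ?S (Y' N (A, w, v)) \<partial>Gv N \<partial>Gv N \<partial>Gm N)"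
      unfolding eq[OF N] by simp
    also have "\<dots> = (\<integral>\<^sup>+x. indicator ?S (Y' N x) \<partial>PN N)" by (rule nn_integral_PN[OF i2, symmetric])
    also have "\<dots> = emeasure (PN N) {x. \<epsilon> < \<bar>Y' N x - c\<bar>}"
      unfolding nn_integral_indicator[OF S2, symmetric] by (rule nn_integral_cong) (simp split: split_indicator)
    finally show ?thesis by (simp add: measure_def)
  qed
  then have "\<forall>\<^sub>F N in sequentially. measure (PN N) {x \<in> space (PN N). \<epsilon> < \<bar>Y' N x - c\<bar>} = measure (Gm N) {A \<in> space (Gm N). \<epsilon> < \<bar>Y N A - c\<bar>}"
    by (intro eventually_sequentiallyI[of 1]) simp
  from Lim_transform_eventually[OF P.cvp_tendsto[OF Y' \<epsilon>] this]
  show "(\<lambda>N. measure (Gm N) {A \<in> space (Gm N). \<epsilon> < \<bar>Y N A - c\<bar>}) \<longlonglongrightarrow> 0" .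
qed

lemma PN_markov:
  assumes T: "\<And>N. T N \<in> borel_measurable (PN N)" and nn: "\<And>N x. 0 <= T N x"
    and le: "\<And>N A. N >= 1 ==> (\<integral>\<^sup>+w. \<integral>\<^sup>+v. ennreal (T N (A, w, v)) \<partial>Gv N \<partial>Gv N) <= ennreal (C / real N)"
  shows "P.cvp T 0"
proof (rule P.cvp_markov[OF T nn, where e="\<lambda>N. C / real N"])
  show "\<forall>\<^sub>F N in sequentially. (\<integral>\<^sup>+x. ennreal (T N x) \<partial>PN N) <= ennreal (C / real N)"
  proof (rule eventually_sequentiallyI[of 1])
    fix N :: nat assume N: "1 <= N"
    have m: "(\<lambda>x. ennreal (T N x)) \<in> borel_measurable (borel \<Otimes>\<^sub>M (borel \<Otimes>\<^sub>M borel))"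
      using T[of N] by (simp cong: measurable_cong_sets)
    have "(\<integral>\<^sup>+x. ennreal (T N x) \<partial>PN N) = (\<integral>\<^sup>+A. \<integral>\<^sup>+w. \<integral>\<^sup>+v. ennreal (T N (A, w, v)) \<partial>Gv N \<partial>Gv N \<partial>Gm N)"
      by (rule nn_integral_PN[OF m])
    also have "\<dots> <= (\<integral>\<^sup>+A. ennreal (C / real N) \<partial>Gm N)"
      by (rule nn_integral_mono) (rule le[OF N])
    finally show "(\<integral>\<^sup>+x. ennreal (T N x) \<partial>PN N) <= ennreal (C / real N)" by simp
  qed
  show "(\<lambda>N. C / real N) \<longlonglongrightarrow> 0" by (rule lim_const_over_n)
qed

lemma ip_orthogonal_sums:
  assumes S: "finite S" and orth: "\<And>s t. s \<in> S ==> t \<in> S ==> s ~= t ==> ip N (p s) (p t) = 0"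
  shows "ip N (\<lambda>i. \<Sum>s\<in>S. c s * p s i) (\<lambda>i. \<Sum>s\<in>S. d s * p s i) = (\<Sum>s\<in>S. c s * d s * ip N (p s) (p s))"
proof -
  have "ip N (\<lambda>i. \<Sum>s\<in>S. c s * p s i) (\<lambda>i. \<Sum>s\<in>S. d s * p s i) = (\<Sum>s\<in>S. \<Sum>t\<in>S. c s * (d t * ip N (p s) (p t)))"
    unfolding ip_sum ip_linear sum_distrib_left by (rule refl)
  also have "\<dots> = (\<Sum>s\<in>S. \<Sum>t\<in>S. if t = s then c s * d s * ip N (p s) (p s) else 0)"
    by (intro sum.cong refl) (auto simp: orth)
  finally show ?thesis using S by (simp add: sum.delta)
qed

lemma ip_cauchy_schwarz: "(ip N x y)\<^sup>2 <= ip N x x * ip N y y"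
proof -
  have "(\<Sum>i<N. x i * y i)\<^sup>2 <= (\<Sum>i<N. (x i)\<^sup>2) * (\<Sum>i<N. (y i)\<^sup>2)" by (rule Cauchy_Schwarz_ineq_sum)
  from divide_right_mono[OF this, of "(real N)\<^sup>2"] show ?thesis
    by (simp add: ip_def power_divide power2_eq_square)
qed

lemma unit_or_zero_ip: "unit_or_zero N x ==> ip N x x = 0 \<or> ip N x x = 1"
  by (auto simp: unit_or_zero_def ip_zero)

lemma ip_phi:
  assumes "N >= 1" "s >= 1"
  shows "ip N (it_phi \<beta> h N A s) (it_phi \<beta> h N A s) \<in> {0..1}"
  using unit_or_zero_ip[OF it_phi_unit_or_zero[OF assms, of \<beta> h A]] by auto

text \<open>Because z is orthogonal to all directions, the right-hand projections act trivially and
  only those applied to the image remain.\<close>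

lemma mult_mv_deflates:
  assumes N: "N >= 1" and z: "\<And>s. s \<in> {1..k} ==> ip N (it_phi \<beta> h N A s) z = 0"
  shows "mult_mv N (deflates \<beta> h N k A X) z = (\<lambda>i. mult_mv N X z i - (\<Sum>s=1..k. ip N (it_phi \<beta> h N A s) (mult_mv N X z) * it_phi \<beta> h N A s i))"
  using z
proof (induction k)
  case (Suc k)
  let ?p = "it_phi \<beta> h N A" and ?g = "deflates \<beta> h N k A X"
  have IH: "mult_mv N ?g z = (\<lambda>i. mult_mv N X z i - (\<Sum>s=1..k. ip N (?p s) (mult_mv N X z) * ?p s i))"
    by (rule Suc.IH) (rule Suc.prems, simp)
  have z0: "ip N (?p (Suc k)) z = 0" by (rule Suc.prems) simp
  have "(\<Sum>s=1..k. ip N (?p s) (mult_mv N X z) * ip N (?p (Suc k)) (?p s)) = 0"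
    by (rule sum.neutral) (use it_phi_orthogonal[OF N] in auto)
  then have e: "ip N (?p (Suc k)) (mult_mv N ?g z) = ip N (?p (Suc k)) (mult_mv N X z)"
    unfolding IH ip_linear ip_sum by simp
  show ?case
    unfolding deflates.simps mult_mv_deflate z0 e by (auto simp: IH)
qed simp

lemma borel_measurable_Gm: "f \<in> borel_measurable borel ==> f \<in> borel_measurable (Gm N)"
  by (simp cong: measurable_cong_sets)

lemma borel_measurable_PN: "f \<in> borel_measurable borel ==> (\<lambda>x. f (fst x)) \<in> borel_measurable (PN N)"
  by (rule measurable_compose[OF PN_entry(1)])

lemma ip_measurable_raw [measurable (raw)]:
  assumes "\<And>i. (\<lambda>x. q x i) \<in> borel_measurable M" "\<And>i. (\<lambda>x. p x i) \<in> borel_measurable M"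
  shows "(\<lambda>x. ip N (p x) (q x)) \<in> borel_measurable M"
  by (rule ip_measurable[OF assms])

lemma Gv_entry [measurable]: "(\<lambda>x. x i) \<in> borel_measurable (Gv N)"
  by (rule vect_entry) simp

lemmas Gm_it_measurable [measurable] = it_measurable[THEN borel_measurable_Gm]
lemmas PN_it_measurable [measurable] = it_measurable[THEN borel_measurable_PN]
declare PN_entry(3,4) [measurable]

lemma (in prob_seq) cvp_0_of_power2:
  assumes X: "\<And>N. X N \<in> borel_measurable (M N)" and c: "cvp (\<lambda>N x. (X N x)\<^sup>2) 0"
  shows "cvp X 0"
proof (rule cvp_sandwich[OF _ X])
  show "cvp (\<lambda>N x. sqrt ((X N x)\<^sup>2)) 0" using cvp_sqrt[OF c] by simp
qed simp

lemma (in prob_seq) cvp_bounded_diff: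
  assumes D: "cvp D 0" and X: "\<And>N. X N \<in> borel_measurable (M N)" and Y: "cvp Y c"
    and le: "\<forall>\<^sub>F N in sequentially. \<forall>x\<in>space (M N). (X N x - Y N x)\<^sup>2 <= D N x"
  shows "cvp X c"
proof -
  note [measurable] = X cvp_measurable[OF Y]
  have "cvp (\<lambda>N x. X N x - Y N x) 0"
  proof (rule cvp_sandwich)
    show "cvp (\<lambda>N x. sqrt (D N x)) 0" using cvp_sqrt[OF D] by simp
    show "\<forall>\<^sub>F N in sequentially. \<forall>x\<in>space (M N). \<bar>X N x - Y N x - 0\<bar> <= sqrt (D N x)"
      using le by eventually_elim (auto intro!: real_le_rsqrt)
  qed simp
  from cvp_add[OF this Y] show ?thesis by simp
qed

section \<open>The fresh vector of one step and its error\<close>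

context sk_params
begin

abbreviation "phi N A s \<equiv> it_phi \<beta> h N A s"
abbreviation "ze N A s \<equiv> it_zeta \<beta> h N A s"

definition om :: "vect => vect => vect" where "om w v = (\<lambda>i. (w i + v i) / sqrt 2)"

text \<open>Coefficients by which zeta^(k+1) deviates from the Gaussian vector
  \<open>om w v\<close>. For s <= k they remove the component along phi^(s). For s = k + 1 they
  correct for the entry <phi, g phi>, which xi and eta share although w and v are
  independent.\<close>

definition kap :: "nat => nat => matr => vect => vect => nat => real" where
  "kap k N A w v s = (if s = Suc k then (ip N (phi N A (Suc k)) v - ip N (phi N A (Suc k)) w) / sqrt 2
     else - ip N (phi N A s) (om w v))"

definition err :: "nat => nat => matr => vect => vect => vect" where
  "err k N A w v = (\<lambda>i. \<Sum>s\<in>{1..Suc k}. kap k N A w v s * phi N A s i)"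

lemma ip_err_le:
  assumes N: "N >= 1" shows "ip N (err k N A w v) (err k N A w v) <= (\<Sum>s\<in>{1..Suc k}. (kap k N A w v s)\<^sup>2)"
proof -
  have "ip N (err k N A w v) (err k N A w v) = (\<Sum>s\<in>{1..Suc k}. kap k N A w v s * kap k N A w v s * ip N (phi N A s) (phi N A s))"
    unfolding err_def by (rule ip_orthogonal_sums) (auto intro!: it_phi_orthogonal[OF N])
  also have "\<dots> <= (\<Sum>s\<in>{1..Suc k}. (kap k N A w v s)\<^sup>2)"
  proof (rule sum_mono)
    fix s assume "s \<in> {1..Suc k}"
    then have "ip N (phi N A s) (phi N A s) <= 1" using ip_phi[OF N, of s \<beta> h A] by auto
    from mult_left_mono[OF this, of "kap k N A w v s * kap k N A w v s"]
    show "kap k N A w v s * kap k N A w v s * ip N (phi N A s) (phi N A s) <= (kap k N A w v s)\<^sup>2"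
      by (simp add: power2_eq_square)
  qed
  finally show ?thesis .
qed

text \<open>xi^(k+1) and eta^(k+1) are the refreshed matrix and its transpose applied to p,
  projected off phi^(1), ..., phi^(k). The factor \<open>ip N p p\<close> is 1 in the regular case
  and 0 when the Gram-Schmidt step degenerates, so one formula serves both.\<close>

lemma it_resample_refresh:
  fixes k N A w v g
  assumes N: "N >= 1"
  defines "p \<equiv> phi N A (Suc k)"
  defines "R \<equiv> resample \<beta> h N k A (refresh N p w v g)"
  shows "ze N R (Suc k) = (\<lambda>i. ip N p p * (om w v i + err k N A w v i))"
    and "ip N (phi N R (Suc k)) (it_xi \<beta> h N R (Suc k)) = ip N p p * ip N p v"
    and "s <= Suc k ==> phi N R s = phi N A s"
    and "1 <= s ==> s <= k ==> ze N R s = ze N A s"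
    and "s <= k ==> it_xi \<beta> h N R s = it_xi \<beta> h N A s"
proof -
  let ?X = "refresh N p w v g"
  show phi: "phi N R s = phi N A s" if "s <= Suc k" for s
    using resample_invariants(1)[OF N, of s k \<beta> h A ?X] that by (simp add: R_def)
  show xi: "it_xi \<beta> h N R s = it_xi \<beta> h N A s" if "s <= k" for s
    using resample_invariants(2)[OF N, of s k \<beta> h A ?X] that by (simp add: R_def)
  show "ze N R s = ze N A s" if "1 <= s" "s <= k" for s
    using resample_invariants(3)[OF N, of s k \<beta> h A ?X] that xi[OF that(2)] by (simp add: R_def it_zeta.simps)
  have orth: "ip N (phi N A s) p = 0" if "s \<in> {1..k}" for s
    unfolding p_def by (rule it_phi_orthogonal[OF N]) (use that in auto)
  have x: "it_xi \<beta> h N R (Suc k) = mult_mv N (deflates \<beta> h N k A ?X) p"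
    unfolding it_xi.simps phi[OF order_refl] p_def[symmetric] unfolding R_def it_g_resample[OF N] ..
  have y: "it_eta \<beta> h N R (Suc k) = mult_mv N (deflates \<beta> h N k A (transp_m ?X)) p"
    unfolding it_eta.simps phi[OF order_refl] p_def[symmetric] unfolding R_def it_g_resample[OF N] transp_deflates ..
  have D: "mult_mv N (deflates \<beta> h N k A X) p = (\<lambda>i. mult_mv N X p i - (\<Sum>s=1..k. ip N (phi N A s) (mult_mv N X p) * phi N A s i))" for X
    by (rule mult_mv_deflates[OF N]) (rule orth)
  note x' = x[unfolded D] and y' = y[unfolded D]
  have "unit_or_zero N p" unfolding p_def by (rule it_phi_unit_or_zero[OF N]) simp
  then consider (one) "ip N p p = 1" | (zero) "\<And>i. i < N ==> p i = 0" unfolding unit_or_zero_def by blast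
  then have "ze N R (Suc k) = (\<lambda>i. ip N p p * (om w v i + err k N A w v i)) \<and>
    ip N (phi N R (Suc k)) (it_xi \<beta> h N R (Suc k)) = ip N p p * ip N p v"
  proof cases
    case one
    note m = refresh_mult[OF one, of w v g]
    have o: "ip N (phi N A s) (\<lambda>i. w i + (ip N v p - ip N p w) * p i) = ip N (phi N A s) w" if "s \<in> {1..k}" for s
      unfolding ip_linear orth[OF that] by simp
    have xi: "it_xi \<beta> h N R (Suc k) = (\<lambda>i. w i + (ip N v p - ip N p w) * p i - (\<Sum>s=1..k. ip N (phi N A s) w * phi N A s i))"
      unfolding x' m using o by simp
    have eta: "it_eta \<beta> h N R (Suc k) = (\<lambda>i. v i - (\<Sum>s=1..k. ip N (phi N A s) v * phi N A s i))"
      unfolding y' m ..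
    have "ze N R (Suc k) i = om w v i + err k N A w v i" for i
    proof -
      have "(\<Sum>s=1..k. kap k N A w v s * phi N A s i) = (\<Sum>s=1..k. - (ip N (phi N A s) w * phi N A s i + ip N (phi N A s) v * phi N A s i) / sqrt 2)"
        by (rule sum.cong[OF refl]) (simp add: kap_def om_def ip_linear field_simps)
      also have "\<dots> = - ((\<Sum>s=1..k. ip N (phi N A s) w * phi N A s i) + (\<Sum>s=1..k. ip N (phi N A s) v * phi N A s i)) / sqrt 2"
        by (simp only: sum_divide_distrib[symmetric] sum_negf sum.distrib)
      finally have e: "err k N A w v i = kap k N A w v (Suc k) * p i - ((\<Sum>s=1..k. ip N (phi N A s) w * phi N A s i) + (\<Sum>s=1..k. ip N (phi N A s) v * phi N A s i)) / sqrt 2"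
        unfolding err_def p_def by (simp add: add_divide_distrib diff_divide_distrib)
      have "kap k N A w v (Suc k) = (ip N v p - ip N p w) / sqrt 2" by (simp add: kap_def p_def ip_commute)
      then show ?thesis unfolding it_zeta.simps xi eta e om_def by (simp add: add_divide_distrib diff_divide_distrib left_diff_distrib)
    qed
    moreover have "ip N p (it_xi \<beta> h N R (Suc k)) = ip N p v"
    proof -
      have "(\<Sum>s=1..k. ip N (phi N A s) w * ip N p (phi N A s)) = 0"
        by (rule sum.neutral) (use orth in \<open>simp add: ip_commute[of N p]\<close>)
      then show ?thesis unfolding xi ip_linear ip_sum one by (simp add: ip_commute)
    qed
    ultimately show ?thesis using phi[of "Suc k"] one by (auto simp: p_def)
  next
    case zero
    have "it_xi \<beta> h N R (Suc k) = (\<lambda>_. 0)" "it_eta \<beta> h N R (Suc k) = (\<lambda>_. 0)"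
      unfolding x y by (rule mult_mv_zero[OF zero]; simp)+
    then show ?thesis using ip_zero(1)[OF zero] by (simp add: it_zeta.simps ip_linear)
  qed
  then show "ze N R (Suc k) = (\<lambda>i. ip N p p * (om w v i + err k N A w v i))"
    "ip N (phi N R (Suc k)) (it_xi \<beta> h N R (Suc k)) = ip N p p * ip N p v" by auto
qed

lemma om_measurable [measurable]: "(\<lambda>x. om (fst (snd x)) (snd (snd x)) i) \<in> borel_measurable (PN N)"
  unfolding om_def by measurable

lemma kap_measurable [measurable]: "(\<lambda>x. kap k N (fst x) (fst (snd x)) (snd (snd x)) s) \<in> borel_measurable (PN N)"
  unfolding kap_def by measurable

lemma err_measurable [measurable]: "(\<lambda>x. err k N (fst x) (fst (snd x)) (snd (snd x)) i) \<in> borel_measurable (PN N)"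
  unfolding err_def by measurable

lemma Gv_ip_square_phi:
  assumes "N >= 1" "s >= 1" shows "(\<integral>\<^sup>+\<omega>. ennreal ((ip N (phi N A s) \<omega>)\<^sup>2) \<partial>Gv N) <= ennreal (1 / real N)"
  by (rule order_trans[OF Gv_ip_square ennreal_leI]) (use ip_phi[OF assms, of \<beta> h A] assms in \<open>auto intro!: divide_right_mono\<close>)

lemma Gv_om:
  fixes F :: "vect => ennreal"
  assumes F: "F \<in> borel_measurable borel"
  shows "(\<integral>\<^sup>+w. \<integral>\<^sup>+v. F (om w v) \<partial>Gv N \<partial>Gv N) = (\<integral>\<^sup>+\<omega>. F \<omega> \<partial>Gv N)"
  unfolding om_def by (rule Gv_half_sum[OF F])

lemma vect_borel_id [measurable]: "(\<lambda>x::vect. x i) \<in> borel_measurable borel"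
  by (rule vect_entry) simp

lemma cvp_phi_om:
  assumes s: "s >= 1" shows "P.cvp (\<lambda>N x. ip N (phi N (fst x) s) (om (fst (snd x)) (snd (snd x)))) 0"
proof (rule P.cvp_0_of_power2, measurable, rule PN_markov[where C=1])
  fix N :: nat and A assume N: "1 <= N"
  have "(\<integral>\<^sup>+w. \<integral>\<^sup>+v. ennreal ((ip N (phi N A s) (om w v))\<^sup>2) \<partial>Gv N \<partial>Gv N) = (\<integral>\<^sup>+\<omega>. ennreal ((ip N (phi N A s) \<omega>)\<^sup>2) \<partial>Gv N)"
    by (rule Gv_om) measurable
  then show "(\<integral>\<^sup>+w. \<integral>\<^sup>+v. ennreal ((ip N (phi N (fst (A, w, v)) s) (om (fst (snd (A, w, v))) (snd (snd (A, w, v)))))\<^sup>2) \<partial>Gv N \<partial>Gv N) <= ennreal (1 / real N)"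
    using Gv_ip_square_phi[OF N s, of A] by simp
qed simp_all

lemma cvp_phi_w:
  assumes s: "s >= 1"
  shows "P.cvp (\<lambda>N x. ip N (phi N (fst x) s) (fst (snd x))) 0" "P.cvp (\<lambda>N x. ip N (phi N (fst x) s) (snd (snd x))) 0"
  by (rule P.cvp_0_of_power2, measurable, rule PN_markov[where C=1];
      use Gv_ip_square_phi[OF _ s] in \<open>simp add: Gv.emeasure_space_1[simplified]\<close>)+

text \<open>The error lies in the span of k + 1 fixed directions, and each coefficient is an inner
  product of a direction with a Gaussian vector, of second moment O(1/N).\<close>

lemma cvp_err: "P.cvp (\<lambda>N x. ip N (err k N (fst x) (fst (snd x)) (snd (snd x))) (err k N (fst x) (fst (snd x)) (snd (snd x)))) 0"
proof (rule P.cvp_sandwich)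
  have k: "P.cvp (\<lambda>N x. kap k N (fst x) (fst (snd x)) (snd (snd x)) s) 0" if "s \<in> {1..Suc k}" for s
  proof (cases "s = Suc k")
    case True
    have "P.cvp (\<lambda>N x. (ip N (phi N (fst x) (Suc k)) (snd (snd x)) - ip N (phi N (fst x) (Suc k)) (fst (snd x))) / sqrt 2) ((0 - 0) / sqrt 2)"
      by (intro P.cvp_divide P.cvp_diff cvp_phi_w P.cvp_const) auto
    then show ?thesis unfolding kap_def using True by simp
  next
    case False
    have "P.cvp (\<lambda>N x. - ip N (phi N (fst x) s) (om (fst (snd x)) (snd (snd x)))) (- 0)"
      by (intro P.cvp_uminus cvp_phi_om) (use that in auto)
    then show ?thesis unfolding kap_def using False by simp
  qed
  have "P.cvp (\<lambda>N x. \<Sum>s\<in>{1..Suc k}. (kap k N (fst x) (fst (snd x)) (snd (snd x)) s)\<^sup>2) (\<Sum>s\<in>{1..Suc k}. 0\<^sup>2)"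
    by (intro P.cvp_sum P.cvp_power2 k) auto
  then show "P.cvp (\<lambda>N x. \<Sum>s\<in>{1..Suc k}. (kap k N (fst x) (fst (snd x)) (snd (snd x)) s)\<^sup>2) 0" by simp
  show "\<forall>\<^sub>F N in sequentially. \<forall>x\<in>space (PN N). \<bar>ip N (err k N (fst x) (fst (snd x)) (snd (snd x))) (err k N (fst x) (fst (snd x)) (snd (snd x))) - 0\<bar>
      <= (\<Sum>s\<in>{1..Suc k}. (kap k N (fst x) (fst (snd x)) (snd (snd x)) s)\<^sup>2)"
    by (rule eventually_sequentiallyI[of 1], rule ballI) (simp only: diff_zero abs_of_nonneg[OF ip_self_nonneg] ip_err_le)
qed measurable

lemma cvp_om_norm: "P.cvp (\<lambda>N x. ip N (om (fst (snd x)) (snd (snd x))) (om (fst (snd x)) (snd (snd x)))) 1"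
proof -
  have "P.cvp (\<lambda>N x. ip N (om (fst (snd x)) (snd (snd x))) (om (fst (snd x)) (snd (snd x))) - 1) 0"
  proof (rule P.cvp_0_of_power2, measurable, rule PN_markov[where C=3])
    fix N :: nat and A assume N: "1 <= N"
    have "(\<integral>\<^sup>+w. \<integral>\<^sup>+v. ennreal ((ip N (om w v) (om w v) - 1)\<^sup>2) \<partial>Gv N \<partial>Gv N) = (\<integral>\<^sup>+\<omega>. ennreal ((ip N \<omega> \<omega> - 1)\<^sup>2) \<partial>Gv N)"
      by (rule Gv_om) measurable
    then show "(\<integral>\<^sup>+w. \<integral>\<^sup>+v. ennreal ((ip N (om (fst (snd (A, w, v))) (snd (snd (A, w, v)))) (om (fst (snd (A, w, v))) (snd (snd (A, w, v)))) - 1)\<^sup>2) \<partial>Gv N \<partial>Gv N) <= ennreal (3 / real N)"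
      using Gv_norm[OF N] by simp
  qed simp_all
  from P.cvp_add[OF this P.cvp_const[of 1]] show ?thesis by simp
qed

text \<open>The norm of zeta^(s) is random and unbounded, so the Markov bound is applied after
  division by 1 + <zeta, zeta>; this factor converges and can be multiplied back.\<close>

lemma cvp_zeta_om:
  assumes z: "G.cvp (\<lambda>N A. ip N (ze N A s) (ze N A s)) c" and c: "0 <= c"
  shows "P.cvp (\<lambda>N x. ip N (ze N (fst x) s) (om (fst (snd x)) (snd (snd x)))) 0"
proof (rule P.cvp_0_of_power2)
  let ?I = "\<lambda>N x. ip N (ze N (fst x) s) (om (fst (snd x)) (snd (snd x)))" and ?D = "\<lambda>N A. 1 + ip N (ze N A s) (ze N A s)"
  have D: "0 < ?D N A" for N A using ip_self_nonneg[of N "ze N A s"] by simp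
  have "P.cvp (\<lambda>N x. (?I N x)\<^sup>2 / ?D N (fst x)) 0"
  proof (rule PN_markov[where C=1])
    show "0 <= (?I N x)\<^sup>2 / ?D N (fst x)" for N x using D[of N "fst x"] by simp
    fix N :: nat and A assume N: "1 <= N"
    have "(\<integral>\<^sup>+w. \<integral>\<^sup>+v. ennreal ((ip N (ze N A s) (om w v))\<^sup>2 / ?D N A) \<partial>Gv N \<partial>Gv N) = (\<integral>\<^sup>+\<omega>. ennreal ((ip N (ze N A s) \<omega>)\<^sup>2 / ?D N A) \<partial>Gv N)"
      by (rule Gv_om) measurable
    also have "\<dots> = (\<integral>\<^sup>+\<omega>. ennreal (1 / ?D N A) * ennreal ((ip N (ze N A s) \<omega>)\<^sup>2) \<partial>Gv N)"
      by (rule nn_integral_cong, subst ennreal_mult[symmetric]) (use D[of N A] in auto)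
    also have "\<dots> = ennreal (1 / ?D N A) * (\<integral>\<^sup>+\<omega>. ennreal ((ip N (ze N A s) \<omega>)\<^sup>2) \<partial>Gv N)"
      by (rule nn_integral_cmult) measurable
    also have "\<dots> <= ennreal (1 / ?D N A) * ennreal (ip N (ze N A s) (ze N A s) / real N)"
      by (intro mult_left_mono Gv_ip_square) simp
    also have "\<dots> = ennreal (ip N (ze N A s) (ze N A s) / ?D N A / real N)"
      by (subst ennreal_mult[symmetric]) (use D[of N A] ip_self_nonneg[of N "ze N A s"] in auto)
    also have "\<dots> <= ennreal (1 / real N)"
      by (intro ennreal_leI divide_right_mono) (use D[of N A] in auto)
    finally show "(\<integral>\<^sup>+w. \<integral>\<^sup>+v. ennreal ((?I N (A, w, v))\<^sup>2 / ?D N (fst (A, w, v))) \<partial>Gv N \<partial>Gv N) <= ennreal (1 / real N)" by simp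
  qed measurable
  from P.cvp_mult[OF this P.cvp_add[OF P.cvp_const[of 1] PN_lift[OF z]]]
  have "P.cvp (\<lambda>N x. (?I N x)\<^sup>2 / ?D N (fst x) * ?D N (fst x)) 0" by simp
  moreover have "(?I N x)\<^sup>2 / ?D N (fst x) * ?D N (fst x) = (?I N x)\<^sup>2" for N x using D[of N "fst x"] by simp
  ultimately show "P.cvp (\<lambda>N x. (?I N x)\<^sup>2) 0" by simp
qed measurable

end

lemma square_sum5_le: "(u + v + w + x + y)\<^sup>2 <= 5 * (u\<^sup>2 + v\<^sup>2 + w\<^sup>2 + x\<^sup>2 + y\<^sup>2)" for u v w x y :: real
proof -
  have "5 * (u\<^sup>2 + v\<^sup>2 + w\<^sup>2 + x\<^sup>2 + y\<^sup>2) - (u + v + w + x + y)\<^sup>2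
     = (u-v)\<^sup>2 + (u-w)\<^sup>2 + (u-x)\<^sup>2 + (u-y)\<^sup>2 + (v-w)\<^sup>2 + (v-x)\<^sup>2 + (v-y)\<^sup>2 + (w-x)\<^sup>2 + (w-y)\<^sup>2 + (x-y)\<^sup>2"
    by (simp add: power2_eq_square algebra_simps)
  moreover have "0 <= (u-v)\<^sup>2 + (u-w)\<^sup>2 + (u-x)\<^sup>2 + (u-y)\<^sup>2 + (v-w)\<^sup>2 + (v-x)\<^sup>2 + (v-y)\<^sup>2 + (w-x)\<^sup>2 + (w-y)\<^sup>2 + (x-y)\<^sup>2" by simp
  ultimately show ?thesis by linarith
qed

text \<open>The tame Lipschitz bound is |e_i| times a factor u_i of linear growth at each site;
  Cauchy-Schwarz separates the two, and the mean square of u is bounded by the norms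
  involved.\<close>

lemma tame_perturb:
  fixes a b :: real and p q \<omega> e :: vect
  assumes L: "tame_bound L f" and N: "N >= 1"
  defines "c \<equiv> \<bar>a\<bar> + \<bar>b\<bar>"
  shows "((\<Sum>i<N. f (p i + a * (\<omega> i + e i)) (q i + b * (\<omega> i + e i))) / real N - (\<Sum>i<N. f (p i + a * \<omega> i) (q i + b * \<omega> i)) / real N)\<^sup>2
    <= (L * c)\<^sup>2 * (5 * (1 + 4 * ip N p p + 4 * ip N q q + 4 * c\<^sup>2 * ip N \<omega> \<omega> + c\<^sup>2 * ip N e e)) * ip N e e"
proof -
  define d where "d i = f (p i + a * (\<omega> i + e i)) (q i + b * (\<omega> i + e i)) - f (p i + a * \<omega> i) (q i + b * \<omega> i)" for i
  define u where "u i = 1 + 2 * \<bar>p i\<bar> + 2 * \<bar>q i\<bar> + 2 * c * \<bar>\<omega> i\<bar> + c * \<bar>e i\<bar>" for i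
  have L0: "0 <= L" and c0: "0 <= c" using L by (auto simp: tame_bound_def c_def)
  have d: "\<bar>d i\<bar> <= L * c * (u i * \<bar>e i\<bar>)" for i
  proof -
    have t: "\<bar>y + r * z\<bar> <= \<bar>y\<bar> + \<bar>r\<bar> * \<bar>z\<bar>" for y r z :: real
      using abs_triangle_ineq[of y "r * z"] by (simp add: abs_mult)
    have t2: "\<bar>y + r * (z + z')\<bar> <= \<bar>y\<bar> + \<bar>r\<bar> * \<bar>z\<bar> + \<bar>r\<bar> * \<bar>z'\<bar>" for y r z z' :: real
      using t[of "y + r * z" r z'] t[of y r z] by (simp add: distrib_left add.assoc)
    have "\<bar>d i\<bar> <= L * (1 + \<bar>p i + a * (\<omega> i + e i)\<bar> + \<bar>q i + b * (\<omega> i + e i)\<bar> + \<bar>p i + a * \<omega> i\<bar> + \<bar>q i + b * \<omega> i\<bar>)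
        * (\<bar>(p i + a * (\<omega> i + e i)) - (p i + a * \<omega> i)\<bar> + \<bar>(q i + b * (\<omega> i + e i)) - (q i + b * \<omega> i)\<bar>)"
      unfolding d_def using L unfolding tame_bound_def by blast
    also have "\<dots> <= L * u i * (c * \<bar>e i\<bar>)"
    proof (intro mult_mono)
      show "1 + \<bar>p i + a * (\<omega> i + e i)\<bar> + \<bar>q i + b * (\<omega> i + e i)\<bar> + \<bar>p i + a * \<omega> i\<bar> + \<bar>q i + b * \<omega> i\<bar> <= u i"
        using t2[of "p i" a "\<omega> i" "e i"] t2[of "q i" b "\<omega> i" "e i"] t[of "p i" a "\<omega> i"] t[of "q i" b "\<omega> i"]
        unfolding u_def c_def by (simp add: algebra_simps)
      show "\<bar>(p i + a * (\<omega> i + e i)) - (p i + a * \<omega> i)\<bar> + \<bar>(q i + b * (\<omega> i + e i)) - (q i + b * \<omega> i)\<bar> <= c * \<bar>e i\<bar>"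
        by (simp add: c_def algebra_simps abs_mult)
    qed (use L0 c0 in \<open>auto simp: u_def\<close>)
    finally show ?thesis by (simp add: mult_ac)
  qed
  have E: "(\<Sum>i<N. f (p i + a * (\<omega> i + e i)) (q i + b * (\<omega> i + e i))) / real N - (\<Sum>i<N. f (p i + a * \<omega> i) (q i + b * \<omega> i)) / real N = (\<Sum>i<N. d i) / real N"
    unfolding d_def by (simp add: sum_subtractf diff_divide_distrib)
  have "((\<Sum>i<N. d i) / real N)\<^sup>2 <= (L * c * ip N u (\<lambda>i. \<bar>e i\<bar>))\<^sup>2"
  proof -
    have "\<bar>\<Sum>i<N. d i\<bar> <= (\<Sum>i<N. \<bar>d i\<bar>)" by (rule sum_abs)
    moreover have "(\<Sum>i<N. \<bar>d i\<bar>) <= (\<Sum>i<N. L * c * (u i * \<bar>e i\<bar>))" by (rule sum_mono) (rule d)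
    moreover have "(\<Sum>i<N. L * c * (u i * \<bar>e i\<bar>)) = L * c * (\<Sum>i<N. u i * \<bar>e i\<bar>)" by (rule sum_distrib_left[symmetric])
    ultimately have "\<bar>\<Sum>i<N. d i\<bar> / real N <= L * c * (\<Sum>i<N. u i * \<bar>e i\<bar>) / real N" by (intro divide_right_mono) linarith+
    then have "\<bar>(\<Sum>i<N. d i) / real N\<bar> <= L * c * ip N u (\<lambda>i. \<bar>e i\<bar>)" by (simp add: ip_def)
    from power_mono[OF this, of 2] show ?thesis unfolding power2_abs by simp
  qed
  also have "\<dots> <= (L * c)\<^sup>2 * (ip N u u * ip N e e)"
    unfolding power_mult_distrib[of "L * c"]
    using ip_cauchy_schwarz[of N u "\<lambda>i. \<bar>e i\<bar>"] by (intro mult_left_mono) (auto simp: ip_def)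
  finally have 1: "((\<Sum>i<N. d i) / real N)\<^sup>2 <= (L * c)\<^sup>2 * (ip N u u * ip N e e)" .
  have "ip N u u <= 5 * (1 + 4 * ip N p p + 4 * ip N q q + 4 * c\<^sup>2 * ip N \<omega> \<omega> + c\<^sup>2 * ip N e e)"
  proof -
    have "(u i)\<^sup>2 <= 5 * (1 + 4 * (p i)\<^sup>2 + 4 * (q i)\<^sup>2 + 4 * c\<^sup>2 * (\<omega> i)\<^sup>2 + c\<^sup>2 * (e i)\<^sup>2)" for i
      using square_sum5_le[of 1 "2 * \<bar>p i\<bar>" "2 * \<bar>q i\<bar>" "2 * c * \<bar>\<omega> i\<bar>" "c * \<bar>e i\<bar>"]
      unfolding u_def by (simp add: power_mult_distrib)
    then have "u i * u i <= 5 * (1 + 4 * (p i * p i) + 4 * (q i * q i) + 4 * c\<^sup>2 * (\<omega> i * \<omega> i) + c\<^sup>2 * (e i * e i))" for i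
      by (simp add: power2_eq_square)
    then have "(\<Sum>i<N. u i * u i) <= (\<Sum>i<N. 5 * (1 + 4 * (p i * p i) + 4 * (q i * q i) + 4 * c\<^sup>2 * (\<omega> i * \<omega> i) + c\<^sup>2 * (e i * e i)))"
      by (intro sum_mono)
    also have "\<dots> = 5 * (real N + 4 * (\<Sum>i<N. p i * p i) + 4 * (\<Sum>i<N. q i * q i) + 4 * c\<^sup>2 * (\<Sum>i<N. \<omega> i * \<omega> i) + c\<^sup>2 * (\<Sum>i<N. e i * e i))"
      by (simp add: sum_distrib_left[symmetric] sum.distrib)
    also have "\<dots> = real N * (5 * (1 + 4 * ip N p p + 4 * ip N q q + 4 * c\<^sup>2 * ip N \<omega> \<omega> + c\<^sup>2 * ip N e e))"
      using N by (simp add: ip_def field_simps)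
    finally have "ip N u u <= real N * (5 * (1 + 4 * ip N p p + 4 * ip N q q + 4 * c\<^sup>2 * ip N \<omega> \<omega> + c\<^sup>2 * ip N e e)) / real N"
      unfolding ip_def[of N u u] by (intro divide_right_mono) auto
    then show ?thesis using N by simp
  qed
  then have "(L * c)\<^sup>2 * (ip N u u * ip N e e) <= (L * c)\<^sup>2 * ((5 * (1 + 4 * ip N p p + 4 * ip N q q + 4 * c\<^sup>2 * ip N \<omega> \<omega> + c\<^sup>2 * ip N e e)) * ip N e e)"
    by (intro mult_left_mono mult_right_mono ip_self_nonneg) auto
  from order_trans[OF 1 this] show ?thesis unfolding E mult.assoc[of "(L * c)\<^sup>2"] .
qed

context sk_params
begin

abbreviation "lin k a N A \<equiv> (\<lambda>i. \<Sum>s=1..k. a s * ze N A s i)"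

text \<open>The induction hypothesis. Two linear combinations are allowed at once because overlaps
  of the m^(j) and of m with zeta are needed. The Gram matrix of the zeta is listed separately,
  since the product x y grows quadratically and is not tame.\<close>

definition lln :: "nat => bool" where
  "lln k \<longleftrightarrow>
    (\<forall>f a b. tame f --> G.cvp (\<lambda>N A. (\<Sum>i<N. f (lin k a N A i) (lin k b N A i)) / real N) (Ef k f a b)) \<and>
    (\<forall>s\<in>{1..k}. \<forall>t\<in>{1..k}. G.cvp (\<lambda>N A. ip N (ze N A s) (ze N A t)) (if s = t then 1 else 0)) \<and>
    (\<forall>s\<in>{1..k}. G.cvp (\<lambda>N A. ip N (phi N A s) (it_xi \<beta> h N A s)) 0)"

lemma llnD:
  assumes "lln k"
  shows "tame f ==> G.cvp (\<lambda>N A. (\<Sum>i<N. f (lin k a N A i) (lin k b N A i)) / real N) (Ef k f a b)"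
    "s \<in> {1..k} ==> t \<in> {1..k} ==> G.cvp (\<lambda>N A. ip N (ze N A s) (ze N A t)) (if s = t then 1 else 0)"
    "s \<in> {1..k} ==> G.cvp (\<lambda>N A. ip N (phi N A s) (it_xi \<beta> h N A s)) 0"
  using assms unfolding lln_def by blast+

lemma cvp_lin:
  assumes "lln k"
  shows "G.cvp (\<lambda>N A. ip N (lin k a N A) (lin k a N A)) (\<Sum>t\<in>{1..k}. a t * (\<Sum>s\<in>{1..k}. a s * (if s = t then 1 else 0)))"
  unfolding ip_sum(2) ip_linear(9) unfolding ip_sum(1) ip_linear(3)
  by (intro G.cvp_sum G.cvp_cmult llnD(2)[OF assms]) auto

text \<open>Given the matrix, the second moment is bounded by a random multiple \<open>D\<close> of
  1/N. Dividing by \<open>D\<close> yields a uniform Markov bound, and convergence of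
  \<open>D\<close> in probability restores the factor.\<close>

lemma PN_markov_normalized:
  fixes Y :: "nat => matr => vect => real"
  assumes mY: "\<And>N A. Y N A \<in> borel_measurable borel" and mP: "\<And>N. (\<lambda>x. Y N (fst x) (om (fst (snd x)) (snd (snd x)))) \<in> borel_measurable (PN N)"
    and D: "\<And>N A. 0 < D N A" and C: "0 <= C"
    and le: "\<And>N A. N >= 1 ==> (\<integral>\<^sup>+\<omega>. ennreal ((Y N A \<omega>)\<^sup>2) \<partial>Gv N) <= ennreal (C * D N A / real N)"
    and d: "P.cvp (\<lambda>N x. D N (fst x)) d"
  shows "P.cvp (\<lambda>N x. Y N (fst x) (om (fst (snd x)) (snd (snd x)))) 0"
proof (rule P.cvp_0_of_power2[OF mP])
  note [measurable] = mP P.cvp_measurable[OF d]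
  let ?X = "\<lambda>N x. Y N (fst x) (om (fst (snd x)) (snd (snd x)))"
  have "P.cvp (\<lambda>N x. (?X N x)\<^sup>2 / D N (fst x)) 0"
  proof (rule PN_markov[where C=C])
    show "0 <= (?X N x)\<^sup>2 / D N (fst x)" for N x
      using D[of N "fst x"] by (intro divide_nonneg_nonneg) auto
    fix N :: nat and A assume N: "1 <= N"
    note [measurable] = mY[of N A]
    have "(\<integral>\<^sup>+w. \<integral>\<^sup>+v. ennreal ((Y N A (om w v))\<^sup>2 / D N A) \<partial>Gv N \<partial>Gv N) = (\<integral>\<^sup>+\<omega>. ennreal ((Y N A \<omega>)\<^sup>2 / D N A) \<partial>Gv N)"
      by (rule Gv_om) measurable
    also have "\<dots> = (\<integral>\<^sup>+\<omega>. ennreal (1 / D N A) * ennreal ((Y N A \<omega>)\<^sup>2) \<partial>Gv N)"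
      by (rule nn_integral_cong, subst ennreal_mult[symmetric]) (use D[of N A] in auto)
    also have "\<dots> = ennreal (1 / D N A) * (\<integral>\<^sup>+\<omega>. ennreal ((Y N A \<omega>)\<^sup>2) \<partial>Gv N)"
      by (rule nn_integral_cmult) measurable
    also have "\<dots> <= ennreal (1 / D N A) * ennreal (C * D N A / real N)"
      by (intro mult_left_mono le[OF N]) simp
    also have "\<dots> = ennreal (1 / D N A * (C * D N A / real N))"
      by (subst ennreal_mult[symmetric]) (use D[of N A] C in auto)
    also have "1 / D N A * (C * D N A / real N) = C / real N" using D[of N A] by simp
    finally show "(\<integral>\<^sup>+w. \<integral>\<^sup>+v. ennreal ((?X N (A, w, v))\<^sup>2 / D N (fst (A, w, v))) \<partial>Gv N \<partial>Gv N) <= ennreal (C / real N)"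
      by simp
  qed measurable
  from P.cvp_mult[OF this d]
  have "P.cvp (\<lambda>N x. (?X N x)\<^sup>2 / D N (fst x) * D N (fst x)) 0" by simp
  moreover have "(?X N x)\<^sup>2 / D N (fst x) * D N (fst x) = (?X N x)\<^sup>2" for N x
    using D[of N "fst x"] by simp
  ultimately show "P.cvp (\<lambda>N x. (?X N x)\<^sup>2) 0" by simp
qed

text \<open>Given the matrix, the average concentrates around that of the smeared function
  (\<open>Gv_smear\<close>); this one is again tame, and the induction hypothesis identifies its
  limit through \<open>Ef_Suc\<close>.\<close>

lemma cvp_avg_om:
  assumes l: "lln k" and f: "tame f"
  shows "P.cvp (\<lambda>N x. (\<Sum>i<N. f (lin k a N (fst x) i + a (Suc k) * om (fst (snd x)) (snd (snd x)) i)
      (lin k b N (fst x) i + b (Suc k) * om (fst (snd x)) (snd (snd x)) i)) / real N) (Ef (Suc k) f a b)" (is "P.cvp ?X _")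
proof -
  obtain L where L: "tame_bound L f" using f by (auto simp: tame_def)
  let ?s = "smear (a (Suc k)) (b (Suc k)) f"
  have sm: "tame ?s" by (rule tame_smear[OF f])
  define F where "F N A = (\<Sum>i<N. ?s (lin k a N A i) (lin k b N A i)) / real N" for N A
  have F: "P.cvp (\<lambda>N x. F N (fst x)) (Ef (Suc k) f a b)"
    unfolding F_def using PN_lift[OF llnD(1)[OF l sm, of a b]] unfolding Ef_Suc[OF f] .
  note [measurable] = P.cvp_measurable[OF F]
  define c where "c = \<bar>a (Suc k)\<bar> + \<bar>b (Suc k)\<bar>"
  define D where "D N A = 1 + ip N (lin k a N A) (lin k a N A) + ip N (lin k b N A) (lin k b N A) + c\<^sup>2" for N A
  have D: "0 < D N A" for N A
    using ip_self_nonneg[of N "lin k a N A"] ip_self_nonneg[of N "lin k b N A"] zero_le_power2[of c] unfolding D_def by linarith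
  note d = P.cvp_add[OF P.cvp_add[OF P.cvp_add[OF P.cvp_const[of 1] PN_lift[OF cvp_lin[OF l, of a]]] PN_lift[OF cvp_lin[OF l, of b]]] P.cvp_const[of "c\<^sup>2"], folded D_def]
  define Y where "Y N A \<omega> = (\<Sum>i<N. f (lin k a N A i + a (Suc k) * \<omega> i) (lin k b N A i + b (Suc k) * \<omega> i)) / real N - F N A" for N A \<omega>
  have "P.cvp (\<lambda>N x. Y N (fst x) (om (fst (snd x)) (snd (snd x)))) 0"
  proof (rule PN_markov_normalized[OF _ _ D _ _ d, where C="4 * L\<^sup>2"])
    show "Y N A \<in> borel_measurable borel" for N A
      unfolding Y_def
      by (intro borel_measurable_diff borel_measurable_divide borel_measurable_sum tame_measurable2[OF f] borel_measurable_const
          borel_measurable_add borel_measurable_times vect_borel_id)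
    show "(\<lambda>x. Y N (fst x) (om (fst (snd x)) (snd (snd x)))) \<in> borel_measurable (PN N)" for N
      unfolding Y_def
      by (intro borel_measurable_diff borel_measurable_divide borel_measurable_sum tame_measurable2[OF f] borel_measurable_const
          borel_measurable_add borel_measurable_times om_measurable PN_it_measurable P.cvp_measurable[OF F])
    show "(\<integral>\<^sup>+\<omega>. ennreal ((Y N A \<omega>)\<^sup>2) \<partial>Gv N) <= ennreal (4 * L\<^sup>2 * D N A / real N)" if "N >= 1" for N A
      using Gv_smear[OF L that, of "lin k a N A" "a (Suc k)" "lin k b N A" "b (Suc k)"] unfolding Y_def D_def F_def c_def .
  qed simp
  from P.cvp_add[OF this F] show ?thesis by (simp add: Y_def)
qed

abbreviation "omP x \<equiv> om (fst (snd x)) (snd (snd x))"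
abbreviation "erP k N x \<equiv> err k N (fst x) (fst (snd x)) (snd (snd x))"

lemma cvp_avg_err:
  assumes l: "lln k" and f: "tame f"
  shows "P.cvp (\<lambda>N x. (\<Sum>i<N. f (lin k a N (fst x) i + a (Suc k) * (omP x i + erP k N x i))
      (lin k b N (fst x) i + b (Suc k) * (omP x i + erP k N x i))) / real N) (Ef (Suc k) f a b)"
proof -
  obtain L where L: "tame_bound L f" using f by (auto simp: tame_def)
  let ?c = "\<bar>a (Suc k)\<bar> + \<bar>b (Suc k)\<bar>"
  let ?D = "\<lambda>N x. (L * ?c)\<^sup>2 * (5 * (1 + 4 * ip N (lin k a N (fst x)) (lin k a N (fst x)) + 4 * ip N (lin k b N (fst x)) (lin k b N (fst x))
     + 4 * ?c\<^sup>2 * ip N (omP x) (omP x) + ?c\<^sup>2 * ip N (erP k N x) (erP k N x))) * ip N (erP k N x) (erP k N x)"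
  show ?thesis
  proof (rule P.cvp_bounded_diff[OF _ _ cvp_avg_om[OF l f]])
    have "\<exists>d. P.cvp (\<lambda>N x. (L * ?c)\<^sup>2 * (5 * (1 + 4 * ip N (lin k a N (fst x)) (lin k a N (fst x)) + 4 * ip N (lin k b N (fst x)) (lin k b N (fst x))
     + 4 * ?c\<^sup>2 * ip N (omP x) (omP x) + ?c\<^sup>2 * ip N (erP k N x) (erP k N x)))) d"
      by (rule exI, (rule P.cvp_cmult P.cvp_add P.cvp_const cvp_om_norm cvp_err PN_lift[OF cvp_lin[OF l]])+)
    then obtain d where "P.cvp (\<lambda>N x. (L * ?c)\<^sup>2 * (5 * (1 + 4 * ip N (lin k a N (fst x)) (lin k a N (fst x)) + 4 * ip N (lin k b N (fst x)) (lin k b N (fst x))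
     + 4 * ?c\<^sup>2 * ip N (omP x) (omP x) + ?c\<^sup>2 * ip N (erP k N x) (erP k N x)))) d" by blast
    from P.cvp_mult[OF this cvp_err] show "P.cvp ?D 0" by simp
    show "\<forall>\<^sub>F N in sequentially. \<forall>x\<in>space (PN N).
      ((\<Sum>i<N. f (lin k a N (fst x) i + a (Suc k) * (omP x i + erP k N x i)) (lin k b N (fst x) i + b (Suc k) * (omP x i + erP k N x i))) / real N
       - (\<Sum>i<N. f (lin k a N (fst x) i + a (Suc k) * omP x i) (lin k b N (fst x) i + b (Suc k) * omP x i)) / real N)\<^sup>2 <= ?D N x"
      by (rule eventually_sequentiallyI[of 1], rule ballI, rule tame_perturb[OF L])
  qed (intro borel_measurable_divide borel_measurable_sum tame_measurable2[OF f] borel_measurable_add borel_measurable_times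
        borel_measurable_const om_measurable err_measurable PN_it_measurable ip_measurable_raw)
qed

lemma it_block:
  assumes "meq N A B" "i < N"
  shows "it_phi \<beta> h N A s i = it_phi \<beta> h N B s i" "it_xi \<beta> h N A s i = it_xi \<beta> h N B s i" "ze N A s i = ze N B s i"
  using it_veq[OF assms(1), of \<beta> h s] assms(2) by (auto simp: veq_def it_zeta.simps)

text \<open>Every claim is moved to \<open>PN\<close>, where zeta^(k+1) is om + err up to a factor 0
  or 1. Averages come from \<open>cvp_avg_err\<close>, the mixed Gram entries from
  \<open>cvp_zeta_om\<close>, and err drops out by Cauchy-Schwarz.\<close>

lemma lln_Suc:
  assumes l: "lln k" and U: "G.cvp (\<lambda>N A. ip N (phi N A (Suc k)) (phi N A (Suc k))) 1"
  shows "lln (Suc k)"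
  unfolding lln_def
proof (intro conjI allI impI ballI)
  let ?U = "\<lambda>N (x :: matr \<times> vect \<times> vect). ip N (phi N (fst x) (Suc k)) (phi N (fst x) (Suc k))"
  note U' = PN_lift[OF U]
  let ?z = "\<lambda>N x i. ?U N x * (omP x i + erP k N x i)"
  {
    fix f a b assume f: "tame f"
    let ?Y = "\<lambda>N x. (\<Sum>i<N. f (lin k a N (fst x) i + a (Suc k) * ?z N x i) (lin k b N (fst x) i + b (Suc k) * ?z N x i)) / real N"
    have Y: "P.cvp ?Y (Ef (Suc k) f a b)"
    \<comment> \<open>The squared norm of phi^(k+1) is 0 or 1, so being within 1/2 of 1 forces it to
      be 1.\<close>
    proof (rule P.cvp_on_event[OF cvp_avg_err[OF l f] U', where \<delta>="1/2"])
      show "\<forall>\<^sub>F N in sequentially. \<forall>x\<in>space (PN N). \<bar>?U N x - 1\<bar> <= 1 / 2 --> ?Y N x =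
         (\<Sum>i<N. f (lin k a N (fst x) i + a (Suc k) * (omP x i + erP k N x i)) (lin k b N (fst x) i + b (Suc k) * (omP x i + erP k N x i))) / real N"
      proof (rule eventually_sequentiallyI[of 1], intro ballI impI)
        fix N :: nat and x assume N: "1 <= N" and u: "\<bar>?U N x - 1\<bar> <= 1 / 2"
        have "?U N x = 1" using unit_or_zero_ip[OF it_phi_unit_or_zero[OF N, of "Suc k" \<beta> h "fst x"]] u by auto
        then show "?Y N x = (\<Sum>i<N. f (lin k a N (fst x) i + a (Suc k) * (omP x i + erP k N x i)) (lin k b N (fst x) i + b (Suc k) * (omP x i + erP k N x i))) / real N" by simp
      qed
    qed ((intro borel_measurable_divide borel_measurable_sum tame_measurable2[OF f] borel_measurable_add borel_measurable_times
        borel_measurable_const om_measurable err_measurable PN_it_measurable ip_measurable_raw), simp)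
    show "G.cvp (\<lambda>N A. (\<Sum>i<N. f (lin (Suc k) a N A i) (lin (Suc k) b N A i)) / real N) (Ef (Suc k) f a b)"
    proof (rule PN_transfer[OF _ _ _ Y, where k=k and \<beta>=\<beta> and h=h])
      show "on_block N (\<lambda>A. (\<Sum>i<N. f (lin (Suc k) a N A i) (lin (Suc k) b N A i)) / real N)" for N
        unfolding on_block_def by (intro allI impI arg_cong[of _ _ "\<lambda>x. x / real N"] sum.cong refl arg_cong2[of _ _ _ _ f] arg_cong[of _ _ "\<lambda>x. _ * x"] it_block(3)) auto
      fix N A g w v assume N: "1 <= (N::nat)"
      let ?R = "resample \<beta> h N k A (refresh N (it_phi \<beta> h N A (Suc k)) w v g)"
      have "lin (Suc k) c N ?R i = lin k c N A i + c (Suc k) * ?z N (A, w, v) i" for c i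
      proof -
        have "lin k c N ?R i = lin k c N A i" by (intro sum.cong refl) (simp add: it_resample_refresh(4)[OF N])
        then show ?thesis using it_resample_refresh(1)[OF N, of k A w v g] by simp
      qed
      then show "(\<Sum>i<N. f (lin (Suc k) a N ?R i) (lin (Suc k) b N ?R i)) / real N = ?Y N (A, w, v)" by simp
    next
      show "(\<lambda>A. (\<Sum>i<N. f (lin (Suc k) a N A i) (lin (Suc k) b N A i)) / real N) \<in> borel_measurable borel" for N
        by (intro borel_measurable_divide borel_measurable_sum tame_measurable2[OF f] borel_measurable_times borel_measurable_const it_measurable)
    qed
  }
  note [measurable] = it_measurable
  have e0: "P.cvp (\<lambda>N x. ip N (y N x) (erP k N x)) 0"
    if y: "P.cvp (\<lambda>N x. ip N (y N x) (y N x)) c" and [measurable]: "\<And>N i. (\<lambda>x. y N x i) \<in> borel_measurable (PN N)" for y c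
  proof (rule P.cvp_0_of_power2, measurable, rule P.cvp_sandwich)
    show "P.cvp (\<lambda>N x. ip N (y N x) (y N x) * ip N (erP k N x) (erP k N x)) 0" using P.cvp_mult[OF y cvp_err] by simp
    show "\<forall>\<^sub>F N in sequentially. \<forall>x\<in>space (PN N). \<bar>(ip N (y N x) (erP k N x))\<^sup>2 - 0\<bar> <= ip N (y N x) (y N x) * ip N (erP k N x) (erP k N x)"
      using ip_cauchy_schwarz by (intro always_eventually) auto
  qed measurable
  have ot: "G.cvp (\<lambda>N A. ip N (ze N A s) (ze N A (Suc k))) 0" if s: "s \<in> {1..k}" for s
  proof (rule PN_transfer[where k=k and \<beta>=\<beta> and h=h])
    have ss: "G.cvp (\<lambda>N A. ip N (ze N A s) (ze N A s)) 1" using llnD(2)[OF l s s] by simp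
    have "P.cvp (\<lambda>N x. ?U N x * (ip N (ze N (fst x) s) (omP x) + ip N (ze N (fst x) s) (erP k N x))) (1 * (0 + 0))"
      by (intro P.cvp_mult P.cvp_add U' cvp_zeta_om[OF ss] e0[OF PN_lift[OF ss]]) auto
    then show "P.cvp (\<lambda>N x. ip N (ze N (fst x) s) (?z N x)) 0" unfolding ip_linear by simp
    fix N A g w v assume N: "1 <= (N::nat)"
    show "ip N (ze N (resample \<beta> h N k A (refresh N (it_phi \<beta> h N A (Suc k)) w v g)) s) (ze N (resample \<beta> h N k A (refresh N (it_phi \<beta> h N A (Suc k)) w v g)) (Suc k))
        = ip N (ze N (fst (A, w, v)) s) (?z N (A, w, v))"
      using it_resample_refresh(4)[OF N, of s k A w v g] it_resample_refresh(1)[OF N, of k A w v g] s by simp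
  next
    show "on_block N (\<lambda>A. ip N (ze N A s) (ze N A (Suc k)))" for N
      unfolding on_block_def by (intro allI impI ip_cong it_block(3))
  qed measurable
  have tt: "G.cvp (\<lambda>N A. ip N (ze N A (Suc k)) (ze N A (Suc k))) 1"
  proof (rule PN_transfer[where k=k and \<beta>=\<beta> and h=h])
    have "P.cvp (\<lambda>N x. ?U N x * (?U N x * (ip N (omP x) (omP x) + ip N (omP x) (erP k N x) + ip N (omP x) (erP k N x) + ip N (erP k N x) (erP k N x)))) (1 * (1 * (1 + 0 + 0 + 0)))"
      by (intro P.cvp_mult P.cvp_add U' cvp_om_norm cvp_err e0[OF cvp_om_norm]) auto
    moreover have "ip N (?z N x) (?z N x) = ?U N x * (?U N x * (ip N (omP x) (omP x) + ip N (omP x) (erP k N x) + ip N (omP x) (erP k N x) + ip N (erP k N x) (erP k N x)))" for N x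
      unfolding ip_linear ip_commute[of N "erP k N x" "omP x"] by (simp add: algebra_simps)
    ultimately show "P.cvp (\<lambda>N x. ip N (?z N x) (?z N x)) 1" by simp
    fix N A g w v assume N: "1 <= (N::nat)"
    show "ip N (ze N (resample \<beta> h N k A (refresh N (it_phi \<beta> h N A (Suc k)) w v g)) (Suc k)) (ze N (resample \<beta> h N k A (refresh N (it_phi \<beta> h N A (Suc k)) w v g)) (Suc k))
        = ip N (?z N (A, w, v)) (?z N (A, w, v))"
      using it_resample_refresh(1)[OF N, of k A w v g] by simp
  next
    show "on_block N (\<lambda>A. ip N (ze N A (Suc k)) (ze N A (Suc k)))" for N
      unfolding on_block_def by (intro allI impI ip_cong it_block(3))
  qed measurable
  {
    fix s t assume st: "s \<in> {1..Suc k}" "t \<in> {1..Suc k}"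
    consider "s \<in> {1..k}" "t \<in> {1..k}" | "s \<in> {1..k}" "t = Suc k" | "s = Suc k" "t \<in> {1..k}" | "s = Suc k" "t = Suc k"
      using st by fastforce
    then show "G.cvp (\<lambda>N A. ip N (ze N A s) (ze N A t)) (if s = t then 1 else 0)"
    proof cases
      case 1 then show ?thesis by (rule llnD(2)[OF l])
    next
      case 2 then show ?thesis using ot[of s] by auto
    next
      case 3 then show ?thesis using ot[of t] unfolding ip_commute[of _ "ze _ _ s"] by auto
    next
      case 4 then show ?thesis using tt by simp
    qed
  next
    fix s assume s: "s \<in> {1..Suc k}"
    show "G.cvp (\<lambda>N A. ip N (phi N A s) (it_xi \<beta> h N A s)) 0"
    proof (cases "s = Suc k")
      case False
      then show ?thesis using llnD(3)[OF l, of s] s by auto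
    next
      case True
      show ?thesis unfolding True
      proof (rule PN_transfer[where k=k and \<beta>=\<beta> and h=h])
        show "P.cvp (\<lambda>N x. ?U N x * ip N (phi N (fst x) (Suc k)) (snd (snd x))) 0"
          using P.cvp_mult[OF U' cvp_phi_w(2)[of "Suc k"]] by simp
        fix N A g w v assume N: "1 <= (N::nat)"
        show "ip N (phi N (resample \<beta> h N k A (refresh N (it_phi \<beta> h N A (Suc k)) w v g)) (Suc k)) (it_xi \<beta> h N (resample \<beta> h N k A (refresh N (it_phi \<beta> h N A (Suc k)) w v g)) (Suc k))
            = ?U N (A, w, v) * ip N (phi N (fst (A, w, v)) (Suc k)) (snd (snd (A, w, v)))"
          using it_resample_refresh(2)[OF N, of k A w v g] by simp
      next
        show "on_block N (\<lambda>A. ip N (phi N A (Suc k)) (it_xi \<beta> h N A (Suc k)))" for N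
          unfolding on_block_def by (intro allI impI ip_cong it_block(1,2))
      qed measurable
    qed
  }
qed

end

section \<open>Limits of the overlaps\<close>

context sk_params
begin

text \<open>The coefficients of zeta^(1), ..., zeta^(j) in h^(j+1): m^(j+1) is \<open>Th\<close> of
  the combination with weights \<open>tau j\<close>. They vanish beyond j, so one k serves all j <=
  k.\<close>

definition tau :: "nat => nat => real" where
  "tau j s = (if s < j then gam \<beta> h s else if s = j then sqrt (dd j) else 0)"

lemma sum_tau:
  assumes "1 <= j" "j <= k"
  shows "(\<Sum>s=1..k. tau j s * c s) = (\<Sum>s=1..<j. gam \<beta> h s * c s) + sqrt (dd j) * c j"
proof -
  have "(\<Sum>s=1..k. tau j s * c s) = (\<Sum>s=1..j. tau j s * c s)"
    by (rule sum.mono_neutral_right) (use assms in \<open>auto simp: tau_def\<close>)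
  also have "{1..j} = insert j {1..<j}" using assms by auto
  also have "(\<Sum>s\<in>insert j {1..<j}. tau j s * c s) = tau j j * c j + (\<Sum>s=1..<j. tau j s * c s)" by (rule sum.insert) auto
  also have "(\<Sum>s=1..<j. tau j s * c s) = (\<Sum>s=1..<j. gam \<beta> h s * c s)" by (rule sum.cong) (auto simp: tau_def)
  finally show ?thesis by (simp add: tau_def)
qed

lemma Gam_sq_pred: "1 <= j ==> (\<Sum>s=1..<j. (gam \<beta> h s)\<^sup>2) = Gam_sq \<beta> h (j - 1)"
  unfolding Gam_sq_def by (rule sum.cong) auto

text \<open>The last weight sqrt(q - Gamma_(j-1)^2) completes the variance to q. For j < l the
  common part is Gamma_(j-1)^2 + gamma_j sqrt(q - Gamma_(j-1)^2), which is rho_j by the choice of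
  gamma_j.\<close>

lemma tau_gram:
  assumes "1 <= j" "j <= k"
  shows "(\<Sum>s=1..k. (tau j s)\<^sup>2) = Q" and "j < l ==> l <= k ==> (\<Sum>s=1..k. tau j s * tau l s) = rho \<beta> h j"
proof -
  have "(\<Sum>s=1..k. (tau j s)\<^sup>2) = (\<Sum>s=1..<j. gam \<beta> h s * tau j s) + sqrt (dd j) * tau j j"
    using sum_tau[OF assms, of "tau j"] by (simp only: power2_eq_square)
  also have "(\<Sum>s=1..<j. gam \<beta> h s * tau j s) = Gam_sq \<beta> h (j - 1)"
    unfolding Gam_sq_pred[OF assms(1), symmetric] by (rule sum.cong) (auto simp: tau_def power2_eq_square)
  finally show "(\<Sum>s=1..k. (tau j s)\<^sup>2) = Q" using dd_pos[OF assms(1)] by (simp add: tau_def dd_def)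
  assume l: "j < l" "l <= k"
  have "(\<Sum>s=1..<j. gam \<beta> h s * tau l s) = Gam_sq \<beta> h (j - 1)"
    unfolding Gam_sq_pred[OF assms(1), symmetric] by (rule sum.cong) (use l in \<open>auto simp: tau_def power2_eq_square\<close>)
  then show "(\<Sum>s=1..k. tau j s * tau l s) = rho \<beta> h j"
    unfolding sum_tau[OF assms] using l gam_sqrt_dd[OF assms(1)] by (simp add: tau_def mult.commute)
qed

lemma it_m_Suc:
  assumes "1 <= j" "j <= k"
  shows "it_m \<beta> h N A (Suc j) = (\<lambda>i. Th \<beta> h (lin k (tau j) N A i))"
proof -
  obtain l where l: "j = Suc l" using assms(1) by (cases j) auto
  show ?thesis
    unfolding sum_tau[OF assms] unfolding l it_m.simps Let_def
    by (simp add: Th_def Q_def[symmetric] dd_def algebra_simps)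
qed

lemma Th_lipschitz: "\<bar>Th \<beta> h x - Th \<beta> h y\<bar> <= \<bar>x - y\<bar>"
proof -
  have "\<bar>Th \<beta> h x - Th \<beta> h y\<bar> <= \<bar>(h + \<beta> * x) - (h + \<beta> * y)\<bar>" unfolding Th_def by (rule tanh_lipschitz)
  also have "\<dots> = \<beta> * \<bar>x - y\<bar>" using beta_pos by (simp add: abs_mult flip: right_diff_distrib)
  also have "\<dots> <= 1 * \<bar>x - y\<bar>" by (rule mult_right_mono) (use beta_sq_less(3) in auto)
  finally show ?thesis by simp
qed

lemma tame_boundI:
  assumes L: "0 <= L" and g: "\<And>x y. \<bar>f x y\<bar> <= L * (1 + \<bar>x\<bar> + \<bar>y\<bar>)"
    and l: "\<And>x y x' y'. \<bar>f x y - f x' y'\<bar> <= L * (1 + \<bar>y\<bar>) * (\<bar>x - x'\<bar> + \<bar>y - y'\<bar>)"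
  shows "tame f"
  unfolding tame_def tame_bound_def
proof (intro exI[of _ L] conjI allI L g)
  fix x y x' y'
  have "L * (1 + \<bar>y\<bar>) * (\<bar>x - x'\<bar> + \<bar>y - y'\<bar>) <= L * (1 + \<bar>x\<bar> + \<bar>y\<bar> + \<bar>x'\<bar> + \<bar>y'\<bar>) * (\<bar>x - x'\<bar> + \<bar>y - y'\<bar>)"
    using L by (intro mult_right_mono mult_left_mono) auto
  then show "\<bar>f x y - f x' y'\<bar> <= L * (1 + \<bar>x\<bar> + \<bar>y\<bar> + \<bar>x'\<bar> + \<bar>y'\<bar>) * (\<bar>x - x'\<bar> + \<bar>y - y'\<bar>)"
    using l[of x y x' y'] by linarith
qed

lemma tame_Th_mult: "tame (\<lambda>x y. Th \<beta> h x * y)"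
proof (rule tame_boundI[of 1])
  show "\<bar>Th \<beta> h x * y\<bar> <= 1 * (1 + \<bar>x\<bar> + \<bar>y\<bar>)" for x y
    using mult_right_mono[OF Th_bound[of x], of "\<bar>y\<bar>"] by (simp add: abs_mult)
  fix x y x' y'
  have "Th \<beta> h x * y - Th \<beta> h x' * y' = (Th \<beta> h x - Th \<beta> h x') * y + Th \<beta> h x' * (y - y')" by (simp add: algebra_simps)
  then have "\<bar>Th \<beta> h x * y - Th \<beta> h x' * y'\<bar> <= \<bar>Th \<beta> h x - Th \<beta> h x'\<bar> * \<bar>y\<bar> + \<bar>Th \<beta> h x'\<bar> * \<bar>y - y'\<bar>"
    by (simp only: abs_mult[symmetric] abs_triangle_ineq)
  also have "\<dots> <= \<bar>x - x'\<bar> * \<bar>y\<bar> + 1 * \<bar>y - y'\<bar>"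
    by (intro add_mono mult_right_mono Th_lipschitz Th_bound) auto
  also have "\<dots> <= \<bar>x - x'\<bar> * (1 + \<bar>y\<bar>) + (1 + \<bar>y\<bar>) * \<bar>y - y'\<bar>" by (intro add_mono mult_left_mono mult_right_mono) auto
  finally show "\<bar>Th \<beta> h x * y - Th \<beta> h x' * y'\<bar> <= 1 * (1 + \<bar>y\<bar>) * (\<bar>x - x'\<bar> + \<bar>y - y'\<bar>)" by (simp add: algebra_simps)
qed simp

lemma tame_Th_Th: "tame (\<lambda>x y. Th \<beta> h x * Th \<beta> h y)"
proof (rule tame_boundI[of 1])
  show "\<bar>Th \<beta> h x * Th \<beta> h y\<bar> <= 1 * (1 + \<bar>x\<bar> + \<bar>y\<bar>)" for x y
    using mult_mono[OF Th_bound[of x] Th_bound[of y]] by (simp add: abs_mult)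
  fix x y x' y'
  have "Th \<beta> h x * Th \<beta> h y - Th \<beta> h x' * Th \<beta> h y' = (Th \<beta> h x - Th \<beta> h x') * Th \<beta> h y + Th \<beta> h x' * (Th \<beta> h y - Th \<beta> h y')" by (simp add: algebra_simps)
  then have "\<bar>Th \<beta> h x * Th \<beta> h y - Th \<beta> h x' * Th \<beta> h y'\<bar> <= \<bar>Th \<beta> h x - Th \<beta> h x'\<bar> * \<bar>Th \<beta> h y\<bar> + \<bar>Th \<beta> h x'\<bar> * \<bar>Th \<beta> h y - Th \<beta> h y'\<bar>"
    by (simp only: abs_mult[symmetric] abs_triangle_ineq)
  also have "\<dots> <= \<bar>x - x'\<bar> * 1 + 1 * \<bar>y - y'\<bar>"
    by (intro add_mono mult_mono Th_lipschitz Th_bound) auto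
  also have "\<dots> <= \<bar>x - x'\<bar> * (1 + \<bar>y\<bar>) + (1 + \<bar>y\<bar>) * \<bar>y - y'\<bar>" by (intro add_mono mult_left_mono mult_right_mono) auto
  finally show "\<bar>Th \<beta> h x * Th \<beta> h y - Th \<beta> h x' * Th \<beta> h y'\<bar> <= 1 * (1 + \<bar>y\<bar>) * (\<bar>x - x'\<bar> + \<bar>y - y'\<bar>)" by (simp add: algebra_simps)
qed simp

lemma tame_Th: "tame (\<lambda>x y. Th \<beta> h x)"
proof (rule tame_boundI[of 1])
  show "\<bar>Th \<beta> h x\<bar> <= 1 * (1 + \<bar>x\<bar> + \<bar>y\<bar>)" for x y :: real using Th_bound[of x] by simp
  show "\<bar>Th \<beta> h x - Th \<beta> h x'\<bar> <= 1 * (1 + \<bar>y\<bar>) * (\<bar>x - x'\<bar> + \<bar>y - y'\<bar>)" for x y x' y' :: real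
    using Th_lipschitz[of x x'] mult_mono[of 1 "1 + \<bar>y\<bar>" "\<bar>x - x'\<bar>" "\<bar>x - x'\<bar> + \<bar>y - y'\<bar>"] by simp
qed simp

lemma tame_ln_cosh: "tame (\<lambda>x y. ln (cosh (h + \<beta> * x)))"
proof (rule tame_boundI[of "1 + h"])
  have b: "\<beta> * \<bar>x\<bar> <= 1 * \<bar>x\<bar>" for x by (rule mult_right_mono) (use beta_sq_less(3) in auto)
  show "\<bar>ln (cosh (h + \<beta> * x))\<bar> <= (1 + h) * (1 + \<bar>x\<bar> + \<bar>y\<bar>)" for x y :: real
  proof -
    have "\<bar>ln (cosh (h + \<beta> * x))\<bar> <= \<bar>h\<bar> + \<bar>\<beta> * x\<bar>" by (rule order_trans[OF ln_cosh_bound abs_triangle_ineq])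
    also have "\<dots> <= h + \<bar>x\<bar>" using b[of x] h_pos beta_pos by (simp add: abs_mult)
    also have "\<dots> <= (1 + h) * (1 + \<bar>x\<bar> + \<bar>y\<bar>)" using h_pos by (simp add: algebra_simps)
    finally show ?thesis .
  qed
  fix x y x' y' :: real
  have "\<bar>ln (cosh (h + \<beta> * x)) - ln (cosh (h + \<beta> * x'))\<bar> <= \<bar>(h + \<beta> * x) - (h + \<beta> * x')\<bar>" by (rule ln_cosh_lipschitz)
  also have "\<dots> = \<beta> * \<bar>x - x'\<bar>" using beta_pos by (simp add: abs_mult flip: right_diff_distrib)
  also have "\<dots> <= \<bar>x - x'\<bar>" using b by simp
  also have "\<dots> <= ((1 + h) * (1 + \<bar>y\<bar>)) * (\<bar>x - x'\<bar> + \<bar>y - y'\<bar>)"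
  proof -
    have "1 * 1 <= (1 + h) * (1 + \<bar>y\<bar>)" by (intro mult_mono) (use h_pos in auto)
    then have "1 * \<bar>x - x'\<bar> <= ((1 + h) * (1 + \<bar>y\<bar>)) * (\<bar>x - x'\<bar> + \<bar>y - y'\<bar>)" by (intro mult_mono) auto
    then show ?thesis by simp
  qed
  finally show "\<bar>ln (cosh (h + \<beta> * x)) - ln (cosh (h + \<beta> * x'))\<bar> <= (1 + h) * (1 + \<bar>y\<bar>) * (\<bar>x - x'\<bar> + \<bar>y - y'\<bar>)" .
qed (use h_pos in simp)

text \<open>The law of large numbers turns the overlap of two m's into a Gaussian expectation of two
  \<open>Th\<close> factors with the covariance of \<open>tau_gram\<close>; that expectation is psi
  of the previous rho.\<close>

lemma cvp_m_gram:
  assumes l: "lln k"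
  shows "1 <= j ==> j < t ==> t <= Suc k ==> G.cvp (\<lambda>N A. ip N (it_m \<beta> h N A j) (it_m \<beta> h N A t)) (rho \<beta> h j)"
    and "1 <= j ==> j <= Suc k ==> G.cvp (\<lambda>N A. ip N (it_m \<beta> h N A j) (it_m \<beta> h N A j)) Q"
proof -
  assume j: "1 <= j" "j < t" "t <= Suc k"
  then obtain t' where t': "t = Suc t'" "1 <= t'" "t' <= k" by (cases t) auto
  note mt = it_m_Suc[OF t'(2,3)]
  show "G.cvp (\<lambda>N A. ip N (it_m \<beta> h N A j) (it_m \<beta> h N A t)) (rho \<beta> h j)"
  proof (cases "j = 1")
    case True
    have "G.cvp (\<lambda>N A. sqrt Q * ((\<Sum>i<N. Th \<beta> h (lin k (tau t') N A i)) / real N)) (sqrt Q * gamma_1 \<beta> h)"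
      using G.cvp_cmult[OF llnD(1)[OF l tame_Th, of "tau t'" "\<lambda>_. 0"], of "sqrt Q"]
      unfolding Ef_def Th_gs(2)[OF finite_atLeastAtMost tau_gram(1)[OF t'(2,3)]] .
    moreover have "ip N (it_m \<beta> h N A j) (it_m \<beta> h N A t) = sqrt Q * ((\<Sum>i<N. Th \<beta> h (lin k (tau t') N A i)) / real N)" for N A
      unfolding t'(1) mt True by (simp add: it_m.simps ip_def Q_def[symmetric] sum_distrib_left)
    ultimately show ?thesis using True by (simp add: Q_def[symmetric])
  next
    \<comment> \<open>With j = n + 2 the vector m^(j) uses the weights \<open>tau (n + 1)\<close>,
      whose covariance with the later weights is rho_(n+1); the limit psi(rho_(n+1)) is rho_(n+2) =
      rho_j.\<close>
    case False
    then have "2 <= j" using j(1) by simp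
    then obtain n where "j = 2 + n" using le_Suc_ex by blast
    then have n: "j = Suc (Suc n)" by simp
    have jj: "1 <= Suc n" "Suc n <= k" "Suc n < t'" using j n t' by auto
    note mj = it_m_Suc[OF jj(1,2)]
    have "G.cvp (\<lambda>N A. (\<Sum>i<N. Th \<beta> h (lin k (tau (Suc n)) N A i) * Th \<beta> h (lin k (tau t') N A i)) / real N) (psi \<beta> h (rho \<beta> h (Suc n)))"
      using llnD(1)[OF l tame_Th_Th, of "tau (Suc n)" "tau t'"]
      unfolding Ef_def psi_eq[OF finite_atLeastAtMost rho_bounds[OF jj(1)] tau_gram(1)[OF jj(1,2)] tau_gram(1)[OF t'(2,3)] tau_gram(2)[OF jj(1,2,3) t'(3)]] .
    then show ?thesis unfolding t'(1) n mt mj ip_def by simp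
  qed
next
  assume j: "1 <= j" "j <= Suc k"
  show "G.cvp (\<lambda>N A. ip N (it_m \<beta> h N A j) (it_m \<beta> h N A j)) Q"
  proof (cases "j = 1")
    case True
    show ?thesis
    proof (rule G.cvp_eventually_cong[OF G.cvp_const])
      show "\<forall>\<^sub>F N in sequentially. \<forall>A\<in>space (Gm N). ip N (it_m \<beta> h N A j) (it_m \<beta> h N A j) = Q"
        by (rule eventually_sequentiallyI[of 1]) (use True Q(1) in \<open>simp add: it_m.simps ip_def Q_def[symmetric]\<close>)
    qed measurable
  next
    case False
    then obtain n where n: "j = Suc n" "1 <= n" "n <= k" using j by (cases j) auto
    have "G.cvp (\<lambda>N A. (\<Sum>i<N. Th \<beta> h (lin k (tau n) N A i) * Th \<beta> h (lin k (tau n) N A i)) / real N) Q"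
      using llnD(1)[OF l tame_Th_Th, of "tau n" "tau n"]
      unfolding Ef_def power2_eq_square[symmetric] Th_gs(1)[OF finite_atLeastAtMost tau_gram(1)[OF n(2,3)]] .
    then show ?thesis unfolding n(1) it_m_Suc[OF n(2,3)] ip_def .
  qed
qed

text \<open>The vector normalized by Gram-Schmidt. At s = 1 it is m^(1), a positive multiple of the
  all-ones vector, so the formula for phi^(s) holds there too.\<close>

definition resid :: "nat => matr => nat => vect" where
  "resid N A s = (\<lambda>i. it_m \<beta> h N A s i - (\<Sum>t=1..<s. ip N (it_m \<beta> h N A s) (phi N A t) * phi N A t i))"

lemma it_phi_resid:
  assumes N: "N >= 1" and s: "s >= 1" shows "phi N A s = (\<lambda>i. resid N A s i / nrm N (resid N A s))"
proof (cases "s = 1")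
  case True
  have "resid N A s = (\<lambda>i. sqrt Q)" by (simp add: resid_def True it_m.simps Q_def)
  moreover have "nrm N (\<lambda>i. sqrt Q) = sqrt Q" using N Q(1) by (simp add: nrm_def ip_def)
  ultimately show ?thesis using Q(1) True by (simp add: it_phi.simps)
next
  case False
  then have "2 <= s" using s by simp
  then obtain l where "s = 2 + l" using le_Suc_ex by blast
  then have l: "s = Suc (Suc l)" by simp
  have "{1..Suc l} = {1..<s}" using l by auto
  then show ?thesis unfolding l by (simp only: it_phi.simps Let_def resid_def)
qed

lemma ip_projection:
  assumes N: "N >= 1" and S: "finite S" "S \<subseteq> {1..}"
  shows "ip N (\<lambda>i. x i - (\<Sum>t\<in>S. ip N x (phi N A t) * phi N A t i)) (\<lambda>i. x i - (\<Sum>t\<in>S. ip N x (phi N A t) * phi N A t i))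
    = ip N x x - (\<Sum>t\<in>S. (ip N x (phi N A t))\<^sup>2)"
proof -
  let ?c = "\<lambda>t. ip N x (phi N A t)"
  let ?p = "\<lambda>i. \<Sum>t\<in>S. ?c t * phi N A t i"
  have "ip N ?p ?p = (\<Sum>t\<in>S. ?c t * ?c t * ip N (phi N A t) (phi N A t))"
    by (rule ip_orthogonal_sums[OF S(1)]) (use S in \<open>auto intro!: it_phi_orthogonal[OF N]\<close>)
  also have "\<dots> = (\<Sum>t\<in>S. ?c t * ?c t)"
  proof (rule sum.cong[OF refl])
    fix t assume "t \<in> S"
    then show "?c t * ?c t * ip N (phi N A t) (phi N A t) = ?c t * ?c t"
      using unit_or_zero_mult[OF it_phi_unit_or_zero[OF N, of t \<beta> h A], of x] S(2) by (auto simp: mult.assoc)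
  qed
  finally have pp: "ip N ?p ?p = (\<Sum>t\<in>S. ?c t * ?c t)" .
  have mp: "ip N x ?p = (\<Sum>t\<in>S. ?c t * ?c t)" unfolding ip_sum ip_linear ..
  have "ip N (\<lambda>i. x i - ?p i) (\<lambda>i. x i - ?p i) = ip N x x - ip N x ?p - (ip N x ?p - ip N ?p ?p)"
    unfolding ip_linear(2) ip_linear(8) ip_commute[of N ?p x] ..
  then show ?thesis unfolding pp mp by (simp add: power2_eq_square)
qed

lemma bessel:
  assumes "N >= 1" shows "(\<Sum>t=1..k. (ip N x (phi N A t))\<^sup>2) <= ip N x x"
  using ip_projection[OF assms, of "{1..k}" x A] ip_self_nonneg by (metis (no_types, lifting) atLeastAtMost_iff atLeast_iff diff_ge_0_iff_ge finite_atLeastAtMost subsetI)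

lemma ip_resid:
  assumes N: "N >= 1"
  shows "ip N (resid N A s) (resid N A s) = ip N (it_m \<beta> h N A s) (it_m \<beta> h N A s) - (\<Sum>t=1..<s. (ip N (it_m \<beta> h N A s) (phi N A t))\<^sup>2)"
  unfolding resid_def by (rule ip_projection[OF N]) auto

text \<open>Gram-Schmidt carried out on the limiting Gram matrix. The squared residual norm tends to
  q - Gamma_(s-1)^2, which is positive; hence phi^(s) is a unit vector with probability tending to
  1, and <m^(t), phi^(s)> tends to (rho_s - Gamma_(s-1)^2) / sqrt(q - Gamma_(s-1)^2) = gamma_s for
  every t > s.\<close>

lemma cvp_m_phi:
  assumes l: "lln k"
  shows "1 <= s ==> s <= Suc k ==>
    (\<forall>t. s < t --> t <= Suc k --> G.cvp (\<lambda>N A. ip N (it_m \<beta> h N A t) (phi N A s)) (gam \<beta> h s)) \<and>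
    G.cvp (\<lambda>N A. ip N (phi N A s) (phi N A s)) 1"
proof (induction s rule: less_induct)
  case (less s)
  have IH: "G.cvp (\<lambda>N A. ip N (it_m \<beta> h N A t) (phi N A r)) (gam \<beta> h r)" if "1 <= r" "r < s" "r < t" "t <= Suc k" for r t
  proof -
    have "r <= Suc k" using that less.prems by simp
    with less.IH[OF that(2,1)] that show ?thesis by blast
  qed
  have "G.cvp (\<lambda>N A. ip N (it_m \<beta> h N A s) (it_m \<beta> h N A s) - (\<Sum>t=1..<s. (ip N (it_m \<beta> h N A s) (phi N A t))\<^sup>2)) (Q - (\<Sum>t=1..<s. (gam \<beta> h t)\<^sup>2))"
    by (intro G.cvp_diff G.cvp_sum G.cvp_power2 cvp_m_gram(2)[OF l] IH) (use less.prems in auto)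
  then have rr: "G.cvp (\<lambda>N A. ip N (resid N A s) (resid N A s)) (dd s)"
    unfolding Gam_sq_pred[OF less.prems(1)] dd_def
  proof (rule G.cvp_eventually_cong)
    show "(\<lambda>A. ip N (resid N A s) (resid N A s)) \<in> borel_measurable (Gm N)" for N unfolding resid_def by measurable
    show "\<forall>\<^sub>F N in sequentially. \<forall>A\<in>space (Gm N). ip N (resid N A s) (resid N A s)
       = ip N (it_m \<beta> h N A s) (it_m \<beta> h N A s) - (\<Sum>t=1..<s. (ip N (it_m \<beta> h N A s) (phi N A t))\<^sup>2)"
      by (rule eventually_sequentiallyI[of 1], rule ballI, rule ip_resid)
  qed
  have d0: "0 < dd s" by (rule dd_pos[OF less.prems(1)])
  have n: "G.cvp (\<lambda>N A. nrm N (resid N A s)) (sqrt (dd s))" unfolding nrm_def by (rule G.cvp_sqrt[OF rr])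
  show ?case
  proof (intro conjI allI impI)
    fix t assume t: "s < t" "t <= Suc k"
    have "G.cvp (\<lambda>N A. (ip N (it_m \<beta> h N A s) (it_m \<beta> h N A t) - (\<Sum>r=1..<s. ip N (it_m \<beta> h N A s) (phi N A r) * ip N (it_m \<beta> h N A t) (phi N A r))) / nrm N (resid N A s))
      ((rho \<beta> h s - (\<Sum>r=1..<s. gam \<beta> h r * gam \<beta> h r)) / sqrt (dd s))"
      by (intro G.cvp_divide G.cvp_diff G.cvp_sum G.cvp_mult cvp_m_gram(1)[OF l] IH n) (use less.prems t d0 in auto)
    moreover have "(rho \<beta> h s - (\<Sum>r=1..<s. gam \<beta> h r * gam \<beta> h r)) / sqrt (dd s) = gam \<beta> h s"
      using gam_sqrt_dd[OF less.prems(1)] Gam_sq_pred[OF less.prems(1)] d0 by (simp add: power2_eq_square field_simps)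
    ultimately show "G.cvp (\<lambda>N A. ip N (it_m \<beta> h N A t) (phi N A s)) (gam \<beta> h s)"
    proof (rule G.cvp_eventually_cong[OF back_subst[of "G.cvp _"]])
      show "\<forall>\<^sub>F N in sequentially. \<forall>A\<in>space (Gm N). ip N (it_m \<beta> h N A t) (phi N A s) =
        (ip N (it_m \<beta> h N A s) (it_m \<beta> h N A t) - (\<Sum>r=1..<s. ip N (it_m \<beta> h N A s) (phi N A r) * ip N (it_m \<beta> h N A t) (phi N A r))) / nrm N (resid N A s)"
      proof (rule eventually_sequentiallyI[of 1], rule ballI)
        fix N :: nat and A assume N: "1 <= N"
        show "ip N (it_m \<beta> h N A t) (phi N A s) =
        (ip N (it_m \<beta> h N A s) (it_m \<beta> h N A t) - (\<Sum>r=1..<s. ip N (it_m \<beta> h N A s) (phi N A r) * ip N (it_m \<beta> h N A t) (phi N A r))) / nrm N (resid N A s)"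
          unfolding it_phi_resid[OF N less.prems(1)] ip_linear(11)
          unfolding resid_def ip_linear ip_sum ip_commute[of N "it_m \<beta> h N A s" "it_m \<beta> h N A t"] ..
      qed
    qed measurable
  next
    have "G.cvp (\<lambda>N A. ip N (resid N A s) (resid N A s) / nrm N (resid N A s) / nrm N (resid N A s)) (dd s / sqrt (dd s) / sqrt (dd s))"
      by (intro G.cvp_divide rr n) (use d0 in auto)
    moreover have "dd s / sqrt (dd s) / sqrt (dd s) = 1" using d0 by (simp add: field_simps)
    ultimately show "G.cvp (\<lambda>N A. ip N (phi N A s) (phi N A s)) 1"
    proof (rule G.cvp_eventually_cong[OF back_subst[of "G.cvp _"]])
      show "\<forall>\<^sub>F N in sequentially. \<forall>A\<in>space (Gm N). ip N (phi N A s) (phi N A s) = ip N (resid N A s) (resid N A s) / nrm N (resid N A s) / nrm N (resid N A s)"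
      proof (rule eventually_sequentiallyI[of 1], rule ballI)
        fix N :: nat and A assume N: "1 <= N"
        show "ip N (phi N A s) (phi N A s) = ip N (resid N A s) (resid N A s) / nrm N (resid N A s) / nrm N (resid N A s)"
          unfolding it_phi_resid[OF N less.prems(1)] ip_linear(5) ip_linear(11) ..
      qed
    qed measurable
  qed
qed

text \<open>Closes the loop: the statement at k gives, through \<open>cvp_m_phi\<close>, the
  nondegeneracy of phi^(k+1) that the step to k + 1 requires.\<close>

theorem lln: "lln k"
proof (induction k)
  case 0
  have "G.cvp (\<lambda>N A. (\<Sum>i<N. f (lin 0 a N A i) (lin 0 b N A i)) / real N) (Ef 0 f a b)" for f a b
  proof (rule G.cvp_eventually_cong[OF G.cvp_const])
    interpret g: prob_space "gs ({}::nat set)" by (rule prob_space_gs)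
    have "Ef 0 f a b = f 0 0" by (simp add: Ef_def g.prob_space[simplified])
    then show "\<forall>\<^sub>F N in sequentially. \<forall>A\<in>space (Gm N). (\<Sum>i<N. f (lin 0 a N A i) (lin 0 b N A i)) / real N = Ef 0 f a b"
      by (intro eventually_sequentiallyI[of 1]) simp
  qed simp
  then show ?case by (simp add: lln_def)
next
  case (Suc k)
  show ?case by (rule lln_Suc[OF Suc]) (use cvp_m_phi[OF Suc, of "Suc k"] in simp)
qed

lemma cvp_ln_cosh:
  assumes k: "1 <= k"
  shows "G.cvp (\<lambda>N A. (\<Sum>i<N. ln (cosh (h + \<beta> * lin k (tau k) N A i))) / real N) (V Q)"
  using llnD(1)[OF lln[of k] tame_ln_cosh, of "tau k" "\<lambda>_. 0"]
  unfolding Ef_def Th_gs(3)[OF finite_atLeastAtMost tau_gram(1)[OF k order_refl]] .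

text \<open>In the limit the argument of \<open>Th\<close> and zeta^(s) are jointly Gaussian with
  covariance \<open>tau k s\<close>. Regressing the second on the first leaves the mean of Z Th(sqrt
  Q Z), which integration by parts and the fixed point equation evaluate to beta sqrt Q (1 -
  Q).\<close>

lemma cvp_m_zeta:
  assumes k: "1 <= k" and s: "s \<in> {1..k}"
  shows "G.cvp (\<lambda>N A. ip N (it_m \<beta> h N A (Suc k)) (ze N A s)) (\<beta> * tau k s * (1 - Q))"
proof -
  \<comment> \<open>The weights that select zeta^(s) itself as the second linear
    combination.\<close>
  let ?e = "\<lambda>t. if t = s then 1 else (0::real)"
  let ?p = "sqrt Q" and ?r = "tau k s / sqrt Q"
  have p: "0 < ?p" "?p\<^sup>2 = Q" using Q(1) by auto
  have "(tau k s)\<^sup>2 <= (\<Sum>t=1..k. (tau k t)\<^sup>2)" by (rule member_le_sum) (use s in auto)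
  then have t2: "(tau k s)\<^sup>2 <= Q" unfolding tau_gram(1)[OF k order_refl] .
  then have r: "?r\<^sup>2 <= 1" using Q(1) by (simp add: power_divide)
  \<comment> \<open>Length of the part of zeta^(s) independent of the argument of \<open>Th\<close>;
    real because \<open>tau k s\<close> is one of the weights whose squares add up to Q.\<close>
  define t where "t = sqrt (1 - ?r\<^sup>2)"
  have t: "?r\<^sup>2 + t\<^sup>2 = 1" using r by (simp add: t_def)
  have se: "(\<Sum>u=1..k. c u * ?e u) = c s" for c :: "nat => real"
  proof -
    have "(\<Sum>u=1..k. c u * ?e u) = (\<Sum>u=1..k. if u = s then c u else 0)" by (rule sum.cong) auto
    then show ?thesis using s by (simp add: sum.delta)
  qed
  have se2: "(\<Sum>u=1..k. ?e u * c u) = c s" for c using se[of c] by (simp add: mult.commute)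
  have "Ef k (\<lambda>x y. Th \<beta> h x * y) (tau k) ?e
     = (\<integral>x. Th \<beta> h (?p * fst x) * (?r * fst x + t * snd x) \<partial>(sn \<Otimes>\<^sub>M sn))"
    unfolding Ef_def
  proof (rule gs_integral_two_functionals)
    show "(\<Sum>u=1..k. (tau k u)\<^sup>2) = ?p\<^sup>2" unfolding p(2) by (rule tau_gram(1)[OF k order_refl])
    show "(\<Sum>u=1..k. tau k u * ?e u) = ?p * ?r" unfolding se using p(1) by simp
    show "(\<Sum>u=1..k. (?e u)\<^sup>2) = ?r\<^sup>2 + t\<^sup>2" unfolding t unfolding power2_eq_square se by simp
    show "(\<lambda>(x, y). Th \<beta> h x * y) \<in> borel_measurable (borel \<Otimes>\<^sub>M borel)" by (rule tame_measurable[OF tame_Th_mult])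
  qed (use p in auto)
  also have "\<dots> = (\<integral>x. ?r * Th \<beta> h (?p * fst x) * fst x + t * Th \<beta> h (?p * fst x) * snd x \<partial>(sn \<Otimes>\<^sub>M sn))"
    by (intro Bochner_Integration.integral_cong) (auto simp: algebra_simps)
  also have "\<dots> = ?r * (\<beta> * ?p * (1 - Q))"
  proof -
    have i1: "integrable sn (\<lambda>x. ?r * Th \<beta> h (?p * x) * x)"
    proof (rule sn_integrable_linear[where a=0 and b="\<bar>?r\<bar>"])
      show "\<bar>?r * Th \<beta> h (?p * x) * x\<bar> <= 0 + \<bar>?r\<bar> * \<bar>x\<bar>" for x
        using mult_right_mono[OF mult_left_mono[OF Th_bound[of "?p * x"], of "\<bar>?r\<bar>"], of "\<bar>x\<bar>"] by (simp add: abs_mult)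
    qed simp_all
    have i2: "integrable sn (\<lambda>x. t * Th \<beta> h (?p * x))"
      by (intro integrable_mult_right sn_integrable_bounded[where B=1] Th_bound) simp
    have i3: "integrable sn (\<lambda>x::real. x)" by (rule sn_integrable_linear[where a=0 and b=1]) auto
    have "(\<integral>x. x * Th \<beta> h (?p * x) \<partial>sn) = (\<integral>x. \<beta> * ?p * (1 - (Th \<beta> h (?p * x))\<^sup>2) \<partial>sn)"
    proof (rule sn_integration_by_parts)
      fix x
      have "((\<lambda>x. tanh (h + \<beta> * (?p * x))) has_real_derivative (1 - (tanh (h + \<beta> * (?p * x)))\<^sup>2) * (\<beta> * ?p)) (at x)"
        by (rule DERIV_chain2[OF DERIV_tanh_real]) (auto intro!: derivative_eq_intros)
      then show "((\<lambda>x. Th \<beta> h (?p * x)) has_real_derivative \<beta> * ?p * (1 - (Th \<beta> h (?p * x))\<^sup>2)) (at x)"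
        by (simp add: Th_def mult_ac)
      have "cosh (h + \<beta> * (?p * x)) ~= 0" by simp
      then show "isCont (\<lambda>x. \<beta> * ?p * (1 - (Th \<beta> h (?p * x))\<^sup>2)) x"
        unfolding Th_def by (intro continuous_intros) auto
      show "\<bar>Th \<beta> h (?p * x)\<bar> <= 1 + \<beta> * ?p"
        using Th_bound[of "?p * x"] mult_pos_pos[OF beta_pos p(1)] by linarith
      have "\<beta> * ?p * (1 - (Th \<beta> h (?p * x))\<^sup>2) <= \<beta> * ?p * 1"
        by (rule mult_left_mono) (use beta_pos p in auto)
      moreover have "0 <= \<beta> * ?p * (1 - (Th \<beta> h (?p * x))\<^sup>2)"
        using beta_pos p tanh_bounds(2)[of "h + \<beta> * (?p * x)"] by (intro mult_nonneg_nonneg) (auto simp: Th_def)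
      ultimately show "\<bar>\<beta> * ?p * (1 - (Th \<beta> h (?p * x))\<^sup>2)\<bar> <= 1 + \<beta> * ?p" by linarith
    qed
    also have "\<dots> = \<beta> * ?p * (1 - (\<integral>x. (Th \<beta> h (?p * x))\<^sup>2 \<partial>sn))"
    proof -
      have "integrable sn (\<lambda>x. (Th \<beta> h (?p * x))\<^sup>2)"
        by (rule sn_integrable_bounded[where B=1]) (auto simp: Th_def tanh_bounds)
      then show ?thesis by simp
    qed
    also have "(\<integral>x. (Th \<beta> h (?p * x))\<^sup>2 \<partial>sn) = F Q"
      unfolding F_def gauss_E_def Th_def by (simp add: mult.assoc)
    also have "F Q = Q" by (rule Q(2)[symmetric])
    finally have I: "(\<integral>x. x * Th \<beta> h (?p * x) \<partial>sn) = \<beta> * ?p * (1 - Q)" .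
    have "(\<integral>x. ?r * Th \<beta> h (?p * fst x) * fst x + t * Th \<beta> h (?p * fst x) * snd x \<partial>(sn \<Otimes>\<^sub>M sn))
       = (\<integral>x. ?r * Th \<beta> h (?p * fst x) * fst x \<partial>(sn \<Otimes>\<^sub>M sn)) + (\<integral>x. t * Th \<beta> h (?p * fst x) * snd x \<partial>(sn \<Otimes>\<^sub>M sn))"
      by (rule Bochner_Integration.integral_add[OF pair_integral_fst_snd(2)[OF i1] pair_integral_mult(2)[OF i2 i3]])
    also have "\<dots> = (\<integral>x. ?r * Th \<beta> h (?p * x) * x \<partial>sn) + (\<integral>x. t * Th \<beta> h (?p * x) \<partial>sn) * (\<integral>x. x \<partial>sn)"
      unfolding pair_integral_fst_snd(1)[OF i1] pair_integral_mult(1)[OF i2 i3] ..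
    also have "\<dots> = ?r * (\<integral>x. x * Th \<beta> h (?p * x) \<partial>sn)"
    proof -
      have "(\<integral>x. ?r * Th \<beta> h (?p * x) * x \<partial>sn) = (\<integral>x. ?r * (x * Th \<beta> h (?p * x)) \<partial>sn)"
        by (intro Bochner_Integration.integral_cong) auto
      then show ?thesis unfolding sn_moments integral_mult_right_zero by simp
    qed
    finally show ?thesis unfolding I .
  qed
  also have "\<dots> = \<beta> * tau k s * (1 - Q)" using p(1) by simp
  finally have E: "Ef k (\<lambda>x y. Th \<beta> h x * y) (tau k) ?e = \<beta> * tau k s * (1 - Q)" .
  show ?thesis
    using llnD(1)[OF lln[of k] tame_Th_mult, of "tau k" ?e] unfolding E se2
    unfolding it_m_Suc[OF k order_refl] ip_def .
qed

end

section \<open>Concentration of the tilted partition function\<close>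

lemma log_partition_bound:
  fixes w Y q :: "'s => real"
  assumes S: "finite S" "S ~= {}" and w: "\<And>\<sigma>. \<sigma> \<in> S ==> 0 < w \<sigma>"
    and Y: "\<And>\<sigma>. \<sigma> \<in> S ==> \<bar>Y \<sigma> - e\<bar> <= r + q \<sigma>"
    and q: "(\<Sum>\<sigma>\<in>S. w \<sigma> * exp (q \<sigma>)) <= (\<Sum>\<sigma>\<in>S. w \<sigma>) * C" and C: "0 < C"
  shows "\<bar>ln (\<Sum>\<sigma>\<in>S. w \<sigma> * exp (Y \<sigma>)) - ln (\<Sum>\<sigma>\<in>S. w \<sigma>) - e\<bar> <= r + ln C"
proof -
  let ?P = "\<Sum>\<sigma>\<in>S. w \<sigma>" and ?Z = "\<Sum>\<sigma>\<in>S. w \<sigma> * exp (Y \<sigma>)" and ?Z' = "\<Sum>\<sigma>\<in>S. w \<sigma> * exp (- Y \<sigma>)"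
  have P: "0 < ?P" "0 < ?Z" "0 < ?Z'" using S w by (auto intro!: sum_pos)
  have up: "(\<Sum>\<sigma>\<in>S. w \<sigma> * exp (f \<sigma>)) <= ?P * exp (c + r + ln C)" if f: "\<And>\<sigma>. \<sigma> \<in> S ==> f \<sigma> <= c + r + q \<sigma>" for f c
  proof -
    have "(\<Sum>\<sigma>\<in>S. w \<sigma> * exp (f \<sigma>)) <= (\<Sum>\<sigma>\<in>S. exp (c + r) * (w \<sigma> * exp (q \<sigma>)))"
    proof (rule sum_mono)
      fix \<sigma> assume s: "\<sigma> \<in> S"
      have "w \<sigma> * exp (f \<sigma>) <= w \<sigma> * exp (c + r + q \<sigma>)" using f[OF s] w[OF s] by (intro mult_left_mono) auto
      then show "w \<sigma> * exp (f \<sigma>) <= exp (c + r) * (w \<sigma> * exp (q \<sigma>))" by (simp add: exp_add mult_ac)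
    qed
    also have "\<dots> = exp (c + r) * (\<Sum>\<sigma>\<in>S. w \<sigma> * exp (q \<sigma>))" by (rule sum_distrib_left[symmetric])
    also have "\<dots> <= exp (c + r) * (?P * C)" by (rule mult_left_mono[OF q]) simp
    also have "\<dots> = ?P * exp (c + r + ln C)" using C by (simp add: exp_add)
    finally show ?thesis .
  qed
  have "Y \<sigma> <= e + r + q \<sigma>" "- Y \<sigma> <= - e + r + q \<sigma>" if "\<sigma> \<in> S" for \<sigma>
    using Y[OF that] by linarith+
  then have Z: "?Z <= ?P * exp (e + r + ln C)" and Z': "?Z' <= ?P * exp (- e + r + ln C)" by (intro up; simp)+
  have "ln ?Z <= ln (?P * exp (e + r + ln C))" using Z P by simp
  also have "\<dots> = ln ?P + (e + r + ln C)" using P by (simp add: ln_mult)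
  finally have 1: "ln ?Z <= ln ?P + (e + r + ln C)" .
  \<comment> \<open>The square root of each weight is split as the geometric mean of the Y-tilted
    and the (-Y)-tilted weight. The bound on Y is two-sided, so the upper bound also holds for the
    sum with -Y, and Cauchy-Schwarz reverses it.\<close>
  have "?P\<^sup>2 = (\<Sum>\<sigma>\<in>S. (sqrt (w \<sigma>) * exp (Y \<sigma> / 2)) * (sqrt (w \<sigma>) * exp (- Y \<sigma> / 2)))\<^sup>2"
  proof -
    have "w \<sigma> = (sqrt (w \<sigma>) * exp (Y \<sigma> / 2)) * (sqrt (w \<sigma>) * exp (- Y \<sigma> / 2))" if "\<sigma> \<in> S" for \<sigma>
    proof -
      have "(sqrt (w \<sigma>) * exp (Y \<sigma> / 2)) * (sqrt (w \<sigma>) * exp (- Y \<sigma> / 2)) = (sqrt (w \<sigma>) * sqrt (w \<sigma>)) * (exp (Y \<sigma> / 2) * exp (- Y \<sigma> / 2))" by simp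
      also have "exp (Y \<sigma> / 2) * exp (- Y \<sigma> / 2) = 1" by (simp flip: exp_add)
      finally show ?thesis using w[OF that] by simp
    qed
    then show ?thesis by (intro arg_cong[of _ _ "\<lambda>x. x\<^sup>2"] sum.cong) auto
  qed
  also have "\<dots> <= (\<Sum>\<sigma>\<in>S. (sqrt (w \<sigma>) * exp (Y \<sigma> / 2))\<^sup>2) * (\<Sum>\<sigma>\<in>S. (sqrt (w \<sigma>) * exp (- Y \<sigma> / 2))\<^sup>2)"
    by (rule Cauchy_Schwarz_ineq_sum)
  also have "(\<Sum>\<sigma>\<in>S. (sqrt (w \<sigma>) * exp (Y \<sigma> / 2))\<^sup>2) = ?Z"
    by (rule sum.cong) (use w in \<open>auto simp: power_mult_distrib less_imp_le simp flip: exp_of_nat_mult\<close>)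
  also have "(\<Sum>\<sigma>\<in>S. (sqrt (w \<sigma>) * exp (- Y \<sigma> / 2))\<^sup>2) = ?Z'"
    by (rule sum.cong) (use w in \<open>auto simp: power_mult_distrib less_imp_le simp flip: exp_of_nat_mult\<close>)
  also have "?Z * ?Z' <= ?Z * (?P * exp (- e + r + ln C))" by (rule mult_left_mono[OF Z']) (use P in simp)
  finally have "?P * ?P <= (?Z * exp (- e + r + ln C)) * ?P" by (simp add: power2_eq_square mult_ac)
  then have "?P <= ?Z * exp (- e + r + ln C)" using P(1) by (simp only: mult_le_cancel_right_pos)
  then have "ln ?P <= ln (?Z * exp (- e + r + ln C))" using P by simp
  also have "\<dots> = ln ?Z + (- e + r + ln C)" using P by (simp add: ln_mult)
  finally show ?thesis using 1 by (simp add: abs_le_iff)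
qed

text \<open>Expansion at (xb, yb) of beta x.y - beta tau.y + beta^2 / 4 (1 - |x|^2)^2, with x, y the
  coordinates of a configuration and xb, yb those of the mean. The gradient there is beta (yb - beta
  B xb) in x and beta (xb - tau) in y; since both are small in the application, they are split off
  as squares. The remaining terms are at most 2 beta times the squared increments.\<close>

lemma tilt_exponent_bound:
  fixes x y xb yb \<tau> a :: "'s => real"
  assumes \<beta>: "0 < \<beta>" "\<beta> <= 1" and x: "(\<Sum>s\<in>K. (x s)\<^sup>2) <= 1" and xb: "(\<Sum>s\<in>K. (xb s)\<^sup>2) <= 1" and K: "finite K"
  defines "B \<equiv> 1 - (\<Sum>s\<in>K. (xb s)\<^sup>2)"
  shows "\<bar>\<beta> * (\<Sum>s\<in>K. x s * y s) - \<beta> * (\<Sum>s\<in>K. \<tau> s * y s) - \<beta> / sqrt 2 * (\<Sum>s\<in>K. a s * (x s)\<^sup>2) + \<beta>\<^sup>2 / 4 * (1 - (\<Sum>s\<in>K. (x s)\<^sup>2))\<^sup>2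
      - (\<beta> * (\<Sum>s\<in>K. (xb s - \<tau> s) * yb s) + \<beta>\<^sup>2 / 4 * B\<^sup>2)\<bar>
    <= \<beta> * (\<Sum>s\<in>K. \<bar>a s\<bar>) + \<beta> / 2 * ((\<Sum>s\<in>K. (yb s - \<beta> * B * xb s)\<^sup>2) + (\<Sum>s\<in>K. (xb s - \<tau> s)\<^sup>2))
      + 2 * \<beta> * ((\<Sum>s\<in>K. (x s - xb s)\<^sup>2) + (\<Sum>s\<in>K. (y s - yb s)\<^sup>2))"
proof -
  define u where "u s = x s - xb s" for s
  define v where "v s = y s - yb s" for s
  define w where "w s = yb s - \<beta> * B * xb s" for s
  let ?U = "\<Sum>s\<in>K. (u s)\<^sup>2" and ?V = "\<Sum>s\<in>K. (v s)\<^sup>2" and ?W = "\<Sum>s\<in>K. (w s)\<^sup>2" and ?T = "\<Sum>s\<in>K. (xb s - \<tau> s)\<^sup>2"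
  define \<delta> where "\<delta> = - 2 * (\<Sum>s\<in>K. xb s * u s) - ?U"
  have B: "0 <= B" "B <= 1" using xb by (auto simp: B_def sum_nonneg)
  have U0: "0 <= ?U" by (simp add: sum_nonneg)
  have amgm: "\<bar>\<Sum>s\<in>K. f s * g s\<bar> <= ((\<Sum>s\<in>K. (f s)\<^sup>2) + (\<Sum>s\<in>K. (g s)\<^sup>2)) / 2" for f g :: "'s => real"
  proof -
    have "\<bar>f s * g s\<bar> <= ((f s)\<^sup>2 + (g s)\<^sup>2) / 2" for s
      using zero_le_power2[of "\<bar>f s\<bar> - \<bar>g s\<bar>"] by (simp add: power2_eq_square algebra_simps abs_mult)
    then have "(\<Sum>s\<in>K. \<bar>f s * g s\<bar>) <= (\<Sum>s\<in>K. ((f s)\<^sup>2 + (g s)\<^sup>2) / 2)" by (intro sum_mono)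
    also have "\<dots> = ((\<Sum>s\<in>K. (f s)\<^sup>2) + (\<Sum>s\<in>K. (g s)\<^sup>2)) / 2" by (simp only: sum_divide_distrib[symmetric] sum.distrib)
    finally show ?thesis using sum_abs[of "\<lambda>s. f s * g s" K] by linarith
  qed
  have x2: "(\<Sum>s\<in>K. (x s)\<^sup>2) = (\<Sum>s\<in>K. (xb s)\<^sup>2) - \<delta>"
  proof -
    have "(\<Sum>s\<in>K. (x s)\<^sup>2) = (\<Sum>s\<in>K. (xb s)\<^sup>2 + 2 * (xb s * u s) + (u s)\<^sup>2)"
      by (rule sum.cong) (auto simp: u_def power2_eq_square algebra_simps)
    then show ?thesis by (simp add: sum.distrib \<delta>_def flip: sum_distrib_left)
  qed
  \<comment> \<open>The quartic term becomes quadratic because x and xb both lie in the unit ball: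
    delta is the inner product of -(x + xb) with x - xb, and |x + xb|^2 <= 4.\<close>
  have d2: "\<delta>\<^sup>2 <= 4 * ?U"
  proof -
    have "\<delta> = - (\<Sum>s\<in>K. (x s + xb s) * u s)"
      unfolding \<delta>_def sum_distrib_left sum_negf[symmetric] sum_subtractf[symmetric]
      by (rule sum.cong) (auto simp: u_def power2_eq_square algebra_simps)
    then have "\<delta>\<^sup>2 = (\<Sum>s\<in>K. (x s + xb s) * u s)\<^sup>2" by simp
    also have "\<dots> <= (\<Sum>s\<in>K. (x s + xb s)\<^sup>2) * ?U" by (rule Cauchy_Schwarz_ineq_sum)
    also have "\<dots> <= 4 * ?U"
    proof (rule mult_right_mono[OF _ U0])
      have "(\<Sum>s\<in>K. (x s + xb s)\<^sup>2) <= (\<Sum>s\<in>K. 2 * (x s)\<^sup>2 + 2 * (xb s)\<^sup>2)"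
      proof (rule sum_mono)
        fix s show "(x s + xb s)\<^sup>2 <= 2 * (x s)\<^sup>2 + 2 * (xb s)\<^sup>2"
          using zero_le_power2[of "x s - xb s"] by (simp add: power2_eq_square algebra_simps)
      qed
      also have "\<dots> = 2 * (\<Sum>s\<in>K. (x s)\<^sup>2) + 2 * (\<Sum>s\<in>K. (xb s)\<^sup>2)" by (simp add: sum.distrib sum_distrib_left)
      finally show "(\<Sum>s\<in>K. (x s + xb s)\<^sup>2) <= 4" using x xb by linarith
    qed
    finally show ?thesis .
  qed
  have lin: "(\<Sum>s\<in>K. x s * y s) - (\<Sum>s\<in>K. \<tau> s * y s) - (\<Sum>s\<in>K. (xb s - \<tau> s) * yb s) - \<beta> * B * (\<Sum>s\<in>K. xb s * u s)
      = (\<Sum>s\<in>K. u s * w s) + (\<Sum>s\<in>K. (xb s - \<tau> s) * v s) + (\<Sum>s\<in>K. u s * v s)"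
    unfolding sum_distrib_left sum_subtractf[symmetric] sum.distrib[symmetric]
    by (rule sum.cong) (auto simp: u_def v_def w_def algebra_simps)
  have sq: "(1 - (\<Sum>s\<in>K. (x s)\<^sup>2))\<^sup>2 = B\<^sup>2 - 4 * B * (\<Sum>s\<in>K. xb s * u s) + (\<delta>\<^sup>2 - 2 * B * ?U)"
  proof -
    have "1 - (\<Sum>s\<in>K. (x s)\<^sup>2) = B + \<delta>" using x2 by (simp add: B_def)
    then have "(1 - (\<Sum>s\<in>K. (x s)\<^sup>2))\<^sup>2 = B\<^sup>2 + \<delta>\<^sup>2 + 2 * B * \<delta>" by (simp only: power2_sum)
    then show ?thesis by (simp add: \<delta>_def algebra_simps)
  qed
  have T: "\<beta> * (\<Sum>s\<in>K. x s * y s) - \<beta> * (\<Sum>s\<in>K. \<tau> s * y s) - \<beta> / sqrt 2 * (\<Sum>s\<in>K. a s * (x s)\<^sup>2) + \<beta>\<^sup>2 / 4 * (1 - (\<Sum>s\<in>K. (x s)\<^sup>2))\<^sup>2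
      - (\<beta> * (\<Sum>s\<in>K. (xb s - \<tau> s) * yb s) + \<beta>\<^sup>2 / 4 * B\<^sup>2)
    = \<beta> * ((\<Sum>s\<in>K. u s * w s) + (\<Sum>s\<in>K. (xb s - \<tau> s) * v s) + (\<Sum>s\<in>K. u s * v s)) + \<beta>\<^sup>2 / 4 * (\<delta>\<^sup>2 - 2 * B * ?U)
      - \<beta> / sqrt 2 * (\<Sum>s\<in>K. a s * (x s)\<^sup>2)" (is "?L = ?A + ?Q - ?S")
    unfolding sq lin[symmetric] by (simp add: power2_eq_square algebra_simps)
  have abs3: "\<bar>a + b + c\<bar> <= (a' + b' + c') / 2" if "\<bar>a\<bar> <= a' / 2" "\<bar>b\<bar> <= b' / 2" "\<bar>c\<bar> <= c' / 2" for a b c a' b' c' :: real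
    using abs_le_D1[OF that(1)] abs_le_D2[OF that(1)] abs_le_D1[OF that(2)] abs_le_D2[OF that(2)] abs_le_D1[OF that(3)] abs_le_D2[OF that(3)]
    by (intro abs_leI) argo+
  have bA: "\<bar>?A\<bar> <= \<beta> / 2 * ((?U + ?W) + (?T + ?V) + (?U + ?V))"
  proof -
    have "\<bar>(\<Sum>s\<in>K. u s * w s) + (\<Sum>s\<in>K. (xb s - \<tau> s) * v s) + (\<Sum>s\<in>K. u s * v s)\<bar> <= ((?U + ?W) + (?T + ?V) + (?U + ?V)) / 2"
      by (rule abs3[OF amgm amgm amgm])
    from mult_left_mono[OF this, of \<beta>] show ?thesis using \<beta> by (simp add: abs_mult)
  qed
  have bQ: "\<bar>?Q\<bar> <= \<beta> * ?U"
  proof -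
    have "B * ?U <= 1 * ?U" "0 <= B * ?U"
      by (rule mult_right_mono[OF B(2) U0], rule mult_nonneg_nonneg[OF B(1) U0])
    then have "\<bar>\<delta>\<^sup>2 - 2 * B * ?U\<bar> <= 4 * ?U" using d2 U0 zero_le_power2[of \<delta>] by linarith
    then have "\<beta>\<^sup>2 / 4 * \<bar>\<delta>\<^sup>2 - 2 * B * ?U\<bar> <= \<beta>\<^sup>2 / 4 * (4 * ?U)" by (intro mult_left_mono) auto
    also have "\<dots> = \<beta> * (\<beta> * ?U)" by (simp add: power2_eq_square)
    also have "\<dots> <= \<beta> * (1 * ?U)" using \<beta> U0 by (intro mult_left_mono mult_right_mono) auto
    finally show ?thesis by (simp add: abs_mult)
  qed
  have bS: "\<bar>?S\<bar> <= \<beta> * (\<Sum>s\<in>K. \<bar>a s\<bar>)"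
  proof -
    have "\<bar>a s * (x s)\<^sup>2\<bar> <= \<bar>a s\<bar>" if "s \<in> K" for s
    proof -
      have "(x s)\<^sup>2 <= (\<Sum>s\<in>K. (x s)\<^sup>2)" by (rule member_le_sum) (use that K in auto)
      then have "(x s)\<^sup>2 <= 1" using x by linarith
      from mult_left_mono[OF this, of "\<bar>a s\<bar>"] show ?thesis by (simp add: abs_mult)
    qed
    then have "(\<Sum>s\<in>K. \<bar>a s * (x s)\<^sup>2\<bar>) <= (\<Sum>s\<in>K. \<bar>a s\<bar>)" by (rule sum_mono)
    then have "\<bar>\<Sum>s\<in>K. a s * (x s)\<^sup>2\<bar> <= (\<Sum>s\<in>K. \<bar>a s\<bar>)" using sum_abs[of "\<lambda>s. a s * (x s)\<^sup>2" K] by linarith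
    then have "\<beta> / sqrt 2 * \<bar>\<Sum>s\<in>K. a s * (x s)\<^sup>2\<bar> <= \<beta> / 1 * (\<Sum>s\<in>K. \<bar>a s\<bar>)"
      using \<beta> by (intro mult_mono divide_left_mono) auto
    then show ?thesis using \<beta> by (simp add: abs_mult)
  qed
  have "\<bar>?L\<bar> <= \<bar>?A\<bar> + \<bar>?Q\<bar> + \<bar>?S\<bar>" unfolding T by linarith
  also have "\<dots> <= \<beta> / 2 * ((?U + ?W) + (?T + ?V) + (?U + ?V)) + \<beta> * ?U + \<beta> * (\<Sum>s\<in>K. \<bar>a s\<bar>)"
    using bA bQ bS by linarith
  also have "\<dots> <= \<beta> * (\<Sum>s\<in>K. \<bar>a s\<bar>) + \<beta> / 2 * (?W + ?T) + 2 * \<beta> * (?U + ?V)"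
  proof -
    have "0 <= \<beta> * ?V" using \<beta> by (intro mult_nonneg_nonneg sum_nonneg) auto
    then show ?thesis by (simp add: algebra_simps)
  qed
  finally show ?thesis unfolding u_def v_def w_def .
qed

lemma sum_spins_exp: "(\<Sum>\<sigma>\<in>{..<N} \<rightarrow>\<^sub>E {-1, 1}. exp (\<Sum>i<N. c i * \<sigma> i)) = 2 ^ N * (\<Prod>i<N. cosh (c i))" for c :: vect
proof -
  have "2 ^ N * (\<Prod>i<N. cosh (c i)) = (\<Prod>i<N. 2 * cosh (c i))" by (simp add: prod.distrib)
  also have "\<dots> = (\<Prod>i<N. \<Sum>y\<in>{-1, 1}. exp (c i * y))"
    by (rule prod.cong) (auto simp: cosh_field_def add.commute)
  also have "\<dots> = (\<Sum>\<sigma>\<in>{..<N} \<rightarrow>\<^sub>E {-1, 1}. \<Prod>i<N. exp (c i * \<sigma> i))"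
    by (rule prod_sum_PiE) auto
  finally show ?thesis by (simp add: exp_sum)
qed

text \<open>Spins weighted by exp(H sigma) are independent with means tanh H, and the second
  derivative of ln cosh is at most 1. So the centered spins are sub-Gaussian with variance proxy
  1.\<close>

lemma sum_spins_tilt:
  fixes H b :: vect
  shows "(\<Sum>\<sigma>\<in>{..<N} \<rightarrow>\<^sub>E {-1, 1}. exp (\<Sum>i<N. H i * \<sigma> i) * exp (\<Sum>i<N. b i * (\<sigma> i - tanh (H i))))
    <= (\<Sum>\<sigma>\<in>{..<N} \<rightarrow>\<^sub>E {-1, 1}. exp (\<Sum>i<N. H i * \<sigma> i)) * exp (\<Sum>i<N. (b i)\<^sup>2 / 2)"
proof -
  let ?c = "exp (- (\<Sum>i<N. b i * tanh (H i)))"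
  have "(\<Sum>\<sigma>\<in>{..<N} \<rightarrow>\<^sub>E {-1, 1}. exp (\<Sum>i<N. H i * \<sigma> i) * exp (\<Sum>i<N. b i * (\<sigma> i - tanh (H i))))
     = (\<Sum>\<sigma>\<in>{..<N} \<rightarrow>\<^sub>E {-1, 1}. exp (\<Sum>i<N. (H i + b i) * \<sigma> i) * ?c)"
    by (rule sum.cong[OF refl]) (simp add: exp_add[symmetric] sum.distrib[symmetric] sum_negf[symmetric] algebra_simps)
  also have "\<dots> = 2 ^ N * (\<Prod>i<N. cosh (H i + b i)) * ?c"
    by (simp only: sum_distrib_right[symmetric] sum_spins_exp)
  also have "\<dots> <= 2 ^ N * ((\<Prod>i<N. cosh (H i)) * exp (\<Sum>i<N. b i * tanh (H i) + (b i)\<^sup>2 / 2)) * ?c"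
  proof (intro mult_right_mono mult_left_mono)
    have "(\<Prod>i<N. cosh (H i + b i)) <= (\<Prod>i<N. cosh (H i) * exp (b i * tanh (H i) + (b i)\<^sup>2 / 2))"
    proof (rule prod_mono, intro conjI)
      fix i
      have "ln (cosh (H i + b i)) <= ln (cosh (H i)) + (b i * tanh (H i) + (b i)\<^sup>2 / 2)"
        using abs_le_D1[OF ln_cosh_taylor2[of "H i" "b i"]] by (simp add: mult.commute[of "b i"])
      then have "exp (ln (cosh (H i + b i))) <= exp (ln (cosh (H i)) + (b i * tanh (H i) + (b i)\<^sup>2 / 2))" by (simp only: exp_le_cancel_iff)
      then show "cosh (H i + b i) <= cosh (H i) * exp (b i * tanh (H i) + (b i)\<^sup>2 / 2)" by (simp add: exp_add)
    qed (use cosh_real_pos in \<open>auto intro: less_imp_le\<close>)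
    then show "(\<Prod>i<N. cosh (H i + b i)) <= (\<Prod>i<N. cosh (H i)) * exp (\<Sum>i<N. b i * tanh (H i) + (b i)\<^sup>2 / 2)"
      by (simp add: prod.distrib exp_sum)
  qed auto
  also have "\<dots> = (\<Sum>\<sigma>\<in>{..<N} \<rightarrow>\<^sub>E {-1, 1}. exp (\<Sum>i<N. H i * \<sigma> i)) * exp (\<Sum>i<N. (b i)\<^sup>2 / 2)"
  proof -
    have "exp (\<Sum>i<N. b i * tanh (H i) + (b i)\<^sup>2 / 2) * ?c = exp (\<Sum>i<N. (b i)\<^sup>2 / 2)"
      unfolding sum.distrib by (simp flip: exp_add)
    then show ?thesis unfolding sum_spins_exp by (simp only: mult.assoc)
  qed
  finally show ?thesis .
qed

lemma nn_integral_gs_prod: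
  fixes f :: "'i => real => ennreal"
  assumes "finite I" "\<And>i. i \<in> I ==> f i \<in> borel_measurable borel"
  shows "(\<integral>\<^sup>+x. (\<Prod>i\<in>I. f i (x i)) \<partial>gs I) = (\<Prod>i\<in>I. \<integral>\<^sup>+x. f i x \<partial>sn)"
  by (rule GS.product_nn_integral_prod) (use assms in auto)

text \<open>Each exp(2 beta N r^2) is a Gaussian average of exp(2 sqrt(beta N) r g). For fixed g the
  exponent is linear in the spins, and \<open>sum_spins_tilt\<close> leaves exp(2 beta |sum g_t
  p_t|^2), which the Gram bound makes integrable uniformly in N.\<close>

lemma sum_spins_quadratic:
  fixes p :: "'i => vect" and H :: vect
  assumes I: "finite I" and N: "N >= 1" and \<beta>: "0 < \<beta>" "\<beta> <= 1 / 32"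
    and gram: "\<And>g. ip N (\<lambda>i. \<Sum>t\<in>I. g t * p t i) (\<lambda>i. \<Sum>t\<in>I. g t * p t i) <= 4 * (\<Sum>t\<in>I. (g t)\<^sup>2)"
  shows "(\<Sum>\<sigma>\<in>{..<N} \<rightarrow>\<^sub>E {-1, 1}. exp (\<Sum>i<N. H i * \<sigma> i) * exp (2 * \<beta> * real N * (\<Sum>t\<in>I. (ip N (\<lambda>i. \<sigma> i - tanh (H i)) (p t))\<^sup>2)))
    <= (\<Sum>\<sigma>\<in>{..<N} \<rightarrow>\<^sub>E {-1, 1}. exp (\<Sum>i<N. H i * \<sigma> i)) * sqrt 2 ^ card I"
proof -
  let ?S = "{..<N} \<rightarrow>\<^sub>E {-1, 1::real}" and ?w = "\<lambda>\<sigma>. exp (\<Sum>i<N. H i * \<sigma> i)" and ?P = "\<Sum>\<sigma>\<in>{..<N} \<rightarrow>\<^sub>E {-1, 1}. exp (\<Sum>i<N. H i * \<sigma> i)"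
  have P0: "0 <= ?P" by (intro sum_nonneg) simp
  \<comment> \<open>Chosen so that \<open>?c\<^sup>2 / 2\<close> equals 2 beta N, the coefficient to
    be linearized.\<close>
  let ?c = "2 * sqrt (\<beta> * real N)"
  define r where "r \<sigma> t = ip N (\<lambda>i. \<sigma> i - tanh (H i)) (p t)" for \<sigma> t
  have lin: "ennreal (exp (2 * \<beta> * real N * (\<Sum>t\<in>I. (r \<sigma> t)\<^sup>2))) = (\<integral>\<^sup>+g. ennreal (exp (\<Sum>t\<in>I. ?c * r \<sigma> t * g t)) \<partial>gs I)" for \<sigma>
  proof -
    have "(\<integral>\<^sup>+g. ennreal (exp (\<Sum>t\<in>I. ?c * r \<sigma> t * g t)) \<partial>gs I) = (\<integral>\<^sup>+g. (\<Prod>t\<in>I. ennreal (exp (?c * r \<sigma> t * g t))) \<partial>gs I)"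
      using I by (intro nn_integral_cong) (simp add: exp_sum prod_ennreal)
    also have "\<dots> = (\<Prod>t\<in>I. \<integral>\<^sup>+x. ennreal (exp (?c * r \<sigma> t * x)) \<partial>sn)" by (rule nn_integral_gs_prod[OF I]) simp
    also have "\<dots> = (\<Prod>t\<in>I. ennreal (exp (2 * \<beta> * real N * (r \<sigma> t)\<^sup>2)))"
      unfolding sn_mgf by (rule prod.cong) (use \<beta> in \<open>auto simp: power_mult_distrib\<close>)
    also have "\<dots> = ennreal (exp (2 * \<beta> * real N * (\<Sum>t\<in>I. (r \<sigma> t)\<^sup>2)))"
      using I by (simp add: prod_ennreal exp_sum sum_distrib_left)
    finally show ?thesis by simp
  qed
  have comp: "(\<lambda>g. g t) \<in> borel_measurable (gs I)" if "t \<in> I" for t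
    using measurable_component_singleton[OF that, of "\<lambda>_. sn"] by (simp cong: measurable_cong_sets)
  have m: "(\<lambda>g. ennreal (exp (\<Sum>t\<in>I. c t * g t))) \<in> borel_measurable (gs I)" for c
    by (intro measurable_compose[OF _ measurable_ennreal] measurable_compose[OF _ borel_measurable_exp] borel_measurable_sum borel_measurable_times borel_measurable_const comp)
  have m2: "(\<lambda>g. \<Prod>t\<in>I. ennreal (exp ((g t)\<^sup>2 / 4))) \<in> borel_measurable (gs I)"
    by (intro borel_measurable_prod_ennreal measurable_compose[OF _ measurable_ennreal] measurable_compose[OF _ borel_measurable_exp] borel_measurable_divide borel_measurable_power borel_measurable_const comp)
  have "ennreal (\<Sum>\<sigma>\<in>?S. ?w \<sigma> * exp (2 * \<beta> * real N * (\<Sum>t\<in>I. (r \<sigma> t)\<^sup>2)))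
     = (\<Sum>\<sigma>\<in>?S. ennreal (?w \<sigma>) * (\<integral>\<^sup>+g. ennreal (exp (\<Sum>t\<in>I. ?c * r \<sigma> t * g t)) \<partial>gs I))"
    unfolding lin[symmetric] by (simp add: ennreal_mult'' flip: sum_ennreal)
  also have "\<dots> = (\<integral>\<^sup>+g. (\<Sum>\<sigma>\<in>?S. ennreal (?w \<sigma>) * ennreal (exp (\<Sum>t\<in>I. ?c * r \<sigma> t * g t))) \<partial>gs I)"
  proof -
    have "(\<Sum>\<sigma>\<in>?S. ennreal (?w \<sigma>) * (\<integral>\<^sup>+g. ennreal (exp (\<Sum>t\<in>I. ?c * r \<sigma> t * g t)) \<partial>gs I))
       = (\<Sum>\<sigma>\<in>?S. \<integral>\<^sup>+g. ennreal (?w \<sigma>) * ennreal (exp (\<Sum>t\<in>I. ?c * r \<sigma> t * g t)) \<partial>gs I)"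
      by (intro sum.cong refl nn_integral_cmult[symmetric] m)
    also have "\<dots> = (\<integral>\<^sup>+g. (\<Sum>\<sigma>\<in>?S. ennreal (?w \<sigma>) * ennreal (exp (\<Sum>t\<in>I. ?c * r \<sigma> t * g t))) \<partial>gs I)"
      by (rule nn_integral_sum[symmetric]) (intro borel_measurable_times_ennreal borel_measurable_const m)
    finally show ?thesis .
  qed
  also have "\<dots> <= (\<integral>\<^sup>+g. ennreal ?P * (\<Prod>t\<in>I. ennreal (exp ((g t)\<^sup>2 / 4))) \<partial>gs I)"
  proof (rule nn_integral_mono)
    fix g :: "'i => real"
    define c where "c i = (\<Sum>t\<in>I. g t * p t i)" for i
    define b where "b i = ?c / real N * c i" for i
    have e: "(\<Sum>t\<in>I. ?c * r \<sigma> t * g t) = (\<Sum>i<N. b i * (\<sigma> i - tanh (H i)))" for \<sigma>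
    proof -
      have "(\<Sum>t\<in>I. ?c * r \<sigma> t * g t) = ?c * (\<Sum>t\<in>I. g t * r \<sigma> t)" by (simp add: sum_distrib_left mult_ac)
      also have "(\<Sum>t\<in>I. g t * r \<sigma> t) = ip N (\<lambda>i. \<sigma> i - tanh (H i)) c"
        unfolding c_def ip_sum ip_linear(9) r_def ..
      also have "?c * \<dots> = (\<Sum>i<N. b i * (\<sigma> i - tanh (H i)))"
        unfolding b_def ip_def by (simp add: sum_distrib_left sum_divide_distrib mult_ac)
      finally show ?thesis .
    qed
    have "(\<Sum>i<N. (b i)\<^sup>2 / 2) = 2 * \<beta> * ip N c c"
    proof -
      have "(b i)\<^sup>2 / 2 = 2 * \<beta> / real N * (c i * c i)" for i
        unfolding b_def power_mult_distrib power_divide using N \<beta> by (simp add: power2_eq_square)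
      then show ?thesis unfolding ip_def by (simp only: sum_distrib_left[symmetric]) simp
    qed
    also have "\<dots> <= 2 * \<beta> * (4 * (\<Sum>t\<in>I. (g t)\<^sup>2))"
      unfolding c_def by (intro mult_left_mono gram) (use \<beta> in auto)
    also have "\<dots> = 8 * \<beta> * (\<Sum>t\<in>I. (g t)\<^sup>2)" by simp
    \<comment> \<open>This is where beta <= 1/32 enters: 8 beta <= 1/4 keeps the exponent within the
      range of \<open>sn_exp_square\<close>.\<close>
    also have "\<dots> <= 1 / 4 * (\<Sum>t\<in>I. (g t)\<^sup>2)"
      by (rule mult_right_mono) (use \<beta> in \<open>auto intro: sum_nonneg\<close>)
    also have "\<dots> = (\<Sum>t\<in>I. (g t)\<^sup>2 / 4)" by (simp add: sum_divide_distrib)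
    finally have b: "exp (\<Sum>i<N. (b i)\<^sup>2 / 2) <= exp (\<Sum>t\<in>I. (g t)\<^sup>2 / 4)" by simp
    have "(\<Sum>\<sigma>\<in>?S. ?w \<sigma> * exp (\<Sum>t\<in>I. ?c * r \<sigma> t * g t)) <= ?P * exp (\<Sum>i<N. (b i)\<^sup>2 / 2)"
      unfolding e by (rule sum_spins_tilt)
    also have "\<dots> <= ?P * exp (\<Sum>t\<in>I. (g t)\<^sup>2 / 4)" by (rule mult_left_mono[OF b P0])
    finally have fin: "ennreal (\<Sum>\<sigma>\<in>?S. ?w \<sigma> * exp (\<Sum>t\<in>I. ?c * r \<sigma> t * g t)) <= ennreal (?P * exp (\<Sum>t\<in>I. (g t)\<^sup>2 / 4))"
      by (rule ennreal_leI)
    show "(\<Sum>\<sigma>\<in>?S. ennreal (?w \<sigma>) * ennreal (exp (\<Sum>t\<in>I. ?c * r \<sigma> t * g t))) <= ennreal ?P * (\<Prod>t\<in>I. ennreal (exp ((g t)\<^sup>2 / 4)))"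
    proof -
      have "(\<Sum>\<sigma>\<in>?S. ennreal (?w \<sigma>) * ennreal (exp (\<Sum>t\<in>I. ?c * r \<sigma> t * g t))) = (\<Sum>\<sigma>\<in>?S. ennreal (?w \<sigma> * exp (\<Sum>t\<in>I. ?c * r \<sigma> t * g t)))"
        by (intro sum.cong refl ennreal_mult[symmetric]) simp_all
      also have "\<dots> = ennreal (\<Sum>\<sigma>\<in>?S. ?w \<sigma> * exp (\<Sum>t\<in>I. ?c * r \<sigma> t * g t))"
        by (rule sum_ennreal) simp
      finally have l: "(\<Sum>\<sigma>\<in>?S. ennreal (?w \<sigma>) * ennreal (exp (\<Sum>t\<in>I. ?c * r \<sigma> t * g t))) = \<dots>" .
      have "(\<Prod>t\<in>I. ennreal (exp ((g t)\<^sup>2 / 4))) = ennreal (exp (\<Sum>t\<in>I. (g t)\<^sup>2 / 4))"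
        unfolding exp_sum[OF I] by (rule prod_ennreal) simp
      moreover have "ennreal (?P * exp (\<Sum>t\<in>I. (g t)\<^sup>2 / 4)) = ennreal ?P * ennreal (exp (\<Sum>t\<in>I. (g t)\<^sup>2 / 4))"
        by (rule ennreal_mult[OF P0]) simp
      ultimately show ?thesis unfolding l using fin by (simp only:)
    qed
  qed
  also have "\<dots> = ennreal ?P * (\<integral>\<^sup>+g. (\<Prod>t\<in>I. ennreal (exp ((g t)\<^sup>2 / 4))) \<partial>gs I)"
    by (rule nn_integral_cmult[OF m2])
  also have "\<dots> = ennreal ?P * (\<Prod>t\<in>I. \<integral>\<^sup>+x. ennreal (exp (x\<^sup>2 / 4)) \<partial>sn)"
    by (subst nn_integral_gs_prod[OF I]) simp_all
  also have "\<dots> = ennreal (?P * sqrt 2 ^ card I)"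
    unfolding sn_exp_square using P0 by (simp add: ennreal_power ennreal_mult)
  finally have "ennreal (\<Sum>\<sigma>\<in>?S. ?w \<sigma> * exp (2 * \<beta> * real N * (\<Sum>t\<in>I. (r \<sigma> t)\<^sup>2))) <= ennreal (?P * sqrt 2 ^ card I)" .
  moreover have "0 <= ?P * sqrt 2 ^ card I" using P0 by simp
  ultimately show ?thesis unfolding r_def by (simp only: ennreal_le_iff)
qed

lemma sum_bool_times: "(\<Sum>t\<in>UNIV \<times> K. f t) = (\<Sum>s\<in>K. f (True, s)) + (\<Sum>s\<in>K. f (False, s))" for f :: "bool \<times> nat => real"
  using sum.cartesian_product[of "\<lambda>a b. f (a, b)" K "UNIV :: bool set"] by (simp add: UNIV_bool add.commute)

lemma abs_mult_sum_le:
  fixes c :: real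
  assumes "0 <= c" "c <= 1" and le: "\<And>s. s \<in> K ==> \<bar>f s\<bar> <= g s"
  shows "\<bar>c * sum f K\<bar> <= sum g K"
proof -
  have "\<bar>sum f K\<bar> <= sum g K" by (rule order_trans[OF sum_abs sum_mono[OF le]])
  moreover have "c * \<bar>sum f K\<bar> <= 1 * \<bar>sum f K\<bar>" by (rule mult_right_mono) (use assms in auto)
  ultimately show ?thesis using assms(1) by (simp add: abs_mult)
qed

lemma scaled_abs_bound:
  fixes n p q r w A B h :: real
  assumes n: "0 <= n" and p: "\<bar>p\<bar> <= A" and q: "\<bar>q\<bar> <= B" and r: "\<bar>r\<bar> <= 1" and w: "\<bar>w\<bar> <= n * h"
  shows "\<bar>n * (p - q + r) + w\<bar> <= n * (1 + h + A + B)"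
proof -
  have "\<bar>p - q + r\<bar> <= 1 + A + B" using p q r by linarith
  from mult_left_mono[OF this n] have "\<bar>n * (p - q + r)\<bar> <= n * (1 + A + B)" using n by (simp add: abs_mult)
  then have "\<bar>n * (p - q + r) + w\<bar> <= n * (1 + A + B) + n * h" using w by linarith
  also have "\<dots> = n * (1 + h + A + B)" by (simp add: distrib_left)
  finally show ?thesis .
qed

lemma ip_add_self_le: "ip N (\<lambda>i. x i + z i) (\<lambda>i. x i + z i) <= 2 * ip N x x + 2 * ip N z z"
  using ip_self_nonneg[of N "\<lambda>i. x i - z i"] unfolding ip_linear ip_commute[of N z x] by simp

context sk_params
begin

text \<open>Distance of the Gram matrix of the zeta from the identity. It tends to 0 in probability,
  so the event that it is at most 1 may be assumed.\<close>

definition defect :: "nat => nat => matr => real" where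
  "defect k N A = (\<Sum>s=1..k. \<Sum>t=1..k. \<bar>ip N (ze N A s) (ze N A t) - (if s = t then 1 else 0)\<bar>)"

text \<open>The phi-part and the zeta-part are separated by |a + b|^2 <= 2 |a|^2 + 2 |b|^2. The
  first satisfies |a|^2 <= sum c^2 by orthogonality, the second |b|^2 <= 2 sum d^2 because the
  defect is at most 1; hence the constant 4.\<close>

lemma gram_bound:
  assumes N: "N >= 1" and D: "defect k N A <= 1"
  shows "ip N (\<lambda>i. \<Sum>t\<in>UNIV \<times> {1..k}. g t * (if fst t then phi N A (snd t) else ze N A (snd t)) i)
      (\<lambda>i. \<Sum>t\<in>UNIV \<times> {1..k}. g t * (if fst t then phi N A (snd t) else ze N A (snd t)) i)
    <= 4 * (\<Sum>t\<in>UNIV \<times> {1..k}. (g t)\<^sup>2)"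
proof -
  define c where "c s = g (True, s)" for s
  define d where "d s = g (False, s)" for s
  let ?p = "\<lambda>i. \<Sum>s=1..k. c s * phi N A s i" and ?z = "\<lambda>i. \<Sum>s=1..k. d s * ze N A s i"
  have p: "ip N ?p ?p <= (\<Sum>s=1..k. (c s)\<^sup>2)"
  proof -
    have "ip N ?p ?p = (\<Sum>s=1..k. c s * c s * ip N (phi N A s) (phi N A s))"
      by (rule ip_orthogonal_sums) (auto intro!: it_phi_orthogonal[OF N])
    also have "\<dots> <= (\<Sum>s=1..k. (c s)\<^sup>2)"
    proof (rule sum_mono)
      fix s assume "s \<in> {1..k}"
      then have "ip N (phi N A s) (phi N A s) <= 1" using ip_phi[OF N, of s \<beta> h A] by auto
      from mult_left_mono[OF this, of "c s * c s"]
      show "c s * c s * ip N (phi N A s) (phi N A s) <= (c s)\<^sup>2" by (simp add: power2_eq_square)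
    qed
    finally show ?thesis .
  qed
  have z: "ip N ?z ?z <= 2 * (\<Sum>s=1..k. (d s)\<^sup>2)"
  proof -
    let ?G = "\<lambda>s t. ip N (ze N A s) (ze N A t)" and ?D = "\<Sum>s=1..k. (d s)\<^sup>2"
    have D0: "0 <= ?D" by (simp add: sum_nonneg)
    have "ip N ?z ?z = (\<Sum>t=1..k. \<Sum>s=1..k. d t * (d s * ?G s t))"
      unfolding ip_sum(2) ip_linear(9) unfolding ip_sum(1) ip_linear(3) sum_distrib_left ..
    also have "\<dots> = (\<Sum>t=1..k. (d t)\<^sup>2 + (\<Sum>s=1..k. d t * d s * (?G s t - (if s = t then 1 else 0))))"
    proof (rule sum.cong[OF refl])
      fix t assume t: "t \<in> {1..k}"
      have "(\<Sum>s=1..k. d t * (d s * ?G s t)) = (\<Sum>s=1..k. (if s = t then (d t)\<^sup>2 else 0) + d t * d s * (?G s t - (if s = t then 1 else 0)))"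
      proof (rule sum.cong[OF refl])
        fix s show "d t * (d s * ?G s t) = (if s = t then (d t)\<^sup>2 else 0) + d t * d s * (?G s t - (if s = t then 1 else 0))"
          by (cases "s = t") (simp_all add: power2_eq_square right_diff_distrib)
      qed
      also have "\<dots> = (\<Sum>s=1..k. if s = t then (d t)\<^sup>2 else 0) + (\<Sum>s=1..k. d t * d s * (?G s t - (if s = t then 1 else 0)))"
        by (rule sum.distrib)
      also have "(\<Sum>s=1..k. if s = t then (d t)\<^sup>2 else 0) = (d t)\<^sup>2" using t by (simp add: sum.delta)
      finally show "(\<Sum>s=1..k. d t * (d s * ?G s t)) = (d t)\<^sup>2 + (\<Sum>s=1..k. d t * d s * (?G s t - (if s = t then 1 else 0)))" .
    qed
    also have "\<dots> = ?D + (\<Sum>t=1..k. \<Sum>s=1..k. d t * d s * (?G s t - (if s = t then 1 else 0)))"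
      by (rule sum.distrib)
    finally have 1: "ip N ?z ?z = ?D + (\<Sum>t=1..k. \<Sum>s=1..k. d t * d s * (?G s t - (if s = t then 1 else 0)))" .
    have "(\<Sum>t=1..k. \<Sum>s=1..k. d t * d s * (?G s t - (if s = t then 1 else 0)))
       <= (\<Sum>t=1..k. \<Sum>s=1..k. ?D * \<bar>?G t s - (if t = s then 1 else 0)\<bar>)"
    proof (intro sum_mono)
      fix t s assume ts: "t \<in> {1..k}" "s \<in> {1..k}"
      have sq: "(d t)\<^sup>2 <= ?D" "(d s)\<^sup>2 <= ?D" by (rule member_le_sum; use ts in auto)+
      have "\<bar>d t * d s\<bar> <= ((d t)\<^sup>2 + (d s)\<^sup>2) / 2"
        using zero_le_power2[of "\<bar>d t\<bar> - \<bar>d s\<bar>"] by (simp add: power2_eq_square algebra_simps abs_mult)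
      also have "\<dots> <= ?D" using sq by simp
      finally have b: "\<bar>d t * d s\<bar> <= ?D" .
      have "d t * d s * (?G s t - (if s = t then 1 else 0)) <= \<bar>d t * d s\<bar> * \<bar>?G s t - (if s = t then 1 else 0)\<bar>"
        unfolding abs_mult[symmetric, of "d t * d s"] by (rule abs_ge_self)
      also have "\<dots> <= ?D * \<bar>?G s t - (if s = t then 1 else 0)\<bar>" by (rule mult_right_mono[OF b]) simp
      also have "\<dots> = ?D * \<bar>?G t s - (if t = s then 1 else 0)\<bar>" by (simp only: ip_commute[of N "ze N A s" "ze N A t"] eq_commute[of s t])
      finally show "d t * d s * (?G s t - (if s = t then 1 else 0)) <= ?D * \<bar>?G t s - (if t = s then 1 else 0)\<bar>" .
    qed
    also have "\<dots> = ?D * defect k N A" by (simp only: defect_def sum_distrib_left)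
    also have "\<dots> <= ?D * 1" by (rule mult_left_mono[OF D D0])
    finally show ?thesis unfolding 1 by simp
  qed
  have "ip N (\<lambda>i. ?p i + ?z i) (\<lambda>i. ?p i + ?z i) <= 2 * ip N ?p ?p + 2 * ip N ?z ?z"
    by (rule ip_add_self_le)
  also have "\<dots> <= 2 * (\<Sum>s=1..k. (c s)\<^sup>2) + 4 * (\<Sum>s=1..k. (d s)\<^sup>2)" using p z by linarith
  also have "\<dots> <= 4 * ((\<Sum>s=1..k. (c s)\<^sup>2) + (\<Sum>s=1..k. (d s)\<^sup>2))"
    using sum_nonneg[of "{1..k}" "\<lambda>s. (c s)\<^sup>2"] by simp
  finally show ?thesis unfolding sum_bool_times by (simp add: c_def d_def)
qed

abbreviation "mk k N A \<equiv> it_m \<beta> h N A (Suc k)"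

text \<open>The free energy of the independent tilted spins plus the exponent at their mean
  m^(k+1).\<close>

definition lead :: "nat => nat => matr => real" where
  "lead k N A = (\<Sum>i<N. ln (cosh (h + \<beta> * lin k (tau k) N A i))) / real N
     + (\<beta> * (\<Sum>s=1..k. (ip N (mk k N A) (phi N A s) - tau k s) * ip N (mk k N A) (ze N A s))
        + \<beta>\<^sup>2 / 4 * (1 - (\<Sum>s=1..k. (ip N (mk k N A) (phi N A s))\<^sup>2))\<^sup>2)"

text \<open>The first two groups of error terms of \<open>tilt_exponent_bound\<close>; the third,
  quadratic in the centered coordinates, is handled by \<open>sum_spins_quadratic\<close>.\<close>

definition remainder :: "nat => nat => matr => real" where
  "remainder k N A = \<beta> * (\<Sum>s=1..k. \<bar>ip N (phi N A s) (it_xi \<beta> h N A s)\<bar>)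
     + \<beta> / 2 * ((\<Sum>s=1..k. (ip N (mk k N A) (ze N A s) - \<beta> * (1 - (\<Sum>s=1..k. (ip N (mk k N A) (phi N A s))\<^sup>2)) * ip N (mk k N A) (phi N A s))\<^sup>2)
        + (\<Sum>s=1..k. (ip N (mk k N A) (phi N A s) - tau k s)\<^sup>2))"

lemma ln_Wpart_estimate:
  assumes N: "N >= 1" and k: "k >= 1" and D: "defect k N A <= 1"
  shows "\<bar>ln (Wpart \<beta> h N k A) / real N - lead k N A\<bar> <= remainder k N A + real k * ln 2 / real N"
proof -
  let ?S = "{..<N} \<rightarrow>\<^sub>E {-1, 1::real}" and ?I = "UNIV \<times> {1..k} :: (bool \<times> nat) set"
  let ?p = "\<lambda>t. if fst t then phi N A (snd t) else ze N A (snd t)"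
  define H where "H i = h + \<beta> * lin k (tau k) N A i" for i
  define m where "m = mk k N A"
  have mH: "m = (\<lambda>i. tanh (H i))" unfolding m_def it_m_Suc[OF k order_refl] Th_def H_def ..
  define w where "w \<sigma> = exp (\<Sum>i<N. H i * \<sigma> i)" for \<sigma> :: vect
  define E where "E = \<beta> * (\<Sum>s=1..k. (ip N m (phi N A s) - tau k s) * ip N m (ze N A s)) + \<beta>\<^sup>2 / 4 * (1 - (\<Sum>s=1..k. (ip N m (phi N A s))\<^sup>2))\<^sup>2"
  define \<Psi> where "\<Psi> \<sigma> = \<beta> * (\<Sum>s=1..k. ip N \<sigma> (phi N A s) * ip N \<sigma> (ze N A s)) - \<beta> * (\<Sum>s=1..k. tau k s * ip N \<sigma> (ze N A s))
     - \<beta> / sqrt 2 * (\<Sum>s=1..k. ip N (phi N A s) (it_xi \<beta> h N A s) * (ip N \<sigma> (phi N A s))\<^sup>2) + \<beta>\<^sup>2 / 4 * (1 - (\<Sum>s=1..k. (ip N \<sigma> (phi N A s))\<^sup>2))\<^sup>2" for \<sigma>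
  define q where "q \<sigma> = 2 * \<beta> * real N * (\<Sum>t\<in>?I. (ip N (\<lambda>i. \<sigma> i - tanh (H i)) (?p t))\<^sup>2)" for \<sigma>
  \<comment> \<open>Tilting: beta times the \<open>tau k\<close> combination of the <sigma,
    zeta^(s)> is added to the field h, giving H = h^(k+1), and subtracted again in \<Psi>.\<close>
  have W: "exp (Wexp \<beta> h N k A \<sigma>) = w \<sigma> * exp (real N * \<Psi> \<sigma>)" for \<sigma>
  proof -
    have "(\<Sum>i<N. H i * \<sigma> i) = h * (\<Sum>i<N. \<sigma> i) + \<beta> * (real N * ip N \<sigma> (lin k (tau k) N A))"
    proof -
      have "real N * ip N \<sigma> x = (\<Sum>i<N. \<sigma> i * x i)" for x using N by (simp add: ip_def)
      moreover have "(\<Sum>i<N. (h + \<beta> * x i) * \<sigma> i) = h * (\<Sum>i<N. \<sigma> i) + \<beta> * (\<Sum>i<N. \<sigma> i * x i)" for x :: vect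
        by (simp add: algebra_simps sum.distrib sum_distrib_left)
      ultimately show ?thesis unfolding H_def by simp
    qed
    also have "ip N \<sigma> (lin k (tau k) N A) = (\<Sum>s=1..k. tau k s * ip N \<sigma> (ze N A s))"
      unfolding ip_sum ip_linear ..
    finally have "Wexp \<beta> h N k A \<sigma> = (\<Sum>i<N. H i * \<sigma> i) + real N * \<Psi> \<sigma>"
      unfolding Wexp_def \<Psi>_def by (simp add: algebra_simps)
    then show ?thesis by (simp add: w_def exp_add)
  qed
  have m1: "ip N m m <= 1"
  proof -
    have "(\<Sum>i<N. m i * m i) <= (\<Sum>i<N. 1)"
      by (rule sum_mono) (simp add: mH tanh_bounds flip: power2_eq_square)
    then show ?thesis unfolding ip_def using N by simp
  qed
  have Y: "\<bar>real N * \<Psi> \<sigma> - real N * E\<bar> <= real N * remainder k N A + q \<sigma>" if s: "\<sigma> \<in> ?S" for \<sigma>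
  proof -
    have "\<bar>\<Psi> \<sigma> - E\<bar> <= remainder k N A + 2 * \<beta> * ((\<Sum>s=1..k. (ip N \<sigma> (phi N A s) - ip N m (phi N A s))\<^sup>2) + (\<Sum>s=1..k. (ip N \<sigma> (ze N A s) - ip N m (ze N A s))\<^sup>2))"
      unfolding \<Psi>_def E_def remainder_def m_def[symmetric]
    proof (rule tilt_exponent_bound[where K="{1..k}" and x="\<lambda>s. ip N \<sigma> (phi N A s)" and y="\<lambda>s. ip N \<sigma> (ze N A s)"
        and xb="\<lambda>s. ip N m (phi N A s)" and yb="\<lambda>s. ip N m (ze N A s)" and \<tau>="tau k" and a="\<lambda>s. ip N (phi N A s) (it_xi \<beta> h N A s)"])
      show "(\<Sum>s=1..k. (ip N \<sigma> (phi N A s))\<^sup>2) <= 1" using bessel[OF N, where x=\<sigma>] spin_norm[OF N s] by simp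
      show "(\<Sum>s=1..k. (ip N m (phi N A s))\<^sup>2) <= 1" by (rule order_trans[OF bessel[OF N] m1])
    qed (use beta_pos beta_sq_less(3) in auto)
    moreover have "2 * \<beta> * ((\<Sum>s=1..k. (ip N \<sigma> (phi N A s) - ip N m (phi N A s))\<^sup>2) + (\<Sum>s=1..k. (ip N \<sigma> (ze N A s) - ip N m (ze N A s))\<^sup>2)) = q \<sigma> / real N"
    proof -
      have "(\<Sum>t\<in>?I. (ip N (\<lambda>i. \<sigma> i - tanh (H i)) (?p t))\<^sup>2) = (\<Sum>s=1..k. (ip N \<sigma> (phi N A s) - ip N m (phi N A s))\<^sup>2) + (\<Sum>s=1..k. (ip N \<sigma> (ze N A s) - ip N m (ze N A s))\<^sup>2)"
        unfolding sum_bool_times by (simp add: ip_linear mH)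
      then show ?thesis unfolding q_def using N by simp
    qed
    ultimately have "\<bar>\<Psi> \<sigma> - E\<bar> <= remainder k N A + q \<sigma> / real N" by simp
    then have "real N * \<bar>\<Psi> \<sigma> - E\<bar> <= real N * (remainder k N A + q \<sigma> / real N)" by (rule mult_left_mono) simp
    then show ?thesis using N by (simp add: abs_mult distrib_left flip: right_diff_distrib)
  qed
  have Q: "(\<Sum>\<sigma>\<in>?S. w \<sigma> * exp (q \<sigma>)) <= (\<Sum>\<sigma>\<in>?S. w \<sigma>) * 2 ^ k"
  proof -
    have "(\<Sum>\<sigma>\<in>?S. w \<sigma> * exp (q \<sigma>)) <= (\<Sum>\<sigma>\<in>?S. w \<sigma>) * sqrt 2 ^ card ?I"
      unfolding w_def q_def
      by (rule sum_spins_quadratic[OF _ N beta_pos beta_le gram_bound[OF N D]]) simp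
    \<comment> \<open>A factor sqrt 2 for each of the 2k coordinates; after logarithm and division
      by N it contributes k ln 2 / N.\<close>
    also have "sqrt 2 ^ card ?I = 2 ^ k"
    proof -
      have "card ?I = 2 * k" by (simp add: card_cartesian_product)
      then show ?thesis by (simp add: power_mult)
    qed
    finally show ?thesis .
  qed
  have fin: "finite ?S" "?S ~= {}" by (auto intro: finite_PiE simp: PiE_eq_empty_iff)
  have "\<bar>ln (\<Sum>\<sigma>\<in>?S. w \<sigma> * exp (real N * \<Psi> \<sigma>)) - ln (\<Sum>\<sigma>\<in>?S. w \<sigma>) - real N * E\<bar> <= real N * remainder k N A + ln (2 ^ k)"
    by (rule log_partition_bound[OF fin _ Y Q]) (auto simp: w_def)
  moreover have "ln (\<Sum>\<sigma>\<in>?S. w \<sigma>) = real N * ln 2 + (\<Sum>i<N. ln (cosh (H i)))"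
    unfolding w_def sum_spins_exp by (simp add: ln_mult ln_realpow ln_prod prod_pos)
  moreover have "ln (Wpart \<beta> h N k A) = ln (\<Sum>\<sigma>\<in>?S. w \<sigma> * exp (real N * \<Psi> \<sigma>)) - real N * ln 2"
  proof -
    have "0 < (\<Sum>\<sigma>\<in>?S. w \<sigma> * exp (real N * \<Psi> \<sigma>))" by (rule sum_pos[OF fin]) (simp add: w_def)
    then show ?thesis unfolding Wpart_def W by (simp add: ln_div ln_realpow)
  qed
  moreover have "real N * lead k N A = (\<Sum>i<N. ln (cosh (H i))) + real N * E"
    unfolding lead_def E_def m_def H_def using N by (simp add: distrib_left)
  ultimately have "\<bar>ln (Wpart \<beta> h N k A) - real N * lead k N A\<bar> <= real N * remainder k N A + real k * ln 2"
    by (simp add: ln_realpow)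
  then have "\<bar>ln (Wpart \<beta> h N k A) - real N * lead k N A\<bar> / real N <= (real N * remainder k N A + real k * ln 2) / real N"
    by (rule divide_right_mono) simp
  moreover have "\<bar>ln (Wpart \<beta> h N k A) - real N * lead k N A\<bar> / real N = \<bar>ln (Wpart \<beta> h N k A) / real N - lead k N A\<bar>"
  proof -
    have "ln (Wpart \<beta> h N k A) / real N - lead k N A = (ln (Wpart \<beta> h N k A) - real N * lead k N A) / real N"
      using N by (simp add: field_simps)
    then show ?thesis by (simp add: abs_divide)
  qed
  ultimately show ?thesis using N by (simp add: add_divide_distrib)
qed

text \<open>Every inner product with a spin vector is bounded by Cauchy-Schwarz or Bessel. The bound
  covers also the matrices with large defect and supplies the second moments needed for convergence
  in mean.\<close>

lemma ln_Wpart_crude: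
  assumes N: "N >= 1"
  shows "\<bar>ln (Wpart \<beta> h N k A) / real N\<bar> <= 1 + h + (\<Sum>s=1..k. sqrt (ip N (ze N A s) (ze N A s))) + (\<Sum>s=1..k. \<bar>ip N (phi N A s) (it_xi \<beta> h N A s)\<bar>)" (is "_ <= ?K")
proof -
  let ?S = "{..<N} \<rightarrow>\<^sub>E {-1, 1::real}"
  have fin: "finite ?S" "?S ~= {}" by (auto intro: finite_PiE simp: PiE_eq_empty_iff)
  have card: "card ?S = 2 ^ N" by (simp add: card_PiE numeral_2_eq_2)
  have W: "\<bar>Wexp \<beta> h N k A \<sigma> - 0\<bar> <= real N * ?K + 0" if s: "\<sigma> \<in> ?S" for \<sigma>
  proof -
    let ?x = "\<lambda>s. ip N \<sigma> (phi N A s)" and ?y = "\<lambda>s. ip N \<sigma> (ze N A s)" and ?a = "\<lambda>s. ip N (phi N A s) (it_xi \<beta> h N A s)"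
    have n: "ip N \<sigma> \<sigma> = 1" by (rule spin_norm[OF N s])
    have X: "(\<Sum>s=1..k. (?x s)\<^sup>2) <= 1" using bessel[OF N, where x=\<sigma>] n by simp
    have X0: "0 <= (\<Sum>s=1..k. (?x s)\<^sup>2)" by (simp add: sum_nonneg)
    have x2: "(?x s)\<^sup>2 <= 1" if "s \<in> {1..k}" for s
    proof -
      have "(?x s)\<^sup>2 <= (\<Sum>s=1..k. (?x s)\<^sup>2)" by (rule member_le_sum) (use that in auto)
      then show ?thesis using X by linarith
    qed
    have x1: "\<bar>?x s\<bar> <= 1" if "s \<in> {1..k}" for s using x2[OF that] by (simp add: abs_square_le_1)
    have y: "\<bar>?y s\<bar> <= sqrt (ip N (ze N A s) (ze N A s))" for s
      using ip_cauchy_schwarz[of N \<sigma> "ze N A s"] n by (intro real_le_rsqrt) simp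
    have 1: "\<bar>\<beta> * (\<Sum>s=1..k. ?x s * ?y s)\<bar> <= (\<Sum>s=1..k. sqrt (ip N (ze N A s) (ze N A s)))"
    proof (rule abs_mult_sum_le)
      fix s assume s: "s \<in> {1..k}"
      show "\<bar>?x s * ?y s\<bar> <= sqrt (ip N (ze N A s) (ze N A s))"
        using mult_mono[OF x1[OF s] y[of s]] by (simp add: abs_mult)
    qed (use beta_pos beta_sq_less(3) in auto)
    have 2: "\<bar>\<beta> / sqrt 2 * (\<Sum>s=1..k. ?a s * (?x s)\<^sup>2)\<bar> <= (\<Sum>s=1..k. \<bar>?a s\<bar>)"
    proof (rule abs_mult_sum_le)
      fix s assume s: "s \<in> {1..k}"
      show "\<bar>?a s * (?x s)\<^sup>2\<bar> <= \<bar>?a s\<bar>"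
        using mult_left_mono[OF x2[OF s], of "\<bar>?a s\<bar>"] by (simp add: abs_mult)
    next
      show "\<beta> / sqrt 2 <= 1" using order_trans[OF less_imp_le[OF beta_sq_less(3)], of "sqrt 2"] by (simp add: divide_le_eq)
    qed (use beta_pos in simp)
    have 3: "\<bar>\<beta>\<^sup>2 / 4 * (1 - (\<Sum>s=1..k. (?x s)\<^sup>2))\<^sup>2\<bar> <= 1"
    proof -
      have "(1 - X)\<^sup>2 <= 1" if "0 <= X" "X <= 1" for X :: real using that by (intro power_le_one) auto
      from this[OF X0 X] have S: "(1 - (\<Sum>s=1..k. (?x s)\<^sup>2))\<^sup>2 <= 1" .
      have "\<beta>\<^sup>2 / 4 <= 1" using beta_sq_less(1) by simp
      from mult_mono[OF this S] show ?thesis by simp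
    qed
    have 4: "\<bar>h * (\<Sum>i<N. \<sigma> i)\<bar> <= real N * h"
    proof -
      have "\<bar>\<sigma> i\<bar> <= 1" if "i < N" for i
      proof -
        have "\<sigma> i \<in> {-1, 1}" using s that by (auto simp: PiE_def Pi_def)
        then show ?thesis by auto
      qed
      then have "\<bar>1 * (\<Sum>i<N. \<sigma> i)\<bar> <= (\<Sum>i<N. 1)" by (intro abs_mult_sum_le) auto
      then have "\<bar>\<Sum>i<N. \<sigma> i\<bar> <= real N" by simp
      from mult_left_mono[OF this less_imp_le[OF h_pos]] show ?thesis using h_pos by (simp add: abs_mult mult.commute)
    qed
    show ?thesis
      unfolding Wexp_def diff_zero add_0_right by (rule scaled_abs_bound[OF of_nat_0_le_iff 1 2 3 4])
  qed
  have "\<bar>ln (\<Sum>\<sigma>\<in>?S. 1 * exp (Wexp \<beta> h N k A \<sigma>)) - ln (\<Sum>\<sigma>\<in>?S. 1) - 0\<bar> <= real N * ?K + ln 1"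
    \<comment> \<open>Unit weights, center 0, q = 0 and C = 1: a uniform bound on the exponent
      passes to the logarithm of the mean.\<close>
    by (rule log_partition_bound[OF fin _ W]) auto
  moreover have "ln (Wpart \<beta> h N k A) = ln (\<Sum>\<sigma>\<in>?S. 1 * exp (Wexp \<beta> h N k A \<sigma>)) - ln (\<Sum>\<sigma>\<in>?S. 1)"
  proof -
    have "0 < (\<Sum>\<sigma>\<in>?S. exp (Wexp \<beta> h N k A \<sigma>))" by (rule sum_pos[OF fin]) simp
    then show ?thesis unfolding Wpart_def by (simp add: ln_div card)
  qed
  ultimately have "\<bar>ln (Wpart \<beta> h N k A)\<bar> <= real N * ?K" by simp
  then have "\<bar>ln (Wpart \<beta> h N k A)\<bar> / real N <= real N * ?K / real N" by (rule divide_right_mono) simp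
  then show ?thesis using N by (simp add: abs_divide)
qed

end

section \<open>Conclusion\<close>

lemma (in prob_seq) cvp_sequence:
  assumes x: "x \<longlonglongrightarrow> c" shows "cvp (\<lambda>N _. x N) c"
proof (rule cvp_dominated2[OF cvp_const[of 0] cvp_const[of 0]])
  fix \<epsilon> :: real assume e: "0 < \<epsilon>"
  have "\<forall>\<^sub>F N in sequentially. \<bar>x N - c\<bar> <= \<epsilon>"
    using tendstoD[OF x e] by eventually_elim (simp add: dist_real_def)
  then have "\<forall>\<^sub>F N in sequentially. \<forall>y\<in>space (M N). \<bar>0 - 0::real\<bar> <= 1 --> \<bar>0 - 0::real\<bar> <= 1 --> \<bar>x N - c\<bar> <= \<epsilon>"
    by eventually_elim blast
  note E = this
  show "\<exists>\<delta>>0. \<forall>\<^sub>F N in sequentially. \<forall>y\<in>space (M N). \<bar>0 - 0 :: real\<bar> <= \<delta> --> \<bar>0 - 0 :: real\<bar> <= \<delta> --> \<bar>x N - c\<bar> <= \<epsilon>"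
    by (rule exI[where x=1], rule conjI[OF zero_less_one E])
qed simp

lemma nn_integral_PN_le:
  assumes T: "T \<in> borel_measurable (PN N)" and le: "\<And>A. (\<integral>\<^sup>+w. \<integral>\<^sup>+v. T (A, w, v) \<partial>Gv N \<partial>Gv N) <= C"
  shows "(\<integral>\<^sup>+x. T x \<partial>PN N) <= C"
proof -
  have "T \<in> borel_measurable (borel \<Otimes>\<^sub>M (borel \<Otimes>\<^sub>M borel))" using T by (simp cong: measurable_cong_sets)
  then have "(\<integral>\<^sup>+x. T x \<partial>PN N) = (\<integral>\<^sup>+A. \<integral>\<^sup>+w. \<integral>\<^sup>+v. T (A, w, v) \<partial>Gv N \<partial>Gv N \<partial>Gm N)" by (rule nn_integral_PN)
  also have "\<dots> <= (\<integral>\<^sup>+A. C \<partial>Gm N)" by (rule nn_integral_mono) (rule le)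
  finally show ?thesis by simp
qed

text \<open>The counterpart of \<open>PN_transfer\<close> for expectations; an inequality suffices,
  which absorbs the factor 0 or 1 of the degenerate case.\<close>

lemma nn_integral_transfer:
  assumes N: "N >= 1" and Y: "Y \<in> borel_measurable borel" "on_block N Y" and Y': "Y' \<in> borel_measurable (PN N)"
    and eq: "\<And>A g w v. Y (resample \<beta> h N k A (refresh N (it_phi \<beta> h N A (Suc k)) w v g)) <= Y' (A, w, v)"
  shows "(\<integral>\<^sup>+A. Y A \<partial>Gm N) <= (\<integral>\<^sup>+x. Y' x \<partial>PN N)"
proof -
  have m: "Y' \<in> borel_measurable (borel \<Otimes>\<^sub>M (borel \<Otimes>\<^sub>M borel))" using Y' by (simp cong: measurable_cong_sets)
  have "(\<integral>\<^sup>+A. Y A \<partial>Gm N) = (\<integral>\<^sup>+A. \<integral>\<^sup>+g. \<integral>\<^sup>+w. \<integral>\<^sup>+v. Y (resample \<beta> h N k A (refresh N (it_phi \<beta> h N A (Suc k)) w v g)) \<partial>Gv N \<partial>Gv N \<partial>Gm N \<partial>Gm N)"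
    by (rule Gm_resample_refresh[OF N Y])
  also have "\<dots> <= (\<integral>\<^sup>+A. \<integral>\<^sup>+g. \<integral>\<^sup>+w. \<integral>\<^sup>+v. Y' (A, w, v) \<partial>Gv N \<partial>Gv N \<partial>Gm N \<partial>Gm N)"
    by (intro nn_integral_mono eq)
  also have "\<dots> = (\<integral>\<^sup>+A. \<integral>\<^sup>+w. \<integral>\<^sup>+v. Y' (A, w, v) \<partial>Gv N \<partial>Gv N \<partial>Gm N)" by simp
  also have "\<dots> = (\<integral>\<^sup>+x. Y' x \<partial>PN N)" by (rule nn_integral_PN[OF m, symmetric])
  finally show ?thesis .
qed

context sk_params
begin

lemma second_moments:
  assumes N: "N >= 1" and s: "s >= 1"
  shows "(\<integral>\<^sup>+x. ennreal ((ip N (phi N (fst x) s) (omP x))\<^sup>2) \<partial>PN N) <= ennreal 1"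
    and "(\<integral>\<^sup>+x. ennreal ((ip N (phi N (fst x) s) (fst (snd x)))\<^sup>2) \<partial>PN N) <= ennreal 1"
    and "(\<integral>\<^sup>+x. ennreal ((ip N (phi N (fst x) s) (snd (snd x)))\<^sup>2) \<partial>PN N) <= ennreal 1"
    and "(\<integral>\<^sup>+x. ennreal ((ip N (omP x) (omP x) - 1)\<^sup>2) \<partial>PN N) <= ennreal 3"
proof -
  have le: "ennreal (c / real N) <= ennreal c" if "0 <= c" for c
    using that N mult_right_mono[of 1 "real N" c] by (intro ennreal_leI) (simp add: divide_le_eq mult.commute)
  have p: "(\<integral>\<^sup>+\<omega>. ennreal ((ip N (phi N A s) \<omega>)\<^sup>2) \<partial>Gv N) <= ennreal 1" for A
    by (rule order_trans[OF Gv_ip_square_phi[OF N s]]) (rule le, simp)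
  show "(\<integral>\<^sup>+x. ennreal ((ip N (phi N (fst x) s) (omP x))\<^sup>2) \<partial>PN N) <= ennreal 1"
  proof (rule nn_integral_PN_le)
    fix A :: matr
    have "(\<integral>\<^sup>+w. \<integral>\<^sup>+v. ennreal ((ip N (phi N A s) (om w v))\<^sup>2) \<partial>Gv N \<partial>Gv N) = (\<integral>\<^sup>+\<omega>. ennreal ((ip N (phi N A s) \<omega>)\<^sup>2) \<partial>Gv N)"
      by (rule Gv_om) measurable
    then show "(\<integral>\<^sup>+w. \<integral>\<^sup>+v. ennreal ((ip N (phi N (fst (A, w, v)) s) (omP (A, w, v)))\<^sup>2) \<partial>Gv N \<partial>Gv N) <= ennreal 1"
      using p[of A] by simp
  qed (intro measurable_compose[OF _ measurable_ennreal] borel_measurable_power borel_measurable_diff ip_measurable_raw borel_measurable_const om_measurable PN_it_measurable PN_entry)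
  show "(\<integral>\<^sup>+x. ennreal ((ip N (phi N (fst x) s) (fst (snd x)))\<^sup>2) \<partial>PN N) <= ennreal 1"
    by (rule nn_integral_PN_le, (intro measurable_compose[OF _ measurable_ennreal] borel_measurable_power borel_measurable_diff ip_measurable_raw borel_measurable_const om_measurable PN_it_measurable PN_entry)) (use p in \<open>simp add: Gv.emeasure_space_1[simplified]\<close>)
  show "(\<integral>\<^sup>+x. ennreal ((ip N (phi N (fst x) s) (snd (snd x)))\<^sup>2) \<partial>PN N) <= ennreal 1"
    by (rule nn_integral_PN_le, (intro measurable_compose[OF _ measurable_ennreal] borel_measurable_power borel_measurable_diff ip_measurable_raw borel_measurable_const om_measurable PN_it_measurable PN_entry)) (use p in \<open>simp add: Gv.emeasure_space_1[simplified]\<close>)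
  show "(\<integral>\<^sup>+x. ennreal ((ip N (omP x) (omP x) - 1)\<^sup>2) \<partial>PN N) <= ennreal 3"
  proof (rule nn_integral_PN_le)
    fix A :: matr
    have "(\<integral>\<^sup>+w. \<integral>\<^sup>+v. ennreal ((ip N (om w v) (om w v) - 1)\<^sup>2) \<partial>Gv N \<partial>Gv N) = (\<integral>\<^sup>+\<omega>. ennreal ((ip N \<omega> \<omega> - 1)\<^sup>2) \<partial>Gv N)"
      by (rule Gv_om) measurable
    also have "\<dots> <= ennreal 3" by (rule order_trans[OF Gv_norm[OF N]]) (rule le, simp)
    finally show "(\<integral>\<^sup>+w. \<integral>\<^sup>+v. ennreal ((ip N (omP (A, w, v)) (omP (A, w, v)) - 1)\<^sup>2) \<partial>Gv N \<partial>Gv N) <= ennreal 3" by simp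
  qed (intro measurable_compose[OF _ measurable_ennreal] borel_measurable_power borel_measurable_diff ip_measurable_raw borel_measurable_const om_measurable PN_it_measurable PN_entry)
qed

lemma xi_second_moment:
  assumes N: "N >= 1" and s: "s >= 1"
  shows "(\<integral>\<^sup>+A. ennreal ((ip N (phi N A s) (it_xi \<beta> h N A s))\<^sup>2) \<partial>Gm N) <= ennreal 1"
proof -
  obtain k where k: "s = Suc k" using s by (cases s) auto
  note [measurable] = it_measurable
  have "(\<integral>\<^sup>+A. ennreal ((ip N (phi N A s) (it_xi \<beta> h N A s))\<^sup>2) \<partial>Gm N) <= (\<integral>\<^sup>+x. ennreal ((ip N (phi N (fst x) s) (snd (snd x)))\<^sup>2) \<partial>PN N)"
  proof (rule nn_integral_transfer[OF N, where k=k and \<beta>=\<beta> and h=h])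
    show "on_block N (\<lambda>A. ennreal ((ip N (phi N A s) (it_xi \<beta> h N A s))\<^sup>2))"
      unfolding on_block_def by (intro allI impI arg_cong[of _ _ "\<lambda>x. ennreal (x\<^sup>2)"] ip_cong it_block(1,2))
    fix A g w v
    have "(ip N (phi N A s) (phi N A s) * ip N (phi N A s) v)\<^sup>2 <= (ip N (phi N A s) v)\<^sup>2"
      using unit_or_zero_ip[OF it_phi_unit_or_zero[OF N s, of \<beta> h A]] by auto
    then show "ennreal ((ip N (phi N (resample \<beta> h N k A (refresh N (phi N A (Suc k)) w v g)) s) (it_xi \<beta> h N (resample \<beta> h N k A (refresh N (phi N A (Suc k)) w v g)) s))\<^sup>2)
        <= ennreal ((ip N (phi N (fst (A, w, v)) s) (snd (snd (A, w, v))))\<^sup>2)"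
      unfolding k it_resample_refresh(2)[OF N] by (simp add: ennreal_leI)
  qed measurable
  also have "\<dots> <= ennreal 1" by (rule second_moments(3)[OF N s])
  finally show ?thesis .
qed

text \<open>The constant is 14 + 2k = 4 + 2 * 3 + 2k + 2 + 2: twice the bound 2 + (<om, om> - 1)^2
  for the norm of om, and twice the squared coefficients of err, k of them for the old directions
  and two moments for the new one.\<close>

lemma zeta_second_moment:
  assumes N: "N >= 1"
  shows "(\<integral>\<^sup>+A. ennreal (ip N (ze N A (Suc k)) (ze N A (Suc k))) \<partial>Gm N) <= ennreal (14 + 2 * real k)"
proof -
  note [measurable] = it_measurable
  let ?a = "\<lambda>x. (ip N (omP x) (omP x) - 1)\<^sup>2" and ?b = "\<lambda>s x. (ip N (phi N (fst x) s) (omP x))\<^sup>2"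
  let ?c = "\<lambda>x. (ip N (phi N (fst x) (Suc k)) (fst (snd x)))\<^sup>2" and ?d = "\<lambda>x. (ip N (phi N (fst x) (Suc k)) (snd (snd x)))\<^sup>2"
  have pt: "ip N (ze N R (Suc k)) (ze N R (Suc k)) <= 4 + (2 * ?a (A, w, v) + ((\<Sum>s=1..k. 2 * ?b s (A, w, v)) + (2 * ?c (A, w, v) + 2 * ?d (A, w, v))))"
    if R: "R = resample \<beta> h N k A (refresh N (phi N A (Suc k)) w v g)" for R A g w v
  proof -
    let ?u = "ip N (phi N A (Suc k)) (phi N A (Suc k))" and ?o = "om w v" and ?e = "err k N A w v"
    have u: "?u = 0 \<or> ?u = 1" by (rule unit_or_zero_ip[OF it_phi_unit_or_zero[OF N]]) simp
    have "ip N (ze N R (Suc k)) (ze N R (Suc k)) = ?u * (?u * ip N (\<lambda>i. ?o i + ?e i) (\<lambda>i. ?o i + ?e i))"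
      unfolding R it_resample_refresh(1)[OF N] ip_linear(3) ip_linear(9) ..
    also have "\<dots> <= ip N (\<lambda>i. ?o i + ?e i) (\<lambda>i. ?o i + ?e i)" using u ip_self_nonneg by auto
    also have "\<dots> <= 2 * ip N ?o ?o + 2 * ip N ?e ?e" by (rule ip_add_self_le)
    finally have 1: "ip N (ze N R (Suc k)) (ze N R (Suc k)) <= 2 * ip N ?o ?o + 2 * ip N ?e ?e" .
    \<comment> \<open>Bounds the norm by its centered square, the quantity whose mean is estimated
      in \<open>second_moments\<close>.\<close>
    have x: "x <= 2 + (x - 1)\<^sup>2" for x :: real
      using zero_le_power2[of "x - 3/2"] by (simp add: power2_eq_square algebra_simps)
    have "{1..Suc k} = insert (Suc k) {1..k}" by auto
    then have S: "(\<Sum>s\<in>{1..Suc k}. (kap k N A w v s)\<^sup>2) = (kap k N A w v (Suc k))\<^sup>2 + (\<Sum>s=1..k. (kap k N A w v s)\<^sup>2)" by simp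
    have "(\<Sum>s=1..k. (kap k N A w v s)\<^sup>2) = (\<Sum>s=1..k. ?b s (A, w, v))"
      by (rule sum.cong) (auto simp: kap_def)
    moreover have "(kap k N A w v (Suc k))\<^sup>2 <= ?c (A, w, v) + ?d (A, w, v)"
    proof -
      have "((p - q) / sqrt 2)\<^sup>2 <= q\<^sup>2 + p\<^sup>2" for p q :: real
        using zero_le_power2[of "p + q"] by (simp add: power_divide power2_eq_square algebra_simps)
      then show ?thesis by (simp add: kap_def)
    qed
    ultimately have "ip N ?e ?e <= ?c (A, w, v) + ?d (A, w, v) + (\<Sum>s=1..k. ?b s (A, w, v))"
      using ip_err_le[OF N, of k A w v] S by linarith
    moreover have "(\<Sum>s=1..k. 2 * ?b s (A, w, v)) = 2 * (\<Sum>s=1..k. ?b s (A, w, v))" by (rule sum_distrib_left[symmetric])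
    moreover have "ip N ?o ?o <= 2 + ?a (A, w, v)" using x[of "ip N ?o ?o"] by simp
    ultimately show ?thesis using 1 by linarith
  qed
  have e2: "ennreal (2 * y\<^sup>2) = 2 * ennreal (y\<^sup>2)" for y by (simp add: ennreal_mult)
  have "(\<integral>\<^sup>+A. ennreal (ip N (ze N A (Suc k)) (ze N A (Suc k))) \<partial>Gm N)
     <= (\<integral>\<^sup>+x. 4 + (2 * ennreal (?a x) + ((\<Sum>s=1..k. 2 * ennreal (?b s x)) + (2 * ennreal (?c x) + 2 * ennreal (?d x)))) \<partial>PN N)"
  proof (rule nn_integral_transfer[OF N, where k=k and \<beta>=\<beta> and h=h])
    show "on_block N (\<lambda>A. ennreal (ip N (ze N A (Suc k)) (ze N A (Suc k))))"
      unfolding on_block_def by (intro allI impI arg_cong[of _ _ ennreal] ip_cong it_block(3))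
    fix A g w v
    let ?R = "resample \<beta> h N k A (refresh N (phi N A (Suc k)) w v g)" and ?x = "(A, w, v)"
    have "ennreal (ip N (ze N ?R (Suc k)) (ze N ?R (Suc k))) <= ennreal (4 + (2 * ?a ?x + ((\<Sum>s=1..k. 2 * ?b s ?x) + (2 * ?c ?x + 2 * ?d ?x))))"
      by (rule ennreal_leI[OF pt[OF refl]])
    also have "\<dots> = ennreal 4 + (ennreal (2 * ?a ?x) + (ennreal (\<Sum>s=1..k. 2 * ?b s ?x) + (ennreal (2 * ?c ?x) + ennreal (2 * ?d ?x))))"
      by (subst ennreal_plus, simp, intro add_nonneg_nonneg sum_nonneg, simp_all)
         (subst ennreal_plus, simp, intro add_nonneg_nonneg sum_nonneg, simp_all add: ennreal_plus sum_nonneg)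
    also have "ennreal (\<Sum>s=1..k. 2 * ?b s ?x) = (\<Sum>s=1..k. ennreal (2 * ?b s ?x))" by (rule sum_ennreal[symmetric]) simp
    finally show "ennreal (ip N (ze N ?R (Suc k)) (ze N ?R (Suc k))) <= 4 + (2 * ennreal (?a ?x) + ((\<Sum>s=1..k. 2 * ennreal (?b s ?x)) + (2 * ennreal (?c ?x) + 2 * ennreal (?d ?x))))"
      unfolding e2 by simp
  qed measurable
  also have "\<dots> = 4 + (2 * (\<integral>\<^sup>+x. ennreal (?a x) \<partial>PN N) + ((\<Sum>s=1..k. 2 * (\<integral>\<^sup>+x. ennreal (?b s x) \<partial>PN N)) + (2 * (\<integral>\<^sup>+x. ennreal (?c x) \<partial>PN N) + 2 * (\<integral>\<^sup>+x. ennreal (?d x) \<partial>PN N))))"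
    using prob_space.emeasure_space_1[OF prob_space_PN[of N]] by (simp add: nn_integral_add nn_integral_sum nn_integral_cmult)
  also have "\<dots> <= ennreal 4 + (ennreal 2 * ennreal 3 + ((\<Sum>s=1..k. ennreal 2 * ennreal 1) + (ennreal 2 * ennreal 1 + ennreal 2 * ennreal 1)))"
    unfolding ennreal_numeral
    by (intro add_mono mult_mono sum_mono order_refl second_moments[OF N, unfolded ennreal_numeral] zero_le) auto
  also have "\<dots> = ennreal (14 + 2 * real k)"
  proof -
    have "(\<Sum>s=1..k. ennreal 2 * ennreal 1) = ennreal (\<Sum>s=1..k. 2 * 1)" by (subst sum_ennreal[symmetric]) (simp_all add: ennreal_mult)
    also have "\<dots> = ennreal (2 * real k)" by (simp add: mult.commute)
    finally show ?thesis by (simp only: ennreal_mult[symmetric] ennreal_plus[symmetric] zero_le_numeral zero_le_one mult_nonneg_nonneg add_nonneg_nonneg of_nat_0_le_iff) simp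
  qed
  finally show ?thesis .
qed

text \<open>Squares \<open>ln_Wpart_crude\<close>. The bound depends on k but not on N, which is
  enough since N tends to infinity first.\<close>

lemma Wpart_second_moment:
  "\<exists>B\<ge>0. \<forall>N\<ge>1. (\<integral>\<^sup>+A. ennreal ((ln (Wpart \<beta> h N k A) / real N - c)\<^sup>2) \<partial>Gm N) <= ennreal B"
proof -
  define K where "K = 1 + h + \<bar>c\<bar>"
  define B where "B = 3 * K\<^sup>2 + ((\<Sum>s=1..k. 3 * real k * (14 + 2 * real s)) + (\<Sum>s=1..k. 3 * real k * 1))"
  have "(\<integral>\<^sup>+A. ennreal ((ln (Wpart \<beta> h N k A) / real N - c)\<^sup>2) \<partial>Gm N) <= ennreal B" if N: "N >= 1" for N
  proof -
    let ?z = "\<lambda>s A. ip N (ze N A s) (ze N A s)" and ?a = "\<lambda>s A. (ip N (phi N A s) (it_xi \<beta> h N A s))\<^sup>2"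
    have cs: "(\<Sum>s=1..k. f s)\<^sup>2 <= real k * (\<Sum>s=1..k. (f s)\<^sup>2)" for f :: "nat => real"
      using Cauchy_Schwarz_ineq_sum[of "\<lambda>_. 1" f "{1..k}"] by simp
    have sq: "x\<^sup>2 <= 3 * (p\<^sup>2 + q\<^sup>2 + r\<^sup>2)" if "\<bar>x\<bar> <= p + q + r" for x p q r :: real
    proof -
      have "x\<^sup>2 <= (p + q + r)\<^sup>2" using power_mono[OF that abs_ge_zero, of 2] by simp
      moreover have "3 * (p\<^sup>2 + q\<^sup>2 + r\<^sup>2) - (p + q + r)\<^sup>2 = (p - q)\<^sup>2 + (p - r)\<^sup>2 + (q - r)\<^sup>2" by (simp add: power2_eq_square algebra_simps)
      moreover have "0 <= (p - q)\<^sup>2 + (p - r)\<^sup>2 + (q - r)\<^sup>2" by simp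
      ultimately show ?thesis by linarith
    qed
    have comb: "x <= 3 * a + (3 * p' + 3 * q')" if "x <= 3 * (a + p + q)" "p <= p'" "q <= q'" for x a p q p' q' :: real
      using that by argo
    have pt: "(ln (Wpart \<beta> h N k A) / real N - c)\<^sup>2 <= 3 * K\<^sup>2 + ((\<Sum>s=1..k. 3 * real k * ?z s A) + (\<Sum>s=1..k. 3 * real k * ?a s A))" for A
    proof -
      have "\<bar>ln (Wpart \<beta> h N k A) / real N - c\<bar> <= K + (\<Sum>s=1..k. sqrt (?z s A)) + (\<Sum>s=1..k. \<bar>ip N (phi N A s) (it_xi \<beta> h N A s)\<bar>)"
        using ln_Wpart_crude[OF N, of k A] unfolding K_def by linarith
      from sq[OF this] have c1: "(ln (Wpart \<beta> h N k A) / real N - c)\<^sup>2 <= 3 * (K\<^sup>2 + (\<Sum>s=1..k. sqrt (?z s A))\<^sup>2 + (\<Sum>s=1..k. \<bar>ip N (phi N A s) (it_xi \<beta> h N A s)\<bar>)\<^sup>2)" .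
      have c2: "(\<Sum>s=1..k. sqrt (?z s A))\<^sup>2 <= real k * (\<Sum>s=1..k. ?z s A)"
        using cs[of "\<lambda>s. sqrt (?z s A)"] by (simp add: ip_self_nonneg)
      have c3: "(\<Sum>s=1..k. \<bar>ip N (phi N A s) (it_xi \<beta> h N A s)\<bar>)\<^sup>2 <= real k * (\<Sum>s=1..k. ?a s A)"
        using cs[of "\<lambda>s. \<bar>ip N (phi N A s) (it_xi \<beta> h N A s)\<bar>"] by simp
      have "(\<Sum>s=1..k. 3 * real k * ?z s A) = 3 * (real k * (\<Sum>s=1..k. ?z s A))" "(\<Sum>s=1..k. 3 * real k * ?a s A) = 3 * (real k * (\<Sum>s=1..k. ?a s A))"
        by (simp_all add: sum_distrib_left mult.assoc)
      with comb[OF c1 c2 c3] show ?thesis by (simp only:)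
    qed
    have "(\<integral>\<^sup>+A. ennreal ((ln (Wpart \<beta> h N k A) / real N - c)\<^sup>2) \<partial>Gm N)
       <= (\<integral>\<^sup>+A. ennreal (3 * K\<^sup>2) + ((\<Sum>s=1..k. ennreal (3 * real k) * ennreal (?z s A)) + (\<Sum>s=1..k. ennreal (3 * real k) * ennreal (?a s A))) \<partial>Gm N)"
    proof (rule nn_integral_mono)
      fix A
      have "ennreal ((ln (Wpart \<beta> h N k A) / real N - c)\<^sup>2) <= ennreal (3 * K\<^sup>2 + ((\<Sum>s=1..k. 3 * real k * ?z s A) + (\<Sum>s=1..k. 3 * real k * ?a s A)))"
        by (rule ennreal_leI[OF pt])
      also have "\<dots> = ennreal (3 * K\<^sup>2) + (ennreal (\<Sum>s=1..k. 3 * real k * ?z s A) + ennreal (\<Sum>s=1..k. 3 * real k * ?a s A))"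
        by (subst ennreal_plus; (subst ennreal_plus)?) (auto intro!: sum_nonneg add_nonneg_nonneg mult_nonneg_nonneg ip_self_nonneg)
      also have "ennreal (\<Sum>s=1..k. 3 * real k * ?z s A) = (\<Sum>s=1..k. ennreal (3 * real k) * ennreal (?z s A))"
        by (subst sum_ennreal[symmetric]) (auto simp: ennreal_mult ip_self_nonneg)
      also have "ennreal (\<Sum>s=1..k. 3 * real k * ?a s A) = (\<Sum>s=1..k. ennreal (3 * real k) * ennreal (?a s A))"
        by (subst sum_ennreal[symmetric]) (auto simp: ennreal_mult)
      finally show "ennreal ((ln (Wpart \<beta> h N k A) / real N - c)\<^sup>2) <= ennreal (3 * K\<^sup>2) + ((\<Sum>s=1..k. ennreal (3 * real k) * ennreal (?z s A)) + (\<Sum>s=1..k. ennreal (3 * real k) * ennreal (?a s A)))" .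
    qed
    also have "\<dots> = ennreal (3 * K\<^sup>2) + ((\<Sum>s=1..k. ennreal (3 * real k) * (\<integral>\<^sup>+A. ennreal (?z s A) \<partial>Gm N)) + (\<Sum>s=1..k. ennreal (3 * real k) * (\<integral>\<^sup>+A. ennreal (?a s A) \<partial>Gm N)))"
      by (simp add: nn_integral_add nn_integral_sum nn_integral_cmult)
    also have "\<dots> <= ennreal (3 * K\<^sup>2) + ((\<Sum>s=1..k. ennreal (3 * real k) * ennreal (14 + 2 * real s)) + (\<Sum>s=1..k. ennreal (3 * real k) * ennreal 1))"
    proof (intro add_mono order_refl sum_mono mult_left_mono zero_le)
      fix s assume s: "s \<in> {1..k}"
      then obtain j where j: "s = Suc j" by (cases s) auto
      show "(\<integral>\<^sup>+A. ennreal (?z s A) \<partial>Gm N) <= ennreal (14 + 2 * real s)"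
        unfolding j by (rule order_trans[OF zeta_second_moment[OF N] ennreal_leI]) simp
      show "(\<integral>\<^sup>+A. ennreal (?a s A) \<partial>Gm N) <= ennreal 1" by (rule xi_second_moment[OF N]) (use s in auto)
    qed
    also have "\<dots> = ennreal B"
    proof -
      have s: "(\<Sum>s=1..k. ennreal (3 * real k) * ennreal (f s)) = ennreal (\<Sum>s=1..k. 3 * real k * f s)" if "\<And>s. 0 <= f s" for f :: "nat => real"
        by (subst sum_ennreal[symmetric]) (auto simp: ennreal_mult that)
      have "ennreal B = ennreal (3 * K\<^sup>2) + (ennreal (\<Sum>s=1..k. 3 * real k * (14 + 2 * real s)) + ennreal (\<Sum>s=1..k. 3 * real k * 1))"
        unfolding B_def by (subst ennreal_plus; (subst ennreal_plus)?) (auto intro!: sum_nonneg add_nonneg_nonneg mult_nonneg_nonneg)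
      then show ?thesis using s[of "\<lambda>s. 14 + 2 * real s"] s[of "\<lambda>_. 1"] by simp
    qed
    finally show ?thesis .
  qed
  moreover have "0 <= B" unfolding B_def by (intro add_nonneg_nonneg sum_nonneg mult_nonneg_nonneg) auto
  ultimately show ?thesis by blast
qed

text \<open>The deterministic error left after k steps, not to be confused with the vectors eta^(s);
  the factor 4 collects the constants of \<open>eta_bounds\<close>.\<close>

definition eta :: "nat => real" where "eta k = 4 * dd k + 4 * dd (Suc k)"

lemma sum_tau_diff:
  assumes k: "1 <= k"
  shows "(\<Sum>s=1..k. (gam \<beta> h s - tau k s) * f s) = (gam \<beta> h k - sqrt (dd k)) * f k"
proof -
  have "(\<Sum>s=1..k. (gam \<beta> h s - tau k s) * f s) = (\<Sum>s\<in>{k}. (gam \<beta> h s - tau k s) * f s)"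
    by (rule sum.mono_neutral_right) (use k in \<open>auto simp: tau_def\<close>)
  then show ?thesis by (simp add: tau_def)
qed

text \<open>The limits of \<open>lead\<close> and \<open>remainder\<close> are compared with
  \<open>RS_eq\<close>. Since gamma and \<open>tau k\<close> differ only at index k, by at most
  sqrt(dd k), and the sum of the gamma_s^2 is Q - dd(k + 1), every discrepancy is bounded by these
  two quantities.\<close>

lemma eta_bounds:
  assumes k: "1 <= k"
  defines "g \<equiv> \<Sum>s=1..k. (gam \<beta> h s)\<^sup>2"
  shows "\<bar>V Q + (\<beta> * (\<Sum>s=1..k. (gam \<beta> h s - tau k s) * (\<beta> * tau k s * (1 - Q))) + \<beta>\<^sup>2 / 4 * (1 - g)\<^sup>2) - RS \<beta> h\<bar>
      + (\<beta> / 2 * ((\<Sum>s=1..k. (\<beta> * tau k s * (1 - Q) - \<beta> * (1 - g) * gam \<beta> h s)\<^sup>2) + (\<Sum>s=1..k. (gam \<beta> h s - tau k s)\<^sup>2)))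
    <= eta k"
proof -
  let ?D = "dd k" and ?d = "dd (Suc k)" and ?x = "gam \<beta> h k - sqrt (dd k)"
  have g: "g = Q - ?d" by (simp add: g_def dd_def Gam_sq_def)
  have g0: "0 <= g" unfolding g_def by (simp add: sum_nonneg)
  have d: "0 < ?d" "?d <= 1" "g <= 1" "0 < ?D" using dd_pos[of "Suc k"] dd_pos[OF k] g g0 Q(3) by auto
  have Q01: "0 <= 1 - Q" "1 - Q <= 1" using Q(1,3) by auto
  have b: "0 <= \<beta>" "\<beta> <= 1" "0 <= \<beta>\<^sup>2" "\<beta>\<^sup>2 <= 1" using beta_pos beta_sq_less by auto
  have x: "\<bar>?x\<bar> <= sqrt ?D" using gam_bounds[OF k] d(4) by (intro abs_leI) auto
  have xD: "\<bar>?x * sqrt ?D\<bar> <= ?D"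
    using mult_right_mono[OF x, of "sqrt ?D"] d(4) by (simp add: abs_mult)
  have x2: "?x\<^sup>2 <= ?D" using power_mono[OF x abs_ge_zero, of 2] d(4) by simp
  have small: "\<bar>c * y\<bar> <= \<bar>y\<bar>" if "0 <= c" "c <= 1" for c y :: real
    using mult_right_mono[OF that(2), of "\<bar>y\<bar>"] that by (simp add: abs_mult)
  have T: "(\<Sum>s=1..k. (gam \<beta> h s - tau k s)\<^sup>2) = ?x\<^sup>2"
    using sum_tau_diff[OF k, of "\<lambda>s. gam \<beta> h s - tau k s"] by (simp add: power2_eq_square tau_def)
  have A: "\<bar>V Q + (\<beta> * (\<Sum>s=1..k. (gam \<beta> h s - tau k s) * (\<beta> * tau k s * (1 - Q))) + \<beta>\<^sup>2 / 4 * (1 - g)\<^sup>2) - RS \<beta> h\<bar> <= ?D + ?d"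
  proof -
    have "V Q + (\<beta> * (\<Sum>s=1..k. (gam \<beta> h s - tau k s) * (\<beta> * tau k s * (1 - Q))) + \<beta>\<^sup>2 / 4 * (1 - g)\<^sup>2) - RS \<beta> h
       = \<beta>\<^sup>2 * ((1 - Q) * (?x * sqrt ?D)) + \<beta>\<^sup>2 * (((1 - g)\<^sup>2 - (1 - Q)\<^sup>2) / 4)"
    proof -
      have "a + (\<beta> * (x * (\<beta> * y * z)) + \<beta>\<^sup>2 / 4 * P) - (a + \<beta>\<^sup>2 * R / 4) = \<beta>\<^sup>2 * (z * (x * y)) + \<beta>\<^sup>2 * ((P - R) / 4)" for a x y z P R :: real
        by (simp add: power2_eq_square right_diff_distrib distrib_left diff_divide_distrib mult_ac)
      \<comment> \<open>After \<open>sum_tau_diff\<close> only the index k contributes, and there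
        the weight is the square root of dd k.\<close>
      moreover have "tau k k = sqrt ?D" by (simp add: tau_def)
      ultimately show ?thesis unfolding sum_tau_diff[OF k] RS_eq by simp
    qed
    moreover have "\<bar>\<beta>\<^sup>2 * ((1 - Q) * (?x * sqrt ?D))\<bar> <= ?D"
      by (rule order_trans[OF small[OF b(3,4)] order_trans[OF small[OF Q01] xD]])
    moreover have "\<bar>\<beta>\<^sup>2 * (((1 - g)\<^sup>2 - (1 - Q)\<^sup>2) / 4)\<bar> <= ?d"
    proof (rule order_trans[OF small[OF b(3,4)]])
      have "(1 - g)\<^sup>2 - (1 - Q)\<^sup>2 = ?d * (2 * (1 - Q) + ?d)" unfolding g by (simp add: power2_eq_square algebra_simps)
      moreover have "?d * (2 * (1 - Q) + ?d) <= ?d * 4" using d Q01 by (intro mult_left_mono) argo+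
      moreover have "0 <= ?d * (2 * (1 - Q) + ?d)" using d Q01 by (intro mult_nonneg_nonneg) auto
      ultimately show "\<bar>((1 - g)\<^sup>2 - (1 - Q)\<^sup>2) / 4\<bar> <= ?d" by simp
    qed
    ultimately show ?thesis by linarith
  qed
  have W: "(\<Sum>s=1..k. (\<beta> * tau k s * (1 - Q) - \<beta> * (1 - g) * gam \<beta> h s)\<^sup>2) <= 2 * ?D + 2 * ?d"
  proof -
    have "(\<beta> * tau k s * (1 - Q) - \<beta> * (1 - g) * gam \<beta> h s)\<^sup>2 <= 2 * (gam \<beta> h s - tau k s)\<^sup>2 + 2 * (?d * (gam \<beta> h s)\<^sup>2)" for s
    proof -
      let ?u = "(1 - Q) * (gam \<beta> h s - tau k s)" and ?v = "?d * gam \<beta> h s"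
      have "\<beta> * tau k s * (1 - Q) - \<beta> * (1 - g) * gam \<beta> h s = - (\<beta> * (?u + ?v))" unfolding g by (simp add: algebra_simps)
      then have "(\<beta> * tau k s * (1 - Q) - \<beta> * (1 - g) * gam \<beta> h s)\<^sup>2 = \<beta>\<^sup>2 * (?u + ?v)\<^sup>2" by (simp add: power_mult_distrib)
      moreover have "\<beta>\<^sup>2 * (?u + ?v)\<^sup>2 <= 1 * (?u + ?v)\<^sup>2" by (rule mult_right_mono[OF b(4)]) simp
      moreover have "(?u + ?v)\<^sup>2 <= 2 * ?u\<^sup>2 + 2 * ?v\<^sup>2"
        using zero_le_power2[of "?u - ?v"] unfolding power2_diff power2_sum by argo
      moreover have "?u\<^sup>2 <= (gam \<beta> h s - tau k s)\<^sup>2"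
        using power_mono[OF small[OF Q01, of "gam \<beta> h s - tau k s"] abs_ge_zero, of 2] by simp
      moreover have "?v\<^sup>2 <= ?d * (gam \<beta> h s)\<^sup>2"
        using mult_right_mono[OF mult_left_mono[OF d(2) less_imp_le[OF d(1)]], of "(gam \<beta> h s)\<^sup>2"] by (simp add: power2_eq_square mult_ac)
      ultimately show ?thesis by argo
    qed
    then have "(\<Sum>s=1..k. (\<beta> * tau k s * (1 - Q) - \<beta> * (1 - g) * gam \<beta> h s)\<^sup>2) <= (\<Sum>s=1..k. 2 * (gam \<beta> h s - tau k s)\<^sup>2 + 2 * (?d * (gam \<beta> h s)\<^sup>2))"
      by (rule sum_mono)
    moreover have "(\<Sum>s=1..k. 2 * (gam \<beta> h s - tau k s)\<^sup>2 + 2 * (?d * (gam \<beta> h s)\<^sup>2)) = 2 * ?x\<^sup>2 + 2 * (?d * g)"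
      unfolding sum.distrib sum_distrib_left[symmetric] T g_def ..
    moreover have "?d * g <= ?d * 1" by (rule mult_left_mono) (use d in auto)
    ultimately show ?thesis using x2 by argo
  qed
  have "\<beta> / 2 * ((\<Sum>s=1..k. (\<beta> * tau k s * (1 - Q) - \<beta> * (1 - g) * gam \<beta> h s)\<^sup>2) + (\<Sum>s=1..k. (gam \<beta> h s - tau k s)\<^sup>2))
     <= 1 * ((2 * ?D + 2 * ?d) + ?D)"
    by (rule mult_mono) (use b W T x2 in \<open>auto intro!: add_mono add_nonneg_nonneg sum_nonneg\<close>)
  with A show ?thesis unfolding eta_def using d by argo
qed

lemma eta_tendsto: "eta \<longlonglongrightarrow> 0"
proof -
  have "(\<lambda>k. 4 * dd k + 4 * dd (Suc k)) \<longlonglongrightarrow> 4 * 0 + 4 * 0"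
    by (intro tendsto_intros dd_tendsto LIMSEQ_Suc[OF dd_tendsto])
  then show ?thesis unfolding eta_def[abs_def] by simp
qed

lemma cvp_defect: "G.cvp (defect k) 0"
proof -
  have "G.cvp (\<lambda>N A. \<Sum>s=1..k. \<Sum>t=1..k. \<bar>ip N (ze N A s) (ze N A t) - (if s = t then 1 else 0)\<bar>)
     (\<Sum>s=1..k. \<Sum>t=1..k. \<bar>(if s = t then 1 else 0) - (if s = t then 1 else 0 :: real)\<bar>)"
    by (intro G.cvp_sum G.cvp_abs G.cvp_diff G.cvp_const llnD(2)[OF lln[of k]]) auto
  then show ?thesis unfolding defect_def[abs_def] by simp
qed

text \<open>On the event of small defect \<open>ln_Wpart_estimate\<close> applies, and its
  right-hand side converges in probability to at most \<open>eta k\<close>. The second moments then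
  give the bound in mean.\<close>

lemma free_energy_limsup:
  assumes k: "1 <= k"
  shows "limsup (\<lambda>N. \<integral>\<^sup>+A. ennreal \<bar>ln (Wpart \<beta> h N k A) / real N - RS \<beta> h\<bar> \<partial>Gm N) <= ennreal (2 * (eta k + 1 / real k))"
proof -
  let ?Y = "\<lambda>N A. ln (Wpart \<beta> h N k A) / real N - RS \<beta> h"
  let ?g = "\<Sum>s=1..k. (gam \<beta> h s)\<^sup>2"
  have mY: "?Y N \<in> borel_measurable (Gm N)" for N
    by (rule borel_measurable_Gm) (use Wpart_borel[of \<beta> h N k] in measurable)
  have mphi: "G.cvp (\<lambda>N A. ip N (mk k N A) (phi N A s)) (gam \<beta> h s)" if "s \<in> {1..k}" for s
    using cvp_m_phi[OF lln[of k], of s] that by auto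
  have mze: "G.cvp (\<lambda>N A. ip N (mk k N A) (ze N A s)) (\<beta> * tau k s * (1 - Q))" if "s \<in> {1..k}" for s
    by (rule cvp_m_zeta[OF k that])
  have xi: "G.cvp (\<lambda>N A. ip N (phi N A s) (it_xi \<beta> h N A s)) 0" if "s \<in> {1..k}" for s
    by (rule llnD(3)[OF lln that])
  have lead: "G.cvp (lead k) (V Q + (\<beta> * (\<Sum>s=1..k. (gam \<beta> h s - tau k s) * (\<beta> * tau k s * (1 - Q))) + \<beta>\<^sup>2 / 4 * (1 - ?g)\<^sup>2))" (is "G.cvp _ ?L")
    unfolding lead_def[abs_def]
    by (intro G.cvp_add cvp_ln_cosh[OF k] G.cvp_cmult G.cvp_sum G.cvp_mult G.cvp_diff G.cvp_power2 G.cvp_const mphi mze) auto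
  have rem: "G.cvp (remainder k) (\<beta> * (\<Sum>s=1..k. \<bar>0\<bar>) + \<beta> / 2 * ((\<Sum>s=1..k. (\<beta> * tau k s * (1 - Q) - \<beta> * (1 - ?g) * gam \<beta> h s)\<^sup>2)
      + (\<Sum>s=1..k. (gam \<beta> h s - tau k s)\<^sup>2)))" (is "G.cvp _ ?R")
    unfolding remainder_def[abs_def]
    by (intro G.cvp_add G.cvp_cmult G.cvp_sum G.cvp_abs G.cvp_mult G.cvp_diff G.cvp_power2 G.cvp_const mphi mze xi) auto
  have "(\<lambda>N. real k * ln 2 / real N) \<longlonglongrightarrow> 0" by (rule lim_const_over_n)
  note sq = G.cvp_sequence[OF this]
  define W where "W N A = \<bar>lead k N A - RS \<beta> h\<bar> + remainder k N A + real k * ln 2 / real N" for N A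
  have W: "G.cvp W (\<bar>?L - RS \<beta> h\<bar> + ?R + 0)"
    unfolding W_def[abs_def] by (intro G.cvp_add G.cvp_abs G.cvp_diff G.cvp_const lead rem sq)
  have le: "\<bar>?L - RS \<beta> h\<bar> + ?R + 0 <= eta k" using eta_bounds[OF k] by simp
  \<comment> \<open>The limit of the estimate is only known to be at most \<open>eta k\<close>, so
    convergence is claimed for the excess of the absolute error over \<open>eta k\<close>.\<close>
  define Z where "Z N A = max 0 (\<bar>?Y N A\<bar> - eta k)" for N A
  have Z: "G.cvp Z 0"
  proof (rule G.cvp_dominated2[OF W cvp_defect[of k]])
    show "Z N \<in> borel_measurable (Gm N)" for N
      unfolding Z_def by (intro borel_measurable_max borel_measurable_const borel_measurable_diff borel_measurable_abs mY)
    fix \<epsilon> :: real assume e: "0 < \<epsilon>"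
    show "\<exists>\<delta>>0. \<forall>\<^sub>F N in sequentially. \<forall>A\<in>space (Gm N).
        \<bar>W N A - (\<bar>?L - RS \<beta> h\<bar> + ?R + 0)\<bar> <= \<delta> --> \<bar>defect k N A - 0\<bar> <= \<delta> --> \<bar>Z N A - 0\<bar> <= \<epsilon>"
    proof (intro exI[of _ "min \<epsilon> 1"] conjI eventually_sequentiallyI[of 1] ballI impI)
      fix N :: nat and A assume N: "1 <= N" and w: "\<bar>W N A - (\<bar>?L - RS \<beta> h\<bar> + ?R + 0)\<bar> <= min \<epsilon> 1"
        and D: "\<bar>defect k N A - 0\<bar> <= min \<epsilon> 1"
      have "\<bar>defect k N A\<bar> <= 1" using D by simp
      then have "defect k N A <= 1" by (rule abs_le_D1)
      from ln_Wpart_estimate[OF N k this] have "\<bar>?Y N A\<bar> <= W N A"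
        unfolding W_def using abs_triangle_ineq[of "ln (Wpart \<beta> h N k A) / real N - lead k N A" "lead k N A - RS \<beta> h"] by simp
      moreover have "W N A <= eta k + \<epsilon>" using abs_le_D1[OF w] le by linarith
      ultimately show "\<bar>Z N A - 0\<bar> <= \<epsilon>" unfolding Z_def using e by simp
    qed (use e in simp)
  qed
  \<comment> \<open>The excess tends to 0 in probability but need not vanish, so the threshold in
    \<open>limsup_expectation\<close> gets a margin 1/k, which disappears as k grows.\<close>
  have k0: "0 < 1 / real k" using k by simp
  have e0: "0 <= eta k" using dd_pos[OF k] dd_pos[of "Suc k"] by (simp add: eta_def)
  have lim: "(\<lambda>N. measure (Gm N) {A \<in> space (Gm N). eta k + 1 / real k < \<bar>?Y N A\<bar>}) \<longlonglongrightarrow> 0"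
  proof -
    have iff: "a + e < y \<longleftrightarrow> e < \<bar>max 0 (y - a) - 0\<bar>" if "0 < e" for a e y :: real
    proof (cases "0 <= y - a")
      case True then show ?thesis by (simp add: max_def less_diff_eq add.commute)
    next
      case False
      then have "\<bar>max 0 (y - a) - 0\<bar> = 0" by (simp add: max_def)
      with False that show ?thesis by argo
    qed
    have "{A \<in> space (Gm N). eta k + 1 / real k < \<bar>?Y N A\<bar>} = {A \<in> space (Gm N). 1 / real k < \<bar>Z N A - 0\<bar>}" for N
      unfolding Z_def iff[OF k0] ..
    then show ?thesis using G.cvp_tendsto[OF Z k0] by simp
  qed
  obtain B where B: "0 <= B" "\<forall>N\<ge>1. (\<integral>\<^sup>+A. ennreal ((?Y N A)\<^sup>2) \<partial>Gm N) <= ennreal B"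
    using Wpart_second_moment[of k "RS \<beta> h"] by blast
  have "\<forall>\<^sub>F N in sequentially. (\<integral>\<^sup>+A. ennreal ((?Y N A)\<^sup>2) \<partial>Gm N) <= ennreal B"
    by (rule eventually_sequentiallyI[of 1]) (use B(2) in blast)
  then show ?thesis by (rule G.limsup_expectation[OF mY add_nonneg_pos[OF e0 k0] B(1) lim])
qed

end

theorem proposition8:
  shows "\<exists>\<beta>\<^sub>0>0. \<forall>h>0. \<forall>\<beta>>0. \<beta> \<le> \<beta>\<^sub>0 \<longrightarrow>
    (\<forall>(M :: nat \<Rightarrow> 'a measure) (g :: nat \<Rightarrow> 'a \<Rightarrow> nat \<Rightarrow> nat \<Rightarrow> real).
      (\<forall>N\<ge>1. gaussian_disorder (M N) N (g N)) \<longrightarrow>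
      (\<lambda>k. limsup (\<lambda>N. \<integral>\<^sup>+ \<omega>. ennreal
          \<bar>ln (real_cond_exp (M N) (sigma_G \<beta> h (M N) N (g N) k)
                 (\<lambda>\<omega>. partition_fn \<beta> h N (g N \<omega>)) \<omega>) / real N - RS \<beta> h\<bar> \<partial>M N))
        \<longlonglongrightarrow> 0)"
proof (intro exI[of _ "1 / 32"] conjI allI impI)
  fix h \<beta> :: real and M :: "nat \<Rightarrow> 'a measure" and g :: "nat \<Rightarrow> 'a \<Rightarrow> nat \<Rightarrow> nat \<Rightarrow> real"
  assume h: "0 < h" and \<beta>: "0 < \<beta>" "\<beta> \<le> 1 / 32" and g: "\<forall>N\<ge>1. gaussian_disorder (M N) N (g N)"
  interpret sk_params \<beta> h by unfold_locales (use h \<beta> in auto)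
  let ?I = "\<lambda>k N. \<integral>\<^sup>+ \<omega>. ennreal \<bar>ln (real_cond_exp (M N) (sigma_G \<beta> h (M N) N (g N) k) (\<lambda>\<omega>. partition_fn \<beta> h N (g N \<omega>)) \<omega>) / real N - RS \<beta> h\<bar> \<partial>M N"
  \<comment> \<open>The disorder is assumed Gaussian only for N >= 1, so the two sequences in N are
    identified eventually.\<close>
  have eq: "limsup (?I k) = limsup (\<lambda>N. \<integral>\<^sup>+A. ennreal \<bar>ln (Wpart \<beta> h N k A) / real N - RS \<beta> h\<bar> \<partial>Gm N)" for k
    by (rule Limsup_eq, rule eventually_sequentiallyI[of 1]) (use g in \<open>auto intro!: nn_integral_cond_exp_partition_fn\<close>)
  have lim: "(\<lambda>k. ennreal (2 * (eta k + 1 / real k))) \<longlonglongrightarrow> 0"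
  proof -
    have "(\<lambda>k. 2 * (eta k + 1 / real k)) \<longlonglongrightarrow> 2 * (0 + 0)"
      by (intro tendsto_intros eta_tendsto lim_1_over_n)
    then show ?thesis using tendsto_ennrealI[of "\<lambda>k. 2 * (eta k + 1 / real k)" 0 sequentially] by simp
  qed
  show "(\<lambda>k. limsup (?I k)) \<longlonglongrightarrow> 0"
  proof (rule tendsto_sandwich[OF _ _ tendsto_const lim])
    show "\<forall>\<^sub>F k in sequentially. limsup (?I k) \<le> ennreal (2 * (eta k + 1 / real k))"
      unfolding eq by (rule eventually_sequentiallyI[of 1]) (rule free_energy_limsup)
  qed simp
qed simp

end
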